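(* For every positive integer $k$, the quotient space $S_{k,1}(\mathrm{GL}_2(A))/S^2_{k,1}(\mathrm{GL}_2(A))$ is diagonalizable for the action of the Hecke operators $\mathbb{T}_\mathfrak{p}$. More precisely, it has a basis consisting of images of Hecke eigenforms in $S_{k,1}(\mathrm{GL}_2(A))$, each having eigenvalues $\lambda_\mathfrak{p}=\wp$ for every nonzero prime $\mathfrak{p}=(\wp)$ of $A$ with $\wp$ monic.
   Context: Let $q$ be a prime power, $A=\mathbb{F}_q[T]$, $\mathbb{C}_\infty$ the completion of an algebraic closure of $K_\infty=\mathbb{F}_q((1/T))$, and $\Omega=\mathbb{C}_\infty\setminus K_\infty$. Fix a Carlitz period $\widetilde{\pi}$ with Carlitz exponential $e_{\widetilde{\pi}A}(z)=z\prod_{0\neq\lambda\in\widetilde{\pi}A}(1-z/\lambda)$, and put $t(z)=1/e_{\widetilde{\pi}A}(\widetilde{\pi}z)$. A Drinfeld modular form of weight $k$ and type $m\in\mathbb{Z}/(q-1)$ for $\mathrm{GL}_2(A)$ is a rigid analytic $f:\Omega\to\mathbb{C}_\infty$ with $f(\gamma z)=(\det\gamma)^{-m}(cz+d)^kf(z)$ for all $\gamma=\begin{pmatrix}a&b\\c&d\end{pmatrix}\in\mathrm{GL}_2(A)$, having a $t$-expansion $f=\sum_{i\ge0}a_it^i$ near infinity. - $S_{k,m}(\mathrm{GL}_2(A))$ denotes the cusp forms, those with $a_0=0$. - $S^2_{k,m}(\mathrm{GL}_2(A))$ denotes the double-cuspidal forms, those with $a_0=a_1=0$. For a nonzero prime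 $\mathfrak{p}=(\wp)$, $\wp$ monic, the Hecke operator is \[ \mathbb{T}_\mathfrak{p}f(z)=\wp^kf(\wp z)+\sum_{\beta\in A,\ \deg\beta<\deg\wp}f\!\left(\tfrac{z+\beta}{\wp}\right). \] It preserves $S_{k,m}$ and $S^2_{k,m}$, and hence acts on the quotient. An eigenform is a nonzero form that is an eigenvector of all $\mathbb{T}_\mathfrak{p}$. *)

theory Defs
  imports
    "HOL-Analysis.Analysis"
    "HOL-Algebra.Algebraic_Closure_Type"
    "HOL-Computational_Algebra.Computational_Algebra"
    "HOL-Library.Function_Algebras"
    "HOL-Library.Set_Algebras"
begin

section \<open>The field \<open>C\<^sub>\<infinity>\<close>\<close>

text \<open>
  Fields with a metric induced by a multiplicative non-archimedean absolute value. The library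
  reserves \<open>norm\<close> for real normed spaces, so the absolute value is \<^term>\<open>dist x 0\<close>.
\<close>

class nonarch_field = field + metric_space +
  assumes nonarch_dist_diff: "dist x y = dist (x - y) 0"
    and nonarch_dist_mult: "dist (x * y) 0 = dist x 0 * dist y 0"
    and nonarch_dist_add: "dist (x + y) 0 \<le> max (dist x 0) (dist y 0)"

definition absv :: "'c::nonarch_field \<Rightarrow> real" where
  "absv x = dist x 0"

text \<open>
  \<open>'q\<close> is the finite field with \<open>q\<close> elements. The field \<open>K\<^sub>\<infinity> = F\<^sub>q((1/T))\<close> is \<^typ>\<open>'q fls\<close>, whose
  formal variable \<^const>\<open>fls_X\<close> plays the role of \<open>1/T\<close>; so \<open>T\<close> is \<^const>\<open>fls_X_inv\<close>, and the absolute
  value is normalised by \<open>|T| = q\<close>.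
\<close>

definition K_inf_abs :: "'q::finite_field fls \<Rightarrow> real" where
  "K_inf_abs x = (if x = 0 then 0 else real CARD('q) powi (- fls_subdegree x))"

text \<open>
  \<^term>\<open>C_inf j\<close> says that the type \<open>'c\<close>, together with \<open>j\<close>, is the completion of the algebraic closure
  of \<open>K\<^sub>\<infinity>\<close> for the (unique) extension of the absolute value. Completeness is part of the sort of
  \<open>'c\<close>; as the extension of the absolute value is unique, it suffices to prescribe it on \<open>K\<^sub>\<infinity>\<close>.
\<close>

definition C_inf ::
    "('q::finite_field fls alg_closure \<Rightarrow> 'c::{nonarch_field, complete_space}) \<Rightarrow> bool" where
  "C_inf j \<longleftrightarrow>
     j 1 = 1 \<and> (\<forall>x y. j (x + y) = j x + j y) \<and> (\<forall>x y. j (x * y) = j x * j y) \<and>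
     (\<forall>x. absv (j (to_ac x)) = K_inf_abs x) \<and>
     closure (range j) = UNIV"

definition K_inf :: "('q::finite_field fls alg_closure \<Rightarrow> 'c) \<Rightarrow> 'c set" where
  "K_inf j = range (\<lambda>x. j (to_ac x))"

definition of_A :: "('q::finite_field fls alg_closure \<Rightarrow> 'c) \<Rightarrow> 'q poly \<Rightarrow> 'c" where
  "of_A j a = j (to_ac (poly (map_poly fls_const a) fls_X_inv))"

definition Omega :: "('q::finite_field fls alg_closure \<Rightarrow> 'c) \<Rightarrow> 'c set" where
  "Omega j = UNIV - K_inf j"


section \<open>The Carlitz exponential and the parameter at infinity\<close>

definition lattice_exp :: "'c::nonarch_field set \<Rightarrow> 'c \<Rightarrow> 'c" where
  "lattice_exp \<Lambda> z =
     z * Lim (finite_subsets_at_top (\<Lambda> - {0})) (\<lambda>F. \<Prod>l\<in>F. 1 - z / l)"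

definition period_lattice :: "('q::finite_field fls alg_closure \<Rightarrow> 'c::nonarch_field) \<Rightarrow> 'c \<Rightarrow> 'c set" where
  "period_lattice j w = range (\<lambda>a. w * of_A j a)"

text \<open>
  \<open>w\<close> is a Carlitz period iff the rank one lattice \<open>wA\<close> is the one belonging to the Carlitz module
  \<open>\<rho>\<^sub>T(X) = T X + X\<^sup>q\<close>; this determines \<open>w\<close> up to a factor in \<open>F\<^sub>q\<^sup>\<times>\<close>.
\<close>

definition carlitz_period :: "('q::finite_field fls alg_closure \<Rightarrow> 'c::nonarch_field) \<Rightarrow> 'c \<Rightarrow> bool" where
  "carlitz_period j w \<longleftrightarrow> w \<noteq> 0 \<and>
     (\<forall>z. lattice_exp (period_lattice j w) (of_A j [:0, 1:] * z) =
          of_A j [:0, 1:] * lattice_exp (period_lattice j w) z +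
          lattice_exp (period_lattice j w) z ^ CARD('q))"

definition t_param :: "('q::finite_field fls alg_closure \<Rightarrow> 'c::nonarch_field) \<Rightarrow> 'c \<Rightarrow> 'c \<Rightarrow> 'c" where
  "t_param j w z = 1 / lattice_exp (period_lattice j w) (w * z)"


section \<open>Drinfeld modular forms\<close>

text \<open>
  The affinoid subsets \<open>\<Omega>\<^sub>n\<close> form the standard admissible covering of \<open>\<Omega>\<close>. A function on \<open>\<Omega>\<close> is rigid
  analytic iff its restriction to each of them is a uniform limit of rational functions without
  poles there.
\<close>

definition Omega_aff :: "('q::finite_field fls alg_closure \<Rightarrow> 'c::nonarch_field) \<Rightarrow> nat \<Rightarrow> 'c set" where
  "Omega_aff j n =
     {z. absv z \<le> real CARD('q) ^ n \<and> (\<forall>x\<in>K_inf j. 1 / real CARD('q) ^ n \<le> absv (z - x))}"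

definition rigid_analytic :: "('q::finite_field fls alg_closure \<Rightarrow> 'c::nonarch_field) \<Rightarrow> ('c \<Rightarrow> 'c) \<Rightarrow> bool" where
  "rigid_analytic j f \<longleftrightarrow>
     (\<forall>n. \<exists>P Q :: nat \<Rightarrow> 'c poly.
        (\<forall>i. \<forall>z\<in>Omega_aff j n. poly (Q i) z \<noteq> 0) \<and>
        uniform_limit (Omega_aff j n) (\<lambda>i z. poly (P i) z / poly (Q i) z) f sequentially)"

text \<open>
  A neighbourhood of infinity in \<open>\<Omega>\<close> is a set where the imaginary absolute value
  \<open>|z|\<^sub>i = inf {|z - x| : x \<in> K\<^sub>\<infinity>}\<close> is large.
\<close>

definition has_t_expansion ::
    "('q::finite_field fls alg_closure \<Rightarrow> 'c::nonarch_field) \<Rightarrow> 'c \<Rightarrow> ('c \<Rightarrow> 'c) \<Rightarrow> (nat \<Rightarrow> 'c) \<Rightarrow> bool" where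
  "has_t_expansion j w f a \<longleftrightarrow>
     (\<exists>r. \<forall>z\<in>Omega j. infdist z (K_inf j) > r \<longrightarrow> (\<lambda>i. a i * t_param j w z ^ i) sums f z)"

text \<open>
  Functions on \<open>\<Omega>\<close> are represented by total functions that vanish outside \<open>\<Omega>\<close>. The type \<open>m\<close> only
  matters modulo \<open>q - 1\<close>, since \<open>det \<gamma>\<close> lies in \<open>F\<^sub>q\<^sup>\<times>\<close>.
\<close>

definition modular_transform ::
    "('q::finite_field fls alg_closure \<Rightarrow> 'c::nonarch_field) \<Rightarrow> nat \<Rightarrow> int \<Rightarrow> ('c \<Rightarrow> 'c) \<Rightarrow> bool" where
  "modular_transform j k m f \<longleftrightarrow>
     (\<forall>a b c d. is_unit (a * d - b * c) \<longrightarrow> (\<forall>z\<in>Omega j.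
        f ((of_A j a * z + of_A j b) / (of_A j c * z + of_A j d)) =
        of_A j (a * d - b * c) powi (- m) * (of_A j c * z + of_A j d) ^ k * f z))"

definition modular_forms ::
    "('q::finite_field fls alg_closure \<Rightarrow> 'c::nonarch_field) \<Rightarrow> 'c \<Rightarrow> nat \<Rightarrow> int \<Rightarrow> ('c \<Rightarrow> 'c) set" where
  "modular_forms j w k m =
     {f. (\<forall>z. z \<notin> Omega j \<longrightarrow> f z = 0) \<and> rigid_analytic j f \<and> modular_transform j k m f \<and>
         (\<exists>a. has_t_expansion j w f a)}"

definition cusp_forms ::
    "('q::finite_field fls alg_closure \<Rightarrow> 'c::nonarch_field) \<Rightarrow> 'c \<Rightarrow> nat \<Rightarrow> int \<Rightarrow> ('c \<Rightarrow> 'c) set" where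
  "cusp_forms j w k m =
     {f \<in> modular_forms j w k m. \<exists>a. has_t_expansion j w f a \<and> a 0 = 0}"

definition double_cusp_forms ::
    "('q::finite_field fls alg_closure \<Rightarrow> 'c::nonarch_field) \<Rightarrow> 'c \<Rightarrow> nat \<Rightarrow> int \<Rightarrow> ('c \<Rightarrow> 'c) set" where
  "double_cusp_forms j w k m =
     {f \<in> modular_forms j w k m. \<exists>a. has_t_expansion j w f a \<and> a 0 = 0 \<and> a 1 = 0}"


section \<open>Hecke operators\<close>

definition monic_prime :: "'q::finite_field poly \<Rightarrow> bool" where
  "monic_prime P \<longleftrightarrow> prime_elem P \<and> Polynomial.lead_coeff P = 1"

definition hecke ::
    "('q::finite_field fls alg_closure \<Rightarrow> 'c::nonarch_field) \<Rightarrow> nat \<Rightarrow> 'q poly \<Rightarrow> ('c \<Rightarrow> 'c) \<Rightarrow> 'c \<Rightarrow> 'c" where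
  "hecke j k P f = (\<lambda>z.
     of_A j P ^ k * f (of_A j P * z) +
     (\<Sum>\<beta> | Polynomial.degree \<beta> < Polynomial.degree P. f ((z + of_A j \<beta>) / of_A j P)))"

definition fscale :: "'c::field \<Rightarrow> ('c \<Rightarrow> 'c) \<Rightarrow> 'c \<Rightarrow> 'c" where
  "fscale c f = (\<lambda>z. c * f z)"

definition hecke_eigenform ::
    "('q::finite_field fls alg_closure \<Rightarrow> 'c::nonarch_field) \<Rightarrow> nat \<Rightarrow> ('c \<Rightarrow> 'c) \<Rightarrow> bool" where
  "hecke_eigenform j k f \<longleftrightarrow>
     f \<noteq> 0 \<and> (\<forall>P. monic_prime P \<longrightarrow> (\<exists>c. hecke j k P f = fscale c f))"


section \<open>Quotients of function spaces\<close>

text \<open>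
  The elements of \<open>V / U\<close> are the cosets \<open>f +o U\<close>. Sums of cosets are sums of sets; the summand \<open>U\<close> in
  the following definitions makes the empty combination, the zero scalar and the image of a coset
  under an operator preserving \<open>U\<close> come out as cosets as well.
\<close>

definition quotient_space :: "('c::field \<Rightarrow> 'c) set \<Rightarrow> ('c \<Rightarrow> 'c) set \<Rightarrow> ('c \<Rightarrow> 'c) set set" where
  "quotient_space V U = (\<lambda>f. f +o U) ` V"

definition quotient_lincomb ::
    "('c::field \<Rightarrow> 'c) set \<Rightarrow> (('c \<Rightarrow> 'c) set \<Rightarrow> 'c) \<Rightarrow> ('c \<Rightarrow> 'c) set set \<Rightarrow> ('c \<Rightarrow> 'c) set" where
  "quotient_lincomb U c F = (\<Sum>C\<in>F. fscale (c C) ` C) + U"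

definition quotient_basis ::
    "('c::field \<Rightarrow> 'c) set \<Rightarrow> ('c \<Rightarrow> 'c) set \<Rightarrow> ('c \<Rightarrow> 'c) set set \<Rightarrow> bool" where
  "quotient_basis V U B \<longleftrightarrow>
     B \<subseteq> quotient_space V U \<and>
     (\<forall>F c. finite F \<and> F \<subseteq> B \<and> quotient_lincomb U c F = U \<longrightarrow> (\<forall>C\<in>F. c C = 0)) \<and>
     (\<forall>Y\<in>quotient_space V U. \<exists>F c. finite F \<and> F \<subseteq> B \<and> Y = quotient_lincomb U c F)"

definition quotient_scale :: "('c::field \<Rightarrow> 'c) set \<Rightarrow> 'c \<Rightarrow> ('c \<Rightarrow> 'c) set \<Rightarrow> ('c \<Rightarrow> 'c) set" where
  "quotient_scale U c C = fscale c ` C + U"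

definition quotient_map ::
    "('c::field \<Rightarrow> 'c) set \<Rightarrow> (('c \<Rightarrow> 'c) \<Rightarrow> 'c \<Rightarrow> 'c) \<Rightarrow> ('c \<Rightarrow> 'c) set \<Rightarrow> ('c \<Rightarrow> 'c) set" where
  "quotient_map U H C = H ` C + U"

definition hecke_diagonalizable ::
    "('q::finite_field fls alg_closure \<Rightarrow> 'c::nonarch_field) \<Rightarrow> nat \<Rightarrow> ('c \<Rightarrow> 'c) set \<Rightarrow> ('c \<Rightarrow> 'c) set \<Rightarrow> bool" where
  "hecke_diagonalizable j k V U \<longleftrightarrow>
     (\<exists>B. quotient_basis V U B \<and>
        (\<forall>C\<in>B. \<forall>P. monic_prime P \<longrightarrow> (\<exists>c. quotient_map U (hecke j k P) C = quotient_scale U c C)))"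

end

theory Submission
  imports Defs
begin

text \<open>
  With \<open>\<tau>(z) = \<Sum>\<^bsub>b \<in> A\<^esub> 1 / (z - b)\<close>, which is \<open>t\<close> times the Carlitz period \<open>w\<close>, the series
  \<open>G\<^sub>k(z) = \<Sum>\<^bsub>0 \<noteq> a \<in> A\<^esub> a\<^sup>k\<^sup>-\<^sup>1 \<tau>(a z)\<close> is a cusp form of weight \<open>k\<close> and type 1 whenever \<open>k \<ge> 3\<close> and
  \<open>k \<equiv> 2\<close> modulo \<open>q - 1\<close>. Inversion symmetry holds already for the finite double sums over
  \<open>deg a, deg b < d\<close>, because low power sums over the polynomials of degree less than \<open>d\<close> vanish. As
  \<open>\<Sum>\<^bsub>deg \<beta> < deg P\<^esub> \<tau>((z + \<beta>) / P) = P \<tau>(z)\<close> and the terms with \<open>P\<close> not dividing \<open>a\<close> only permute the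
  residues \<open>\<beta>\<close>, the Hecke operator at \<open>P\<close> multiplies \<open>G\<^sub>k\<close> by \<open>P\<close>. The first coefficient of \<open>G\<^sub>k\<close> is \<open>- w\<close>,
  so \<open>G\<^sub>k\<close> spans the quotient, which is at most one-dimensional.

  In the other weights the quotient is zero. If \<open>k\<close> is not congruent to 2, the scalar matrices show
  that every form vanishes. If \<open>k \<le> 2\<close>, a rational approximation of a cusp form is split into its
  principal parts at the residue discs of the elements of \<open>A\<close> and the part at infinity.
  Translation invariance makes the principal parts agree up to a small error, the decay at infinity
  kills the part at infinity, and the inversion \<open>z \<mapsto> 1/z\<close> matches the coefficients of the principal
  part at 0 with coefficients of the sum of the other parts, which are smaller by a factor \<open>q\<close>.
  Hence the form vanishes for large imaginary part.
\<close>

text \<open>The double series of a^(k-1) / (a z + b) does not converge unconditionally: for fixed b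
  and k > 2 its terms grow with a. The inversion is therefore visible only on truncations symmetric
  in a and b, and their convergence to \<open>G\<close> has to be proved separately. An eigenform
  alone does not settle the action on the quotient: \<open>quotient_map\<close> takes the image of a
  whole coset, so the operators must be shown to preserve double cuspidality of arbitrary forms. The
  part of the operator that divides by P is not a substitution in t; it is handled by power sums
  over the roots of \<rho>(X) = e(z), where \<rho> is the Carlitz polynomial of P, whose derivative
  is constant. In weights 1 and 2 contour arguments are replaced by Cauchy estimates for Laurent
  polynomials on circles whose radius is a half-integral power of q. Such circles avoid K_inf, whose
  absolute values are integral powers of q. The estimates rest on C_inf being algebraically closed,
  which also yields partial fractions and a square root of T.\<close>

hide_const (open) Polynomials.degree Polynomials.lead_coeff up_ring.coeff up_ring.monom Coset.order module.smult

section \<open>Non-archimedean fields\<close>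

lemma absv_0 [simp]: "absv (0 :: 'c::nonarch_field) = 0"
  by (simp add: absv_def)

lemma absv_eq_0 [simp]: "absv (x :: 'c::nonarch_field) = 0 \<longleftrightarrow> x = 0"
  by (simp add: absv_def)

lemma absv_nonneg [simp]: "absv (x :: 'c::nonarch_field) \<ge> 0"
  by (simp add: absv_def)

lemma absv_pos [simp]: "absv (x :: 'c::nonarch_field) > 0 \<longleftrightarrow> x \<noteq> 0"
  by (simp add: absv_def)

lemma absv_mult: "absv (x * y :: 'c::nonarch_field) = absv x * absv y"
  by (simp add: absv_def nonarch_dist_mult)

lemma absv_1 [simp]: "absv (1 :: 'c::nonarch_field) = 1"
  using absv_mult[of "1 :: 'c" 1] by simp

lemma absv_power: "absv (x ^ n :: 'c::nonarch_field) = absv x ^ n"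
  by (induction n) (simp_all add: absv_mult)

lemma absv_minus [simp]: "absv (- x :: 'c::nonarch_field) = absv x"
proof -
  have "absv (-1 :: 'c) * absv (-1 :: 'c) = 1"
    by (subst absv_mult[symmetric]) simp
  then have "absv (-1 :: 'c) = 1"
    using absv_nonneg[of "-1 :: 'c"] by (metis abs_of_nonneg real_sqrt_abs2 real_sqrt_one)
  then show ?thesis
    using absv_mult[of "-1" x] by simp
qed

lemma absv_minus_commute: "absv (x - y :: 'c::nonarch_field) = absv (y - x)"
  using absv_minus[of "x - y"] by simp

lemma dist_absv: "dist x y = absv (x - y :: 'c::nonarch_field)"
  using nonarch_dist_diff by (simp add: absv_def)

lemma absv_inverse: "absv (inverse x :: 'c::nonarch_field) = inverse (absv x)"
proof (cases "x = 0")
  case False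
  then have "absv x * absv (inverse x) = 1"
    by (subst absv_mult[symmetric]) simp
  then show ?thesis
    by (metis inverse_unique)
qed simp

lemma absv_divide: "absv (x / y :: 'c::nonarch_field) = absv x / absv y"
  by (simp add: divide_inverse absv_mult absv_inverse)

lemma absv_prod: "absv (\<Prod>i\<in>A. f i :: 'c::nonarch_field) = (\<Prod>i\<in>A. absv (f i))"
  by (induction A rule: infinite_finite_induct) (simp_all add: absv_mult)

lemma absv_add_le: "absv (x + y :: 'c::nonarch_field) \<le> max (absv x) (absv y)"
  by (simp add: absv_def nonarch_dist_add)

lemma absv_add_leI: "absv x \<le> B \<Longrightarrow> absv y \<le> B \<Longrightarrow> absv (x + y :: 'c::nonarch_field) \<le> B"
  using absv_add_le[of x y] by linarith

lemma absv_add_lessI: "absv x < B \<Longrightarrow> absv y < B \<Longrightarrow> absv (x + y :: 'c::nonarch_field) < B"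
  using absv_add_le[of x y] by linarith

lemma absv_diff_leI: "absv x \<le> B \<Longrightarrow> absv y \<le> B \<Longrightarrow> absv (x - y :: 'c::nonarch_field) \<le> B"
  using absv_add_leI[of x B "-y"] by simp

lemma absv_diff_lessI: "absv x < B \<Longrightarrow> absv y < B \<Longrightarrow> absv (x - y :: 'c::nonarch_field) < B"
  using absv_add_lessI[of x B "-y"] by simp

text \<open>If x + y were smaller than x, then so would be x = (x + y) - y; and it cannot be
  larger.\<close>

lemma absv_add_eq: "absv y < absv x \<Longrightarrow> absv (x + y :: 'c::nonarch_field) = absv x"
  using absv_add_le[of x y] absv_add_le[of "x + y" "- y"] by auto

lemma absv_diff_eq: "absv y < absv x \<Longrightarrow> absv (x - y :: 'c::nonarch_field) = absv x"
  using absv_add_eq[of "-y" x] by simp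

lemma absv_diff_eq': "absv x < absv y \<Longrightarrow> absv (x - y :: 'c::nonarch_field) = absv y"
  using absv_diff_eq[of x y] by (simp add: absv_minus_commute)

lemma absv_sum_le:
  "(\<And>i. i \<in> A \<Longrightarrow> absv (f i) \<le> B) \<Longrightarrow> B \<ge> 0 \<Longrightarrow> absv (\<Sum>i\<in>A. f i :: 'c::nonarch_field) \<le> B"
  by (induction A rule: infinite_finite_induct) (auto intro: absv_add_leI)

text \<open>(1 - f x) G - 1 = (1 - f x) (G - 1) - f x, and \<open>B \<le> 1\<close> keeps every
  factor 1 - f x at absolute value at most 1, so the error does not accumulate over the
  product.\<close>

lemma absv_prod_diff_le:
  fixes f :: "'a \<Rightarrow> 'c::nonarch_field"
  assumes "\<And>i. i \<in> A \<Longrightarrow> absv (f i) \<le> B" and "0 \<le> B" and "B \<le> 1"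
  shows "absv ((\<Prod>i\<in>A. 1 - f i) - 1) \<le> B"
  using assms(1)
proof (induction A rule: infinite_finite_induct)
  case (insert x A)
  have "absv (1 - f x) \<le> 1"
    using insert.prems[of x] assms by (intro absv_diff_leI) auto
  then have "absv ((1 - f x) * ((\<Prod>i\<in>A. 1 - f i) - 1)) \<le> 1 * B"
    unfolding absv_mult using insert by (intro mult_mono) auto
  then have "absv ((1 - f x) * ((\<Prod>i\<in>A. 1 - f i) - 1) - f x) \<le> B"
    using insert.prems[of x] by (intro absv_diff_leI) auto
  then show ?case
    using insert.hyps by (simp add: algebra_simps)
qed (simp_all add: assms(2))

section \<open>Limits and series under the ultrametric inequality\<close>

lemma tendsto_absv_iff:
  fixes f :: "'a \<Rightarrow> 'c::nonarch_field"
  shows "(f \<longlongrightarrow> l) F \<longleftrightarrow> ((\<lambda>x. absv (f x - l)) \<longlongrightarrow> 0) F"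
  by (subst tendsto_dist_iff) (simp add: dist_absv)

lemma tendsto_absv_comparison:
  fixes f :: "'a \<Rightarrow> 'c::nonarch_field"
  assumes "\<forall>\<^sub>F x in F. absv (f x - l) \<le> g x" and "(g \<longlongrightarrow> 0) F"
  shows "(f \<longlongrightarrow> l) F"
  unfolding tendsto_absv_iff
  by (rule tendsto_sandwich[OF _ assms(1) tendsto_const assms(2)]) simp

text \<open>With addition and multiplication continuous, the general rules for
  \<open>tendsto\<close> and \<open>sums\<close> apply to a field that is not a real normed
  space.\<close>

instance nonarch_field \<subseteq> topological_ab_group_add
proof
  fix a b :: 'a
  show "LIM x nhds a \<times>\<^sub>F nhds b. fst x + snd x :> nhds (a + b)"
  proof (rule tendsto_absv_comparison)
    show "((\<lambda>x. max (absv (fst x - a)) (absv (snd x - b))) \<longlongrightarrow> 0) (nhds a \<times>\<^sub>F nhds b)"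
      using tendsto_max[of "\<lambda>x. absv (fst x - a)" 0 "nhds a \<times>\<^sub>F nhds b" "\<lambda>x. absv (snd x - b)" 0]
        filterlim_fst[of "nhds a" "nhds b"] filterlim_snd[of "nhds b" "nhds a"]
      by (simp add: tendsto_absv_iff)
    show "\<forall>\<^sub>F x in nhds a \<times>\<^sub>F nhds b. absv (fst x + snd x - (a + b)) \<le> max (absv (fst x - a)) (absv (snd x - b))"
      by (rule always_eventually) (metis absv_add_le add_diff_add)
  qed
next
  fix a :: 'a
  show "(uminus \<longlongrightarrow> - a) (nhds a)"
    unfolding tendsto_absv_iff
    using filterlim_ident[of "nhds a"] unfolding tendsto_absv_iff
    by (simp add: absv_minus_commute)
qed

lemma tendsto_absv: "(f \<longlongrightarrow> l) F \<Longrightarrow> ((\<lambda>x. absv (f x)) \<longlongrightarrow> absv (l :: 'c::nonarch_field)) F"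
  unfolding absv_def by (rule tendsto_dist[OF _ tendsto_const])

instance nonarch_field \<subseteq> topological_semigroup_mult
proof
  fix a b :: 'a
  let ?F = "nhds a \<times>\<^sub>F nhds b"
  have f: "((\<lambda>x. fst x) \<longlongrightarrow> a) ?F" and s: "((\<lambda>x. snd x) \<longlongrightarrow> b) ?F"
    using filterlim_fst[of "nhds a" "nhds b"] filterlim_snd[of "nhds b" "nhds a"] .
  have "((\<lambda>x. absv (fst x) * absv (snd x - b) + absv (fst x - a) * absv b) \<longlongrightarrow> absv a * 0 + 0 * absv b) ?F"
    using f s by (intro tendsto_add tendsto_mult tendsto_absv tendsto_const)
        (simp_all add: tendsto_absv_iff[symmetric])
  then show "LIM x nhds a \<times>\<^sub>F nhds b. fst x * snd x :> nhds (a * b)"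
  proof (intro tendsto_absv_comparison[of _ _ "\<lambda>x. absv (fst x) * absv (snd x - b) + absv (fst x - a) * absv b"])
    show "\<forall>\<^sub>F x in ?F. absv (fst x * snd x - a * b) \<le> absv (fst x) * absv (snd x - b) + absv (fst x - a) * absv b"
    proof (rule always_eventually, rule allI)
      fix x :: "'a \<times> 'a"
      have *: "fst x * snd x - a * b = fst x * (snd x - b) + (fst x - a) * b"
        by (simp add: algebra_simps)
      show "absv (fst x * snd x - a * b) \<le> absv (fst x) * absv (snd x - b) + absv (fst x - a) * absv b"
        using absv_add_le[of "fst x * (snd x - b)" "(fst x - a) * b"]
          mult_nonneg_nonneg[OF absv_nonneg[of "fst x"] absv_nonneg[of "snd x - b"]]
          mult_nonneg_nonneg[OF absv_nonneg[of "fst x - a"] absv_nonneg[of b]]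
        unfolding * absv_mult by linarith
    qed
  qed simp
qed

instance nonarch_field \<subseteq> topological_comm_monoid_mult ..

text \<open>Close to l \<noteq> 0 the absolute value of f is exactly that of l, so the inverses
  differ by |f x - l| / |l|^2.\<close>

lemma tendsto_inverse_nonarch:
  fixes f :: "'a \<Rightarrow> 'c::nonarch_field"
  assumes "(f \<longlongrightarrow> l) F" and "l \<noteq> 0"
  shows "((\<lambda>x. inverse (f x)) \<longlongrightarrow> inverse l) F"
proof -
  have *: "\<forall>\<^sub>F x in F. absv (f x - l) < absv l"
    using assms order_tendstoD(2)[of "\<lambda>x. absv (f x - l)" 0 F "absv l"]
    by (simp add: tendsto_absv_iff)
  have "((\<lambda>x. absv (f x - l) / absv l ^ 2) \<longlongrightarrow> 0 / absv l ^ 2) F"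
    using assms by (intro tendsto_divide tendsto_const) (simp_all add: tendsto_absv_iff)
  then show ?thesis
  proof (intro tendsto_absv_comparison[of _ _ "\<lambda>x. absv (f x - l) / absv l ^ 2"])
    show "\<forall>\<^sub>F x in F. absv (inverse (f x) - inverse l) \<le> absv (f x - l) / absv l ^ 2"
      using *
    proof eventually_elim
      case (elim x)
      have "absv (f x) = absv l"
        using absv_add_eq[of "f x - l" l] elim by simp
      moreover from this assms have "f x \<noteq> 0"
        by force
      moreover have "inverse (f x) - inverse l = (l - f x) / (f x * l)"
        using assms \<open>f x \<noteq> 0\<close> by (simp add: field_simps)
      ultimately show ?case
        by (simp add: absv_divide absv_mult power2_eq_square absv_minus_commute)
    qed
  qed simp
qed

lemma tendsto_poly_nonarch:
  fixes f :: "'a \<Rightarrow> 'c::nonarch_field"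
  assumes "(f \<longlongrightarrow> l) F"
  shows "((\<lambda>x. poly p (f x)) \<longlongrightarrow> poly p l) F"
  by (induction p) (simp_all add: assms tendsto_add tendsto_mult)

lemma absv_limit_le:
  fixes f :: "nat \<Rightarrow> 'c::nonarch_field"
  assumes "f \<longlonglongrightarrow> l" and "\<And>n. n \<ge> N \<Longrightarrow> absv (f n) \<le> B"
  shows "absv l \<le> B"
  using tendsto_absv[OF assms(1)] assms(2) by (meson LIMSEQ_le_const2)

text \<open>A difference of two members is at most the largest increment between them. Small
  increments thus already give a Cauchy sequence, unlike over the reals.\<close>

lemma convergent_if_increments_tendsto_0:
  fixes f :: "nat \<Rightarrow> 'c::{nonarch_field, complete_space}"
  assumes "(\<lambda>n. absv (f (Suc n) - f n)) \<longlonglongrightarrow> 0"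
  shows "convergent f"
proof -
  have "Cauchy f"
  proof (rule metric_CauchyI)
    fix e :: real assume "e > 0"
    then obtain N where N: "\<And>n. n \<ge> N \<Longrightarrow> absv (f (Suc n) - f n) < e"
      using order_tendstoD(2)[OF assms] by (auto simp: eventually_sequentially)
    have *: "absv (f (N + m) - f N) < e" for m
    proof (induction m)
      case (Suc m)
      have "f (N + Suc m) - f N = (f (Suc (N + m)) - f (N + m)) + (f (N + m) - f N)"
        by simp
      then show ?case
        using absv_add_lessI[OF N[of "N + m"] Suc] by simp
    qed (use \<open>e > 0\<close> in simp)
    have "dist (f m) (f n) < e" if "m \<ge> N" "n \<ge> N" for m n
    proof -
      have "absv ((f m - f N) - (f n - f N)) < e"
        using *[of "m - N"] *[of "n - N"] that by (metis absv_diff_lessI le_add_diff_inverse)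
      then show ?thesis
        by (simp add: dist_absv)
    qed
    then show "\<exists>M. \<forall>m\<ge>M. \<forall>n\<ge>M. dist (f m) (f n) < e"
      by blast
  qed
  then show ?thesis
    by (simp add: Cauchy_convergent_iff)
qed

lemma sums_mult_nonarch:
  fixes f :: "nat \<Rightarrow> 'c::nonarch_field"
  assumes "f sums s"
  shows "(\<lambda>n. c * f n) sums (c * s)"
  using assms unfolding sums_def by (simp add: tendsto_mult flip: sum_distrib_left)

lemma sums_imp_tendsto_0_nonarch:
  fixes f :: "nat \<Rightarrow> 'c::nonarch_field"
  assumes "f sums s"
  shows "f \<longlonglongrightarrow> 0"
proof -
  have "(\<lambda>n. (\<Sum>i<n. f i)) \<longlonglongrightarrow> s"
    using assms by (simp add: sums_def)
  then have "(\<lambda>n. (\<Sum>i<Suc n. f i) - (\<Sum>i<n. f i)) \<longlonglongrightarrow> s - s"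
    by (intro tendsto_diff LIMSEQ_Suc) simp_all
  then show ?thesis by simp
qed

lemma summable_nonarch:
  fixes f :: "nat \<Rightarrow> 'c::{nonarch_field, complete_space}"
  assumes "f \<longlonglongrightarrow> 0"
  shows "summable f"
proof -
  have "convergent (\<lambda>n. \<Sum>i<n. f i)"
    using tendsto_absv[OF assms] by (intro convergent_if_increments_tendsto_0) simp
  then show ?thesis
    by (auto simp: convergent_def summable_def sums_def)
qed

lemma absv_sums_le:
  fixes f :: "nat \<Rightarrow> 'c::nonarch_field"
  assumes "f sums s" and "\<And>n. absv (f n) \<le> B"
  shows "absv s \<le> B"
proof (rule absv_limit_le)
  show "(\<lambda>n. \<Sum>i<n. f i) \<longlonglongrightarrow> s"
    using assms by (simp add: sums_def)
  have "B \<ge> 0"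
    using assms(2)[of 0] absv_nonneg[of "f 0"] by linarith
  then show "absv (\<Sum>i<n. f i) \<le> B" for n
    using assms by (intro absv_sum_le) auto
qed

lemma absv_sums_tail_le:
  fixes f :: "nat \<Rightarrow> 'c::nonarch_field"
  assumes "f sums s" and "\<And>n. n \<ge> N \<Longrightarrow> absv (f n) \<le> B"
  shows "absv (s - (\<Sum>n<N. f n)) \<le> B"
proof (rule absv_sums_le)
  show "(\<lambda>n. f (n + N)) sums (s - (\<Sum>n<N. f n))"
  proof -
    have *: "(\<Sum>i<m. f (i + N)) = (\<Sum>i<m + N. f i) - (\<Sum>i<N. f i)" for m
      by (induction m) simp_all
    show ?thesis
      using assms(1) unfolding sums_def * by (intro tendsto_diff tendsto_const LIMSEQ_ignore_initial_segment)
  qed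
qed (use assms in auto)

text \<open>Interchange of summation. As \<open>b n\<close> bounds the entries uniformly in m, one N
  makes the tails of all rows small, and the ultrametric inequality bounds their sum no matter how
  many rows are added. Columns are finite by \<open>h\<close>.\<close>

lemma double_sums_nonarch:
  fixes s :: "nat \<Rightarrow> nat \<Rightarrow> 'c::nonarch_field"
  assumes "\<And>m. s m sums S m" and "S sums \<sigma>"
    and "\<And>m n. absv (s m n) \<le> b n" and "b \<longlonglongrightarrow> 0"
    and "\<And>m n. m > h n \<Longrightarrow> s m n = 0"
  shows "(\<lambda>n. \<Sum>m\<le>h n. s m n) sums \<sigma>"
proof -
  let ?C = "\<lambda>n. \<Sum>m\<le>h n. s m n"
  have "(\<lambda>N. (\<Sum>n<N. ?C n)) \<longlonglongrightarrow> \<sigma>"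
  proof (rule metric_LIMSEQ_I)
    fix r :: real assume r: "r > 0"
    obtain N0 where N0: "\<And>n. n \<ge> N0 \<Longrightarrow> b n < r/2"
      using order_tendstoD(2)[OF assms(4), of "r/2"] r by (auto simp: eventually_sequentially)
    have "dist (\<Sum>n<N. ?C n) \<sigma> < r" if N: "N \<ge> N0" for N
    proof -
      obtain M0 where M0: "\<And>M. M \<ge> M0 \<Longrightarrow> dist (\<Sum>m<M. S m) \<sigma> < r"
        using metric_LIMSEQ_D[OF assms(2)[unfolded sums_def] r] by auto
      \<comment> \<open>\<open>M\<close> lies beyond every \<open>h n\<close> with n < N, so the
        first N columns are complete, and beyond \<open>M0\<close>, so the row sums are already
        close to \<sigma>.\<close>
      define M where "M = max M0 (Suc (Max (h ` {..<N} \<union> {0})))"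
      have "?C n = (\<Sum>m<M. s m n)" if "n < N" for n
      proof (rule sum.mono_neutral_left)
        have "h n \<le> Max (h ` {..<N} \<union> {0})"
          using that by (intro Max_ge) auto
        then show "{..h n} \<subseteq> {..<M}"
          by (auto simp: M_def)
        show "\<forall>m\<in>{..<M} - {..h n}. s m n = 0"
          using assms(5) by auto
      qed auto
      then have "(\<Sum>n<N. ?C n) = (\<Sum>m<M. \<Sum>n<N. s m n)"
        by (subst sum.swap) simp
      then have "(\<Sum>n<N. ?C n) - \<sigma> = ((\<Sum>m<M. S m) - \<sigma>) - (\<Sum>m<M. S m - (\<Sum>n<N. s m n))"
        by (simp add: sum_subtractf)
      moreover have "absv (S m - (\<Sum>n<N. s m n)) \<le> r/2" for m
        using assms(1) order_trans[OF assms(3) less_imp_le[OF N0]] N by (intro absv_sums_tail_le) auto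
      then have "absv (\<Sum>m<M. S m - (\<Sum>n<N. s m n)) \<le> r/2"
        using r by (intro absv_sum_le) auto
      moreover have "absv ((\<Sum>m<M. S m) - \<sigma>) < r"
        using M0[of M] by (simp add: dist_absv M_def)
      ultimately show ?thesis
        using r by (simp only: dist_absv) (rule absv_diff_lessI, assumption, linarith)
    qed
    then show "\<exists>no. \<forall>n\<ge>no. dist (\<Sum>n<n. ?C n) \<sigma> < r"
      by blast
  qed
  then show ?thesis
    by (simp add: sums_def)
qed

section \<open>Polynomials of bounded degree\<close>

text \<open>Since \<open>degree 0 = 0\<close>, the condition \<open>degree a < d\<close> would
  exclude 0 when d = 0. Vanishing coefficients give an additive group for every d;
  \<open>hecke\<close> uses the other form, which agrees for d > 0.\<close>

definition polys_below :: "nat \<Rightarrow> 'a::zero poly set" where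
  "polys_below d = {a. \<forall>i\<ge>d. coeff a i = 0}"

lemma polys_below_iff: "a \<in> polys_below d \<longleftrightarrow> a = 0 \<or> degree a < d"
proof
  assume *: "a \<in> polys_below d"
  show "a = 0 \<or> degree a < d"
  proof (rule ccontr)
    assume "\<not> (a = 0 \<or> degree a < d)"
    with * have "coeff a (degree a) = 0" and "a \<noteq> 0"
      by (auto simp: polys_below_def)
    then show False
      using leading_coeff_0_iff by blast
  qed
next
  assume "a = 0 \<or> degree a < d"
  then have "coeff a i = 0" if "i \<ge> d" for i
    using that Polynomial.coeff_eq_0[of a i] by (cases "a = 0") simp_all
  then show "a \<in> polys_below d"
    by (simp add: polys_below_def)
qed

lemma polys_below_eq: "d > 0 \<Longrightarrow> {a. degree a < d} = polys_below d"
  by (auto simp: polys_below_iff)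

lemma polys_below_0 [simp]: "polys_below 0 = {0}"
  by (auto simp: polys_below_iff)

lemma zero_in_polys_below [simp]: "0 \<in> polys_below d"
  by (simp add: polys_below_def)

lemma polys_below_add: "a \<in> polys_below d \<Longrightarrow> b \<in> polys_below d \<Longrightarrow> a + b \<in> polys_below d"
  for a b :: "'a::comm_monoid_add poly"
  by (simp add: polys_below_def)

lemma polys_below_diff: "a \<in> polys_below d \<Longrightarrow> b \<in> polys_below d \<Longrightarrow> a - b \<in> polys_below d"
  for a b :: "'a::ab_group_add poly"
  by (simp add: polys_below_def)

lemma polys_below_minus_iff [simp]: "- a \<in> polys_below d \<longleftrightarrow> a \<in> polys_below d"
  for a :: "'a::ab_group_add poly"
  by (simp add: polys_below_def)

lemma polys_below_mono: "d \<le> d' \<Longrightarrow> polys_below d \<subseteq> polys_below d'"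
  by (auto simp: polys_below_def)

lemma in_polys_below_Suc_degree [simp]: "a \<in> polys_below (Suc (degree a))"
  by (simp add: polys_below_iff)

lemma pCons_in_polys_below_iff [simp]: "pCons c a \<in> polys_below (Suc d) \<longleftrightarrow> a \<in> polys_below d"
  by (auto simp: polys_below_def coeff_pCons split: nat.splits)

lemma bij_betw_pCons_polys_below:
  "bij_betw (\<lambda>(c, a). pCons c a) (UNIV \<times> polys_below d) (polys_below (Suc d))"
proof (rule bij_betwI')
  fix y :: "'a poly" assume y: "y \<in> polys_below (Suc d)"
  obtain c a where "y = pCons c a"
    by (cases y)
  with y show "\<exists>x\<in>UNIV \<times> polys_below d. y = (case x of (c, a) \<Rightarrow> pCons c a)"
    by auto
qed auto

lemma finite_polys_below [simp]: "finite (polys_below d :: 'a::{zero, finite} poly set)"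
proof (induction d)
  case (Suc d)
  then show ?case
    using bij_betw_finite[OF bij_betw_pCons_polys_below[of d, where 'a = 'a]] by simp
qed simp

lemma sum_polys_below_Suc:
  "(\<Sum>a\<in>polys_below (Suc d). f a) = (\<Sum>a\<in>polys_below d. \<Sum>c\<in>UNIV. f (pCons c a))"
  for f :: "'a::{zero, finite} poly \<Rightarrow> 'b::comm_monoid_add"
proof -
  have "(\<Sum>a\<in>polys_below (Suc d). f a) = (\<Sum>(c, a)\<in>UNIV \<times> polys_below d. f (pCons c a))"
    using sum.reindex_bij_betw[OF bij_betw_pCons_polys_below, of f d] by (simp add: case_prod_beta)
  also have "\<dots> = (\<Sum>c\<in>UNIV. \<Sum>a\<in>polys_below d. f (pCons c a))"
    by (rule sum.cartesian_product[symmetric])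
  finally show ?thesis
    using sum.swap[of "\<lambda>c a. f (pCons c a)" "polys_below d" UNIV] by simp
qed

lemma sum_polys_below_uminus:
  fixes f :: "'a::{ab_group_add, finite} poly \<Rightarrow> 'b::comm_monoid_add"
  shows "(\<Sum>a\<in>polys_below d. f (- a)) = (\<Sum>a\<in>polys_below d. f a)"
  by (rule sum.reindex_bij_witness[of _ uminus uminus]) auto

section \<open>The ring \<open>A\<close> inside \<open>C\<^sub>\<infinity>\<close>\<close>

text \<open>\<open>q\<close> is the cardinality as a real number; carrying it as a parameter keeps
  the conversion from natural numbers out of the estimates.\<close>

locale C_infinity =
  fixes j :: "'q::finite_field fls alg_closure \<Rightarrow> 'c::{nonarch_field, complete_space}"
    and q :: real
  assumes C_inf: "C_inf j"
    and card_eq_q: "real CARD('q) = q"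
begin

lemma q_ge_2: "q \<ge> 2"
proof -
  have "card {0, 1 :: 'q} \<le> CARD('q)"
    by (intro card_mono) auto
  then have "2 \<le> CARD('q)"
    by simp
  then show ?thesis
    by (simp only: of_nat_le_iff[where 'a = real, symmetric] of_nat_numeral card_eq_q)
qed

lemma q_pos [simp]: "q > 0" and q_gt_1 [simp]: "q > 1" and q_ge_1 [simp]: "q \<ge> 1" and q_nonneg [simp]: "q \<ge> 0"
  using q_ge_2 by auto

lemma q_power_pos [simp]: "q ^ n > 0" and q_power_nonneg [simp]: "q ^ n \<ge> 0"
  by (simp_all add: zero_less_power less_imp_le)

lemma q_powi_less_iff [simp]: "q powi m < q powi n \<longleftrightarrow> m < n"
  using power_int_strict_increasing[of m n q] power_int_strict_increasing[of n m q]
  by (cases m n rule: linorder_cases) auto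

lemma q_powi_le_iff [simp]: "q powi m \<le> q powi n \<longleftrightarrow> m \<le> n"
  by (simp flip: not_less)

lemma j_1 [simp]: "j 1 = 1" and j_add: "j (x + y) = j x + j y" and j_mult: "j (x * y) = j x * j y"
  and absv_j_to_ac: "absv (j (to_ac z)) = K_inf_abs z" and dense_range_j: "closure (range j) = UNIV"
  using C_inf by (auto simp: C_inf_def)

lemma j_0 [simp]: "j 0 = 0"
  using j_add[of 0 0] by (metis add.right_neutral add_left_cancel)

lemma j_minus: "j (- x) = - j x"
  using j_add[of x "- x"] by (simp add: add_eq_0_iff)

lemma j_diff: "j (x - y) = j x - j y"
  using j_add[of x "- y"] by (simp add: j_minus)

lemma j_eq_0_iff [simp]: "j x = 0 \<longleftrightarrow> x = 0"
proof
  assume *: "j x = 0"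
  show "x = 0"
  proof (rule ccontr)
    assume "x \<noteq> 0"
    then have "j x * j (inverse x) = 1"
      by (subst j_mult[symmetric]) simp
    with * show False by simp
  qed
qed simp

lemma j_inverse: "j (inverse x) = inverse (j x)"
proof (cases "x = 0")
  case False
  then have "j x * j (inverse x) = 1"
    by (subst j_mult[symmetric]) simp
  then show ?thesis
    by (metis inverse_unique)
qed simp

lemma j_divide: "j (x / y) = j x / j y"
  by (simp add: divide_inverse j_mult j_inverse)

lemma j_power: "j (x ^ n) = j x ^ n"
  by (induction n) (simp_all add: j_mult)

lemma j_sum: "j (\<Sum>i\<in>A. f i) = (\<Sum>i\<in>A. j (f i))"
  by (induction A rule: infinite_finite_induct) (simp_all add: j_add)

abbreviation \<iota> :: "'q poly \<Rightarrow> 'c" where "\<iota> \<equiv> of_A j"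

definition T :: 'c where "T = \<iota> [:0, 1:]"

lemma of_A_pCons_aux: "\<iota> (pCons c p) = j (to_ac (fls_const c)) + j (to_ac fls_X_inv) * \<iota> p"
  by (simp add: of_A_def map_poly_pCons j_add j_mult)

lemma of_A_0 [simp]: "\<iota> 0 = 0"
  by (simp add: of_A_def)

lemma of_A_const: "\<iota> [:c:] = j (to_ac (fls_const c))"
  using of_A_pCons_aux[of c 0] by simp

lemma T_eq: "T = j (to_ac fls_X_inv)"
  using of_A_pCons_aux[of 0 1] by (simp add: T_def of_A_const one_pCons)

lemma of_A_pCons: "\<iota> (pCons c p) = \<iota> [:c:] + T * \<iota> p"
  by (simp add: of_A_pCons_aux of_A_const T_eq)

lemma of_A_1 [simp]: "\<iota> 1 = 1"
  by (simp add: of_A_const one_pCons)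

lemma of_A_add: "\<iota> (p + r) = \<iota> p + \<iota> r"
proof (induction p r rule: poly_induct2)
  case (pCons a p b r)
  then show ?case
    by (simp add: of_A_pCons_aux j_add algebra_simps flip: fls_plus_const)
qed simp

lemma of_A_minus: "\<iota> (- p) = - \<iota> p"
  using of_A_add[of p "- p"] by (simp add: add_eq_0_iff)

lemma of_A_diff: "\<iota> (p - r) = \<iota> p - \<iota> r"
  using of_A_add[of p "- r"] by (simp add: of_A_minus)

lemma of_A_smult: "\<iota> (smult c p) = \<iota> [:c:] * \<iota> p"
  by (induction p) (simp_all add: of_A_pCons_aux j_mult algebra_simps flip: fls_const_mult_const)

lemma of_A_pCons_0: "\<iota> (pCons 0 p) = T * \<iota> p"
  using of_A_pCons[of 0 p] by simp

lemma of_A_mult: "\<iota> (p * r) = \<iota> p * \<iota> r"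
proof (induction p)
  case (pCons a p)
  have "\<iota> (pCons a p * r) = \<iota> [:a:] * \<iota> r + T * (\<iota> p * \<iota> r)"
    using pCons by (simp add: of_A_add of_A_smult of_A_pCons_0)
  also have "\<dots> = \<iota> (pCons a p) * \<iota> r"
    by (simp only: of_A_pCons[of a p] algebra_simps)
  finally show ?case .
qed simp

lemma of_A_power: "\<iota> (p ^ n) = \<iota> p ^ n"
  by (induction n) (simp_all add: of_A_mult)

lemma absv_T: "absv T = q"
  by (simp add: T_eq absv_j_to_ac K_inf_abs_def card_eq_q)

lemma absv_of_A_const: "absv (\<iota> [:c:]) = (if c = 0 then 0 else 1)"
  by (simp add: of_A_const absv_j_to_ac K_inf_abs_def card_eq_q)

lemma absv_of_A: "p \<noteq> 0 \<Longrightarrow> absv (\<iota> p) = q ^ degree p"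
proof (induction p)
  case (pCons c p)
  show ?case
  proof (cases "p = 0")
    case True
    with pCons show ?thesis by (simp add: absv_of_A_const)
  next
    case False
    then have "absv (T * \<iota> p) = q ^ Suc (degree p)"
      using pCons by (simp add: absv_mult absv_T)
    moreover have "q ^ Suc (degree p) > 1"
      by (rule one_less_power) auto
    then have "absv (\<iota> [:c:]) < q ^ Suc (degree p)"
      by (simp add: absv_of_A_const)
    ultimately have "absv (T * \<iota> p + \<iota> [:c:]) = q ^ Suc (degree p)"
      by (subst absv_add_eq) auto
    then show ?thesis
      using False by (simp add: of_A_pCons[of c p] add.commute)
  qed
qed simp

lemma of_A_eq_0_iff [simp]: "\<iota> p = 0 \<longleftrightarrow> p = 0"
  using absv_of_A[of p] by (metis absv_0 of_A_0 power_eq_0_iff q_pos less_irrefl)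

lemma of_A_eq_iff [simp]: "\<iota> p = \<iota> r \<longleftrightarrow> p = r"
  using of_A_eq_0_iff[of "p - r"] by (simp add: of_A_diff)

lemma T_nonzero [simp]: "T \<noteq> 0"
  by (simp add: T_def)

lemma absv_of_A_ge_1: "p \<noteq> 0 \<Longrightarrow> absv (\<iota> p) \<ge> 1"
  by (simp add: absv_of_A one_le_power)

lemma absv_of_A_less:
  assumes "p \<in> polys_below d"
  shows "absv (\<iota> p) < q ^ d"
proof (cases "p = 0")
  case False
  then show ?thesis
    using assms by (simp add: polys_below_iff absv_of_A power_strict_increasing)
qed simp

lemma absv_of_A_le: "p \<in> polys_below d \<Longrightarrow> absv (\<iota> p) \<le> q ^ d"
  using absv_of_A_less less_imp_le by blast

lemma absv_of_A_ge: "p \<notin> polys_below d \<Longrightarrow> absv (\<iota> p) \<ge> q ^ d"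
  by (simp add: polys_below_iff absv_of_A not_less power_increasing)

text \<open>Adding 1 permutes \<open>'q\<close>, so the sum of all elements changes by q * 1 = 0.
  The cancellations below come from this: in derivatives of q-th powers, in power sums, and in sums
  of equal terms over all residues.\<close>

lemma of_nat_card_eq_0: "(of_nat CARD('q) :: 'c) = 0"
proof -
  have "(\<Sum>c\<in>UNIV. c + 1) = (\<Sum>c\<in>UNIV. c :: 'q)"
    by (rule sum.reindex_bij_witness[of _ "\<lambda>c. c - 1" "\<lambda>c. c + 1"]) auto
  then have "of_nat CARD('q) = (0 :: 'q)"
    by (simp add: sum.distrib)
  moreover have "\<iota> [:of_nat n:] = of_nat n" for n
    by (induction n) (simp_all add: of_A_const j_add flip: fls_plus_const)
  ultimately show ?thesis
    by (metis of_A_0 pCons_0_0)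
qed

lemma unit_poly_iff: "is_unit a \<longleftrightarrow> (\<exists>c. c \<noteq> 0 \<and> a = [:c:])" for a :: "'q poly"
  by (metis is_unit_pCons_iff is_unit_poly_iff dvd_field_iff)

subsection \<open>The field \<open>K\<^sub>\<infinity>\<close>\<close>

abbreviation K :: "'c set" where "K \<equiv> K_inf j"

lemma of_A_in_K [simp]: "\<iota> a \<in> K"
  by (auto simp: of_A_def K_inf_def)

lemma zero_in_K [simp]: "0 \<in> K" and one_in_K [simp]: "1 \<in> K"
  using of_A_in_K[of 0] of_A_in_K[of 1] by simp_all

lemma K_add: "x \<in> K \<Longrightarrow> y \<in> K \<Longrightarrow> x + y \<in> K"
  by (auto simp: K_inf_def simp flip: j_add to_ac_add)

lemma K_diff: "x \<in> K \<Longrightarrow> y \<in> K \<Longrightarrow> x - y \<in> K"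
  by (auto simp: K_inf_def simp flip: j_diff to_ac_diff)

lemma K_mult: "x \<in> K \<Longrightarrow> y \<in> K \<Longrightarrow> x * y \<in> K"
  by (auto simp: K_inf_def simp flip: j_mult to_ac_mult)

lemma K_divide: "x \<in> K \<Longrightarrow> y \<in> K \<Longrightarrow> x / y \<in> K"
  by (auto simp: K_inf_def simp flip: j_divide to_ac_divide)

lemma absv_K: "x \<in> K \<Longrightarrow> x \<noteq> 0 \<Longrightarrow> \<exists>n. absv x = q powi n"
  by (auto simp: K_inf_def absv_j_to_ac K_inf_abs_def card_eq_q)

lemma K_inf_abs_le_iff: "K_inf_abs (x :: 'q fls) \<le> q powi n \<longleftrightarrow> x = 0 \<or> fls_subdegree x \<ge> - n"
proof (cases "x = 0")
  case False
  then show ?thesis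
    by (auto simp: K_inf_abs_def card_eq_q)
qed (simp add: K_inf_abs_def less_imp_le)

text \<open>The polynomial part of a Laurent series in 1/T, built by removing the coefficient of the
  highest power of T.\<close>

lemma integral_part_aux:
  assumes "fls_subdegree x \<ge> - int m"
  shows "\<exists>a\<in>polys_below (Suc m). absv (j (to_ac x) - \<iota> a) < 1"
  using assms
proof (induction m arbitrary: x)
  case 0
  define y where "y = x - fls_const (fls_nth x 0)"
  have "absv (j (to_ac y)) < 1"
  proof (cases "y = 0")
    case False
    have "fls_subdegree y > 0"
      using 0 False nth_fls_subdegree_nonzero[OF False]
      by (auto simp: y_def) (metis fls_eq0_below_subdegree linorder_not_less not_less_iff_gr_or_eq zero_le_imp_eq_int not_le order_trans)
    then have "q powi (- fls_subdegree y) < q powi 0"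
      by (simp only: q_powi_less_iff)
    then show ?thesis
      using False by (simp add: absv_j_to_ac K_inf_abs_def card_eq_q)
  qed simp
  then show ?case
    by (intro bexI[of _ "[:fls_nth x 0:]"]) (simp_all add: y_def of_A_const j_diff polys_below_iff)
next
  case (Suc m)
  define c where "c = fls_nth x (- int (Suc m))"
  define y where "y = x - fls_const c * fls_X_inv ^ Suc m"
  have "fls_nth y n = 0" if "n < - int m" for n
  proof -
    have "n = - int (Suc m) \<or> n < - int (Suc m)"
      using that by linarith
    then show ?thesis
      using Suc.prems fls_eq0_below_subdegree[of n x]
      by (auto simp: y_def c_def fls_X_inv_power_conv_shift_1 simp del: power_Suc)
  qed
  then have "y = 0 \<or> fls_subdegree y \<ge> - int m"
    by (metis linorder_not_le nth_fls_subdegree_nonzero)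
  then have "fls_subdegree y \<ge> - int m"
    by auto
  from Suc.IH[OF this] obtain a where a: "a \<in> polys_below (Suc m)" "absv (j (to_ac y) - \<iota> a) < 1"
    by blast
  have "j (to_ac y) = j (to_ac x) - \<iota> [:c:] * T ^ Suc m"
    by (simp add: y_def j_diff j_mult j_power of_A_const T_eq)
  then have "j (to_ac y) - \<iota> a = j (to_ac x) - \<iota> (a + smult c ([:0, 1:] ^ Suc m))"
    by (simp only: of_A_add of_A_smult of_A_power T_def) simp
  moreover have "smult c ([:0, 1:] ^ Suc m) \<in> polys_below (Suc (Suc m))"
    by (auto simp: polys_below_iff degree_power_eq simp del: power_Suc)
  ultimately show ?case
    using a polys_below_mono[of "Suc m" "Suc (Suc m)"] by (metis polys_below_add le_SucI order_refl subsetD)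
qed

text \<open>Absolute values on K are powers of q, so a remainder below 1 is at most 1 / q. The gap
  leaves room for a circle of radius 1 / sqrt q around each polynomial that encloses its own disc of
  radius 1 / q and no other.\<close>

lemma integral_part:
  assumes "x \<in> K" and "absv x \<le> q ^ m"
  obtains a where "a \<in> polys_below (Suc m)" and "absv (x - \<iota> a) \<le> 1 / q"
proof -
  obtain y where y: "x = j (to_ac y)"
    using assms(1) by (auto simp: K_inf_def)
  have "K_inf_abs y \<le> q powi int m"
    using assms(2) by (simp add: y absv_j_to_ac)
  then have "fls_subdegree y \<ge> - int m"
    unfolding K_inf_abs_le_iff by auto
  from integral_part_aux[OF this] obtain a where a: "a \<in> polys_below (Suc m)" "absv (x - \<iota> a) < 1"
    by (auto simp: y)
  have "absv (x - \<iota> a) \<le> 1 / q"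
  proof (cases "x - \<iota> a = 0")
    case False
    have "x - \<iota> a \<in> K"
      using assms by (simp add: K_diff)
    then obtain n where n: "absv (x - \<iota> a) = q powi n"
      using False absv_K by blast
    with a(2) have "q powi n < q powi 0"
      by simp
    then have "n < 0"
      by (simp only: q_powi_less_iff)
    then have "q powi n \<le> q powi (-1)"
      by (simp only: q_powi_le_iff)
    with n show ?thesis
      by (simp add: power_int_minus field_simps)
  qed simp
  with a that show ?thesis by blast
qed

end

section \<open>Polynomials over \<open>C\<^sub>\<infinity>\<close>\<close>

lemma absv_poly_le:
  fixes p :: "'c::nonarch_field poly"
  assumes "\<And>i. absv (coeff p i) \<le> e" and "absv z \<le> M" and "M \<ge> 1" and "degree p \<le> n"
  shows "absv (poly p z) \<le> e * M ^ n"
proof -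
  have e: "e \<ge> 0"
    using assms(1)[of 0] absv_nonneg[of "coeff p 0"] by linarith
  have "absv (coeff p i * z ^ i) \<le> e * M ^ n" if "i \<le> degree p" for i
  proof -
    have "absv z ^ i \<le> M ^ i"
      using assms by (intro power_mono) auto
    also have "\<dots> \<le> M ^ n"
      using assms that by (intro power_increasing) auto
    finally show ?thesis
      unfolding absv_mult absv_power using assms(1)[of i] e by (intro mult_mono) auto
  qed
  then show ?thesis
    unfolding poly_altdef using e assms by (intro absv_sum_le) auto
qed

text \<open>For |z| > M the leading term would strictly dominate all others.\<close>

lemma absv_root_le:
  fixes p :: "'c::nonarch_field poly"
  assumes "\<And>i. absv (coeff p i) \<le> M" and "M \<ge> 1" and "lead_coeff p = 1" and "poly p z = 0"
  shows "absv z \<le> M"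
proof (rule ccontr)
  assume *: "\<not> absv z \<le> M"
  define n where "n = degree p"
  have "n > 0"
  proof (rule ccontr)
    assume "\<not> n > 0"
    then obtain c where "p = [:c:]"
      by (auto simp: n_def elim: degree_eq_zeroE)
    with assms show False by simp
  qed
  have "p \<noteq> 0"
    using assms by auto
  have "poly p z = (\<Sum>i<n. coeff p i * z ^ i) + z ^ n"
    unfolding poly_altdef n_def[symmetric] using assms(3) by (simp add: lessThan_Suc_atMost[symmetric] n_def)
  then have "absv (z ^ n) = absv (\<Sum>i<n. coeff p i * z ^ i)"
    using assms(4) by (metis absv_minus add.commute add_eq_0_iff)
  also have "\<dots> \<le> M * absv z ^ (n - 1)"
  proof (intro absv_sum_le)
    fix i assume "i \<in> {..<n}"
    then have "absv z ^ i \<le> absv z ^ (n - 1)"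
      using * assms by (intro power_increasing) auto
    then show "absv (coeff p i * z ^ i) \<le> M * absv z ^ (n - 1)"
      unfolding absv_mult absv_power using assms(1)[of i] assms(2) by (intro mult_mono) auto
  qed (use assms(2) in \<open>auto intro!: mult_nonneg_nonneg\<close>)
  also have "\<dots> < absv z * absv z ^ (n - 1)"
    using * assms(2) by (intro mult_strict_right_mono zero_less_power) linarith+
  also have "\<dots> = absv (z ^ n)"
    using \<open>n > 0\<close> by (simp add: absv_power flip: power_Suc)
  finally show False by simp
qed

lemma power_le_prod_mset:
  fixes f :: "'a \<Rightarrow> real"
  assumes "\<And>x. x \<in># A \<Longrightarrow> m \<le> f x" and "m \<ge> 0"
  shows "m ^ size A \<le> (\<Prod>x\<in>#A. f x)"
  using assms
proof (induction A)
  case (add x A)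
  have "m * m ^ size A \<le> f x * (\<Prod>x\<in>#A. f x)"
    using add.prems add.IH order_trans[OF \<open>m \<ge> 0\<close> add.prems(1)[of x]]
    by (intro mult_mono) auto
  then show ?case by simp
qed simp

lemma absv_prod_mset: "absv (\<Prod>x\<in>#A. f x :: 'c::nonarch_field) = (\<Prod>x\<in>#A. absv (f x))"
  by (induction A) (simp_all add: absv_mult)

context C_infinity
begin

section \<open>Algebraic closedness of the completion\<close>

lemma map_poly_j_mult: "map_poly j (p * r) = map_poly j p * map_poly j r"
  by (rule poly_eqI) (simp add: coeff_map_poly coeff_mult j_sum j_mult)

lemma map_poly_j_prod: "map_poly j (\<Prod>x\<in>#A. [:- x, 1:]) = (\<Prod>x\<in>#A. [:- j x, 1:])"
proof (induction A)
  case (add x A)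
  then show ?case
    by (simp only: image_mset_add_mset prod_mset.add_mset map_poly_j_mult) (simp add: map_poly_pCons j_minus)
qed simp

text \<open>The lower coefficients are moved into the dense image of the algebraic closure, where
  the polynomial splits, while the leading coefficient stays 1.\<close>

lemma monic_approx:
  fixes Q :: "'c poly"
  assumes "lead_coeff Q = 1" and "e > 0"
  obtains A where "size A = degree Q" and "\<And>i. absv (coeff ((\<Prod>x\<in>#A. [:- j x, 1:]) - Q) i) \<le> e"
proof -
  define n where "n = degree Q"
  have "\<exists>r. absv (j r - x) < e" for x
  proof -
    have "x \<in> closure (range j)"
      by (simp add: dense_range_j)
    then show ?thesis
      using \<open>e > 0\<close> unfolding closure_approachable by (auto simp: dist_absv)
  qed
  then obtain r where r: "\<And>x. absv (j (r x) - x) < e"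
    by metis
  define R where "R = (\<Sum>i<n. monom (r (coeff Q i)) i) + monom 1 n"
  have coeff_R: "coeff R i = (if i < n then r (coeff Q i) else if i = n then 1 else 0)" for i
    by (auto simp: R_def coeff_sum if_distrib[of "\<lambda>x. coeff x _"] coeff_monom sum.If_cases)
  have "degree R = n"
    by (rule antisym[OF degree_le le_degree]) (auto simp: coeff_R)
  then have lc: "lead_coeff R = 1"
    by (simp add: coeff_R)
  then have "R \<noteq> 0"
    by auto
  from alg_closed_imp_factorization[OF this] lc \<open>degree R = n\<close>
  obtain A where A: "size A = n" "R = (\<Prod>x\<in>#A. [:- x, 1:])"
    by auto
  have "absv (coeff (map_poly j R - Q) i) \<le> e" for i
    using r[of "coeff Q i"] assms coeff_eq_0[of Q i]
    by (cases i n rule: linorder_cases) (auto simp: coeff_map_poly coeff_R n_def)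
  then show ?thesis
    using that[of A] A by (simp add: map_poly_j_prod n_def)
qed

text \<open>The completion of an algebraically closed valued field is algebraically closed: the roots of
  close polynomials are close.\<close>

lemma alg_closed_C:
  fixes Q :: "'c poly"
  assumes "degree Q > 0"
  shows "\<exists>x. poly Q x = 0"
proof -
  define Q' where "Q' = smult (inverse (lead_coeff Q)) Q"
  define n where "n = degree Q'"
  have "Q \<noteq> 0"
    using assms by auto
  then have lc: "lead_coeff Q' = 1" and n: "n > 0" and roots: "poly Q' x = 0 \<longleftrightarrow> poly Q x = 0" for x
    using assms by (auto simp: Q'_def n_def)
  define M where "M = Max (insert 1 ((\<lambda>i. absv (coeff Q' i)) ` {..n}))"
  have "M \<ge> 1"
    by (simp add: M_def)
  have M: "absv (coeff Q' i) \<le> M" for i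
  proof (cases "i \<le> n")
    case True
    then show ?thesis unfolding M_def by (intro Max_ge) auto
  next
    case False
    then show ?thesis using \<open>M \<ge> 1\<close> coeff_eq_0[of Q' i] by (simp add: n_def)
  qed
  \<comment> \<open>\<open>M ^ n\<close> bounds the powers of a root, so with this error a root of
    one approximant makes the next approximant at most ((1/2)^m)^n there. That value is a product of
    n distances to roots, so one distance is at most (1/2)^m.\<close>
  define e where "e m = (1/2) ^ (m * n) / M ^ n" for m :: nat
  have e_pos: "e m > 0" for m
    using \<open>M \<ge> 1\<close> by (simp add: e_def)
  have e_le: "e m' \<le> e m" if "m \<le> m'" for m m'
    using \<open>M \<ge> 1\<close> that by (auto simp: e_def intro!: divide_right_mono power_decreasing)
  have eM: "e m * M ^ n = ((1/2) ^ m) ^ n" for m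
    using \<open>M \<ge> 1\<close> by (simp add: e_def power_mult)
  have "e 0 \<le> 1"
    using \<open>M \<ge> 1\<close> by (simp add: e_def one_le_power divide_le_eq)
  have "\<exists>A. size A = n \<and> (\<forall>i. absv (coeff ((\<Prod>x\<in>#A. [:- j x, 1:]) - Q') i) \<le> e m)" for m
    using monic_approx[OF lc e_pos[of m]] unfolding n_def by blast
  then have "\<exists>A. \<forall>m. size (A m) = n \<and> (\<forall>i. absv (coeff ((\<Prod>x\<in>#A m. [:- j x, 1:]) - Q') i) \<le> e m)"
    by (intro choice allI)
  then obtain A where "\<forall>m. size (A m) = n \<and> (\<forall>i. absv (coeff ((\<Prod>x\<in>#A m. [:- j x, 1:]) - Q') i) \<le> e m)" ..
  then have A: "\<And>m. size (A m) = n"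
    "\<And>m i. absv (coeff ((\<Prod>x\<in>#A m. [:- j x, 1:]) - Q') i) \<le> e m"
    by simp_all
  define R where "R m = (\<Prod>x\<in>#A m. [:- j x, 1:])" for m
  have RQ: "absv (coeff (R m - Q') i) \<le> e m" for m i
    using A by (simp add: R_def)
  have poly_R: "poly (R m) z = (\<Prod>x\<in>#A m. z - j x)" for m z
    by (simp add: R_def poly_prod_mset image_mset.compositionality comp_def)
  have deg_R: "degree (R m) = n \<and> lead_coeff (R m) = 1" for m
  proof -
    have "degree (\<Prod>x\<in>#B. [:- j x, 1:]) = size B \<and> lead_coeff (\<Prod>x\<in>#B. [:- j x, 1:]) = 1" for B
    proof (induction B)
      case (add x B)
      define P where "P = (\<Prod>x\<in>#B. [:- j x, 1:])"
      have P: "degree P = size B" "lead_coeff P = 1" "P \<noteq> 0"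
        using add by (auto simp: P_def)
      have "degree ([:- j x, 1:] * P) = Suc (size B)"
        using P by (subst degree_mult_eq) auto
      moreover have "lead_coeff ([:- j x, 1:] * P) = 1"
        using P by (subst lead_coeff_mult) simp
      ultimately show ?case
        by (simp only: image_mset_add_mset prod_mset.add_mset P_def size_add_mset)
    qed simp
    from this[of "A m"] show ?thesis
      unfolding R_def A(1) .
  qed
  have M_R: "absv (coeff (R m) i) \<le> M" for m i
  proof -
    have "absv (coeff (R m - Q') i) \<le> M"
      using RQ[of m i] e_le[of 0 m] \<open>e 0 \<le> 1\<close> \<open>M \<ge> 1\<close> by linarith
    from absv_add_leI[OF this M[of i]] show ?thesis
      by simp
  qed
  have small: "absv (poly P z) \<le> ((1/2) ^ m) ^ n"
    if "\<And>i. absv (coeff P i) \<le> e m" and "poly (R m) z = 0" and "degree P \<le> n" for P z m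
  proof -
    have "absv z \<le> M"
      by (rule absv_root_le[OF M_R \<open>M \<ge> 1\<close> conjunct2[OF deg_R] that(2)])
    from absv_poly_le[OF that(1) this \<open>M \<ge> 1\<close> that(3)] show ?thesis
      unfolding eM .
  qed
  \<comment> \<open>A chain of roots with geometrically small steps; its limit will be a root of
    \<open>Q'\<close>.\<close>
  have "\<exists>r. \<forall>m. poly (R m) (r m) = 0 \<and> absv (r (Suc m) - r m) \<le> (1/2) ^ m"
  proof (rule dependent_nat_choice)
    have "A 0 \<noteq> {#}"
      using A(1)[of 0] n by auto
    then obtain x where "x \<in># A 0"
      by (meson multiset_nonemptyE)
    then show "\<exists>x. poly (R 0) x = 0"
      by (intro exI[of _ "j x"]) (force simp: poly_R prod_mset_zero_iff)
  next
    fix z m assume z: "poly (R m) z = 0"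
    have "absv (coeff (R (Suc m) - Q') i - coeff (R m - Q') i) \<le> e m" for i
      using RQ[of m i] order_trans[OF RQ[of "Suc m" i] e_le[of m "Suc m"]] by (intro absv_diff_leI) auto
    then have "absv (coeff (R (Suc m) - R m) i) \<le> e m" for i
      by simp
    moreover have "degree (R (Suc m) - R m) \<le> n"
      using deg_R[of m] deg_R[of "Suc m"] by (intro degree_diff_le) auto
    ultimately have "absv (poly (R (Suc m) - R m) z) \<le> ((1/2) ^ m) ^ n"
      using z by (intro small)
    then have "absv (poly (R (Suc m)) z) \<le> ((1/2) ^ m) ^ n"
      using z by simp
    then have *: "(\<Prod>x\<in>#A (Suc m). absv (z - j x)) \<le> ((1/2) ^ m) ^ n"
      unfolding poly_R absv_prod_mset .
    have "\<exists>x\<in>#A (Suc m). absv (z - j x) \<le> (1/2) ^ m"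
    proof (rule ccontr)
      assume **: "\<not> ?thesis"
      have ne: "set_mset (A (Suc m)) \<noteq> {}"
        using A(1)[of "Suc m"] n by auto
      define \<mu> where "\<mu> = Min ((\<lambda>x. absv (z - j x)) ` set_mset (A (Suc m)))"
      have "\<mu> \<in> (\<lambda>x. absv (z - j x)) ` set_mset (A (Suc m))"
        unfolding \<mu>_def using ne by (intro Min_in) auto
      then have "\<mu> > (1/2) ^ m"
        using ** by force
      then have "\<mu> ^ n > ((1/2) ^ m) ^ n"
        using n by (intro power_strict_mono) auto
      moreover have "\<mu> ^ size (A (Suc m)) \<le> (\<Prod>x\<in>#A (Suc m). absv (z - j x))"
        using \<open>\<mu> > (1/2) ^ m\<close> order_trans[OF _ less_imp_le[OF \<open>\<mu> > (1/2) ^ m\<close>], of 0]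
        by (intro power_le_prod_mset) (auto simp: \<mu>_def)
      ultimately show False
        using * by (simp add: A(1))
    qed
    then obtain x where x: "x \<in># A (Suc m)" "absv (z - j x) \<le> (1/2) ^ m"
      by blast
    show "\<exists>y. poly (R (Suc m)) y = 0 \<and> absv (y - z) \<le> (1/2) ^ m"
      using x by (intro exI[of _ "j x"]) (force simp: poly_R prod_mset_zero_iff absv_minus_commute)
  qed
  then obtain r where r: "\<And>m. poly (R m) (r m) = 0" "\<And>m. absv (r (Suc m) - r m) \<le> (1/2) ^ m"
    by blast
  have half: "(\<lambda>m. (1/2 :: real) ^ m) \<longlonglongrightarrow> 0"
    by (rule LIMSEQ_realpow_zero) auto
  have "convergent r"
  proof (rule convergent_if_increments_tendsto_0)
    show "(\<lambda>m. absv (r (Suc m) - r m)) \<longlonglongrightarrow> 0"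
      by (rule tendsto_sandwich[OF _ _ tendsto_const half]) (use r in auto)
  qed
  then obtain x where x: "r \<longlonglongrightarrow> x"
    by (auto simp: convergent_def)
  have "(\<lambda>m. poly Q' (r m)) \<longlonglongrightarrow> 0"
  proof (rule tendsto_absv_comparison)
    show "\<forall>\<^sub>F m in sequentially. absv (poly Q' (r m) - 0) \<le> (1/2) ^ m"
    proof (rule always_eventually, rule allI)
      fix m
      have "absv (poly (R m - Q') (r m)) \<le> ((1/2) ^ m) ^ n"
        using deg_R[of m] by (intro small RQ r degree_diff_le) (auto simp: n_def)
      also have "\<dots> \<le> ((1/2) ^ m) ^ 1"
        using n by (intro power_decreasing) (auto simp: power_le_one)
      finally show "absv (poly Q' (r m) - 0) \<le> (1/2) ^ m"
        using r(1)[of m] by simp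
    qed
  qed (rule half)
  then have "poly Q' x = 0"
    using tendsto_poly_nonarch[OF x, of Q'] LIMSEQ_unique by blast
  then show ?thesis
    using roots by blast
qed

text \<open>Take a root of prod (X - z) = 1, the product running over Z and 0. All factors are at
  most 1 and their product is 1, so each has absolute value exactly 1. In effect the residue field
  is infinite.\<close>

lemma exists_unit_away:
  fixes Z :: "'c set"
  assumes "finite Z" and "\<And>z. z \<in> Z \<Longrightarrow> absv z \<le> 1"
  obtains x where "absv x = 1" and "\<And>z. z \<in> Z \<Longrightarrow> absv (x - z) = 1"
proof -
  define Z' where "Z' = insert 0 Z"
  have Z': "finite Z'" "Z' \<noteq> {}" "\<And>z. z \<in> Z' \<Longrightarrow> absv z \<le> 1"
    using assms by (auto simp: Z'_def)
  define p where "p = (\<Prod>z\<in>Z'. [:- z, 1:])"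
  have "degree p = card Z'"
    unfolding p_def by (subst degree_prod_eq_sum_degree) auto
  moreover have "card Z' > 0"
    using Z' by (simp add: card_gt_0_iff)
  ultimately have "degree (p - 1) > 0"
    by (metis degree_1 degree_add_eq_left degree_minus diff_conv_add_uminus)
  then obtain x where "poly (p - 1) x = 0"
    using alg_closed_C by blast
  then have x: "(\<Prod>z\<in>Z'. x - z) = 1"
    by (simp add: p_def poly_prod)
  have "absv x \<le> 1"
  proof (rule ccontr)
    assume *: "\<not> absv x \<le> 1"
    then have "absv (x - z) = absv x" if "z \<in> Z'" for z
      using Z'(3)[OF that] by (intro absv_diff_eq) auto
    then have "absv (\<Prod>z\<in>Z'. x - z) = absv x ^ card Z'"
      by (simp add: absv_prod)
    then show False
      using * x one_less_power[of "absv x" "card Z'"] \<open>card Z' > 0\<close> by simp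
  qed
  then have le: "absv (x - z) \<le> 1" if "z \<in> Z'" for z
    using Z'(3)[OF that] by (rule absv_diff_leI)
  have "absv (x - z) = 1" if "z \<in> Z'" for z
  proof -
    have "1 = absv (\<Prod>z\<in>Z'. x - z)"
      by (simp only: x absv_1)
    also have "\<dots> = absv (x - z) * (\<Prod>y\<in>Z' - {z}. absv (x - y))"
      unfolding absv_prod by (rule prod.remove[OF Z'(1) that])
    also have "\<dots> \<le> absv (x - z) * 1"
      using le by (intro mult_left_mono prod_le_1) auto
    finally show ?thesis
      using le[OF that] by simp
  qed
  with that[of x] show ?thesis
    unfolding Z'_def by (metis diff_zero insert_iff)
qed

lemma exists_separated_units:
  "\<exists>Z :: 'c set. finite Z \<and> card Z = n \<and> (\<forall>z\<in>Z. absv z = 1) \<and> (\<forall>z\<in>Z. \<forall>y\<in>Z. y \<noteq> z \<longrightarrow> absv (y - z) = 1)"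
proof (induction n)
  case 0
  show ?case by (intro exI[of _ "{}"]) simp
next
  case (Suc n)
  then obtain Z :: "'c set" where Z: "finite Z" "card Z = n" "\<forall>z\<in>Z. absv z = 1"
    "\<forall>z\<in>Z. \<forall>y\<in>Z. y \<noteq> z \<longrightarrow> absv (y - z) = 1"
    by (elim exE conjE) (rule that)
  obtain x where x: "absv x = 1" "\<And>z. z \<in> Z \<Longrightarrow> absv (x - z) = 1"
    using exists_unit_away[of Z] Z by auto
  then have "x \<notin> Z"
    by force
  with x Z show ?case
    by (intro exI[of _ "insert x Z"]) (auto simp: absv_minus_commute)
qed

text \<open>Newton interpolation at units with distinct residues: splitting off the value at
  \<open>z0\<close> and dividing by X - z0 uses up one node, and z - z0 has absolute value 1 at the
  others, so the bound passes to the quotient.\<close>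

lemma gauss_norm_aux:
  fixes p :: "'c poly"
  assumes "finite Z" and "\<And>z. z \<in> Z \<Longrightarrow> absv z = 1" and "degree p < card Z"
    and "\<And>z y. z \<in> Z \<Longrightarrow> y \<in> Z \<Longrightarrow> y \<noteq> z \<Longrightarrow> absv (y - z) = 1"
    and "\<And>z. z \<in> Z \<Longrightarrow> absv (poly p z) \<le> B"
  shows "absv (coeff p i) \<le> B"
  using assms
proof (induction "degree p" arbitrary: p Z i)
  case 0
  then obtain c where "p = [:c:]"
    by (metis degree_eq_zeroE)
  moreover obtain z where "z \<in> Z"
    using 0 by fastforce
  ultimately show ?case
    using 0(6)[of z] order_trans[OF absv_nonneg[of c]] by (cases i) auto
next
  case (Suc n)
  obtain z0 where z0: "z0 \<in> Z"
    using Suc by fastforce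
  define p1 where "p1 = synthetic_div p z0"
  have p: "p = [:- z0, 1:] * p1 + [:poly p z0:]"
    by (simp only: p1_def synthetic_div_correct')
  have "absv (poly p1 z) \<le> B" if "z \<in> Z - {z0}" for z
  proof -
    have "poly p z = (z - z0) * poly p1 z + poly p z0"
      by (subst p) (simp add: algebra_simps)
    then have "absv (z - z0) * absv (poly p1 z) = absv (poly p z - poly p z0)"
      by (simp flip: absv_mult)
    also have "\<dots> \<le> B"
      using that z0 Suc.prems(5) by (intro absv_diff_leI) auto
    finally show ?thesis
      using that z0 Suc.prems(4)[of z0 z] by simp
  qed
  moreover have "degree p1 = n"
    using Suc(2) by (simp add: p1_def degree_synthetic_div)
  ultimately have p1: "absv (coeff p1 i) \<le> B" for i
    using Suc.prems z0 Suc(2) by (intro Suc(1)[of p1 "Z - {z0}"]) auto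
  have "coeff p i = coeff (pCons 0 p1) i - z0 * coeff p1 i + coeff [:poly p z0:] i"
    by (subst p) simp
  moreover have "absv (coeff (pCons 0 p1) i) \<le> B" "absv (coeff [:poly p z0:] i) \<le> B"
    using p1 Suc.prems(5)[OF z0] order_trans[OF absv_nonneg p1[of 0]] by (cases i; simp)+
  moreover have "absv (z0 * coeff p1 i) \<le> B"
    using p1[of i] Suc.prems(2)[OF z0] by (simp add: absv_mult)
  ultimately show ?case
    by (metis absv_add_leI absv_diff_leI)
qed

text \<open>Cauchy's inequality for polynomials; substituting y X moves the circle |x| = |y| to the
  unit circle.\<close>

lemma gauss_norm:
  fixes p :: "'c poly" and y :: 'c
  assumes "y \<noteq> 0" and "\<And>x. absv x = absv y \<Longrightarrow> absv (poly p x) \<le> B"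
  shows "absv (coeff p i) * absv y ^ i \<le> B"
proof -
  define r where "r = pcompose p [:0, y:]"
  obtain Z :: "'c set" where Z: "finite Z" "card Z = Suc (degree r)" "\<forall>z\<in>Z. absv z = 1"
    "\<forall>z\<in>Z. \<forall>y\<in>Z. y \<noteq> z \<longrightarrow> absv (y - z) = 1"
    using exists_separated_units[of "Suc (degree r)"] by (elim exE conjE) (rule that)
  have "absv (coeff r i) \<le> B"
  proof (rule gauss_norm_aux[of Z])
    show "absv (poly r z) \<le> B" if "z \<in> Z" for z
      using that Z assms(2)[of "z * y"] by (simp add: r_def poly_pcompose absv_mult)
  qed (use Z in auto)
  then show ?thesis
    by (simp add: r_def coeff_pcompose_linear absv_mult absv_power mult.commute)
qed

text \<open>Cauchy's inequalities for a Laurent polynomial: multiplying by x^(degree W) turns it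
  into a polynomial. With \<open>coeff W 0 = 0\<close> the powers in \<open>W\<close> and
  \<open>U\<close> do not overlap, so each coefficient is read off separately.\<close>

lemma laurent_coeff_bounds:
  fixes W U :: "'c poly" and y :: 'c
  assumes "y \<noteq> 0" and "coeff W 0 = 0"
    and "\<And>x. absv x = absv y \<Longrightarrow> absv (poly W (1 / x) + poly U x) \<le> B"
  shows "absv (coeff W i) \<le> B * absv y ^ i" and "absv (coeff U i) * absv y ^ i \<le> B"
proof -
  define m where "m = degree W"
  define p where "p = reflect_poly W + monom 1 m * U"
  have y: "absv y > 0"
    using assms by simp
  have "B \<ge> 0"
    using assms(3)[of y] order_trans[OF absv_nonneg] by blast
  have "absv (poly p x) \<le> B * absv y ^ m" if x: "absv x = absv y" for x
  proof -
    have "x \<noteq> 0"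
      using assms(1) x by fastforce
    then have "poly p x = x ^ m * (poly W (1 / x) + poly U x)"
      by (simp add: p_def m_def poly_reflect_poly_nz poly_monom algebra_simps inverse_eq_divide)
    then show ?thesis
      using assms(3)[OF x] y x by (simp add: absv_mult absv_power mult.commute)
  qed
  from gauss_norm[OF assms(1) this] have *: "absv (coeff p i) * absv y ^ i \<le> B * absv y ^ m" for i .
  show "absv (coeff W i) \<le> B * absv y ^ i"
  proof (cases "i = 0 \<or> i > m")
    case True
    then have "coeff W i = 0"
      using assms(2) coeff_eq_0[of W i] by (auto simp: m_def)
    with \<open>B \<ge> 0\<close> show ?thesis by simp
  next
    case False
    then have "coeff p (m - i) = coeff W i"
      by (simp add: p_def coeff_reflect_poly coeff_monom_mult m_def)
    with *[of "m - i"] have "absv (coeff W i) * absv y ^ (m - i) \<le> (B * absv y ^ i) * absv y ^ (m - i)"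
      using False by (simp add: mult.assoc flip: power_add)
    then show ?thesis
      using y by simp
  qed
  have "coeff p (m + i) = coeff U i"
    using assms(2) by (simp add: p_def coeff_reflect_poly coeff_monom_mult m_def)
  with *[of "m + i"] have "(absv (coeff U i) * absv y ^ i) * absv y ^ m \<le> B * absv y ^ m"
    by (simp add: power_add mult_ac)
  then show "absv (coeff U i) * absv y ^ i \<le> B"
    using y by simp
qed

text \<open>Supplies a point on the circle of radius sqrt q and, by inversion or multiplication by
  powers of T, on circles of other half-integral exponents. Such circles contain no point of K, see
  \<open>circle_far\<close>.\<close>

lemma exists_sqrt_T: "\<exists>s :: 'c. absv s ^ 2 = q"
proof -
  obtain s :: 'c where "poly [:- T, 0, 1:] s = 0"
    using alg_closed_C[of "[:- T, 0, 1:]"] by auto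
  then have "s ^ 2 = T"
    by (simp add: power2_eq_square eq_neg_iff_add_eq_0[symmetric])
  then have "absv s ^ 2 = q"
    by (simp flip: absv_power add: absv_T)
  then show ?thesis ..
qed

end

section \<open>The exponential of \<open>A\<close>\<close>

lemma absv_le_0_iff [simp]: "absv (x :: 'c::nonarch_field) \<le> 0 \<longleftrightarrow> x = 0"
  using absv_nonneg[of x] absv_eq_0[of x] by linarith

lemma min_factor_bound:
  fixes f :: "'a \<Rightarrow> 'c::nonarch_field"
  assumes "absv u \<le> absv (u - v)"
  shows "absv v \<le> absv (u - v)"
  using assms absv_diff_leI[of u "absv (u - v)" "u - v"] by simp

context C_infinity
begin

definition Prd :: "nat \<Rightarrow> 'c \<Rightarrow> 'c" where
  "Prd d x = (\<Prod>b\<in>polys_below d - {0}. 1 - x / \<iota> b)"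

definition E_fin :: "nat \<Rightarrow> 'c \<Rightarrow> 'c" where
  "E_fin d x = x * Prd d x"

definition tau_fin :: "nat \<Rightarrow> 'c \<Rightarrow> 'c" where
  "tau_fin d x = (\<Sum>b\<in>polys_below d. 1 / (x - \<iota> b))"

text \<open>The linear coefficient of prod (x - b). Dividing by it gives \<open>E_fin\<close> the
  derivative 1 at 0.\<close>

definition kappa :: "nat \<Rightarrow> 'c" where
  "kappa d = (\<Prod>b\<in>polys_below d - {0}. - \<iota> b)"

lemma kappa_nonzero [simp]: "kappa d \<noteq> 0"
  by (simp add: kappa_def)

lemma E_fin_eq: "E_fin d x = (\<Prod>b\<in>polys_below d. x - \<iota> b) / kappa d"
proof -
  have 1: "(\<Prod>b\<in>polys_below d. x - \<iota> b) = x * (\<Prod>b\<in>polys_below d - {0}. x - \<iota> b)"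
    by (subst prod.remove[of _ 0]) auto
  have 2: "Prd d x = (\<Prod>b\<in>polys_below d - {0}. (x - \<iota> b) / (- \<iota> b))"
    unfolding Prd_def by (rule prod.cong) (auto simp: field_simps)
  show ?thesis
    unfolding E_fin_def 1 2 prod_dividef kappa_def by simp
qed

lemma prod_differences:
  assumes "b0 \<in> polys_below d"
  shows "(\<Prod>b\<in>polys_below d - {b0}. \<iota> b0 - \<iota> b) = kappa d"
  unfolding kappa_def
  by (rule prod.reindex_bij_witness[of _ "\<lambda>c. b0 + c" "\<lambda>b. b - b0"])
     (use assms in \<open>auto simp: polys_below_add polys_below_diff of_A_add of_A_diff\<close>)

lemma sum_products_eq_kappa:
  "(\<Sum>b\<in>polys_below d. \<Prod>b'\<in>polys_below d - {b}. x - \<iota> b') = kappa d"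
proof -
  let ?P = "polys_below d :: 'q poly set"
  define p where "p = (\<Sum>b\<in>?P. \<Prod>b'\<in>?P - {b}. [:- \<iota> b', 1:]) - [:kappa d:]"
  have poly_p: "poly p x = (\<Sum>b\<in>?P. \<Prod>b'\<in>?P - {b}. x - \<iota> b') - kappa d" for x
    by (simp add: p_def poly_sum poly_prod)
  have root: "poly p (\<iota> b0) = 0" if b0: "b0 \<in> ?P" for b0
  proof -
    have "(\<Prod>b'\<in>?P - {b}. \<iota> b0 - \<iota> b') = 0" if "b \<in> ?P - {b0}" for b
      using b0 that by (intro prod_zero) auto
    then have "(\<Sum>b\<in>?P - {b0}. \<Prod>b'\<in>?P - {b}. \<iota> b0 - \<iota> b') = 0"
      by (intro sum.neutral ballI)
    then have "(\<Sum>b\<in>?P. \<Prod>b'\<in>?P - {b}. \<iota> b0 - \<iota> b') = (\<Prod>b'\<in>?P - {b0}. \<iota> b0 - \<iota> b')"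
      by (subst sum.remove[OF _ b0]) simp_all
    then show ?thesis
      by (simp add: poly_p prod_differences[OF b0])
  qed
  have "p = 0"
  proof (rule ccontr)
    assume "p \<noteq> 0"
    have card: "card (\<iota> ` ?P) = card ?P"
      by (intro card_image inj_onI) auto
    have "card ?P > 0"
      using card_gt_0_iff[of ?P] zero_in_polys_below[of d] by (metis empty_iff finite_polys_below)
    have "degree (\<Prod>b'\<in>?P - {b}. [:- \<iota> b', 1:]) \<le> card ?P - 1" if "b \<in> ?P" for b
      using that by (subst degree_prod_eq_sum_degree) auto
    then have "degree p \<le> card ?P - 1"
      unfolding p_def by (intro degree_diff_le degree_sum_le) auto
    moreover have "card (\<iota> ` ?P) \<le> degree p"
      using root \<open>p \<noteq> 0\<close>
      by (intro order_trans[OF card_mono card_poly_roots_bound] poly_roots_finite) auto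
    ultimately show False
      using card \<open>card ?P > 0\<close> by linarith
  qed
  then have "poly p x = 0"
    by simp
  then show ?thesis
    unfolding poly_p by simp
qed

text \<open>Partial fractions: the numerator is a polynomial of degree less than \<open>card (polys_below d)\<close>
  that takes the same value at all elements of the group, so it is constant.\<close>

lemma tau_fin_eq:
  assumes "x \<notin> range \<iota>"
  shows "tau_fin d x = 1 / E_fin d x"
proof -
  let ?P = "polys_below d :: 'q poly set"
  have nz: "x - \<iota> b \<noteq> 0" for b
    using assms by auto
  have "tau_fin d x = (\<Sum>b\<in>?P. (\<Prod>b'\<in>?P - {b}. x - \<iota> b') / (\<Prod>b'\<in>?P. x - \<iota> b'))"
    unfolding tau_fin_def
  proof (rule sum.cong)
    fix b :: "'q poly" assume b: "b \<in> ?P"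
    show "1 / (x - \<iota> b) = (\<Prod>b'\<in>?P - {b}. x - \<iota> b') / (\<Prod>b'\<in>?P. x - \<iota> b')"
      using nz by (subst prod.remove[OF finite_polys_below b, of "\<lambda>b'. x - \<iota> b'"]) auto
  qed simp
  also have "\<dots> = kappa d / (\<Prod>b'\<in>?P. x - \<iota> b')"
    by (simp add: sum_products_eq_kappa flip: sum_divide_distrib)
  finally show ?thesis
    by (simp add: E_fin_eq)
qed

text \<open>After translating \<open>x\<close> by the closest \<open>b0\<close>, every factor satisfies \<open>|x - b| \<ge> max y |b|\<close>.\<close>

lemma absv_tau_fin_le:
  assumes y: "y > 0" and far: "\<And>b. y \<le> absv (x - \<iota> b)" and "s \<le> d"
  shows "absv (tau_fin d x) \<le> (1 / y) * (q ^ s / y) ^ (card (polys_below s :: 'q poly set) - 1)"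
proof -
  let ?P = "polys_below d :: 'q poly set"
  let ?S = "polys_below s :: 'q poly set"
  have "x \<notin> range \<iota>"
  proof
    assume "x \<in> range \<iota>"
    then obtain b where "x = \<iota> b" ..
    then show False
      using y far[of b] by simp
  qed
  have "(\<lambda>b. absv (x - \<iota> b)) ` ?P \<noteq> {}"
    using zero_in_polys_below[of d] by blast
  then have "Min ((\<lambda>b. absv (x - \<iota> b)) ` ?P) \<in> (\<lambda>b. absv (x - \<iota> b)) ` ?P"
    by (intro Min_in) auto
  then obtain b0 where b0: "b0 \<in> ?P" "absv (x - \<iota> b0) = Min ((\<lambda>b. absv (x - \<iota> b)) ` ?P)"
    by auto
  then have min: "absv (x - \<iota> b0) \<le> absv (x - \<iota> b)" if "b \<in> ?P" for b
    using that by simp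
  have ge: "max y (absv (\<iota> b)) \<le> absv (x - \<iota> (b0 + b))" if "b \<in> ?P" for b
    using min_factor_bound[of "x - \<iota> b0" "\<iota> b"] min[of "b0 + b"] far[of "b0 + b"] b0(1) that
    by (simp add: of_A_add polys_below_add algebra_simps)
  have "(\<Prod>b\<in>?P. absv (x - \<iota> b)) = (\<Prod>b\<in>?P. absv (x - \<iota> (b0 + b)))"
    by (rule prod.reindex_bij_witness[of _ "\<lambda>b. b0 + b" "\<lambda>b. b - b0"])
       (use b0 in \<open>auto intro: polys_below_add polys_below_diff\<close>)
  also have "\<dots> = absv (x - \<iota> b0) * (\<Prod>b\<in>?P - {0}. absv (x - \<iota> (b0 + b)))"
    by (subst prod.remove[of _ 0]) auto
  also have "\<dots> \<ge> y * (\<Prod>b\<in>?P - {0}. max y (absv (\<iota> b)))"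
    using y far ge by (intro mult_mono prod_mono prod_nonneg) (auto simp: le_max_iff_disj)
  finally have 1: "y * (\<Prod>b\<in>?P - {0}. max y (absv (\<iota> b))) \<le> (\<Prod>b\<in>?P. absv (x - \<iota> b))" .
  have kap: "(\<Prod>b\<in>?P - {0}. absv (\<iota> b)) = absv (kappa d)"
    by (simp add: kappa_def absv_prod)
  \<comment> \<open>Each quotient max y |b| / |b| is at least 1, so the factors outside
    \<open>?S\<close> may be dropped; those inside are at least y / q^s. The free parameter s
    decides which power of 1 / y is gained.\<close>
  have "(y / q ^ s) ^ (card ?S - 1) = (\<Prod>b\<in>?S - {0}. y / q ^ s)"
    by simp
  also have "\<dots> \<le> (\<Prod>b\<in>?S - {0}. max y (absv (\<iota> b)) / absv (\<iota> b))"
    using y absv_of_A_le[of _ s]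
    by (intro prod_mono conjI frac_le) (auto simp: le_max_iff_disj intro!: divide_nonneg_nonneg)
  also have "\<dots> \<le> (\<Prod>b\<in>?P - {0}. max y (absv (\<iota> b)) / absv (\<iota> b))"
    using polys_below_mono[OF \<open>s \<le> d\<close>, where 'a = 'q] y
    by (intro prod_mono2) (auto simp: le_divide_eq_1 intro!: divide_nonneg_nonneg)
  also have "\<dots> = (\<Prod>b\<in>?P - {0}. max y (absv (\<iota> b))) / absv (kappa d)"
    by (simp add: prod_dividef kap)
  finally have "y * (y / q ^ s) ^ (card ?S - 1) \<le> y * ((\<Prod>b\<in>?P - {0}. max y (absv (\<iota> b))) / absv (kappa d))"
    using y by (intro mult_left_mono) auto
  also have "\<dots> \<le> (\<Prod>b\<in>?P. absv (x - \<iota> b)) / absv (kappa d)"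
    using 1 by (simp add: divide_right_mono)
  also have "\<dots> = absv (E_fin d x)"
    by (simp add: E_fin_eq absv_divide absv_prod)
  finally have "absv (tau_fin d x) \<le> 1 / (y * (y / q ^ s) ^ (card ?S - 1))"
    using y unfolding tau_fin_eq[OF \<open>x \<notin> range \<iota>\<close>] absv_divide by (intro frac_le) auto
  also have "\<dots> = (1 / y) * (q ^ s / y) ^ (card ?S - 1)"
    by (simp add: power_divide)
  finally show ?thesis .
qed

subsection \<open>Convergence\<close>

text \<open>An omitted b has |b| \<ge> q^d > |x|, hence |x - b| = |b|, and the tail is at most its
  largest term.\<close>

lemma absv_tau_fin_diff_le:
  assumes "absv x < q ^ d" and "d \<le> m"
  shows "absv (tau_fin m x - tau_fin d x) \<le> 1 / q ^ d"
proof -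
  have sub: "polys_below d \<subseteq> (polys_below m :: 'q poly set)"
    by (rule polys_below_mono) fact
  have "tau_fin m x - tau_fin d x = (\<Sum>b\<in>polys_below m - polys_below d. 1 / (x - \<iota> b))"
    unfolding tau_fin_def using sum.subset_diff[OF sub finite_polys_below, of "\<lambda>b. 1 / (x - \<iota> b)"] by simp
  also have "absv \<dots> \<le> 1 / q ^ d"
  proof (intro absv_sum_le)
    fix b :: "'q poly" assume "b \<in> polys_below m - polys_below d"
    then have "absv (\<iota> b) \<ge> q ^ d"
      using absv_of_A_ge by blast
    then show "absv (1 / (x - \<iota> b)) \<le> 1 / q ^ d"
      using assms(1) by (simp add: absv_divide absv_diff_eq' frac_le)
  qed auto
  finally show ?thesis .
qed

lemma exists_power_gt: "\<exists>d. x < q ^ d"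
  by (rule real_arch_pow) simp

lemma one_over_q_power_tendsto_0: "(\<lambda>d. C / q ^ d) \<longlonglongrightarrow> 0"
proof -
  have "(\<lambda>d. C * (1 / q) ^ d) \<longlonglongrightarrow> C * 0"
    by (intro tendsto_mult tendsto_const LIMSEQ_realpow_zero) auto
  then show ?thesis
    by (simp add: power_divide)
qed

definition tau :: "'c \<Rightarrow> 'c" where "tau x = lim (\<lambda>d. tau_fin d x)"

lemma tau_fin_tendsto: "(\<lambda>d. tau_fin d x) \<longlonglongrightarrow> tau x"
proof -
  obtain d0 where d0: "absv x < q ^ d0"
    using exists_power_gt by blast
  have lt: "absv x < q ^ d" if "d \<ge> d0" for d
    using d0 that by (meson order.strict_trans2 power_increasing q_ge_1)
  have "convergent (\<lambda>d. tau_fin d x)"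
  proof (rule convergent_if_increments_tendsto_0)
    show "(\<lambda>d. absv (tau_fin (Suc d) x - tau_fin d x)) \<longlonglongrightarrow> 0"
    proof (rule tendsto_sandwich[OF _ _ tendsto_const one_over_q_power_tendsto_0[of 1]])
      show "\<forall>\<^sub>F d in sequentially. absv (tau_fin (Suc d) x - tau_fin d x) \<le> 1 / q ^ d"
        using lt by (intro eventually_sequentiallyI[of d0] absv_tau_fin_diff_le) auto
    qed auto
  qed
  then show ?thesis
    by (simp add: tau_def convergent_LIMSEQ_iff)
qed

lemma absv_tau_diff_le:
  assumes "absv x < q ^ d"
  shows "absv (tau x - tau_fin d x) \<le> 1 / q ^ d"
proof (rule absv_limit_le)
  show "(\<lambda>m. tau_fin m x - tau_fin d x) \<longlonglongrightarrow> tau x - tau_fin d x"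
    by (intro tendsto_diff tau_fin_tendsto tendsto_const)
qed (use absv_tau_fin_diff_le[OF assms] in auto)

lemma absv_tau_le:
  assumes "y > 0" and "\<And>b. y \<le> absv (x - \<iota> b)"
  shows "absv (tau x) \<le> (1 / y) * (q ^ s / y) ^ (card (polys_below s :: 'q poly set) - 1)"
  by (rule absv_limit_le[OF tau_fin_tendsto[of x], of s], rule absv_tau_fin_le[OF assms])

text \<open>F is arbitrary because \<open>lattice_exp\<close> is a limit along all finite subsets of
  the lattice. The additional factors 1 - x / b have |b| \<ge> q^d, so their product is within |x| /
  q^d of 1.\<close>

lemma absv_Prd_diff_le:
  assumes "absv x < q ^ d" and "finite F" and "polys_below d - {0} \<subseteq> F" and "0 \<notin> F"
  shows "absv ((\<Prod>b\<in>F. 1 - x / \<iota> b) - Prd d x) \<le> absv (Prd d x) * absv x / q ^ d"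
proof -
  define G where "G = (\<Prod>b\<in>F - (polys_below d - {0}). 1 - x / \<iota> b)"
  have "absv (G - 1) \<le> absv x / q ^ d"
    unfolding G_def
  proof (rule absv_prod_diff_le)
    fix b :: "'q poly" assume "b \<in> F - (polys_below d - {0})"
    then have "absv (\<iota> b) \<ge> q ^ d" "b \<noteq> 0"
      using assms absv_of_A_ge[of b d] by auto
    then show "absv (x / \<iota> b) \<le> absv x / q ^ d"
      unfolding absv_divide by (intro divide_left_mono) (auto intro!: mult_pos_pos)
  qed (use assms in auto)
  moreover have "(\<Prod>b\<in>F. 1 - x / \<iota> b) = G * Prd d x"
    unfolding G_def Prd_def by (rule prod.subset_diff[OF assms(3,2)])
  then have "(\<Prod>b\<in>F. 1 - x / \<iota> b) - Prd d x = Prd d x * (G - 1)"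
    by (simp add: algebra_simps)
  ultimately show ?thesis
    using mult_left_mono[of "absv (G - 1)" "absv x / q ^ d" "absv (Prd d x)"] by (simp add: absv_mult)
qed

definition Prd_lim :: "'c \<Rightarrow> 'c" where "Prd_lim x = lim (\<lambda>d. Prd d x)"

text \<open>The factors added after d have absolute value 1. Hence one constant serves in the error
  bounds for all later d, and the limit cannot vanish away from A.\<close>

lemma absv_Prd_eq:
  assumes "absv x < q ^ d" and "d \<le> m"
  shows "absv (Prd m x) = absv (Prd d x)"
proof -
  have le: "absv (Prd m x - Prd d x) \<le> absv (Prd d x) * (absv x / q ^ d)"
    using absv_Prd_diff_le[OF assms(1), of "polys_below m - {0}"] polys_below_mono[OF assms(2), where 'a = 'q]
    by (auto simp: Prd_def)
  show ?thesis
  proof (cases "Prd d x = 0")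
    case True
    with le show ?thesis by simp
  next
    case False
    note le
    also have "absv (Prd d x) * (absv x / q ^ d) < absv (Prd d x) * 1"
      using assms False by (intro mult_strict_left_mono) auto
    finally show ?thesis
      using absv_add_eq[of "Prd m x - Prd d x" "Prd d x"] by simp
  qed
qed

lemma Prd_tendsto: "(\<lambda>d. Prd d x) \<longlonglongrightarrow> Prd_lim x"
proof -
  obtain d0 where d0: "absv x < q ^ d0"
    using exists_power_gt by blast
  have lt: "absv x < q ^ d" if "d \<ge> d0" for d
    using d0 that by (meson order.strict_trans2 power_increasing q_ge_1)
  have "convergent (\<lambda>d. Prd d x)"
  proof (rule convergent_if_increments_tendsto_0)
    show "(\<lambda>d. absv (Prd (Suc d) x - Prd d x)) \<longlonglongrightarrow> 0"
    proof (rule tendsto_sandwich[OF _ _ tendsto_const one_over_q_power_tendsto_0[of "absv (Prd d0 x) * absv x"]])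
      show "\<forall>\<^sub>F d in sequentially. absv (Prd (Suc d) x - Prd d x) \<le> absv (Prd d0 x) * absv x / q ^ d"
      proof (rule eventually_sequentiallyI)
        fix d assume "d \<ge> d0"
        then show "absv (Prd (Suc d) x - Prd d x) \<le> absv (Prd d0 x) * absv x / q ^ d"
          using absv_Prd_diff_le[OF lt, of d "polys_below (Suc d) - {0}"] polys_below_mono[of d "Suc d", where 'a = 'q]
            absv_Prd_eq[OF d0, of d]
          by (auto simp: Prd_def)
      qed
    qed auto
  qed
  then show ?thesis
    by (simp add: Prd_lim_def convergent_LIMSEQ_iff)
qed

lemma Prd_tendsto_finite_subsets:
  "((\<lambda>F. \<Prod>b\<in>F. 1 - x / \<iota> b) \<longlongrightarrow> Prd_lim x) (finite_subsets_at_top (UNIV - {0}))"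
proof (rule tendstoI)
  fix r :: real assume r: "r > 0"
  obtain d0 where d0: "absv x < q ^ d0"
    using exists_power_gt by blast
  have lt: "absv x < q ^ d" if "d \<ge> d0" for d
    using d0 that by (meson order.strict_trans2 power_increasing q_ge_1)
  have "\<forall>\<^sub>F d in sequentially. absv (Prd d0 x) * absv x / q ^ d < r"
    using order_tendstoD(2)[OF one_over_q_power_tendsto_0] r by blast
  moreover have "\<forall>\<^sub>F d in sequentially. dist (Prd d x) (Prd_lim x) < r"
    by (rule tendstoD[OF Prd_tendsto r])
  moreover have "\<forall>\<^sub>F d in sequentially. d \<ge> d0"
    by (rule eventually_ge_at_top)
  ultimately have "\<forall>\<^sub>F d in sequentially. absv (Prd d0 x) * absv x / q ^ d < r \<and> dist (Prd d x) (Prd_lim x) < r \<and> d \<ge> d0"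
    by eventually_elim simp
  then obtain d where d: "absv (Prd d0 x) * absv x / q ^ d < r" "dist (Prd d x) (Prd_lim x) < r" "d \<ge> d0"
    by (auto simp: eventually_sequentially)
  show "\<forall>\<^sub>F F in finite_subsets_at_top (UNIV - {0}). dist (\<Prod>b\<in>F. 1 - x / \<iota> b) (Prd_lim x) < r"
    unfolding eventually_finite_subsets_at_top
  proof (intro exI[of _ "polys_below d - {0}"] conjI allI impI)
    fix F :: "'q poly set" assume F: "finite F \<and> polys_below d - {0} \<subseteq> F \<and> F \<subseteq> UNIV - {0}"
    then have "0 \<notin> F"
      by auto
    with F have "absv ((\<Prod>b\<in>F. 1 - x / \<iota> b) - Prd d x) < r"
      using absv_Prd_diff_le[OF lt[OF d(3)], of F] absv_Prd_eq[OF d0 d(3)] d(1) by auto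
    then have "absv ((\<Prod>b\<in>F. 1 - x / \<iota> b) - Prd d x + (Prd d x - Prd_lim x)) < r"
      using d(2) by (intro absv_add_lessI) (simp_all add: dist_absv)
    then show "dist (\<Prod>b\<in>F. 1 - x / \<iota> b) (Prd_lim x) < r"
      by (simp add: dist_absv)
  qed auto
qed

definition e_A :: "'c \<Rightarrow> 'c" where "e_A x = x * Prd_lim x"

lemma E_fin_tendsto: "(\<lambda>d. E_fin d x) \<longlonglongrightarrow> e_A x"
  unfolding E_fin_def e_A_def by (intro tendsto_mult tendsto_const Prd_tendsto)

lemma lattice_exp_eq:
  assumes "w \<noteq> 0"
  shows "lattice_exp (period_lattice j w) (w * x) = w * e_A x"
proof -
  let ?f = "\<lambda>a. w * \<iota> a"
  have inj: "inj ?f"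
    using assms by (auto intro!: injI)
  then have im: "period_lattice j w - {0} = ?f ` (UNIV - {0})"
    using assms by (auto simp: period_lattice_def)
  have "((\<lambda>F. \<Prod>l\<in>F. 1 - w * x / l) \<longlongrightarrow> Prd_lim x) (finite_subsets_at_top (period_lattice j w - {0}))"
    unfolding im
  proof (subst filtermap_image_finite_subsets_at_top[symmetric])
    show "inj_on ?f (UNIV - {0})"
      using inj by (rule inj_on_subset) auto
    have "(\<Prod>l\<in>?f ` F. 1 - w * x / l) = (\<Prod>b\<in>F. 1 - x / \<iota> b)" for F
      using inj assms by (subst prod.reindex) (auto intro: inj_on_subset)
    then show "((\<lambda>F. \<Prod>l\<in>F. 1 - w * x / l) \<longlongrightarrow> Prd_lim x) (filtermap ((`) ?f) (finite_subsets_at_top (UNIV - {0})))"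
      using Prd_tendsto_finite_subsets[of x] by (simp add: filterlim_filtermap)
  qed
  then have "Lim (finite_subsets_at_top (period_lattice j w - {0})) (\<lambda>F. \<Prod>l\<in>F. 1 - w * x / l) = Prd_lim x"
    by (intro tendsto_Lim) auto
  then show ?thesis
    by (simp add: lattice_exp_def e_A_def)
qed

lemma Prd_lim_nonzero:
  assumes "x \<notin> range \<iota>"
  shows "Prd_lim x \<noteq> 0"
proof -
  obtain d0 where d0: "absv x < q ^ d0"
    using exists_power_gt by blast
  have *: "1 - x / \<iota> b \<noteq> 0" if "b \<noteq> 0" for b
  proof
    assume "1 - x / \<iota> b = 0"
    then have "x / \<iota> b = 1"
      by simp
    then have "x = \<iota> b"
      by (simp only: divide_eq_1_iff)
    with assms show False by blast
  qed
  have "Prd d0 x \<noteq> 0"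
  proof
    assume "Prd d0 x = 0"
    have "Prd d0 x = 0 \<longleftrightarrow> (\<exists>b\<in>polys_below d0 - {0}. 1 - x / \<iota> b = 0)"
      unfolding Prd_def by (rule prod_zero_iff) simp
    from iffD1[OF this \<open>Prd d0 x = 0\<close>] obtain b where b: "b \<in> polys_below d0 - {0}" "1 - x / \<iota> b = 0" ..
    then have "b \<noteq> 0"
      by simp
    from *[OF this] b(2) show False
      by (rule notE)
  qed
  then have "absv (Prd d0 x) > 0"
    by simp
  have "(\<lambda>d. absv (Prd d x)) \<longlonglongrightarrow> absv (Prd d0 x)"
    by (rule tendsto_eventually, rule eventually_sequentiallyI[of d0], rule absv_Prd_eq[OF d0])
  from this have "absv (Prd_lim x) = absv (Prd d0 x)"
    by (rule LIMSEQ_unique[OF tendsto_absv[OF Prd_tendsto]])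
  with \<open>absv (Prd d0 x) > 0\<close> show ?thesis
    by auto
qed

lemma e_A_nonzero: "x \<notin> range \<iota> \<Longrightarrow> e_A x \<noteq> 0"
  using Prd_lim_nonzero[of x] by (auto simp: e_A_def)

lemma tau_eq:
  assumes "x \<notin> range \<iota>"
  shows "tau x = 1 / e_A x"
proof -
  have "(\<lambda>d. inverse (E_fin d x)) \<longlonglongrightarrow> inverse (e_A x)"
    by (intro tendsto_inverse_nonarch E_fin_tendsto e_A_nonzero assms)
  then have "(\<lambda>d. tau_fin d x) \<longlonglongrightarrow> inverse (e_A x)"
    by (simp add: tau_fin_eq[OF assms] inverse_eq_divide)
  then show ?thesis
    using LIMSEQ_unique[OF tau_fin_tendsto] by (simp add: inverse_eq_divide)
qed

subsection \<open>Functional equations\<close>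

text \<open>M(X + y) - M(X) - M(y) vanishes on the group \<open>polys_below d\<close>. The leading
  terms cancel, so its degree is below the number of these zeros.\<close>

lemma E_fin_add:
  "E_fin d (x + y) = E_fin d x + E_fin d y"
proof -
  let ?P = "polys_below d :: 'q poly set"
  define M where "M = (\<Prod>b\<in>?P. [:- \<iota> b, 1:])"
  define p where "p = pcompose M [:y, 1:] - M - [:poly M y:]"
  have poly_M: "poly M z = (\<Prod>b\<in>?P. z - \<iota> b)" for z
    by (simp add: M_def poly_prod)
  have card: "card (\<iota> ` ?P) = card ?P"
    by (intro card_image inj_onI) auto
  have pos: "card ?P > 0"
    using card_gt_0_iff[of ?P] zero_in_polys_below[of d] by (metis empty_iff finite_polys_below)
  have deg_M: "degree M = card ?P"
    unfolding M_def by (simp add: degree_prod_eq_sum_degree)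
  have lc_M: "lead_coeff M = 1"
    unfolding M_def lead_coeff_prod by simp
  have "p = 0"
  proof (rule ccontr)
    assume "p \<noteq> 0"
    have root: "poly p (\<iota> b) = 0" if b: "b \<in> ?P" for b
    proof -
      have "poly M (\<iota> b) = 0"
        using b by (auto simp: poly_M)
      moreover have "poly M (y + \<iota> b) = poly M y"
        unfolding poly_M
        by (rule prod.reindex_bij_witness[of _ "\<lambda>c. c + b" "\<lambda>c. c - b"])
           (use b in \<open>auto simp: polys_below_add polys_below_diff of_A_add of_A_diff\<close>)
      ultimately show ?thesis
        by (simp add: p_def poly_pcompose add.commute)
    qed
    have "degree (pcompose M [:y, 1:]) = card ?P"
      by (simp add: degree_pcompose deg_M)
    then have "degree p \<le> card ?P"
      unfolding p_def using deg_M by (intro degree_diff_le) auto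
    moreover have "coeff p (card ?P) = 0"
    proof -
      have "lead_coeff (pcompose M [:y, 1:]) = 1"
        using lc_M by (subst lead_coeff_comp) auto
      moreover have "coeff [:poly M y:] (card ?P) = 0"
        using pos by (cases "card ?P") simp_all
      ultimately show ?thesis
        using lc_M deg_M \<open>degree (pcompose M [:y, 1:]) = card ?P\<close> by (simp add: p_def)
    qed
    ultimately have "degree p < card ?P"
      using \<open>p \<noteq> 0\<close> by (metis le_neq_implies_less leading_coeff_0_iff)
    moreover have "card (\<iota> ` ?P) \<le> degree p"
      using root \<open>p \<noteq> 0\<close>
      by (intro order_trans[OF card_mono card_poly_roots_bound] poly_roots_finite) auto
    ultimately show False
      using card by linarith
  qed
  then have "poly p x = 0"
    by simp
  then have "poly M (x + y) = poly M x + poly M y"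
    by (simp add: p_def poly_pcompose add.commute algebra_simps)
  then show ?thesis
    by (simp add: E_fin_eq poly_M add_divide_distrib)
qed

lemma e_A_add: "e_A (x + y) = e_A x + e_A y"
  using LIMSEQ_unique[OF E_fin_tendsto[of "x + y"]] tendsto_add[OF E_fin_tendsto[of x] E_fin_tendsto[of y]]
  by (simp add: E_fin_add)

lemma e_A_const_mult: "e_A (\<iota> [:c:] * x) = \<iota> [:c:] * e_A x"
proof (cases "c = 0")
  case False
  then have inv: "\<iota> [:c:] * \<iota> [:1 / c:] = 1"
    by (simp add: one_pCons[symmetric] flip: of_A_mult)
  have "Prd d (\<iota> [:c:] * x) = Prd d x" for d
    unfolding Prd_def
    by (rule prod.reindex_bij_witness[of _ "\<lambda>b. smult c b" "\<lambda>b. smult (1 / c) b"])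
       (use False inv in \<open>auto simp: of_A_smult polys_below_def field_simps\<close>)
  then show ?thesis
    by (simp add: e_A_def Prd_lim_def)
qed (simp add: e_A_def)

lemma e_A_of_A [simp]: "e_A (\<iota> b) = 0"
proof -
  have "E_fin d (\<iota> b) = 0" if "d \<ge> Suc (degree b)" for d
  proof -
    have "b \<in> polys_below d"
      using that polys_below_mono[OF that, where 'a = 'q] by auto
    then have "(\<Prod>b'\<in>polys_below d. \<iota> b - \<iota> b') = 0"
      by (intro prod_zero) auto
    then show ?thesis
      by (simp add: E_fin_eq)
  qed
  then have "(\<lambda>d. E_fin d (\<iota> b)) \<longlonglongrightarrow> 0"
    by (intro tendsto_eventually eventually_sequentiallyI)
  then show ?thesis
    using E_fin_tendsto LIMSEQ_unique by blast
qed

lemma e_A_eq_0_iff: "e_A x = 0 \<longleftrightarrow> x \<in> range \<iota>"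
  using e_A_nonzero by auto

lemma tau_add_of_A:
  assumes "x \<notin> range \<iota>"
  shows "tau (x + \<iota> b) = tau x"
proof -
  have "x + \<iota> b \<notin> range \<iota>"
  proof
    assume "x + \<iota> b \<in> range \<iota>"
    then obtain a where "x + \<iota> b = \<iota> a" ..
    then have "x = \<iota> (a - b)"
      by (simp add: of_A_diff eq_diff_eq)
    with assms show False by blast
  qed
  with assms show ?thesis
    by (simp add: tau_eq e_A_add)
qed

lemma tau_const_mult:
  assumes "x \<notin> range \<iota>" and "c \<noteq> 0"
  shows "tau (\<iota> [:c:] * x) = tau x / \<iota> [:c:]"
proof -
  have "\<iota> [:c:] * x \<notin> range \<iota>"
  proof
    assume "\<iota> [:c:] * x \<in> range \<iota>"
    then obtain b where "\<iota> [:c:] * x = \<iota> b" by blast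
    have "\<iota> [:1 / c:] * \<iota> [:c:] = 1"
      using assms(2) by (simp add: one_pCons[symmetric] flip: of_A_mult)
    then have "x = \<iota> [:1 / c:] * (\<iota> [:c:] * x)"
      by (simp flip: mult.assoc)
    also have "\<dots> = \<iota> ([:1 / c:] * b)"
      by (simp only: \<open>\<iota> [:c:] * x = \<iota> b\<close> of_A_mult)
    finally show False using assms(1) by blast
  qed
  with assms show ?thesis
    by (simp add: tau_eq e_A_const_mult)
qed

text \<open>Division with remainder makes P * b - r run exactly once through
  \<open>polys_below (D + degree P)\<close>, so the identity holds already for finite sums. The
  factor P that appears here becomes the eigenvalue.\<close>

lemma tau_distribution:
  assumes "P \<noteq> 0"
  shows "(\<Sum>r\<in>polys_below (degree P). tau ((x + \<iota> r) / \<iota> P)) = \<iota> P * tau x"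
proof -
  let ?l = "degree P"
  have fin: "(\<Sum>r\<in>polys_below ?l. tau_fin D ((x + \<iota> r) / \<iota> P)) = \<iota> P * tau_fin (D + ?l) x" for D
  proof -
    have "(\<Sum>r\<in>polys_below ?l. tau_fin D ((x + \<iota> r) / \<iota> P)) =
      (\<Sum>r\<in>polys_below ?l. \<Sum>b\<in>polys_below D. \<iota> P * (1 / (x - \<iota> (P * b - r))))"
      unfolding tau_fin_def using assms
      by (intro sum.cong refl) (simp add: of_A_diff of_A_mult divide_simps, simp add: algebra_simps)
    also have "\<dots> = (\<Sum>(r, b)\<in>polys_below ?l \<times> polys_below D. \<iota> P * (1 / (x - \<iota> (P * b - r))))"
      by (rule sum.cartesian_product)
    also have "\<dots> = (\<Sum>y\<in>polys_below (D + ?l). \<iota> P * (1 / (x - \<iota> y)))"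
    proof (rule sum.reindex_bij_witness[of _ "\<lambda>y. (- (y mod P), y div P)" "\<lambda>(r, b). P * b - r"])
      fix rb :: "'q poly \<times> 'q poly" assume rb: "rb \<in> polys_below ?l \<times> polys_below D"
      obtain r b where [simp]: "rb = (r, b)" by (cases rb)
      have r: "r = 0 \<or> degree r < ?l" and b: "b = 0 \<or> degree b < D"
        using rb by (auto simp: polys_below_iff)
      have "(P * b - r) mod P = - r"
        using r mod_poly_less[of "- r" P] by (auto simp: mod_diff_left_eq[symmetric] poly_mod_diff_left poly_mod_minus_left)
      moreover have "(P * b - r) div P = b"
        using r assms div_poly_less[of r P] by (auto simp: poly_div_diff_left)
      ultimately show "(\<lambda>y. (- (y mod P), y div P)) ((\<lambda>(r, b). P * b - r) rb) = rb"
        by simp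
      have "P * b \<in> polys_below (D + ?l)"
        using b assms by (cases "b = 0") (simp_all add: polys_below_iff degree_mult_eq)
      moreover have "r \<in> polys_below (D + ?l)"
        using r by (auto simp: polys_below_iff)
      ultimately show "(case rb of (r, b) \<Rightarrow> P * b - r) \<in> polys_below (D + ?l)"
        by (simp add: polys_below_diff)
    next
      fix y :: "'q poly" assume y: "y \<in> polys_below (D + ?l)"
      show "(case (- (y mod P), y div P) of (r, b) \<Rightarrow> P * b - r) = y"
        by simp
      have mod: "y mod P \<in> polys_below ?l"
        using degree_mod_less[OF assms] by (auto simp: polys_below_iff)
      then have "y - y mod P \<in> polys_below (D + ?l)"
        using y polys_below_mono[of ?l "D + ?l", where 'a = 'q] by (intro polys_below_diff) auto
      then have "P * (y div P) \<in> polys_below (D + ?l)"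
        by (simp add: minus_mod_eq_mult_div)
      then have "y div P \<in> polys_below D"
        using assms by (cases "y div P = 0") (simp_all add: polys_below_iff degree_mult_eq)
      with mod show "(- (y mod P), y div P) \<in> polys_below ?l \<times> polys_below D"
        by simp
    qed auto
    finally show ?thesis
      by (simp add: tau_fin_def sum_distrib_left)
  qed
  have "(\<lambda>D. \<Sum>r\<in>polys_below ?l. tau_fin D ((x + \<iota> r) / \<iota> P)) \<longlonglongrightarrow> (\<Sum>r\<in>polys_below ?l. tau ((x + \<iota> r) / \<iota> P))"
    by (intro tendsto_sum tau_fin_tendsto)
  moreover have "(\<lambda>D. \<iota> P * tau_fin (D + ?l) x) \<longlonglongrightarrow> \<iota> P * tau x"
    by (intro tendsto_mult tendsto_const LIMSEQ_ignore_initial_segment[OF tau_fin_tendsto])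
  ultimately show ?thesis
    unfolding fin by (rule LIMSEQ_unique)
qed

end

section \<open>The Drinfeld upper half plane\<close>

context C_infinity
begin

text \<open>Completeness of K by coefficients: approximations within q^-n of z agree in all
  coefficients of index below n, so the coefficients stabilize and define the limit.\<close>

lemma K_closed:
  assumes "\<And>n. \<exists>x\<in>K. absv (z - x) \<le> 1 / q ^ n"
  shows "z \<in> K"
proof -
  have "\<exists>y. absv (z - j (to_ac y)) \<le> 1 / q ^ n" for n
    using assms[of n] by (auto simp: K_inf_def)
  then obtain Y where Y: "\<And>n. absv (z - j (to_ac (Y n))) \<le> 1 / q ^ n"
    by metis
  have powi: "1 / q ^ n = q powi (- int n)" for n
    by (simp add: power_int_minus inverse_eq_divide)
  have eq: "fls_nth (Y m) i = fls_nth (Y n) i" if "n \<le> m" "i < int n" for m n i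
  proof -
    have "1 / q ^ m \<le> 1 / q ^ n"
      using that by (intro divide_left_mono power_increasing) auto
    with Y[of m] have "absv (z - j (to_ac (Y m))) \<le> 1 / q ^ n"
      by linarith
    with Y[of n] have "absv (z - j (to_ac (Y n)) - (z - j (to_ac (Y m)))) \<le> 1 / q ^ n"
      by (rule absv_diff_leI)
    then have "K_inf_abs (Y m - Y n) \<le> q powi (- int n)"
      by (simp add: powi j_diff flip: absv_j_to_ac)
    then have "Y m - Y n = 0 \<or> fls_subdegree (Y m - Y n) \<ge> int n"
      unfolding K_inf_abs_le_iff by simp
    then have "fls_nth (Y m - Y n) i = 0"
    proof
      assume "int n \<le> fls_subdegree (Y m - Y n)"
      with that(2) show ?thesis
        by (intro fls_eq0_below_subdegree) linarith
    qed simp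
    then show ?thesis by simp
  qed
  \<comment> \<open>\<open>Suc (nat i)\<close> is an index whose approximation already has the final
    coefficient at i, also for negative i.\<close>
  define y where "y = Abs_fls (\<lambda>i. fls_nth (Y (Suc (nat i))) i)"
  have nth_y: "fls_nth y i = fls_nth (Y (Suc (nat i))) i" for i
    unfolding y_def
  proof (rule nth_Abs_fls_lower_bound)
    show "\<forall>n < min 0 (fls_subdegree (Y 1)). fls_nth (Y (Suc (nat n))) n = 0"
      by auto
  qed
  have "absv (z - j (to_ac y)) \<le> 1 / q ^ n" for n
  proof -
    have "fls_nth (Y n) i = fls_nth y i" if "i < int n" for i
    proof (cases "Suc (nat i) \<le> n")
      case True
      then show ?thesis using eq[of "Suc (nat i)" n i] by (simp add: nth_y)
    next
      case False
      then show ?thesis using eq[of n "Suc (nat i)" i] that by (simp add: nth_y)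
    qed
    then have "Y n - y = 0 \<or> fls_subdegree (Y n - y) \<ge> int n"
      using fls_subdegree_geI[of "Y n - y" "int n"] by force
    then have "K_inf_abs (Y n - y) \<le> q powi (- int n)"
      unfolding K_inf_abs_le_iff by auto
    then have "absv (j (to_ac (Y n)) - j (to_ac y)) \<le> 1 / q ^ n"
      by (simp add: powi j_diff flip: absv_j_to_ac)
    from absv_add_leI[OF Y[of n] this] show ?thesis by simp
  qed
  moreover have "(\<lambda>n. 1 / q ^ n) \<longlonglongrightarrow> 0"
    by (rule one_over_q_power_tendsto_0)
  ultimately have "absv (z - j (to_ac y)) \<le> 0"
    by (intro LIMSEQ_le_const) auto
  then have "z = j (to_ac y)"
    by simp
  then show ?thesis
    by (auto simp: K_inf_def)
qed

text \<open>\<open>far y z\<close> says that the imaginary absolute value of \<open>z\<close> is at least \<open>y\<close>.\<close>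

definition far :: "real \<Rightarrow> 'c \<Rightarrow> bool" where
  "far y z \<longleftrightarrow> (\<forall>x\<in>K. y \<le> absv (z - x))"

lemma farD: "far y z \<Longrightarrow> x \<in> K \<Longrightarrow> y \<le> absv (z - x)"
  by (simp add: far_def)

lemma far_mono: "far y z \<Longrightarrow> y' \<le> y \<Longrightarrow> far y' z"
  unfolding far_def by (meson order_trans)

lemma far_of_A: "far y z \<Longrightarrow> y \<le> absv (z - \<iota> b)"
  by (simp add: far_def)

lemma far_add: "far y z \<Longrightarrow> x \<in> K \<Longrightarrow> far y (z + x)"
  unfolding far_def by (metis K_diff add_diff_eq diff_diff_eq2 add.commute)

lemma far_mult:
  assumes "far y z" and "a \<in> K" and "a \<noteq> 0"
  shows "far (absv a * y) (a * z)"
  unfolding far_def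
proof
  fix x assume "x \<in> K"
  then have "y \<le> absv (z - x / a)"
    using assms by (intro farD[OF assms(1)] K_divide)
  then have "absv a * y \<le> absv (a * (z - x / a))"
    by (simp add: absv_mult mult_left_mono)
  then show "absv a * y \<le> absv (a * z - x)"
    using assms(3) by (simp add: right_diff_distrib)
qed

lemma Omega_iff: "z \<in> Omega j \<longleftrightarrow> z \<notin> K"
  by (simp add: Omega_def)

lemma far_imp_Omega: "far y z \<Longrightarrow> y > 0 \<Longrightarrow> z \<in> Omega j"
  using farD[of y z z] by (auto simp: Omega_iff)

lemma Omega_imp_far:
  assumes "z \<in> Omega j"
  obtains n where "far (1 / q ^ n) z"
proof -
  have "\<exists>n. \<forall>x\<in>K. \<not> absv (z - x) \<le> 1 / q ^ n"
    using K_closed[of z] assms unfolding Omega_iff by blast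
  then show ?thesis
    using that unfolding far_def by (meson less_imp_le not_le)
qed

lemma Omega_aff_iff: "z \<in> Omega_aff j n \<longleftrightarrow> absv z \<le> q ^ n \<and> far (1 / q ^ n) z"
  by (simp add: Omega_aff_def far_def card_eq_q)

lemma q_power_mono: "n \<le> m \<Longrightarrow> q ^ n \<le> q ^ m"
  by (intro power_increasing) auto

lemma of_A_const_times: "\<iota> [:c * d:] = \<iota> [:c:] * \<iota> [:d:]"
  by (simp flip: of_A_mult)

lemma one_over_q_power_mono: "n \<le> m \<Longrightarrow> 1 / q ^ m \<le> 1 / q ^ n"
  by (intro divide_left_mono power_increasing) auto

lemma Omega_aff_subset: "Omega_aff j n \<subseteq> Omega j"
  by (auto simp: Omega_aff_iff intro!: far_imp_Omega)

lemma Omega_in_aff: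
  assumes "z \<in> Omega j"
  obtains n where "z \<in> Omega_aff j n"
proof -
  obtain n where n: "far (1 / q ^ n) z"
    using Omega_imp_far[OF assms] .
  obtain m where m: "absv z < q ^ m"
    using exists_power_gt by blast
  have "absv z \<le> q ^ max n m"
    using m q_power_mono[of m "max n m"] by linarith
  moreover have "far (1 / q ^ max n m) z"
    using n one_over_q_power_mono[of n "max n m"] by (rule far_mono) simp
  ultimately show ?thesis
    using that by (simp add: Omega_aff_iff)
qed

lemma Omega_notin_A: "z \<in> Omega j \<Longrightarrow> z \<notin> range \<iota>"
  by (auto simp: Omega_iff)

lemma Omega_add_iff: "x \<in> K \<Longrightarrow> z + x \<in> Omega j \<longleftrightarrow> z \<in> Omega j"
  using K_add[of z x] K_diff[of "z + x" x] by (auto simp: Omega_iff)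

lemma Omega_mult_iff: "x \<in> K \<Longrightarrow> x \<noteq> 0 \<Longrightarrow> x * z \<in> Omega j \<longleftrightarrow> z \<in> Omega j"
  using K_mult[of x z] K_divide[of "x * z" x] by (auto simp: Omega_iff)

lemma Omega_divide_iff: "x \<in> K \<Longrightarrow> x \<noteq> 0 \<Longrightarrow> z / x \<in> Omega j \<longleftrightarrow> z \<in> Omega j"
  using Omega_mult_iff[of x "z / x"] by simp

lemma Omega_nonzero: "z \<in> Omega j \<Longrightarrow> z \<noteq> 0"
  using zero_in_K by (auto simp: Omega_iff)

lemma Omega_inverse: "z \<in> Omega j \<Longrightarrow> 1 / z \<in> Omega j"
  using K_divide[of 1 "1 / z"] by (auto simp: Omega_iff)

lemma Omega_linear_nonzero:
  assumes "z \<in> Omega j" and "c \<noteq> 0 \<or> d \<noteq> 0"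
  shows "\<iota> c * z + \<iota> d \<noteq> 0"
proof
  assume *: "\<iota> c * z + \<iota> d = 0"
  show False
  proof (cases "c = 0")
    case False
    with * have "z = - \<iota> d / \<iota> c"
      by (simp add: field_simps eq_neg_iff_add_eq_0)
    then have "z = \<iota> (- d) / \<iota> c"
      by (simp add: of_A_minus)
    with assms show False
      by (simp add: Omega_iff K_divide)
  qed (use * assms in simp)
qed

lemma Omega_moebius:
  assumes "z \<in> Omega j" and "a * d - b * c \<noteq> 0"
  shows "(\<iota> a * z + \<iota> b) / (\<iota> c * z + \<iota> d) \<in> Omega j"
proof (rule ccontr)
  define x where "x = (\<iota> a * z + \<iota> b) / (\<iota> c * z + \<iota> d)"
  assume "(\<iota> a * z + \<iota> b) / (\<iota> c * z + \<iota> d) \<notin> Omega j"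
  then have x: "x \<in> K"
    by (simp add: Omega_iff x_def)
  have "\<iota> c * z + \<iota> d \<noteq> 0"
    using assms by (intro Omega_linear_nonzero) auto
  then have "x * (\<iota> c * z + \<iota> d) = \<iota> a * z + \<iota> b"
    by (simp add: x_def)
  then have *: "(\<iota> a - x * \<iota> c) * z = x * \<iota> d - \<iota> b"
    by (simp add: algebra_simps)
  show False
  proof (cases "\<iota> a - x * \<iota> c = 0")
    case True
    then have "\<iota> a = x * \<iota> c" "\<iota> b = x * \<iota> d"
      using * by simp_all
    then have "\<iota> (a * d - b * c) = 0"
      by (simp add: of_A_diff of_A_mult)
    with assms show False
      by (simp only: of_A_eq_0_iff)
  next
    case False
    then have "z = (x * \<iota> d - \<iota> b) / (\<iota> a - x * \<iota> c)"
      using * by (simp add: field_simps)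
    moreover have "(x * \<iota> d - \<iota> b) / (\<iota> a - x * \<iota> c) \<in> K"
      using x by (intro K_divide K_diff K_mult) auto
    ultimately show False
      using assms by (simp add: Omega_iff)
  qed
qed

text \<open>A unit whose residue differs from those of all constants. The elements of K with |x|
  \<le> 1 have only residues of constants, so none of them comes closer than 1.\<close>

lemma exists_far_1: "\<exists>z. far 1 z \<and> absv z = 1"
proof -
  have fin: "finite ((\<lambda>c. \<iota> [:c:]) ` UNIV)"
    by simp
  have le: "absv y \<le> 1" if "y \<in> (\<lambda>c. \<iota> [:c:]) ` UNIV" for y
    using that by (auto simp: absv_of_A_const)
  obtain z where z: "absv z = 1" "\<And>y. y \<in> (\<lambda>c. \<iota> [:c:]) ` UNIV \<Longrightarrow> absv (z - y) = 1"
    using exists_unit_away[OF fin le] by blast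
  have "1 \<le> absv (z - x)" if x: "x \<in> K" for x
  proof (cases "absv x \<le> 1")
    case True
    then obtain a where a: "a \<in> polys_below (Suc 0)" "absv (x - \<iota> a) \<le> 1 / q"
      using integral_part[OF x, of 0] by auto
    obtain c a' where "a = pCons c a'"
      by (cases a)
    with a(1) have "a = [:c:]"
      by simp
    then have "absv (z - \<iota> a) = 1"
      using z by auto
    moreover have "absv (x - \<iota> a) < 1"
      using a(2) by (rule order.strict_trans1) simp
    ultimately have "absv ((z - \<iota> a) - (x - \<iota> a)) = 1"
      by (subst absv_diff_eq) auto
    then show ?thesis by simp
  next
    case False
    then show ?thesis
      using z(1) by (subst absv_diff_eq') auto
  qed
  with z(1) show ?thesis
    by (auto simp: far_def)
qed

lemma exists_far: "\<exists>z. far y z"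
proof -
  obtain z where z: "far 1 z"
    using exists_far_1 by blast
  obtain n where "y < q ^ n"
    using exists_power_gt by blast
  have "T \<in> K"
    by (simp add: T_def)
  then have "T ^ n \<in> K"
    by (induction n) (auto intro: K_mult)
  then have "far (absv (T ^ n) * 1) (T ^ n * z)"
    by (intro far_mult z) auto
  then have "far y (T ^ n * z)"
    using \<open>y < q ^ n\<close> by (elim far_mono) (simp add: absv_power absv_T)
  then show ?thesis ..
qed

lemma tau_far_le: "far y z \<Longrightarrow> y > 0 \<Longrightarrow> absv (tau z) \<le> 1 / y"
  using absv_tau_le[of y z 0] far_of_A by auto

lemma tau_nonzero: "z \<in> Omega j \<Longrightarrow> tau z \<noteq> 0"
  using e_A_nonzero[of z] by (simp add: tau_eq Omega_notin_A)

section \<open>Rigid analytic functions\<close>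

definition rational_on :: "'c set \<Rightarrow> ('c \<Rightarrow> 'c) \<Rightarrow> bool" where
  "rational_on S g \<longleftrightarrow> (\<exists>P Q. \<forall>z\<in>S. poly Q z \<noteq> 0 \<and> g z = poly P z / poly Q z)"

lemma rational_on_const: "rational_on S (\<lambda>_. c)"
  unfolding rational_on_def by (intro exI[of _ "[:c:]"] exI[of _ 1]) simp

lemma rational_on_add:
  assumes "rational_on S f" and "rational_on S g"
  shows "rational_on S (\<lambda>z. f z + g z)"
proof -
  obtain P Q P' Q' where "\<And>z. z \<in> S \<Longrightarrow> poly Q z \<noteq> 0 \<and> f z = poly P z / poly Q z"
    and "\<And>z. z \<in> S \<Longrightarrow> poly Q' z \<noteq> 0 \<and> g z = poly P' z / poly Q' z"
    using assms unfolding rational_on_def by metis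
  then show ?thesis
    unfolding rational_on_def
    by (intro exI[of _ "P * Q' + P' * Q"] exI[of _ "Q * Q'"]) (simp add: add_frac_eq)
qed

lemma rational_on_mult:
  assumes "rational_on S f" and "rational_on S g"
  shows "rational_on S (\<lambda>z. f z * g z)"
proof -
  obtain P Q P' Q' where "\<And>z. z \<in> S \<Longrightarrow> poly Q z \<noteq> 0 \<and> f z = poly P z / poly Q z"
    and "\<And>z. z \<in> S \<Longrightarrow> poly Q' z \<noteq> 0 \<and> g z = poly P' z / poly Q' z"
    using assms unfolding rational_on_def by metis
  then show ?thesis
    unfolding rational_on_def
    by (intro exI[of _ "P * P'"] exI[of _ "Q * Q'"]) simp
qed

lemma rational_on_sum:
  "(\<And>i. i \<in> I \<Longrightarrow> rational_on S (f i)) \<Longrightarrow> rational_on S (\<lambda>z. \<Sum>i\<in>I. f i z)"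
  by (induction I rule: infinite_finite_induct) (auto intro: rational_on_const rational_on_add)

lemma rational_on_divide_linear:
  assumes "\<And>z. z \<in> S \<Longrightarrow> a * z + b \<noteq> 0"
  shows "rational_on S (\<lambda>z. c / (a * z + b))"
  unfolding rational_on_def
  by (intro exI[of _ "[:c:]"] exI[of _ "[:b, a:]"]) (use assms in \<open>auto simp: algebra_simps\<close>)

lemma rational_on_affine:
  assumes "rational_on S' g" and "\<And>z. z \<in> S \<Longrightarrow> a * z + b \<in> S'"
  shows "rational_on S (\<lambda>z. g (a * z + b))"
proof -
  obtain P Q where "\<And>z. z \<in> S' \<Longrightarrow> poly Q z \<noteq> 0 \<and> g z = poly P z / poly Q z"
    using assms unfolding rational_on_def by metis
  with assms(2) show ?thesis
    unfolding rational_on_def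
    by (intro exI[of _ "pcompose P [:b, a:]"] exI[of _ "pcompose Q [:b, a:]"])
       (simp add: poly_pcompose algebra_simps)
qed

lemma rigid_analyticI:
  assumes "\<And>n e. e > 0 \<Longrightarrow> \<exists>g. rational_on (Omega_aff j n) g \<and> (\<forall>z\<in>Omega_aff j n. absv (g z - f z) < e)"
  shows "rigid_analytic j f"
  unfolding rigid_analytic_def
proof
  fix n
  have "\<exists>P Q. \<forall>z\<in>Omega_aff j n. poly Q z \<noteq> 0 \<and> absv (poly P z / poly Q z - f z) < 1 / real (Suc i)" for i
  proof -
    obtain g where g: "rational_on (Omega_aff j n) g" "\<forall>z\<in>Omega_aff j n. absv (g z - f z) < 1 / real (Suc i)"
      using assms[of "1 / real (Suc i)" n] by auto
    then obtain P Q where "\<forall>z\<in>Omega_aff j n. poly Q z \<noteq> 0 \<and> g z = poly P z / poly Q z"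
      unfolding rational_on_def by blast
    with g(2) show ?thesis
      by (intro exI[of _ P] exI[of _ Q]) auto
  qed
  then obtain P Q where PQ: "\<And>i z. z \<in> Omega_aff j n \<Longrightarrow>
      poly (Q i) z \<noteq> 0 \<and> absv (poly (P i) z / poly (Q i) z - f z) < 1 / real (Suc i)"
    by metis
  have "uniform_limit (Omega_aff j n) (\<lambda>i z. poly (P i) z / poly (Q i) z) f sequentially"
  proof (rule uniform_limitI)
    fix e :: real assume "e > 0"
    then obtain N where N: "1 / real (Suc N) < e"
      using nat_approx_posE by blast
    show "\<forall>\<^sub>F i in sequentially. \<forall>z\<in>Omega_aff j n. dist (poly (P i) z / poly (Q i) z) (f z) < e"
    proof (intro eventually_sequentiallyI[of N] ballI)
      fix i z assume "i \<ge> N" "z \<in> Omega_aff j n"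
      then have "absv (poly (P i) z / poly (Q i) z - f z) < 1 / real (Suc i)" "1 / real (Suc i) \<le> 1 / real (Suc N)"
        using PQ by (auto intro!: divide_left_mono)
      with N show "dist (poly (P i) z / poly (Q i) z) (f z) < e"
        by (simp add: dist_absv)
    qed
  qed
  with PQ show "\<exists>P Q. (\<forall>i. \<forall>z\<in>Omega_aff j n. poly (Q i) z \<noteq> 0) \<and>
      uniform_limit (Omega_aff j n) (\<lambda>i z. poly (P i) z / poly (Q i) z) f sequentially"
    by blast
qed

lemma rigid_analyticE:
  assumes "rigid_analytic j f" and "e > 0"
  obtains P Q where "\<And>z. z \<in> Omega_aff j n \<Longrightarrow> poly Q z \<noteq> 0"
    and "\<And>z. z \<in> Omega_aff j n \<Longrightarrow> absv (poly P z / poly Q z - f z) < e"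
proof -
  obtain P Q where PQ: "\<forall>i. \<forall>z\<in>Omega_aff j n. poly (Q i) z \<noteq> 0"
      "uniform_limit (Omega_aff j n) (\<lambda>i z. poly (P i) z / poly (Q i) z) f sequentially"
    using assms(1) unfolding rigid_analytic_def by blast
  have "\<forall>\<^sub>F i in sequentially. \<forall>z\<in>Omega_aff j n. dist (poly (P i) z / poly (Q i) z) (f z) < e"
    using uniform_limitD[OF PQ(2) assms(2)] .
  then obtain i where "\<forall>z\<in>Omega_aff j n. dist (poly (P i) z / poly (Q i) z) (f z) < e"
    by (auto simp: eventually_sequentially)
  with PQ(1) show ?thesis
    by (intro that[of "Q i" "P i"]) (auto simp: dist_absv)
qed

lemma rigid_analytic_approx:
  assumes "rigid_analytic j f" and "e > 0"
  obtains g where "rational_on (Omega_aff j n) g" and "\<And>z. z \<in> Omega_aff j n \<Longrightarrow> absv (g z - f z) < e"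
proof -
  obtain P Q where PQ: "\<And>z. z \<in> Omega_aff j n \<Longrightarrow> poly Q z \<noteq> 0"
    "\<And>z. z \<in> Omega_aff j n \<Longrightarrow> absv (poly P z / poly Q z - f z) < e"
    by (rule rigid_analyticE[OF assms, of n]) (rule that)
  show ?thesis
    by (rule that[of "\<lambda>z. poly P z / poly Q z"]) (use PQ in \<open>auto simp: rational_on_def\<close>)
qed

lemma rigid_analytic_0: "rigid_analytic j (\<lambda>_. 0)"
  by (rule rigid_analyticI, rule exI[of _ "\<lambda>_. 0"]) (simp add: rational_on_const)

lemma rigid_analytic_add:
  assumes "rigid_analytic j f" and "rigid_analytic j g"
  shows "rigid_analytic j (\<lambda>z. f z + g z)"
proof (rule rigid_analyticI)
  fix n and e :: real assume "e > 0"
  obtain f' where f': "rational_on (Omega_aff j n) f'" "\<And>z. z \<in> Omega_aff j n \<Longrightarrow> absv (f' z - f z) < e"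
    using rigid_analytic_approx[OF assms(1) \<open>e > 0\<close>, of n] by blast
  obtain g' where g': "rational_on (Omega_aff j n) g'" "\<And>z. z \<in> Omega_aff j n \<Longrightarrow> absv (g' z - g z) < e"
    using rigid_analytic_approx[OF assms(2) \<open>e > 0\<close>, of n] by blast
  have "absv (f' z + g' z - (f z + g z)) < e" if "z \<in> Omega_aff j n" for z
    using absv_add_lessI[OF f'(2)[OF that] g'(2)[OF that]] by (simp add: algebra_simps)
  then show "\<exists>h. rational_on (Omega_aff j n) h \<and> (\<forall>z\<in>Omega_aff j n. absv (h z - (f z + g z)) < e)"
    by (intro exI[of _ "\<lambda>z. f' z + g' z"] conjI rational_on_add f'(1) g'(1) ballI)
qed

lemma rigid_analytic_cmult:
  assumes "rigid_analytic j f"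
  shows "rigid_analytic j (\<lambda>z. c * f z)"
proof (cases "c = 0")
  case False
  show ?thesis
  proof (rule rigid_analyticI)
    fix n and e :: real assume "e > 0"
    then have "e / absv c > 0"
      using False by simp
    then obtain f' where f': "rational_on (Omega_aff j n) f'" "\<And>z. z \<in> Omega_aff j n \<Longrightarrow> absv (f' z - f z) < e / absv c"
      using rigid_analytic_approx[OF assms, of "e / absv c" n] by blast
    have "absv (c * f' z - c * f z) < e" if "z \<in> Omega_aff j n" for z
    proof -
      have "absv c * absv (f' z - f z) < absv c * (e / absv c)"
        using f'(2)[OF that] False by (intro mult_strict_left_mono) auto
      then show ?thesis
        using False by (simp flip: absv_mult add: right_diff_distrib)
    qed
    then show "\<exists>h. rational_on (Omega_aff j n) h \<and> (\<forall>z\<in>Omega_aff j n. absv (h z - c * f z) < e)"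
      by (intro exI[of _ "\<lambda>z. c * f' z"] conjI rational_on_mult rational_on_const f'(1) ballI)
  qed
qed (simp add: rigid_analytic_0)

lemma rigid_analytic_sum:
  "(\<And>i. i \<in> I \<Longrightarrow> rigid_analytic j (f i)) \<Longrightarrow> rigid_analytic j (\<lambda>z. \<Sum>i\<in>I. f i z)"
  by (induction I rule: infinite_finite_induct) (auto intro: rigid_analytic_0 rigid_analytic_add)

lemma rigid_analytic_affine:
  assumes "rigid_analytic j f" and "\<And>n. \<exists>m. \<forall>z\<in>Omega_aff j n. a * z + b \<in> Omega_aff j m"
  shows "rigid_analytic j (\<lambda>z. f (a * z + b))"
proof (rule rigid_analyticI)
  fix n and e :: real assume "e > 0"
  obtain m where m: "\<And>z. z \<in> Omega_aff j n \<Longrightarrow> a * z + b \<in> Omega_aff j m"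
    using assms(2)[of n] by blast
  obtain f' where f': "rational_on (Omega_aff j m) f'" "\<And>z. z \<in> Omega_aff j m \<Longrightarrow> absv (f' z - f z) < e"
    using rigid_analytic_approx[OF assms(1) \<open>e > 0\<close>, of m] by blast
  show "\<exists>h. rational_on (Omega_aff j n) h \<and> (\<forall>z\<in>Omega_aff j n. absv (h z - f (a * z + b)) < e)"
    by (intro exI[of _ "\<lambda>z. f' (a * z + b)"] conjI rational_on_affine[OF f'(1)] ballI f'(2) m)
qed

lemma affine_Omega_aff:
  assumes "a \<in> K" and "a \<noteq> 0" and "b \<in> K"
  shows "\<exists>m. \<forall>z\<in>Omega_aff j n. a * z + b \<in> Omega_aff j m"
proof -
  obtain m1 where m1: "absv a * q ^ n < q ^ m1"
    using exists_power_gt by blast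
  obtain m2 where m2: "absv b < q ^ m2"
    using exists_power_gt by blast
  obtain m3 where m3: "q ^ n / absv a < q ^ m3"
    using exists_power_gt by blast
  define m where "m = max m1 (max m2 m3)"
  have m: "q ^ m1 \<le> q ^ m" "q ^ m2 \<le> q ^ m" "q ^ m3 \<le> q ^ m"
    by (simp_all add: m_def power_increasing)
  have "a * z + b \<in> Omega_aff j m" if z: "absv z \<le> q ^ n" "far (1 / q ^ n) z" for z
  proof -
    have "absv (a * z) \<le> absv a * q ^ n"
      using z by (simp add: absv_mult mult_left_mono)
    then have "absv (a * z + b) \<le> q ^ m"
      using m1 m2 m by (intro absv_add_leI) linarith+
    moreover have "far (absv a * (1 / q ^ n)) (a * z + b)"
      using assms z by (intro far_add far_mult)
    moreover have "1 / q ^ m \<le> absv a * (1 / q ^ n)"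
    proof -
      have "q ^ n / absv a \<le> q ^ m"
        using m3 m by linarith
      then have "1 / q ^ m \<le> 1 / (q ^ n / absv a)"
        using assms by (intro divide_left_mono) (auto intro!: mult_pos_pos divide_pos_pos)
      then show ?thesis
        using assms by simp
    qed
    ultimately show ?thesis
      by (auto simp: Omega_aff_iff intro: far_mono)
  qed
  then have "\<forall>z\<in>Omega_aff j n. a * z + b \<in> Omega_aff j m"
    by (simp add: Omega_aff_iff)
  then show ?thesis ..
qed

section \<open>Modularity from generators\<close>

lemma modular_translation:
  assumes "modular_transform j k m f" and "z \<in> Omega j"
  shows "f (z + \<iota> b) = f z"
  using assms(1)[unfolded modular_transform_def, rule_format, of 1 1 b 0 z] assms(2) by simp

lemma modular_unit:
  assumes "modular_transform j k 1 f" and "z \<in> Omega j" and "c \<noteq> 0"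
  shows "f (\<iota> [:c:] * z) = f z / \<iota> [:c:]"
  using assms(1)[unfolded modular_transform_def, rule_format, of "[:c:]" 1 0 0 z] assms(2,3)
  by (simp add: is_unit_const_poly_iff dvd_field_iff power_int_minus divide_inverse mult.commute)

lemma modular_inversion:
  assumes "modular_transform j k 1 f" and "z \<in> Omega j"
  shows "f (1 / z) = - (z ^ k * f z)"
  using assms(1)[unfolded modular_transform_def, rule_format, of 0 0 1 1 z] assms(2)
  by (simp add: of_A_minus power_int_minus)

lemma modular_scalar:
  assumes "modular_transform j k 1 f" and "z \<in> Omega j" and "c \<noteq> 0"
  shows "f z * \<iota> [:c:] ^ 2 = \<iota> [:c:] ^ k * f z"
  using assms(1)[unfolded modular_transform_def, rule_format, of "[:c:]" "[:c:]" 0 0 z] assms(2,3)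
  by (simp add: is_unit_const_poly_iff dvd_field_iff power_int_minus of_A_const_times power2_eq_square field_simps)

text \<open>\<open>GL\<^sub>2(A)\<close> is generated by translations, diagonal matrices and the inversion \<open>z \<mapsto> 1/z\<close>: the
  Euclidean algorithm on the first column reduces the lower left entry to zero.\<close>

lemma modular_transformI:
  assumes weight: "\<And>c :: 'q. c \<noteq> 0 \<Longrightarrow> c ^ k = c ^ 2"
    and trans: "\<And>z b. z \<in> Omega j \<Longrightarrow> f (z + \<iota> b) = f z"
    and unit: "\<And>z c. z \<in> Omega j \<Longrightarrow> c \<noteq> 0 \<Longrightarrow> f (\<iota> [:c:] * z) = f z / \<iota> [:c:]"
    and inv: "\<And>z. z \<in> Omega j \<Longrightarrow> f (1 / z) = - (z ^ k * f z)"
  shows "modular_transform j k 1 f"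
proof -
  have main: "f ((\<iota> a * z + \<iota> b) / (\<iota> c * z + \<iota> d)) =
      (\<iota> c * z + \<iota> d) ^ k * f z / \<iota> (a * d - b * c)"
    if "is_unit (a * d - b * c)" "z \<in> Omega j" for a b c d z
    using that(1)
  \<comment> \<open>The measure is 0 only for c = 0; \<open>degree c\<close> alone would not
    distinguish a nonzero constant from 0.\<close>
  proof (induction "if c = 0 then 0 else Suc (degree c)" arbitrary: a b c d rule: less_induct)
    case less
    show ?case
    proof (cases "c = 0")
      case True
      with less.prems have "is_unit a" "is_unit d"
        by (auto simp: is_unit_mult_iff)
      then obtain \<alpha> \<delta> where ad: "a = [:\<alpha>:]" "d = [:\<delta>:]" "\<alpha> \<noteq> 0" "\<delta> \<noteq> 0"
        unfolding unit_poly_iff by blast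
      have inv_\<delta>: "\<iota> [:1 / \<delta>:] = 1 / \<iota> [:\<delta>:]"
      proof -
        have "\<iota> [:1 / \<delta>:] * \<iota> [:\<delta>:] = 1"
          using ad by (simp add: one_pCons[symmetric] flip: of_A_mult)
        then show ?thesis
          using ad by (simp add: field_simps)
      qed
      have quot: "\<iota> [:\<alpha> / \<delta>:] = \<iota> [:\<alpha>:] / \<iota> [:\<delta>:]"
      proof -
        have "\<iota> [:\<alpha> / \<delta>:] = \<iota> [:\<alpha>:] * \<iota> [:1 / \<delta>:]"
          by (simp flip: of_A_mult)
        then show ?thesis
          by (simp add: inv_\<delta>)
      qed
      have "(\<iota> a * z + \<iota> b) / (\<iota> c * z + \<iota> d) = \<iota> [:\<alpha> / \<delta>:] * z + \<iota> (b * [:1 / \<delta>:])"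
        using True ad by (simp only: of_A_mult inv_\<delta> quot) (simp add: add_divide_distrib)
      moreover have "f (\<iota> [:\<alpha> / \<delta>:] * z + \<iota> (b * [:1 / \<delta>:])) = f z / \<iota> [:\<alpha> / \<delta>:]"
        using that(2) ad by (subst trans) (simp_all add: Omega_mult_iff unit)
      \<comment> \<open>Scaling gives the factor \<delta> / \<alpha>, the transformation law asks
        for \<delta>^k / (\<alpha> \<delta>); the weight condition equates them.\<close>
      moreover have "\<iota> [:\<delta>:] ^ k = \<iota> [:\<delta>:] ^ 2"
        using weight[OF ad(4)] by (metis of_A_power poly_const_pow)
      ultimately show ?thesis
        using True ad by (simp only: quot) (simp add: of_A_const_times power2_eq_square)
    next
      case False
      define u where "u = a div c"
      define r where "r = a mod c"
      define b' where "b' = b - u * d"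
      have a: "a = c * u + r"
        by (simp add: u_def r_def)
      have r: "(if r = 0 then 0 else Suc (degree r)) < (if c = 0 then 0 else Suc (degree c))"
        using False degree_mod_less[of c a] by (auto simp: r_def)
      \<comment> \<open>The induction hypothesis is applied to the rows (c, d) and (r, b'), the
        result of one Euclidean step. Exchanging the rows changes the sign of the determinant, which
        cancels the sign in \<open>inv\<close>.\<close>
      have det: "c * b' - d * r = - (a * d - b * c)"
        by (simp add: b'_def a algebra_simps)
      have unit': "is_unit (c * b' - d * r)"
        using less.prems by (simp only: det minus_dvd_iff)
      have det_ne: "a * d - b * c \<noteq> 0"
        using less.prems by auto
      define \<eta> where "\<eta> = \<iota> c * z + \<iota> d"
      define \<xi> where "\<xi> = \<iota> r * z + \<iota> b'"
      have "c \<noteq> 0 \<or> d \<noteq> 0"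
        using False by simp
      then have \<eta>: "\<eta> \<noteq> 0"
        unfolding \<eta>_def by (rule Omega_linear_nonzero[OF that(2)])
      have "r \<noteq> 0 \<or> b' \<noteq> 0"
        using det_ne det by auto
      then have \<xi>: "\<xi> \<noteq> 0"
        unfolding \<xi>_def by (rule Omega_linear_nonzero[OF that(2)])
      have y: "\<eta> / \<xi> \<in> Omega j"
        unfolding \<eta>_def \<xi>_def using unit' by (intro Omega_moebius that) auto
      then have y': "\<xi> / \<eta> \<in> Omega j"
        using Omega_inverse[OF y] by simp
      have num: "\<iota> a * z + \<iota> b = \<iota> u * \<eta> + \<xi>"
        by (simp add: a b'_def \<eta>_def \<xi>_def of_A_add of_A_mult of_A_diff algebra_simps)
      have "(\<iota> a * z + \<iota> b) / (\<iota> c * z + \<iota> d) = \<xi> / \<eta> + \<iota> u"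
        unfolding num \<eta>_def[symmetric] using \<eta> by (simp add: add_divide_distrib)
      then have "f ((\<iota> a * z + \<iota> b) / (\<iota> c * z + \<iota> d)) = f (1 / (\<eta> / \<xi>))"
        using trans[OF y'] by simp
      also have "\<dots> = - ((\<eta> / \<xi>) ^ k * f (\<eta> / \<xi>))"
        by (rule inv[OF y])
      also have "f (\<eta> / \<xi>) = \<xi> ^ k * f z / \<iota> (c * b' - d * r)"
        unfolding \<eta>_def \<xi>_def by (rule less.hyps[OF r unit'])
      also have "- ((\<eta> / \<xi>) ^ k * (\<xi> ^ k * f z / \<iota> (c * b' - d * r))) = \<eta> ^ k * f z / \<iota> (a * d - b * c)"
        unfolding det of_A_minus using \<xi> by (simp add: power_divide)
      finally show ?thesis
        by (simp add: \<eta>_def)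
    qed
  qed
  show ?thesis
    unfolding modular_transform_def
  proof (intro allI impI ballI)
    fix a b c d :: "'q poly" and z :: 'c assume "is_unit (a * d - b * c)" "z \<in> Omega j"
    from main[OF this] show "f ((\<iota> a * z + \<iota> b) / (\<iota> c * z + \<iota> d)) =
        \<iota> (a * d - b * c) powi (- 1) * (\<iota> c * z + \<iota> d) ^ k * f z"
      by (simp add: power_int_minus divide_inverse mult_ac)
  qed
qed

lemma modular_transform_add:
  "modular_transform j k m f \<Longrightarrow> modular_transform j k m g \<Longrightarrow> modular_transform j k m (\<lambda>z. f z + g z)"
  unfolding modular_transform_def by (simp add: distrib_left)

lemma modular_transform_cmult:
  "modular_transform j k m f \<Longrightarrow> modular_transform j k m (\<lambda>z. c * f z)"
  unfolding modular_transform_def by (simp add: mult_ac)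

lemma modular_transform_0: "modular_transform j k m (\<lambda>_. 0)"
  unfolding modular_transform_def by simp

end

section \<open>Power series\<close>

lemma sums_shift_nonarch:
  fixes f :: "nat \<Rightarrow> 'c::nonarch_field"
  assumes "(\<lambda>i. f (i + n)) sums s" and "\<And>i. i < n \<Longrightarrow> f i = 0"
  shows "f sums s"
proof -
  have *: "(\<Sum>i<m + n. f i) = (\<Sum>i<m. f (i + n))" for m
    by (induction m) (simp_all add: assms(2))
  have "(\<lambda>m. \<Sum>i<m + n. f i) \<longlonglongrightarrow> s"
    using assms(1) unfolding sums_def * .
  then show ?thesis
    unfolding sums_def by (rule LIMSEQ_offset)
qed

lemma poly_mult_sums:
  fixes t :: "'c::nonarch_field"
  assumes "(\<lambda>i. fps_nth g i * t ^ i) sums s"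
  shows "(\<lambda>i. fps_nth (fps_of_poly p * g) i * t ^ i) sums (poly p t * s)"
proof (induction p)
  case (pCons a p)
  have "(\<lambda>i. fps_nth (fps_X * (fps_of_poly p * g)) i * t ^ i) sums (t * (poly p t * s))"
  proof (rule sums_shift_nonarch[where n = 1])
    show "(\<lambda>i. fps_nth (fps_X * (fps_of_poly p * g)) (i + 1) * t ^ (i + 1)) sums (t * (poly p t * s))"
      using sums_mult_nonarch[OF pCons(2), of t] by (simp add: mult_ac)
  qed simp
  then have "(\<lambda>i. a * (fps_nth g i * t ^ i) + fps_nth (fps_X * (fps_of_poly p * g)) i * t ^ i)
      sums (a * s + t * (poly p t * s))"
    by (intro sums_add sums_mult_nonarch assms)
  moreover have "fps_of_poly (pCons a p) * g = fps_const a * g + fps_X * (fps_of_poly p * g)"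
    by (simp add: fps_of_poly_pCons algebra_simps)
  ultimately show ?case
    by (simp add: algebra_simps)
qed simp

text \<open>The recursion for the coefficients of the formal inverse preserves the geometric bound
  because the constant coefficient has absolute value 1. Any convergent value of the inverse series
  is then the reciprocal value.\<close>

lemma reciprocal_series:
  fixes p :: "'c::nonarch_field poly"
  assumes "\<And>i. absv (coeff p i) \<le> r ^ i" and "absv (coeff p 0) = 1" and "r > 0"
  obtains g where "\<And>i. absv (g i) \<le> r ^ i"
    and "\<And>t s. (\<lambda>i. g i * t ^ i) sums s \<Longrightarrow> poly p t * s = 1"
proof -
  define G where "G = inverse (fps_of_poly p)"
  have "coeff p 0 \<noteq> 0"
    using assms(2) by auto
  then have pG: "fps_of_poly p * G = 1"
    unfolding G_def by (subst mult.commute) (simp add: inverse_mult_eq_1)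
  have bound: "absv (fps_nth G n) \<le> r ^ n" for n
  proof (induction n rule: less_induct)
    case (less n)
    have "fps_nth (fps_of_poly p * G) n = (\<Sum>i=0..n. coeff p i * fps_nth G (n - i))"
      by (simp add: fps_mult_nth)
    also have "\<dots> = coeff p 0 * fps_nth G n + (\<Sum>i=1..n. coeff p i * fps_nth G (n - i))"
      by (simp add: sum.atLeast_Suc_atMost)
    finally have "coeff p 0 * fps_nth G n = fps_nth 1 n - (\<Sum>i=1..n. coeff p i * fps_nth G (n - i))"
      by (simp add: pG)
    moreover have "absv (\<Sum>i=1..n. coeff p i * fps_nth G (n - i)) \<le> r ^ n"
    proof (rule absv_sum_le)
      fix i assume i: "i \<in> {1..n}"
      then have "absv (fps_nth G (n - i)) \<le> r ^ (n - i)"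
        by (intro less) auto
      then have "absv (coeff p i * fps_nth G (n - i)) \<le> r ^ i * r ^ (n - i)"
        unfolding absv_mult using assms by (intro mult_mono) auto
      then show "absv (coeff p i * fps_nth G (n - i)) \<le> r ^ n"
        using i by (simp flip: power_add)
    qed (use assms in simp)
    moreover have "absv (fps_nth (1 :: 'c fps) n) \<le> r ^ n"
      using assms by (cases n) auto
    ultimately have "absv (coeff p 0 * fps_nth G n) \<le> r ^ n"
      by (simp only: absv_diff_leI)
    then show ?case
      by (simp add: absv_mult assms(2))
  qed
  have eval: "poly p t * s = 1" if "(\<lambda>i. fps_nth G i * t ^ i) sums s" for t s
  proof -
    have "(\<lambda>i. fps_nth 1 i * t ^ i) sums (poly p t * s)"
      using poly_mult_sums[OF that, of p] by (simp only: pG)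
    moreover have "(\<lambda>i. fps_nth 1 i * t ^ i) sums 1"
    proof -
      have "(\<lambda>i. fps_nth 1 i * t ^ i) sums (\<Sum>i\<in>{0}. fps_nth 1 i * t ^ i)"
        by (rule sums_finite) auto
      then show ?thesis by simp
    qed
    ultimately show ?thesis
      by (rule sums_unique2)
  qed
  show ?thesis
    by (rule that[OF bound eval])
qed

lemma summable_power_series_nonarch:
  fixes a :: "nat \<Rightarrow> 'c::{nonarch_field, complete_space}"
  assumes "\<And>i. absv (a i) \<le> B * L ^ i" and "L * absv t < 1" and "L \<ge> 0"
  shows "summable (\<lambda>i. a i * t ^ i)"
proof (rule summable_nonarch, rule tendsto_absv_comparison)
  have "(\<lambda>i. (L * absv t) ^ i) \<longlonglongrightarrow> 0"
    using assms by (intro LIMSEQ_realpow_zero) auto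
  from tendsto_mult[OF tendsto_const[of B] this] show "(\<lambda>i. B * (L * absv t) ^ i) \<longlonglongrightarrow> 0"
    by simp
  show "\<forall>\<^sub>F i in sequentially. absv (a i * t ^ i - 0) \<le> B * (L * absv t) ^ i"
  proof (rule always_eventually, rule allI)
    fix i
    have "absv (a i) * absv t ^ i \<le> B * L ^ i * absv t ^ i"
      using assms(1) by (intro mult_right_mono) auto
    then show "absv (a i * t ^ i - 0) \<le> B * (L * absv t) ^ i"
      by (simp add: absv_mult absv_power power_mult_distrib mult_ac)
  qed
qed

text \<open>Row m is the power series of the m-th summand. The common geometric bound permits
  rearrangement by powers of t inside its disc, and \<open>h n\<close> limits which rows reach
  t^n.\<close>

lemma compose_sums:
  fixes A :: "nat \<Rightarrow> nat \<Rightarrow> 'c::nonarch_field"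
  assumes "\<And>m n. absv (A m n) \<le> B * L ^ n" and "\<And>m n. m > h n \<Longrightarrow> A m n = 0"
    and "L * absv t < 1" and "L \<ge> 0"
    and "\<And>m. (\<lambda>n. A m n * t ^ n) sums S m" and "S sums \<sigma>"
  shows "(\<lambda>n. (\<Sum>m\<le>h n. A m n) * t ^ n) sums \<sigma>"
proof -
  have "(\<lambda>i. (L * absv t) ^ i) \<longlonglongrightarrow> 0"
    using assms by (intro LIMSEQ_realpow_zero) auto
  from tendsto_mult[OF tendsto_const[of B] this] have lim: "(\<lambda>i. B * (L * absv t) ^ i) \<longlonglongrightarrow> 0"
    by simp
  have "absv (A m n * t ^ n) \<le> B * (L * absv t) ^ n" for m n
  proof -
    have "absv (A m n) * absv t ^ n \<le> B * L ^ n * absv t ^ n"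
      using assms(1) by (intro mult_right_mono) auto
    then show ?thesis
      by (simp add: absv_mult absv_power power_mult_distrib mult_ac)
  qed
  from double_sums_nonarch[OF assms(5,6) this lim, of h] assms(2) show ?thesis
    by (simp add: sum_distrib_right)
qed

lemma absv_coeff_mult_le:
  fixes p r :: "'c::nonarch_field poly"
  assumes "\<And>i. absv (coeff p i) \<le> x ^ i" and "\<And>i. absv (coeff r i) \<le> x ^ i" and "x > 0"
  shows "absv (coeff (p * r) i) \<le> x ^ i"
  unfolding coeff_mult
proof (rule absv_sum_le)
  fix k assume "k \<in> {..i}"
  then show "absv (coeff p k * coeff r (i - k)) \<le> x ^ i"
    using mult_mono[OF assms(1)[of k] assms(2)[of "i - k"]] assms(3)
    by (simp add: absv_mult flip: power_add)
qed (use assms in simp)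

lemma absv_coeff_power_le:
  fixes p :: "'c::nonarch_field poly"
  assumes "\<And>i. absv (coeff p i) \<le> x ^ i" and "x > 0"
  shows "absv (coeff (p ^ n) i) \<le> x ^ i"
proof (induction n arbitrary: i)
  case 0
  show ?case using assms(2) by (cases i) (auto simp: coeff_1)
next
  case (Suc n)
  show ?case
    unfolding power_Suc by (rule absv_coeff_mult_le[OF assms(1) Suc assms(2)])
qed

section \<open>The Carlitz module and \<open>t\<close>-expansions\<close>

locale carlitz = C_infinity j q
  for j :: "'q::finite_field fls alg_closure \<Rightarrow> 'c::{nonarch_field, complete_space}" and q :: real +
  fixes w :: 'c
  assumes period: "carlitz_period j w"
begin

lemma w_nonzero [simp]: "w \<noteq> 0"
  using period by (simp add: carlitz_period_def)

definition e_w :: "'c \<Rightarrow> 'c" where "e_w x = w * e_A x"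

lemma e_w_add: "e_w (x + y) = e_w x + e_w y"
  by (simp add: e_w_def e_A_add distrib_left)

text \<open>Apart from w \<noteq> 0, the condition on the period enters only here.\<close>

lemma e_w_T: "e_w (T * x) = T * e_w x + e_w x ^ CARD('q)"
proof -
  have "lattice_exp (period_lattice j w) (w * (T * x)) =
      T * lattice_exp (period_lattice j w) (w * x) + lattice_exp (period_lattice j w) (w * x) ^ CARD('q)"
    unfolding mult.left_commute[of w T] using period unfolding carlitz_period_def T_def by blast
  then show ?thesis
    by (simp add: lattice_exp_eq e_w_def)
qed

abbreviation t :: "'c \<Rightarrow> 'c" where "t \<equiv> t_param j w"

lemma t_eq: "t z = 1 / e_w z"
  by (simp add: t_param_def lattice_exp_eq e_w_def)

lemma t_eq_tau: "z \<in> Omega j \<Longrightarrow> t z = tau z / w"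
  by (simp add: t_eq tau_eq Omega_notin_A e_w_def)

lemma t_nonzero: "z \<in> Omega j \<Longrightarrow> t z \<noteq> 0"
  by (simp add: t_eq_tau tau_nonzero)

lemma e_w_nonzero: "z \<in> Omega j \<Longrightarrow> e_w z \<noteq> 0"
  using t_nonzero[of z] by (auto simp: t_eq)

lemma absv_t_le: "far y z \<Longrightarrow> y > 0 \<Longrightarrow> absv (t z) \<le> 1 / (absv w * y)"
  using tau_far_le[of y z] divide_right_mono[of "absv (tau z)" "1 / y" "absv w"]
  by (simp add: t_eq_tau far_imp_Omega absv_divide mult.commute)

lemma absv_t_less:
  assumes "\<epsilon> > 0"
  obtains y where "y > 0" and "\<And>z. far y z \<Longrightarrow> absv (t z) < \<epsilon>"
proof -
  define y where "y = 2 / (absv w * \<epsilon>)"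
  have "y > 0"
    using assms by (simp add: y_def)
  moreover have "absv (t z) < \<epsilon>" if "far y z" for z
  proof -
    have "absv (t z) \<le> 1 / (absv w * y)"
      by (rule absv_t_le[OF that \<open>y > 0\<close>])
    also have "\<dots> = \<epsilon> / 2"
      using assms by (simp add: y_def)
    finally show ?thesis
      using assms by simp
  qed
  ultimately show ?thesis
    using that by blast
qed

text \<open>\<open>far R\<close> replaces the infimum over K by a bound at every point of K, at the
  cost of enlarging the radius.\<close>

lemma has_t_expansion_iff:
  "has_t_expansion j w f a \<longleftrightarrow> (\<exists>R>0. \<forall>z. far R z \<longrightarrow> (\<lambda>i. a i * t z ^ i) sums f z)"
proof
  assume "has_t_expansion j w f a"
  then obtain r where r: "\<And>z. z \<in> Omega j \<Longrightarrow> infdist z K > r \<Longrightarrow> (\<lambda>i. a i * t z ^ i) sums f z"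
    unfolding has_t_expansion_def by blast
  define R where "R = max r 0 + 1"
  have "R > 0" "R > r"
    by (simp_all add: R_def)
  moreover have "infdist z K \<ge> R" if "far R z" for z
  proof -
    have "K \<noteq> {}"
      using zero_in_K by blast
    then show ?thesis
      unfolding infdist_notempty[OF \<open>K \<noteq> {}\<close>]
      using farD[OF that] by (intro cINF_greatest) (simp_all add: dist_absv)
  qed
  ultimately show "\<exists>R>0. \<forall>z. far R z \<longrightarrow> (\<lambda>i. a i * t z ^ i) sums f z"
    using r far_imp_Omega by (meson less_le_trans)
next
  assume "\<exists>R>0. \<forall>z. far R z \<longrightarrow> (\<lambda>i. a i * t z ^ i) sums f z"
  then obtain R where R: "\<And>z. far R z \<Longrightarrow> (\<lambda>i. a i * t z ^ i) sums f z"
    by blast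
  have "far R z" if "infdist z K > R" for z
    unfolding far_def
  proof
    fix x assume "x \<in> K"
    from infdist_le[OF this, of z] that show "R \<le> absv (z - x)"
      by (simp add: dist_absv)
  qed
  with R show "has_t_expansion j w f a"
    unfolding has_t_expansion_def by blast
qed

lemma has_t_expansionI:
  assumes "R > 0" and "\<And>z. far R z \<Longrightarrow> (\<lambda>i. a i * t z ^ i) sums f z"
  shows "has_t_expansion j w f a"
  using assms has_t_expansion_iff by blast

lemma has_t_expansionE:
  assumes "has_t_expansion j w f a"
  obtains R where "R > 0" and "\<And>z. far R z \<Longrightarrow> (\<lambda>i. a i * t z ^ i) sums f z"
  using assms has_t_expansion_iff by blast

section \<open>Operations on t-expansions and bounds for their coefficients\<close>

lemma has_t_expansion_0: "has_t_expansion j w (\<lambda>_. 0) (\<lambda>_. 0)"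
  by (rule has_t_expansionI[of 1]) simp_all

lemma has_t_expansion_add:
  assumes "has_t_expansion j w f a" and "has_t_expansion j w g b"
  shows "has_t_expansion j w (\<lambda>z. f z + g z) (\<lambda>i. a i + b i)"
proof -
  obtain R where R: "R > 0" "\<And>z. far R z \<Longrightarrow> (\<lambda>i. a i * t z ^ i) sums f z"
    by (rule has_t_expansionE[OF assms(1)]) (rule that)
  obtain R' where R': "R' > 0" "\<And>z. far R' z \<Longrightarrow> (\<lambda>i. b i * t z ^ i) sums g z"
    by (rule has_t_expansionE[OF assms(2)]) (rule that)
  show ?thesis
  proof (rule has_t_expansionI[of "max R R'"])
    fix z assume z: "far (max R R') z"
    show "(\<lambda>i. (a i + b i) * t z ^ i) sums (f z + g z)"
      using sums_add[OF R(2)[OF far_mono[OF z]] R'(2)[OF far_mono[OF z]]] by (simp add: distrib_right)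
  qed (use R in simp)
qed

lemma has_t_expansion_cmult:
  assumes "has_t_expansion j w f a"
  shows "has_t_expansion j w (\<lambda>z. c * f z) (\<lambda>i. c * a i)"
proof -
  obtain R where R: "R > 0" "\<And>z. far R z \<Longrightarrow> (\<lambda>i. a i * t z ^ i) sums f z"
    by (rule has_t_expansionE[OF assms(1)]) (rule that)
  show ?thesis
    by (rule has_t_expansionI[OF R(1)]) (use sums_mult_nonarch[OF R(2), of _ c] in \<open>simp add: mult.assoc\<close>)
qed

text \<open>Convergence at a single point with t(z) \<noteq> 0 makes the terms there bounded, which
  is a geometric bound for the coefficients.\<close>

lemma t_expansion_coeff_bound:
  assumes "has_t_expansion j w f a"
  obtains B L where "B > 0" and "L \<ge> 1" and "\<And>i. absv (a i) \<le> B * L ^ i"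
proof -
  obtain R where R: "R > 0" "\<And>z. far R z \<Longrightarrow> (\<lambda>i. a i * t z ^ i) sums f z"
    by (rule has_t_expansionE[OF assms(1)]) (rule that)
  obtain z where z: "far R z"
    using exists_far by blast
  have t: "t z \<noteq> 0"
    using z R by (intro t_nonzero far_imp_Omega)
  have "(\<lambda>i. absv (a i * t z ^ i)) \<longlonglongrightarrow> absv (0 :: 'c)"
    by (intro tendsto_absv sums_imp_tendsto_0_nonarch[OF R(2)[OF z]])
  then have "Bseq (\<lambda>i. absv (a i * t z ^ i))"
    by (intro convergent_imp_Bseq) (auto simp: convergent_def)
  then obtain B where B: "B > 0" "\<And>i. norm (absv (a i * t z ^ i)) \<le> B"
    by (auto elim: BseqE)
  define L where "L = max 1 (1 / absv (t z))"
  show ?thesis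
  proof (rule that)
    fix i
    have "absv (a i) * absv (t z) ^ i \<le> B"
      using B(2)[of i] by (simp add: absv_mult absv_power)
    then have "absv (a i) \<le> B * (1 / absv (t z)) ^ i"
      using t by (simp add: field_simps power_divide)
    also have "\<dots> \<le> B * L ^ i"
      using B(1) by (intro mult_left_mono power_mono) (auto simp: L_def)
    finally show "absv (a i) \<le> B * L ^ i" .
  qed (use B in \<open>auto simp: L_def\<close>)
qed

text \<open>Uniqueness of the expansion in the one degree that matters: t takes arbitrarily small
  nonzero values, and for small t a nonzero term a 1 * t would dominate all later ones.\<close>

lemma t_expansion_first_coeff_0:
  assumes "has_t_expansion j w (\<lambda>_. 0) a" and "a 0 = 0"
  shows "a 1 = 0"
proof (rule ccontr)
  assume a1: "a 1 \<noteq> 0"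
  obtain R where R: "R > 0" "\<And>z. far R z \<Longrightarrow> (\<lambda>i. a i * t z ^ i) sums 0"
    by (rule has_t_expansionE[OF assms(1)]) (rule that)
  obtain B L where BL: "B > 0" "L \<ge> 1" "\<And>i. absv (a i) \<le> B * L ^ i"
    by (rule t_expansion_coeff_bound[OF assms(1)]) (rule that)
  \<comment> \<open>The first bound makes the terms from index 2 on decrease, the second makes B L^2
    |t|^2 smaller than |a 1 * t|.\<close>
  define \<epsilon> where "\<epsilon> = min (1 / L) (absv (a 1) / (B * L ^ 2))"
  have "\<epsilon> > 0"
    using BL a1 by (simp add: \<epsilon>_def)
  then obtain y where y: "y > 0" "\<And>z. far y z \<Longrightarrow> absv (t z) < \<epsilon>"
    using absv_t_less by blast
  obtain z where z: "far (max R y) z"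
    using exists_far by blast
  have t0: "t z \<noteq> 0"
    using z R by (intro t_nonzero far_imp_Omega[of "max R y"]) auto
  have t_less: "absv (t z) < \<epsilon>"
    using z by (intro y far_mono[OF z]) simp
  then have Lt: "L * absv (t z) \<le> 1"
    using BL(2) by (simp add: \<epsilon>_def field_simps)
  have "absv (0 - (\<Sum>i<2. a i * t z ^ i)) \<le> B * (L * absv (t z)) ^ 2"
  proof (rule absv_sums_tail_le)
    show "(\<lambda>i. a i * t z ^ i) sums 0"
      by (intro R far_mono[OF z]) simp
    fix i :: nat assume "i \<ge> 2"
    have "absv (a i * t z ^ i) \<le> B * L ^ i * absv (t z) ^ i"
      unfolding absv_mult absv_power using BL(3) by (intro mult_right_mono) auto
    also have "\<dots> = B * (L * absv (t z)) ^ i"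
      by (simp add: power_mult_distrib mult.assoc)
    also have "\<dots> \<le> B * (L * absv (t z)) ^ 2"
      using BL Lt \<open>i \<ge> 2\<close> by (intro mult_left_mono power_decreasing) auto
    finally show "absv (a i * t z ^ i) \<le> B * (L * absv (t z)) ^ 2" .
  qed
  then have "absv (a 1) * absv (t z) \<le> (B * L ^ 2 * absv (t z)) * absv (t z)"
    using assms(2) by (simp add: numeral_2_eq_2 absv_mult power2_eq_square mult_ac)
  then have "absv (a 1) \<le> B * L ^ 2 * absv (t z)"
    using t0 by simp
  moreover have "absv (t z) < absv (a 1) / (B * L ^ 2)"
    using t_less by (simp add: \<epsilon>_def)
  then have "B * L ^ 2 * absv (t z) < absv (a 1)"
    using BL by (simp add: field_simps)
  ultimately show False by simp
qed

text \<open>The witness is the polynomial \<open>\<rho>\<^sub>a\<close> of the Carlitz module.\<close>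

lemma carlitz_poly_exists:
  assumes "a \<noteq> 0"
  shows "\<exists>\<rho>. (\<forall>x. e_w (\<iota> a * x) = poly \<rho> (e_w x)) \<and> degree \<rho> = CARD('q) ^ degree a \<and>
    absv (lead_coeff \<rho>) = 1 \<and> coeff \<rho> 0 = 0 \<and> pderiv \<rho> = [:\<iota> a:] \<and>
    (\<forall>i. absv (coeff \<rho> i) \<le> q ^ (CARD('q) ^ degree a - i))"
  using assms
proof (induction a)
  case (pCons c a)
  have e_const: "e_w (\<iota> [:c:] * x) = \<iota> [:c:] * e_w x" for x
    by (simp add: e_w_def e_A_const_mult)
  show ?case
  proof (cases "a = 0")
    case True
    with pCons have "c \<noteq> 0" by auto
    show ?thesis
    proof (intro exI[of _ "[:0, \<iota> [:c:]:]"] conjI allI)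
      fix i
      show "absv (coeff [:0, \<iota> [:c:]:] i) \<le> q ^ (CARD('q) ^ degree (pCons c a) - i)"
        using True by (cases i; cases "i - 1") (auto simp: absv_of_A_const coeff_pCons split: nat.splits)
    qed (use True \<open>c \<noteq> 0\<close> in \<open>auto simp: e_const absv_of_A_const pderiv_pCons\<close>)
  next
    case False
    let ?N = "CARD('q)"
    define D where "D = ?N ^ degree a"
    from pCons(2)[OF False] obtain \<rho> where \<rho>: "\<And>x. e_w (\<iota> a * x) = poly \<rho> (e_w x)" "degree \<rho> = D"
      "absv (lead_coeff \<rho>) = 1" "coeff \<rho> 0 = 0" "pderiv \<rho> = [:\<iota> a:]"
      "\<And>i. absv (coeff \<rho> i) \<le> q ^ (D - i)"
      unfolding D_def by blast
    have N: "?N \<ge> 2"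
      using q_ge_2 card_eq_q by linarith
    then have "D \<ge> 1"
      by (simp add: D_def)
    \<comment> \<open>The slack D + 1 \<le> q D pays for the factor T in front of \<rho>: its
      absolute value q raises the exponent D - i by one.\<close>
    then have "2 * D \<le> ?N * D"
      using N by (intro mult_right_mono) auto
    with \<open>D \<ge> 1\<close> have ND: "D + 1 \<le> ?N * D" "?N * D > 1"
      by linarith+
    have deg: "?N ^ degree (pCons c a) = ?N * D"
      using False by (simp add: D_def)
    have \<rho>0: "\<rho> \<noteq> 0"
      using \<rho>(3) by auto
    have deg_pow: "degree (\<rho> ^ ?N) = ?N * D"
      by (simp add: degree_power_eq[OF \<rho>0] \<rho>(2))
    \<comment> \<open>A bound q^(D - i) means that the i-th coefficient of the reversed polynomial
      is at most q^i; bounds of this shape are multiplicative.\<close>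
    have power_bound: "degree (\<rho> ^ n) \<le> n * D \<and> (\<forall>i. absv (coeff (\<rho> ^ n) i) \<le> q ^ (n * D - i))" for n
    proof (induction n)
      case 0
      show ?case by (auto simp: coeff_1)
    next
      case (Suc n)
      have "absv (coeff (\<rho> * \<rho> ^ n) i) \<le> q ^ (Suc n * D - i)" for i
        unfolding coeff_mult
      proof (rule absv_sum_le)
        fix k assume k: "k \<in> {..i}"
        show "absv (coeff \<rho> k * coeff (\<rho> ^ n) (i - k)) \<le> q ^ (Suc n * D - i)"
        proof (cases "k \<le> D \<and> i - k \<le> n * D")
          case True
          have "absv (coeff \<rho> k) * absv (coeff (\<rho> ^ n) (i - k)) \<le> q ^ (D - k) * q ^ (n * D - (i - k))"
            using \<rho>(6) Suc by (intro mult_mono) auto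
          also have "\<dots> = q ^ ((D - k) + (n * D - (i - k)))"
            by (rule power_add[symmetric])
          also have "(D - k) + (n * D - (i - k)) = Suc n * D - i"
            unfolding mult_Suc using True k by simp linarith
          finally show ?thesis
            by (simp add: absv_mult)
        next
          case False
          then have "coeff \<rho> k = 0 \<or> coeff (\<rho> ^ n) (i - k) = 0"
            using \<rho>(2) Suc by (metis coeff_eq_0 le_less_trans not_le)
          then show ?thesis by auto
        qed
      qed simp
      moreover have "degree (\<rho> * \<rho> ^ n) \<le> Suc n * D"
        using degree_mult_le[of \<rho> "\<rho> ^ n"] \<rho>(2) Suc by simp
      ultimately show ?case by simp
    qed
    \<comment> \<open>The polynomial of c + T a is c X + T \<rho> + \<rho>^q, because e_w(T x) = T
      e_w(x) + e_w(x)^q.\<close>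
    define \<sigma> where "\<sigma> = [:0, \<iota> [:c:]:] + smult T \<rho> + \<rho> ^ ?N"
    have deg_low: "degree ([:0, \<iota> [:c:]:] + smult T \<rho>) < ?N * D"
    proof (rule degree_add_less)
      show "degree [:0, \<iota> [:c:]:] < ?N * D"
        using ND \<open>D \<ge> 1\<close> by (simp add: degree_pCons_eq_if)
      have "degree (smult T \<rho>) = D"
        using \<rho>(2) by simp
      with ND show "degree (smult T \<rho>) < ?N * D"
        by linarith
    qed
    then have deg_\<sigma>: "degree \<sigma> = ?N * D"
      unfolding \<sigma>_def using deg_pow by (subst degree_add_eq_right) auto
    show ?thesis
      unfolding deg
    proof (intro exI[of _ \<sigma>] conjI allI)
      fix x
      have "e_w (\<iota> (pCons c a) * x) = e_w (\<iota> [:c:] * x) + e_w (T * (\<iota> a * x))"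
        by (subst of_A_pCons) (simp add: distrib_right e_w_add mult.assoc)
      also have "\<dots> = \<iota> [:c:] * e_w x + (T * poly \<rho> (e_w x) + poly \<rho> (e_w x) ^ ?N)"
        by (simp only: e_const e_w_T \<rho>(1))
      finally show "e_w (\<iota> (pCons c a) * x) = poly \<sigma> (e_w x)"
        by (simp add: \<sigma>_def mult.commute[of "e_w x"])
    next
      show "degree \<sigma> = ?N * D"
        by (rule deg_\<sigma>)
      have "lead_coeff \<sigma> = coeff (\<rho> ^ ?N) (?N * D)"
        unfolding deg_\<sigma> using coeff_eq_0[OF deg_low] by (simp add: \<sigma>_def)
      also have "\<dots> = lead_coeff \<rho> ^ ?N"
        using deg_pow lead_coeff_power[of \<rho> ?N] by simp
      finally show "absv (lead_coeff \<sigma>) = 1"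
        by (simp add: absv_power \<rho>(3))
      show "coeff \<sigma> 0 = 0"
        using \<rho>(4) by (simp add: \<sigma>_def coeff_0_power)
      \<comment> \<open>The exponent q is 0 in C_inf, so the derivative of the Carlitz polynomial
        stays constant; \<open>power_sums_of_reciprocal_roots\<close> relies on that.\<close>
      have "pderiv (\<rho> ^ ?N) = 0"
        by (simp add: pderiv_power of_nat_card_eq_0)
      then show "pderiv \<sigma> = [:\<iota> (pCons c a):]"
        using \<rho>(5) of_A_pCons[of c a] by (simp add: \<sigma>_def pderiv_add pderiv_smult pderiv_pCons)
    next
      fix i
      have "absv (coeff [:0, \<iota> [:c:]:] i) \<le> q ^ (?N * D - i)"
        by (cases i; cases "i - 1") (auto simp: absv_of_A_const coeff_pCons one_le_power split: nat.splits)
      moreover have "absv (coeff (smult T \<rho>) i) \<le> q ^ (?N * D - i)"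
      proof (cases "i \<le> D")
        case True
        have "absv (coeff (smult T \<rho>) i) \<le> q * q ^ (D - i)"
          using \<rho>(6)[of i] by (simp add: absv_mult absv_T)
        also have "\<dots> = q ^ Suc (D - i)"
          by simp
        also have "\<dots> \<le> q ^ (?N * D - i)"
          using True ND by (intro q_power_mono) auto
        finally show ?thesis .
      next
        case False
        then show ?thesis
          using \<rho>(2) coeff_eq_0[of \<rho> i] by simp
      qed
      moreover have "absv (coeff (\<rho> ^ ?N) i) \<le> q ^ (?N * D - i)"
        using power_bound by blast
      ultimately show "absv (coeff \<sigma> i) \<le> q ^ (?N * D - i)"
        unfolding \<sigma>_def coeff_add by (intro absv_add_leI)
    qed
  qed
qed simp

text \<open>With e_w(a z) = \<rho>(1/t), clearing denominators gives t(a z) = t^D / r(t), where D =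
  q^(deg a) and r is \<rho> reversed. The constant term of r has absolute value 1, so a power of r
  has a reciprocal series with coefficients at most q^i.\<close>

lemma t_multiple_power_expansion:
  assumes "a \<noteq> 0"
  shows "\<exists>c. (\<forall>i. absv (c i) \<le> q ^ i) \<and> (\<forall>i < CARD('q) ^ degree a * m. c i = 0) \<and>
    (\<forall>z\<in>Omega j. q * absv (t z) < 1 \<longrightarrow> (\<lambda>i. c i * t z ^ i) sums t (\<iota> a * z) ^ m)"
proof -
  define D where "D = CARD('q) ^ degree a"
  obtain \<rho> where \<rho>: "\<And>x. e_w (\<iota> a * x) = poly \<rho> (e_w x)" "degree \<rho> = D"
      "absv (lead_coeff \<rho>) = 1" "coeff \<rho> 0 = 0" "\<And>i. absv (coeff \<rho> i) \<le> q ^ (D - i)"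
    using carlitz_poly_exists[OF assms] unfolding D_def by blast
  define p where "p = reflect_poly \<rho> ^ m"
  have refl: "absv (coeff (reflect_poly \<rho>) i) \<le> q ^ i" for i
    using \<rho>(5)[of "D - i"] by (auto simp: coeff_reflect_poly \<rho>(2))
  have p: "absv (coeff p i) \<le> q ^ i" for i
    unfolding p_def by (rule absv_coeff_power_le[OF refl]) simp
  have p0: "absv (coeff p 0) = 1"
    using \<rho>(3) by (simp add: p_def coeff_0_power absv_power coeff_reflect_poly)
  obtain g where g: "\<And>i. absv (g i) \<le> q ^ i" "\<And>t s. (\<lambda>i. g i * t ^ i) sums s \<Longrightarrow> poly p t * s = 1"
    by (rule reciprocal_series[OF p p0 q_pos]) (rule that)
  define c where "c i = (if i < D * m then 0 else g (i - D * m))" for i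
  have c_bound: "absv (c i) \<le> q ^ i" for i
  proof (cases "i < D * m")
    case False
    have "q ^ (i - D * m) \<le> q ^ i"
      by (intro q_power_mono) auto
    with g(1)[of "i - D * m"] have "absv (g (i - D * m)) \<le> q ^ i"
      by (rule order_trans)
    with False show ?thesis
      by (simp add: c_def)
  qed (simp add: c_def)
  have "(\<lambda>i. c i * t z ^ i) sums t (\<iota> a * z) ^ m" if z: "z \<in> Omega j" "q * absv (t z) < 1" for z
  proof -
    have "summable (\<lambda>i. g i * t z ^ i)"
      using g(1) z(2) by (intro summable_power_series_nonarch[of g 1 q]) auto
    then obtain s where s: "(\<lambda>i. g i * t z ^ i) sums s"
      by (auto simp: summable_def)
    have ps: "poly p (t z) * s = 1"
      by (rule g(2)[OF s])
    have "poly p (t z) = (t z ^ D * poly \<rho> (e_w z)) ^ m"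
      using t_nonzero[OF z(1)] by (simp add: p_def poly_reflect_poly_nz \<rho>(2) t_eq)
    also have "\<dots> = (t z ^ D / t (\<iota> a * z)) ^ m"
      by (simp add: t_eq[of "\<iota> a * z"] \<rho>(1))
    finally have "(t z ^ D / t (\<iota> a * z)) ^ m * s = 1"
      using ps by simp
    moreover have "t (\<iota> a * z) \<noteq> 0"
      using z assms by (intro t_nonzero) (simp add: Omega_mult_iff)
    ultimately have "t (\<iota> a * z) ^ m = t z ^ (D * m) * s"
      by (simp add: power_divide field_simps flip: power_mult)
    moreover have "(\<lambda>i. c i * t z ^ i) sums (t z ^ (D * m) * s)"
    proof (rule sums_shift_nonarch[where n = "D * m"])
      show "(\<lambda>i. c (i + D * m) * t z ^ (i + D * m)) sums (t z ^ (D * m) * s)"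
        using sums_mult_nonarch[OF s, of "t z ^ (D * m)"] by (simp add: c_def power_add mult_ac)
    qed (simp add: c_def)
    ultimately show ?thesis
      by simp
  qed
  with c_bound show ?thesis
    by (intro exI[of _ c]) (auto simp: c_def D_def)
qed

subsection \<open>The spaces of modular forms\<close>

lemma modular_forms_0: "(\<lambda>_. 0) \<in> modular_forms j w k m"
  using has_t_expansion_0 by (auto simp: modular_forms_def rigid_analytic_0 modular_transform_0)

lemma modular_forms_add:
  "f \<in> modular_forms j w k m \<Longrightarrow> g \<in> modular_forms j w k m \<Longrightarrow> (\<lambda>z. f z + g z) \<in> modular_forms j w k m"
  unfolding modular_forms_def
  by (auto intro!: rigid_analytic_add modular_transform_add exI has_t_expansion_add)

lemma modular_forms_cmult:
  "f \<in> modular_forms j w k m \<Longrightarrow> (\<lambda>z. c * f z) \<in> modular_forms j w k m"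
  unfolding modular_forms_def
  by (auto intro!: rigid_analytic_cmult modular_transform_cmult exI has_t_expansion_cmult)

lemma double_cusp_forms_0: "(\<lambda>_. 0) \<in> double_cusp_forms j w k m"
  unfolding double_cusp_forms_def using modular_forms_0 has_t_expansion_0 by blast

lemma double_cusp_forms_add:
  assumes "f \<in> double_cusp_forms j w k m" and "g \<in> double_cusp_forms j w k m"
  shows "(\<lambda>z. f z + g z) \<in> double_cusp_forms j w k m"
proof -
  obtain a b where "has_t_expansion j w f a" "a 0 = 0" "a 1 = 0" "has_t_expansion j w g b" "b 0 = 0" "b 1 = 0"
    using assms unfolding double_cusp_forms_def by blast
  then have "has_t_expansion j w (\<lambda>z. f z + g z) (\<lambda>i. a i + b i) \<and> a 0 + b 0 = 0 \<and> a 1 + b 1 = 0"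
    using has_t_expansion_add by simp
  moreover have "(\<lambda>z. f z + g z) \<in> modular_forms j w k m"
    using assms by (intro modular_forms_add) (simp_all add: double_cusp_forms_def)
  ultimately show ?thesis
    unfolding double_cusp_forms_def by (intro CollectI conjI exI[of _ "\<lambda>i. a i + b i"]) auto
qed

lemma double_cusp_forms_cmult:
  assumes "f \<in> double_cusp_forms j w k m"
  shows "(\<lambda>z. c * f z) \<in> double_cusp_forms j w k m"
proof -
  obtain a where "has_t_expansion j w f a" "a 0 = 0" "a 1 = 0"
    using assms unfolding double_cusp_forms_def by blast
  then have "has_t_expansion j w (\<lambda>z. c * f z) (\<lambda>i. c * a i) \<and> c * a 0 = 0 \<and> c * a 1 = 0"
    using has_t_expansion_cmult by simp
  moreover have "(\<lambda>z. c * f z) \<in> modular_forms j w k m"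
    using assms by (intro modular_forms_cmult) (simp_all add: double_cusp_forms_def)
  ultimately show ?thesis
    unfolding double_cusp_forms_def by (intro CollectI conjI exI[of _ "\<lambda>i. c * a i"]) auto
qed

end

section \<open>A cusp form with non-vanishing first coefficient\<close>

context C_infinity
begin

lemma card_polys_below: "card (polys_below d :: 'q poly set) = CARD('q) ^ d"
proof (induction d)
  case (Suc d)
  then show ?case
    using bij_betw_same_card[OF bij_betw_pCons_polys_below[of d, where 'a = 'q]]
    by (simp add: card_cartesian_product)
qed simp

text \<open>Expand (c + T a)^i. The power sums of a with exponent l < d vanish by induction;
  otherwise l = i, and the sum over c of c^0 is q = 0.\<close>

lemma power_sum_polys_below: "i < d \<Longrightarrow> (\<Sum>a\<in>polys_below d. \<iota> a ^ i) = 0"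
proof (induction d arbitrary: i)
  case (Suc d)
  let ?c = "\<lambda>l a c. of_nat (i choose l) * (T * \<iota> a) ^ l * \<iota> [:c:] ^ (i - l)"
  have "\<iota> (pCons c a) ^ i = (\<Sum>l\<le>i. ?c l a c)" for c a
    by (subst of_A_pCons) (simp add: binomial_ring[of "T * \<iota> a" "\<iota> [:c:]"] add.commute[of "\<iota> [:c:]"])
  then have "(\<Sum>a\<in>polys_below (Suc d). \<iota> a ^ i) = (\<Sum>a\<in>polys_below d. \<Sum>c\<in>UNIV. \<Sum>l\<le>i. ?c l a c)"
    by (simp add: sum_polys_below_Suc)
  also have "\<dots> = (\<Sum>a\<in>polys_below d. \<Sum>l\<le>i. \<Sum>c\<in>UNIV. ?c l a c)"
    by (intro sum.cong refl sum.swap)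
  also have "\<dots> = (\<Sum>l\<le>i. \<Sum>a\<in>polys_below d. \<Sum>c\<in>UNIV. ?c l a c)"
    by (rule sum.swap)
  also have "\<dots> = (\<Sum>l\<le>i. of_nat (i choose l) * T ^ l * (\<Sum>a\<in>polys_below d. \<iota> a ^ l) * (\<Sum>c\<in>UNIV. \<iota> [:c:] ^ (i - l)))"
    by (intro sum.cong refl)
       (simp add: sum_distrib_left sum_distrib_right power_mult_distrib mult_ac)
  also have "\<dots> = 0"
  proof (intro sum.neutral ballI)
    fix l assume l: "l \<in> {..i}"
    show "of_nat (i choose l) * T ^ l * (\<Sum>a\<in>polys_below d. \<iota> a ^ l) * (\<Sum>c\<in>UNIV. \<iota> [:c:] ^ (i - l)) = 0"
    proof (cases "l < d")
      case True
      then show ?thesis by (simp add: Suc.IH)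
    next
      case False
      with l Suc.prems have "i - l = 0"
        by auto
      then show ?thesis
        by (simp add: of_nat_card_eq_0)
    qed
  qed
  finally show ?case .
qed simp

text \<open>\<open>G k\<close> is, up to a constant factor, Petrov's form \<open>\<Sum> a\<^sup>k\<^sup>-\<^sup>1 t(a z)\<close>, the sum being over the
  monic \<open>a\<close>.\<close>

definition G_fin :: "nat \<Rightarrow> nat \<Rightarrow> 'c \<Rightarrow> 'c" where
  "G_fin k d z = (\<Sum>a\<in>polys_below d. \<iota> a ^ (k - 1) * tau (\<iota> a * z))"

definition G :: "nat \<Rightarrow> 'c \<Rightarrow> 'c" where
  "G k z = (if z \<in> Omega j then lim (\<lambda>d. G_fin k d z) else 0)"

text \<open>a and b range over the same set, so exchanging them, which is what inversion does, is a
  symmetry of the sum.\<close>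

definition F_fin :: "nat \<Rightarrow> nat \<Rightarrow> 'c \<Rightarrow> 'c" where
  "F_fin k d z = (\<Sum>a\<in>polys_below d. \<Sum>b\<in>polys_below d. \<iota> a ^ (k - 1) / (\<iota> a * z + \<iota> b))"

lemma F_fin_eq: "F_fin k d z = (\<Sum>a\<in>polys_below d. \<iota> a ^ (k - 1) * tau_fin d (\<iota> a * z))"
proof -
  have "(\<Sum>b\<in>polys_below d. \<iota> a ^ (k - 1) / (\<iota> a * z + \<iota> b)) = \<iota> a ^ (k - 1) * tau_fin d (\<iota> a * z)" for a
    using sum_polys_below_uminus[of "\<lambda>b. \<iota> a ^ (k - 1) / (\<iota> a * z + \<iota> b)" d]
    by (simp add: tau_fin_def sum_distrib_left of_A_minus)
  then show ?thesis
    by (simp add: F_fin_def)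
qed

text \<open>The bound of \<open>absv_tau_le\<close> for s = k at distance y. At distance |a| y it
  gains the factor |a|^-(q^k), which absorbs the coefficient a^(k-1) and leaves 1 / |a|.\<close>

definition Gbound :: "nat \<Rightarrow> real \<Rightarrow> real" where
  "Gbound k y = (q ^ k) ^ (CARD('q) ^ k - 1) / y ^ (CARD('q) ^ k)"

lemma Gbound_pos: "y > 0 \<Longrightarrow> Gbound k y > 0"
  by (simp add: Gbound_def)

lemma G_term_bound_aux:
  assumes "y > 0" and "\<alpha> \<ge> 1" and "k \<ge> 1"
    and "v \<le> (1 / (\<alpha> * y)) * (q ^ k / (\<alpha> * y)) ^ (CARD('q) ^ k - 1)"
  shows "\<alpha> ^ (k - 1) * v \<le> Gbound k y / \<alpha>"
proof -
  define N where "N = CARD('q) ^ k"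
  have "CARD('q) \<ge> 2"
    using q_ge_2 card_eq_q by linarith
  then have "k < N"
    unfolding N_def by (intro less_exp[THEN less_le_trans] power_mono) auto
  have "\<alpha> * \<alpha> ^ (k - 1) = \<alpha> ^ k"
    using assms(3) by (simp flip: power_Suc)
  also have "\<dots> \<le> \<alpha> ^ N"
    using \<open>k < N\<close> assms(2) by (intro power_increasing) auto
  finally have le: "\<alpha> * \<alpha> ^ (k - 1) \<le> \<alpha> ^ N" .
  have eq: "(1 / (\<alpha> * y)) * (q ^ k / (\<alpha> * y)) ^ (N - 1) = (q ^ k) ^ (N - 1) / (\<alpha> ^ N * y ^ N)"
    using \<open>k < N\<close> power_Suc[of "\<alpha> * y" "N - 1"] by (simp add: power_divide power_mult_distrib)
  have "\<alpha> ^ (k - 1) * v \<le> \<alpha> ^ (k - 1) * ((q ^ k) ^ (N - 1) / (\<alpha> ^ N * y ^ N))"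
    using assms(2) by (intro mult_left_mono assms(4)[folded N_def, unfolded eq]) simp
  also have "\<dots> = (\<alpha> ^ (k - 1) / \<alpha> ^ N) * Gbound k y"
    by (simp add: Gbound_def N_def)
  also have "\<dots> \<le> (1 / \<alpha>) * Gbound k y"
  proof (rule mult_right_mono)
    show "\<alpha> ^ (k - 1) / \<alpha> ^ N \<le> 1 / \<alpha>"
      using le assms(2) by (simp add: field_simps)
  qed (use Gbound_pos[OF assms(1)] in \<open>simp add: less_imp_le\<close>)
  finally show ?thesis by simp
qed

lemma G_term_bound:
  assumes "far y z" and "y > 0" and "k \<ge> 1" and "a \<noteq> 0"
  shows "absv (\<iota> a ^ (k - 1) * tau (\<iota> a * z)) \<le> Gbound k y / absv (\<iota> a)"
    and "d \<ge> k \<Longrightarrow> absv (\<iota> a ^ (k - 1) * tau_fin d (\<iota> a * z)) \<le> Gbound k y / absv (\<iota> a)"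
proof -
  have f: "far (absv (\<iota> a) * y) (\<iota> a * z)"
    using assms by (intro far_mult) auto
  have pos: "absv (\<iota> a) * y > 0"
    using assms by simp
  show "absv (\<iota> a ^ (k - 1) * tau (\<iota> a * z)) \<le> Gbound k y / absv (\<iota> a)"
    unfolding absv_mult absv_power
    using absv_tau_le[OF pos far_of_A[OF f], of k] assms absv_of_A_ge_1[of a]
    by (intro G_term_bound_aux) (simp_all add: card_polys_below)
  show "absv (\<iota> a ^ (k - 1) * tau_fin d (\<iota> a * z)) \<le> Gbound k y / absv (\<iota> a)" if "d \<ge> k"
    unfolding absv_mult absv_power
    using absv_tau_fin_le[OF pos far_of_A[OF f] that] assms absv_of_A_ge_1[of a]
    by (intro G_term_bound_aux) (simp_all add: card_polys_below)
qed

lemma absv_G_fin_diff_le: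
  assumes "far y z" and "y > 0" and "k \<ge> 1" and "d \<le> m"
  shows "absv (G_fin k m z - G_fin k d z) \<le> Gbound k y / q ^ d"
proof -
  have sub: "polys_below d \<subseteq> (polys_below m :: 'q poly set)"
    by (rule polys_below_mono) fact
  have "G_fin k m z - G_fin k d z = (\<Sum>a\<in>polys_below m - polys_below d. \<iota> a ^ (k - 1) * tau (\<iota> a * z))"
    unfolding G_fin_def
    using sum.subset_diff[OF sub finite_polys_below, of "\<lambda>a. \<iota> a ^ (k - 1) * tau (\<iota> a * z)"] by simp
  also have "absv \<dots> \<le> Gbound k y / q ^ d"
  proof (intro absv_sum_le)
    fix a :: "'q poly" assume "a \<in> polys_below m - polys_below d"
    then have a: "absv (\<iota> a) \<ge> q ^ d" "a \<noteq> 0"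
      using absv_of_A_ge by auto
    have "absv (\<iota> a ^ (k - 1) * tau (\<iota> a * z)) \<le> Gbound k y / absv (\<iota> a)"
      using assms a by (intro G_term_bound)
    also have "\<dots> \<le> Gbound k y / q ^ d"
      using a Gbound_pos[OF assms(2), of k] by (intro divide_left_mono) auto
    finally show "absv (\<iota> a ^ (k - 1) * tau (\<iota> a * z)) \<le> Gbound k y / q ^ d" .
  qed (use Gbound_pos[OF assms(2), of k] in auto)
  finally show ?thesis .
qed

lemma G_fin_tendsto:
  assumes "z \<in> Omega j" and "k \<ge> 1"
  shows "(\<lambda>d. G_fin k d z) \<longlonglongrightarrow> G k z"
proof -
  obtain n where n: "far (1 / q ^ n) z"
    using Omega_imp_far[OF assms(1)] .
  have "convergent (\<lambda>d. G_fin k d z)"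
  proof (rule convergent_if_increments_tendsto_0)
    show "(\<lambda>d. absv (G_fin k (Suc d) z - G_fin k d z)) \<longlonglongrightarrow> 0"
    proof (rule tendsto_sandwich[OF _ _ tendsto_const one_over_q_power_tendsto_0[of "Gbound k (1 / q ^ n)"]])
      show "\<forall>\<^sub>F d in sequentially. absv (G_fin k (Suc d) z - G_fin k d z) \<le> Gbound k (1 / q ^ n) / q ^ d"
        using n assms by (intro always_eventually allI absv_G_fin_diff_le) auto
    qed auto
  qed
  then show ?thesis
    using assms by (simp add: G_def convergent_LIMSEQ_iff)
qed

lemma absv_G_diff_le:
  assumes "far y z" and "y > 0" and "k \<ge> 1"
  shows "absv (G k z - G_fin k d z) \<le> Gbound k y / q ^ d"
proof (rule absv_limit_le)
  show "(\<lambda>m. G_fin k m z - G_fin k d z) \<longlonglongrightarrow> G k z - G_fin k d z"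
    using assms by (intro tendsto_diff G_fin_tendsto tendsto_const far_imp_Omega[of y])
  show "absv (G_fin k m z - G_fin k d z) \<le> Gbound k y / q ^ d" if "m \<ge> d" for m
    using assms that by (intro absv_G_fin_diff_le)
qed

text \<open>For |a| \<ge> q^m the inner sums, finite or infinite, are small by
  \<open>Gbound\<close>, uniformly in d. For the finitely many other a the inner truncation error is
  at most 1 / q^d times a constant.\<close>

lemma F_fin_uniform:
  assumes "e > 0" and "k \<ge> 2"
  shows "\<exists>d0. \<forall>d\<ge>d0. \<forall>z\<in>Omega_aff j n. absv (F_fin k d z - G k z) < e"
proof -
  define C where "C = Gbound k (1 / q ^ n)"
  have C: "C > 0"
    by (simp add: C_def Gbound_pos)
  obtain m where m: "C / q ^ m < e / 2"
    using order_tendstoD(2)[OF one_over_q_power_tendsto_0, of "e / 2" C] assms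
    by (auto simp: eventually_sequentially)
  obtain d1 where d1: "\<And>d. d \<ge> d1 \<Longrightarrow> (q ^ m) ^ (k - 1) / q ^ d < e / 2"
    using order_tendstoD(2)[OF one_over_q_power_tendsto_0, of "e / 2" "(q ^ m) ^ (k - 1)"] assms
    by (auto simp: eventually_sequentially)
  \<comment> \<open>d \<ge> k is required by the bound for \<open>tau_fin\<close> with s = k, and d
    \<ge> m + n ensures |a z| < q^d for |a| < q^m.\<close>
  define d0 where "d0 = max d1 (max k (m + n))"
  have "absv (F_fin k d z - G k z) < e" if d: "d \<ge> d0" and z: "z \<in> Omega_aff j n" for d z
  proof -
    have z': "absv z \<le> q ^ n" "far (1 / q ^ n) z"
      using z by (simp_all add: Omega_aff_iff)
    have d': "d \<ge> d1" "d \<ge> k" "d \<ge> m" "d \<ge> m + n"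
      using d by (simp_all add: d0_def)
    have "absv (F_fin k d z - G_fin k d z) \<le> e / 2"
      unfolding F_fin_eq G_fin_def sum_subtractf[symmetric]
    proof (rule absv_sum_le)
      fix a :: "'q poly" assume a: "a \<in> polys_below d"
      show "absv (\<iota> a ^ (k - 1) * tau_fin d (\<iota> a * z) - \<iota> a ^ (k - 1) * tau (\<iota> a * z)) \<le> e / 2"
      proof (cases "a \<in> polys_below m")
        case False
        then have a: "absv (\<iota> a) \<ge> q ^ m" "a \<noteq> 0"
          using absv_of_A_ge by auto
        then have "C / absv (\<iota> a) \<le> C / q ^ m"
          using C by (intro divide_left_mono) auto
        then have le: "C / absv (\<iota> a) \<le> e / 2"
          using m by linarith
        show ?thesis
          using G_term_bound[OF z'(2) _ _ a(2), of k] assms d'(2) order_trans[OF _ le]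
          by (intro absv_diff_leI) (auto simp: C_def)
      next
        case True
        show ?thesis
        proof (cases "a = 0")
          case True
          then show ?thesis
            using assms by (simp add: power_0_left)
        next
          case False
          have "absv (\<iota> a * z) \<le> absv (\<iota> a) * q ^ n"
            unfolding absv_mult using z'(1) by (intro mult_left_mono) auto
          also have "\<dots> < q ^ m * q ^ n"
            using absv_of_A_less[OF True] by (intro mult_strict_right_mono) auto
          also have "\<dots> \<le> q ^ d"
            using d' by (simp add: q_power_mono flip: power_add)
          finally have "absv (tau (\<iota> a * z) - tau_fin d (\<iota> a * z)) \<le> 1 / q ^ d"
            by (rule absv_tau_diff_le)
          moreover have "absv (\<iota> a) ^ (k - 1) \<le> (q ^ m) ^ (k - 1)"
            using absv_of_A_le[OF True] by (intro power_mono) auto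
          ultimately have "absv (\<iota> a) ^ (k - 1) * absv (tau (\<iota> a * z) - tau_fin d (\<iota> a * z)) \<le> (q ^ m) ^ (k - 1) * (1 / q ^ d)"
            by (intro mult_mono) auto
          moreover have "\<iota> a ^ (k - 1) * tau_fin d (\<iota> a * z) - \<iota> a ^ (k - 1) * tau (\<iota> a * z) =
              - (\<iota> a ^ (k - 1) * (tau (\<iota> a * z) - tau_fin d (\<iota> a * z)))"
            by (simp add: algebra_simps)
          ultimately show ?thesis
            using d1[OF d'(1)] by (simp only: absv_minus absv_mult absv_power times_divide_eq_right mult_1_right)
        qed
      qed
    qed (use assms in simp)
    moreover have "absv (G k z - G_fin k d z) \<le> C / q ^ d"
      using z' assms unfolding C_def by (intro absv_G_diff_le) auto
    moreover have "C / q ^ d \<le> C / q ^ m"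
      using C d' by (intro divide_left_mono q_power_mono) auto
    ultimately have "absv (F_fin k d z - G_fin k d z) < e" "absv (G k z - G_fin k d z) < e"
      using m assms by linarith+
    from absv_diff_lessI[OF this] show ?thesis by simp
  qed
  then show ?thesis
    by blast
qed

lemma F_fin_tendsto:
  assumes "z \<in> Omega j" and "k \<ge> 2"
  shows "(\<lambda>d. F_fin k d z) \<longlonglongrightarrow> G k z"
proof (rule tendstoI)
  fix e :: real assume "e > 0"
  obtain n where n: "z \<in> Omega_aff j n"
    using Omega_in_aff[OF assms(1)] .
  show "\<forall>\<^sub>F d in sequentially. dist (F_fin k d z) (G k z) < e"
    using F_fin_uniform[OF \<open>e > 0\<close> assms(2), of n] n by (auto simp: eventually_sequentially dist_absv)
qed

lemma rational_on_F_fin: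
  assumes "k \<ge> 2"
  shows "rational_on (Omega_aff j n) (F_fin k d)"
proof -
  have "rational_on (Omega_aff j n) (\<lambda>z. \<iota> a ^ (k - 1) / (\<iota> a * z + \<iota> b))" for a b
  proof (cases "a = 0")
    case True
    then show ?thesis
      using assms rational_on_const[of _ 0] by (simp add: power_0_left)
  next
    case False
    then show ?thesis
      using Omega_aff_subset[of n] by (intro rational_on_divide_linear Omega_linear_nonzero) auto
  qed
  then have "rational_on (Omega_aff j n) (\<lambda>z. F_fin k d z)"
    unfolding F_fin_def by (intro rational_on_sum)
  then show ?thesis by simp
qed

lemma rigid_analytic_G:
  assumes "k \<ge> 2"
  shows "rigid_analytic j (G k)"
proof (rule rigid_analyticI)
  fix n and e :: real assume "e > 0"
  from F_fin_uniform[OF this assms, of n] obtain d where "\<forall>z\<in>Omega_aff j n. absv (F_fin k d z - G k z) < e"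
    by blast
  then show "\<exists>g. rational_on (Omega_aff j n) g \<and> (\<forall>z\<in>Omega_aff j n. absv (g z - G k z) < e)"
    using rational_on_F_fin[OF assms] by blast
qed

section \<open>Transformation of \<open>G\<close> under generators of GL_2(A)\<close>

lemma G_translation:
  assumes "z \<in> Omega j" and "k \<ge> 2"
  shows "G k (z + \<iota> b) = G k z"
proof -
  have "\<iota> a ^ (k - 1) * tau (\<iota> a * (z + \<iota> b)) = \<iota> a ^ (k - 1) * tau (\<iota> a * z)" for a
  proof (cases "a = 0")
    case True
    then show ?thesis using assms by simp
  next
    case False
    then have "\<iota> a * z \<notin> range \<iota>"
      using assms by (intro Omega_notin_A) (simp add: Omega_mult_iff)
    from tau_add_of_A[OF this, of "a * b"] show ?thesis
      by (simp add: distrib_left of_A_mult)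
  qed
  then have "G_fin k d (z + \<iota> b) = G_fin k d z" for d
    unfolding G_fin_def by (intro sum.cong) auto
  then show ?thesis
    using assms by (simp add: G_def Omega_add_iff)
qed

lemma G_unit:
  assumes "z \<in> Omega j" and "k \<ge> 2" and "c \<noteq> 0"
  shows "G k (\<iota> [:c:] * z) = G k z / \<iota> [:c:]"
proof -
  have "\<iota> a ^ (k - 1) * tau (\<iota> a * (\<iota> [:c:] * z)) = \<iota> a ^ (k - 1) * tau (\<iota> a * z) / \<iota> [:c:]" for a
  proof (cases "a = 0")
    case True
    then show ?thesis using assms by (simp add: power_0_left)
  next
    case False
    then have "\<iota> a * z \<notin> range \<iota>"
      using assms by (intro Omega_notin_A) (simp add: Omega_mult_iff)
    from tau_const_mult[OF this assms(3)] show ?thesis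
      by (simp add: mult.left_commute)
  qed
  then have "G_fin k d (\<iota> [:c:] * z) = G_fin k d z / \<iota> [:c:]" for d
    unfolding G_fin_def sum_divide_distrib by (intro sum.cong) auto
  moreover have "(\<lambda>d. G_fin k d z / \<iota> [:c:]) \<longlonglongrightarrow> G k z / \<iota> [:c:]"
    unfolding divide_inverse using assms by (intro tendsto_mult tendsto_const G_fin_tendsto) auto
  moreover have "(\<lambda>d. G_fin k d (\<iota> [:c:] * z)) \<longlonglongrightarrow> G k (\<iota> [:c:] * z)"
    using assms by (intro G_fin_tendsto) (auto simp: Omega_mult_iff)
  ultimately show ?thesis
    using LIMSEQ_unique by simp
qed

text \<open>Writing \<open>(a z)\<^sup>k\<^sup>-\<^sup>1 = (-b)\<^sup>k\<^sup>-\<^sup>1 + (a z + b) \<cdot> (\<dots>)\<close>, the polynomial part contributes nothing, because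
  low power sums over polynomials of bounded degree vanish.\<close>

lemma F_fin_inversion:
  assumes "z \<in> Omega j" and "k \<ge> 3" and "d \<ge> k"
  shows "F_fin k d (1 / z) = (- 1) ^ (k - 1) * z ^ k * F_fin k d z"
proof -
  let ?P = "polys_below d :: 'q poly set"
  have z: "z \<noteq> 0"
    using assms Omega_nonzero by blast
  have split_term: "(\<iota> a * z) ^ (k - 1) / (\<iota> a * z + \<iota> b) =
      (\<Sum>i<k - 1. (\<iota> a * z) ^ i * (- \<iota> b) ^ (k - 2 - i)) + (- \<iota> b) ^ (k - 1) / (\<iota> a * z + \<iota> b)" for a b
  proof (cases "a = 0 \<and> b = 0")
    case True
    \<comment> \<open>On the left the division by 0 yields 0. On the right i and k - 2 - i are never
      both 0, since k \<ge> 3.\<close>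
    have "(\<Sum>i<k - 1. (0 :: 'c) ^ i * 0 ^ (k - 2 - i)) = 0"
    proof (intro sum.neutral ballI)
      fix i assume "i \<in> {..<k - 1}"
      show "(0 :: 'c) ^ i * 0 ^ (k - 2 - i) = 0"
        using assms(2) by (cases i) (auto simp: power_0_left)
    qed
    with True show ?thesis by simp
  next
    case False
    then have ne: "\<iota> a * z + \<iota> b \<noteq> 0"
      using assms by (intro Omega_linear_nonzero) auto
    have "(\<iota> a * z) ^ (k - 1) - (- \<iota> b) ^ (k - 1) =
      (\<iota> a * z + \<iota> b) * (\<Sum>i<k - 1. (\<iota> a * z) ^ i * (- \<iota> b) ^ (k - 2 - i))"
    proof -
      have k: "k - 1 = Suc (k - 2)"
        using assms by simp
      show ?thesis
        unfolding k diff_power_eq_sum by (simp add: mult.commute)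
    qed
    then show ?thesis
      using ne by (simp add: field_simps)
  qed
  have zero: "(\<Sum>a\<in>?P. \<Sum>b\<in>?P. (\<iota> a * z) ^ i * (- \<iota> b) ^ l) = 0" if "i < d" for i l
  proof -
    have "(\<Sum>a\<in>?P. \<Sum>b\<in>?P. (\<iota> a * z) ^ i * (- \<iota> b) ^ l) = (\<Sum>a\<in>?P. \<iota> a ^ i) * (z ^ i * (\<Sum>b\<in>?P. (- \<iota> b) ^ l))"
      by (simp only: sum_distrib_left[of "z ^ i"] sum_product power_mult_distrib mult.assoc)
    then show ?thesis
      by (simp add: power_sum_polys_below[OF that])
  qed
  have "z ^ (k - 1) * F_fin k d z = (\<Sum>a\<in>?P. \<Sum>b\<in>?P. (\<iota> a * z) ^ (k - 1) / (\<iota> a * z + \<iota> b))"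
    unfolding F_fin_def by (simp add: sum_distrib_left power_mult_distrib mult.commute)
  also have "\<dots> = (\<Sum>a\<in>?P. \<Sum>b\<in>?P. \<Sum>i<k - 1. (\<iota> a * z) ^ i * (- \<iota> b) ^ (k - 2 - i)) +
      (\<Sum>a\<in>?P. \<Sum>b\<in>?P. (- \<iota> b) ^ (k - 1) / (\<iota> a * z + \<iota> b))"
    by (simp only: split_term sum.distrib)
  also have "(\<Sum>a\<in>?P. \<Sum>b\<in>?P. \<Sum>i<k - 1. (\<iota> a * z) ^ i * (- \<iota> b) ^ (k - 2 - i)) =
      (\<Sum>a\<in>?P. \<Sum>i<k - 1. \<Sum>b\<in>?P. (\<iota> a * z) ^ i * (- \<iota> b) ^ (k - 2 - i))"
    by (intro sum.cong refl sum.swap)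
  also have "\<dots> = (\<Sum>i<k - 1. \<Sum>a\<in>?P. \<Sum>b\<in>?P. (\<iota> a * z) ^ i * (- \<iota> b) ^ (k - 2 - i))"
    by (rule sum.swap)
  also have "\<dots> = 0"
    using assms(3) by (intro sum.neutral ballI zero) auto
  also have "0 + (\<Sum>a\<in>?P. \<Sum>b\<in>?P. (- \<iota> b) ^ (k - 1) / (\<iota> a * z + \<iota> b)) =
      (\<Sum>b\<in>?P. \<Sum>a\<in>?P. (- \<iota> b) ^ (k - 1) / (\<iota> a * z + \<iota> b))"
    by (simp only: add_0_left) (rule sum.swap)
  also have "\<dots> = (- 1) ^ (k - 1) / z * F_fin k d (1 / z)"
  proof -
    have "(- \<iota> b) ^ (k - 1) / (\<iota> a * z + \<iota> b) = (- 1) ^ (k - 1) / z * (\<iota> b ^ (k - 1) / (\<iota> b * (1 / z) + \<iota> a))" for a b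
    proof -
      have "\<iota> a * z + \<iota> b = z * (\<iota> b * (1 / z) + \<iota> a)"
        using z by (simp add: field_simps)
      moreover have "(- \<iota> b) ^ (k - 1) = (- 1) ^ (k - 1) * \<iota> b ^ (k - 1)"
        by (rule power_minus)
      ultimately show ?thesis by simp
    qed
    then show ?thesis
      unfolding F_fin_def sum_distrib_left by (intro sum.cong refl)
  qed
  finally have "z ^ (k - 1) * F_fin k d z = (- 1) ^ (k - 1) / z * F_fin k d (1 / z)" .
  then have "((- 1) ^ (k - 1) * z) * (z ^ (k - 1) * F_fin k d z) = ((- 1) ^ (k - 1) * z) * ((- 1) ^ (k - 1) / z * F_fin k d (1 / z))"
    by (simp only:)
  then have "(- 1) ^ (k - 1) * (z * z ^ (k - 1)) * F_fin k d z = ((- 1) ^ (k - 1) * (- 1) ^ (k - 1)) * F_fin k d (1 / z)"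
    using z by (simp add: mult.assoc)
  moreover have "z * z ^ (k - 1) = z ^ k"
    using assms by (simp flip: power_Suc)
  moreover have "(- 1 :: 'c) ^ (k - 1) * (- 1) ^ (k - 1) = 1"
    by (simp flip: power_mult_distrib)
  ultimately show ?thesis
    by simp
qed

lemma G_inversion:
  assumes "z \<in> Omega j" and "k \<ge> 3" and weight: "\<And>c :: 'q. c \<noteq> 0 \<Longrightarrow> c ^ k = c ^ 2"
  shows "G k (1 / z) = - (z ^ k * G k z)"
proof -
  \<comment> \<open>The weight condition for c = -1 turns the sign (-1)^(k-1) of
    \<open>F_fin_inversion\<close> into the sign -1 demanded by type 1.\<close>
  have "(- 1 :: 'q) ^ k = 1"
    using weight[of "- 1"] by simp
  then have "\<iota> [:(- 1) ^ k:] = 1"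
    by (simp add: one_pCons[symmetric])
  moreover have "\<iota> [:(- 1) ^ k:] = \<iota> [:- 1:] ^ k"
    by (simp add: poly_const_pow flip: of_A_power)
  moreover have "\<iota> [:- 1:] = - 1"
    using of_A_minus[of "[:1:]"] of_A_1 by (simp add: one_pCons)
  ultimately have "(- 1 :: 'c) ^ k = 1"
    by simp
  then have "(- 1 :: 'c) * (- 1) ^ (k - 1) = 1"
    using assms by (simp flip: power_Suc)
  then have sign: "(- 1 :: 'c) ^ (k - 1) = - 1"
    by (metis add.inverse_inverse mult_minus1)
  have "(\<lambda>d. F_fin k d (1 / z)) \<longlonglongrightarrow> - (z ^ k * G k z)"
  proof (rule Lim_transform_eventually)
    show "(\<lambda>d. - (z ^ k * F_fin k d z)) \<longlonglongrightarrow> - (z ^ k * G k z)"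
      using assms by (intro tendsto_minus tendsto_mult tendsto_const F_fin_tendsto) auto
    show "\<forall>\<^sub>F d in sequentially. - (z ^ k * F_fin k d z) = F_fin k d (1 / z)"
      using F_fin_inversion[OF assms(1,2), unfolded sign] by (intro eventually_sequentiallyI[of k]) simp
  qed
  moreover have "(\<lambda>d. F_fin k d (1 / z)) \<longlonglongrightarrow> G k (1 / z)"
    using assms by (intro F_fin_tendsto Omega_inverse) auto
  ultimately show ?thesis
    using LIMSEQ_unique by blast
qed

lemma modular_transform_G:
  assumes "k \<ge> 3" and "\<And>c :: 'q. c \<noteq> 0 \<Longrightarrow> c ^ k = c ^ 2"
  shows "modular_transform j k 1 (G k)"
  using assms by (intro modular_transformI G_translation G_unit G_inversion) auto

subsection \<open>The eigenvalue property\<close>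

lemma bij_betw_mult_mod:
  fixes P a :: "'q poly"
  assumes "prime_elem P" and "\<not> P dvd a"
  shows "bij_betw (\<lambda>\<beta>. a * \<beta> mod P) (polys_below (degree P)) (polys_below (degree P))"
proof -
  let ?B = "polys_below (degree P) :: 'q poly set"
  have P: "P \<noteq> 0"
    using assms by auto
  have sub: "(\<lambda>\<beta>. a * \<beta> mod P) ` ?B \<subseteq> ?B"
    using degree_mod_less[OF P] by (auto simp: polys_below_iff)
  have inj: "inj_on (\<lambda>\<beta>. a * \<beta> mod P) ?B"
  proof (rule inj_onI)
    fix x y assume x: "x \<in> ?B" and y: "y \<in> ?B" and eq: "a * x mod P = a * y mod P"
    then have "P dvd a * (x - y)"
      by (simp add: mod_eq_dvd_iff right_diff_distrib)
    then have "P dvd x - y"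
      using assms prime_elem_dvd_mult_iff by blast
    moreover have "x - y \<in> ?B"
      using x y by (rule polys_below_diff)
    ultimately show "x = y"
      using dvd_imp_degree_le[of P "x - y"] by (cases "x = y") (auto simp: polys_below_iff)
  qed
  show ?thesis
    using endo_inj_surj[OF finite_polys_below sub inj] inj by (simp add: bij_betw_def)
qed

lemma degree_prime_pos: "prime_elem P \<Longrightarrow> degree P > 0" for P :: "'q poly"
  by (metis is_unit_iff_degree not_prime_elem_zero prime_elem_not_unit gr0I)

lemma of_nat_card_polys_below_eq_0: "d > 0 \<Longrightarrow> of_nat (card (polys_below d :: 'q poly set)) = (0 :: 'c)"
  by (simp add: card_polys_below of_nat_card_eq_0 power_0_left)

text \<open>If P divides a, all summands coincide, and their number q^(deg P) is 0 in C_inf.\<close>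

lemma hecke_tau_sum:
  assumes "prime_elem P" and "z \<in> Omega j" and "a \<noteq> 0"
  shows "(\<Sum>\<beta>\<in>polys_below (degree P). tau (\<iota> a * ((z + \<iota> \<beta>) / \<iota> P))) = (if P dvd a then 0 else \<iota> P * tau (\<iota> a * z))"
proof -
  let ?B = "polys_below (degree P) :: 'q poly set"
  have P: "P \<noteq> 0"
    using assms by auto
  show ?thesis
  proof (cases "P dvd a")
    case True
    then obtain a' where a: "a = P * a'" by blast
    then have "a' \<noteq> 0"
      using assms by auto
    have "tau (\<iota> a * ((z + \<iota> \<beta>) / \<iota> P)) = tau (\<iota> a' * z)" for \<beta>
    proof -
      have eq: "\<iota> a * ((z + \<iota> \<beta>) / \<iota> P) = \<iota> a' * z + \<iota> (a' * \<beta>)"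
        using P by (simp add: a of_A_mult field_simps)
      have "\<iota> a' * z \<notin> range \<iota>"
        using assms \<open>a' \<noteq> 0\<close> by (intro Omega_notin_A) (simp add: Omega_mult_iff)
      then show ?thesis
        unfolding eq by (rule tau_add_of_A)
    qed
    then show ?thesis
      using True of_nat_card_polys_below_eq_0[OF degree_prime_pos[OF assms(1)]] by simp
  next
    case False
    have "tau (\<iota> a * ((z + \<iota> \<beta>) / \<iota> P)) = tau ((\<iota> a * z + \<iota> (a * \<beta> mod P)) / \<iota> P)" for \<beta>
    proof -
      have "(\<iota> a * z + \<iota> (a * \<beta> mod P)) / \<iota> P \<in> Omega j"
        using assms P by (simp add: Omega_divide_iff Omega_add_iff Omega_mult_iff)
      then have "tau ((\<iota> a * z + \<iota> (a * \<beta> mod P)) / \<iota> P + \<iota> (a * \<beta> div P)) = tau ((\<iota> a * z + \<iota> (a * \<beta> mod P)) / \<iota> P)"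
        by (intro tau_add_of_A Omega_notin_A)
      moreover have "\<iota> (a * \<beta>) = \<iota> P * \<iota> (a * \<beta> div P) + \<iota> (a * \<beta> mod P)"
        by (simp flip: of_A_mult of_A_add)
      then have "\<iota> a * ((z + \<iota> \<beta>) / \<iota> P) = (\<iota> a * z + \<iota> (a * \<beta> mod P)) / \<iota> P + \<iota> (a * \<beta> div P)"
        using P by (simp add: of_A_mult field_simps)
      ultimately show ?thesis by simp
    qed
    then have "(\<Sum>\<beta>\<in>?B. tau (\<iota> a * ((z + \<iota> \<beta>) / \<iota> P))) = (\<Sum>\<beta>\<in>?B. tau ((\<iota> a * z + \<iota> (a * \<beta> mod P)) / \<iota> P))"
      by simp
    also have "\<dots> = (\<Sum>r\<in>?B. tau ((\<iota> a * z + \<iota> r) / \<iota> P))"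
      using sum.reindex_bij_betw[OF bij_betw_mult_mod[OF assms(1) False], of "\<lambda>r. tau ((\<iota> a * z + \<iota> r) / \<iota> P)"] .
    also have "\<dots> = \<iota> P * tau (\<iota> a * z)"
      using P by (rule tau_distribution)
    finally show ?thesis
      using False by simp
  qed
qed

text \<open>The sum over \<beta> keeps just the terms with P not dividing a. The missing ones come
  from the first summand, as P^k a^(k-1) = P (P a)^(k-1). Raising the truncation by
  \<open>degree P\<close> makes the match exact.\<close>

lemma hecke_G_fin:
  assumes "prime_elem P" and "z \<in> Omega j" and "k \<ge> 2"
  shows "\<iota> P ^ k * G_fin k d (\<iota> P * z) +
    (\<Sum>\<beta>\<in>polys_below (degree P). G_fin k (d + degree P) ((z + \<iota> \<beta>) / \<iota> P)) = \<iota> P * G_fin k (d + degree P) z"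
proof -
  let ?B = "polys_below (degree P) :: 'q poly set" and ?D = "polys_below (d + degree P) :: 'q poly set"
  let ?g = "\<lambda>a. \<iota> P * (\<iota> a ^ (k - 1) * tau (\<iota> a * z))"
  have P: "P \<noteq> 0"
    using assms by auto
  have "(\<Sum>\<beta>\<in>?B. G_fin k (d + degree P) ((z + \<iota> \<beta>) / \<iota> P)) =
      (\<Sum>a\<in>?D. \<Sum>\<beta>\<in>?B. \<iota> a ^ (k - 1) * tau (\<iota> a * ((z + \<iota> \<beta>) / \<iota> P)))"
    unfolding G_fin_def by (rule sum.swap)
  also have "\<dots> = (\<Sum>a\<in>?D. if P dvd a then 0 else ?g a)"
  proof (intro sum.cong refl)
    fix a
    show "(\<Sum>\<beta>\<in>?B. \<iota> a ^ (k - 1) * tau (\<iota> a * ((z + \<iota> \<beta>) / \<iota> P))) = (if P dvd a then 0 else ?g a)"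
      using hecke_tau_sum[OF assms(1,2), of a] assms(3)
      by (cases "a = 0") (auto simp: mult_ac simp flip: sum_distrib_left)
  qed
  finally have 1: "(\<Sum>\<beta>\<in>?B. G_fin k (d + degree P) ((z + \<iota> \<beta>) / \<iota> P)) = (\<Sum>a\<in>?D. if P dvd a then 0 else ?g a)" .
  have "\<iota> P ^ k = \<iota> P * \<iota> P ^ (k - 1)"
    using assms(3) by (simp flip: power_Suc)
  then have "\<iota> P ^ k * G_fin k d (\<iota> P * z) = (\<Sum>a\<in>polys_below d. ?g (P * a))"
    unfolding G_fin_def by (simp add: sum_distrib_left of_A_mult power_mult_distrib mult_ac)
  also have "\<dots> = (\<Sum>a\<in>{a\<in>?D. P dvd a}. ?g a)"
  proof (rule sum.reindex_bij_witness[of _ "\<lambda>a. a div P" "\<lambda>a. P * a"])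
    fix a :: "'q poly" assume "a \<in> polys_below d"
    then show "P * a \<in> {a \<in> ?D. P dvd a}"
      using P by (cases "a = 0") (simp_all add: polys_below_iff degree_mult_eq)
  next
    fix a assume a: "a \<in> {a \<in> ?D. P dvd a}"
    then obtain a' where "a = P * a'" by blast
    with a P show "a div P \<in> polys_below d"
      by (cases "a' = 0") (simp_all add: polys_below_iff degree_mult_eq)
  qed (use P in auto)
  also have "\<dots> = (\<Sum>a\<in>?D. if P dvd a then ?g a else 0)"
    by (rule sum.inter_filter) simp
  finally have 2: "\<iota> P ^ k * G_fin k d (\<iota> P * z) = (\<Sum>a\<in>?D. if P dvd a then ?g a else 0)" .
  show ?thesis
    unfolding 1 2 sum.distrib[symmetric] by (simp add: G_fin_def sum_distrib_left if_distrib cong: if_cong)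
qed

lemma hecke_eq: "prime_elem P \<Longrightarrow> hecke j k P f z =
    \<iota> P ^ k * f (\<iota> P * z) + (\<Sum>\<beta>\<in>polys_below (degree P). f ((z + \<iota> \<beta>) / \<iota> P))"
  by (simp add: hecke_def polys_below_eq degree_prime_pos)

lemma hecke_outside_Omega:
  assumes "\<And>z. z \<notin> Omega j \<Longrightarrow> f z = 0" and "prime_elem P" and "z \<notin> Omega j"
  shows "hecke j k P f z = 0"
proof -
  have "P \<noteq> 0"
    using assms by auto
  with assms show ?thesis
    by (simp add: hecke_eq Omega_mult_iff Omega_divide_iff Omega_add_iff)
qed

lemma hecke_G:
  assumes "prime_elem P" and "k \<ge> 2"
  shows "hecke j k P (G k) = fscale (\<iota> P) (G k)"
proof
  fix z
  have P: "P \<noteq> 0"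
    using assms by auto
  show "hecke j k P (G k) z = fscale (\<iota> P) (G k) z"
  proof (cases "z \<in> Omega j")
    case True
    have "(\<lambda>d. \<iota> P ^ k * G_fin k d (\<iota> P * z) +
        (\<Sum>\<beta>\<in>polys_below (degree P). G_fin k (d + degree P) ((z + \<iota> \<beta>) / \<iota> P))) \<longlonglongrightarrow> hecke j k P (G k) z"
      unfolding hecke_eq[OF assms(1)] using True P assms
      by (intro tendsto_add tendsto_mult tendsto_const tendsto_sum G_fin_tendsto
           LIMSEQ_ignore_initial_segment[OF G_fin_tendsto])
         (simp_all add: Omega_mult_iff Omega_divide_iff Omega_add_iff)
    moreover have "(\<lambda>d. \<iota> P * G_fin k (d + degree P) z) \<longlonglongrightarrow> \<iota> P * G k z"
      using True assms
      by (intro tendsto_mult tendsto_const LIMSEQ_ignore_initial_segment[OF G_fin_tendsto]) simp_all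
    ultimately show ?thesis
      unfolding hecke_G_fin[OF assms(1) True assms(2)] fscale_def by (rule LIMSEQ_unique)
  next
    case False
    then show ?thesis
      using hecke_outside_Omega[of "G k" P z k] assms by (simp add: fscale_def G_def)
  qed
qed

end

lemma absv_coeff_power_le_const:
  fixes p :: "'c::nonarch_field poly"
  assumes "\<And>i. absv (coeff p i) \<le> R" and "R \<ge> 1"
  shows "absv (coeff (p ^ n) i) \<le> R ^ n"
proof (induction n arbitrary: i)
  case (Suc n)
  show ?case
    unfolding power_Suc coeff_mult
  proof (rule absv_sum_le)
    fix k
    show "absv (coeff p k * coeff (p ^ n) (i - k)) \<le> R * R ^ n"
      unfolding absv_mult using assms Suc by (intro mult_mono) auto
  qed (use assms(2) in simp)
qed (auto simp: coeff_1)

text \<open>Newton's identities. The generating series V of the power sums is -p'/p for p = 1 - t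
  \<rho>, and p' = -t \<pi> is constant; expanding \<pi> t / (1 - t \<rho>) geometrically gives the
  right side.\<close>

lemma power_sums_of_reciprocal_roots:
  fixes y :: "'i \<Rightarrow> 'c::field" and \<rho> :: "'c poly"
  assumes "finite I" and "coeff \<rho> 0 = 0" and "pderiv \<rho> = [:\<pi>:]"
    and eq: "1 - smult t \<rho> = (\<Prod>\<beta>\<in>I. [:1, - y \<beta>:])"
  shows "(\<Sum>\<beta>\<in>I. y \<beta> ^ Suc i) = (\<Sum>n\<le>i. \<pi> * coeff (\<rho> ^ n) i * t ^ Suc n)"
proof -
  define p where "p = 1 - smult t \<rho>"
  define Y where "Y \<beta> = Abs_fps (\<lambda>i. y \<beta> ^ Suc i)" for \<beta>
  define V where "V = (\<Sum>\<beta>\<in>I. Y \<beta>)"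
  define L where "L = fps_of_poly (smult t \<rho>)"
  have geom: "fps_of_poly [:1, - y \<beta>:] * Y \<beta> = fps_const (y \<beta>)" for \<beta>
  proof (rule fps_ext)
    fix n
    show "fps_nth (fps_of_poly [:1, - y \<beta>:] * Y \<beta>) n = fps_nth (fps_const (y \<beta>)) n"
      by (cases n) (simp_all add: fps_of_poly_pCons Y_def algebra_simps)
  qed
  have "fps_of_poly p * Y \<beta> = fps_of_poly (\<Prod>\<beta>'\<in>I - {\<beta>}. [:1, - y \<beta>':]) * fps_const (y \<beta>)" if "\<beta> \<in> I" for \<beta>
  proof -
    have "p = (\<Prod>\<beta>'\<in>I - {\<beta>}. [:1, - y \<beta>':]) * [:1, - y \<beta>:]"
      unfolding p_def eq by (subst prod.remove[OF assms(1) that]) (rule mult.commute)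
    then show ?thesis
      by (simp only: fps_of_poly_mult mult.assoc geom)
  qed
  then have "fps_of_poly p * V = (\<Sum>\<beta>\<in>I. fps_of_poly (\<Prod>\<beta>'\<in>I - {\<beta>}. [:1, - y \<beta>':]) * fps_const (y \<beta>))"
    unfolding V_def by (simp add: sum_distrib_left)
  also have "\<dots> = fps_of_poly (- pderiv p)"
    unfolding p_def eq pderiv_prod
    by (simp add: fps_of_poly_sum pderiv_pCons fps_of_poly_mult fps_of_poly_uminus fps_of_poly_smult
        mult.commute flip: sum_negf)
  also have "- pderiv p = [:t * \<pi>:]"
    by (simp add: p_def pderiv_diff pderiv_smult assms(3))
  finally have pV: "(1 - L) * V = fps_const (t * \<pi>)"
    by (simp add: p_def L_def fps_of_poly_diff)
  obtain \<rho>' where \<rho>': "\<rho> = pCons 0 \<rho>'"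
    using assms(2) by (cases \<rho>) auto
  have L: "L = fps_X * fps_of_poly (smult t \<rho>')"
    by (simp add: L_def \<rho>' fps_of_poly_pCons)
  \<comment> \<open>The geometric series is cut at i + 1: L is divisible by X, so the remainder has
    no coefficient of index i.\<close>
  have "V = (1 - L) * V * (\<Sum>n<Suc i. L ^ n) + V * L ^ Suc i"
  proof -
    have "(1 - L) * (\<Sum>n<Suc i. L ^ n) = 1 - L ^ Suc i"
      by (rule one_diff_power_eq[symmetric])
    then have "(1 - L) * V * (\<Sum>n<Suc i. L ^ n) = V * (1 - L ^ Suc i)"
      by (metis mult.commute mult.assoc)
    then show ?thesis
      by (simp add: right_diff_distrib)
  qed
  moreover have "fps_nth (V * L ^ Suc i) i = 0"
  proof -
    have "V * L ^ Suc i = fps_X ^ Suc i * (V * fps_of_poly (smult t \<rho>') ^ Suc i)"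
      by (simp only: L power_mult_distrib mult.left_commute)
    then show ?thesis
      by (simp only: fps_X_power_mult_nth) simp
  qed
  ultimately have "fps_nth V i = fps_nth (fps_const (t * \<pi>) * (\<Sum>n<Suc i. L ^ n)) i"
    unfolding pV by (metis add.right_neutral fps_add_nth)
  also have "\<dots> = (\<Sum>n\<le>i. \<pi> * coeff (\<rho> ^ n) i * t ^ Suc n)"
  proof -
    have "fps_nth (L ^ n) i = t ^ n * coeff (\<rho> ^ n) i" for n
      by (simp add: L_def smult_power flip: fps_of_poly_power)
    then show ?thesis
      by (simp add: fps_sum_nth sum_distrib_left lessThan_Suc_atMost mult_ac)
  qed
  finally show ?thesis
    by (simp add: V_def Y_def fps_sum_nth)
qed

section \<open>The first coefficient of \<open>G\<close>\<close>

context carlitz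
begin

lemma has_t_expansion_cong:
  assumes "has_t_expansion j w f a" and "\<And>z. z \<in> Omega j \<Longrightarrow> f z = g z"
  shows "has_t_expansion j w g a"
  using assms unfolding has_t_expansion_def by simp

lemma has_t_expansion_t: "has_t_expansion j w t (\<lambda>i. if i = 1 then 1 else 0)"
proof (rule has_t_expansionI[of 1])
  fix z
  have "(\<lambda>i. (if i = 1 then 1 else 0) * t z ^ i) sums (\<Sum>i\<in>{1}. (if i = 1 then 1 else 0) * t z ^ i)"
    by (rule sums_finite) auto
  then show "(\<lambda>i. (if i = 1 then 1 else 0) * t z ^ i) sums t z"
    by simp
qed simp

lemma CARD_ge_2: "CARD('q) \<ge> 2"
  using q_ge_2 card_eq_q by linarith

lemma less_CARD_power: "m < CARD('q) ^ m"
  using CARD_ge_2 by (intro less_exp[THEN less_le_trans] power_mono) auto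

text \<open>Row m collects the a of degree exactly m. The series of t(a z) starts at t^(q^m), and
  q^m > m, so only rows m \<le> n reach t^n; there |a|^(k-1) is at most q^(n (k-1)), which gives the
  geometric bound. Only constants contribute to t^1.\<close>

lemma G_has_t_expansion:
  assumes "k \<ge> 2"
  shows "\<exists>b. has_t_expansion j w (G k) b \<and> b 0 = 0 \<and> b 1 = w * (\<Sum>\<gamma>\<in>UNIV - {0}. \<iota> [:\<gamma>:] ^ (k - 1) / \<iota> [:\<gamma>:])"
proof -
  have "\<forall>a. \<exists>c. a \<noteq> 0 \<longrightarrow> (\<forall>i. absv (c i) \<le> q ^ i) \<and> (\<forall>i < CARD('q) ^ degree a. c i = 0) \<and>
      (\<forall>z\<in>Omega j. q * absv (t z) < 1 \<longrightarrow> (\<lambda>i. c i * t z ^ i) sums t (\<iota> a * z))"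
  proof
    fix a :: "'q poly"
    show "\<exists>c. a \<noteq> 0 \<longrightarrow> (\<forall>i. absv (c i) \<le> q ^ i) \<and> (\<forall>i < CARD('q) ^ degree a. c i = 0) \<and>
      (\<forall>z\<in>Omega j. q * absv (t z) < 1 \<longrightarrow> (\<lambda>i. c i * t z ^ i) sums t (\<iota> a * z))"
      using t_multiple_power_expansion[of a 1] unfolding mult_1_right power_one_right by blast
  qed
  then obtain c where c: "\<forall>a. a \<noteq> 0 \<longrightarrow> (\<forall>i. absv (c a i) \<le> q ^ i) \<and> (\<forall>i < CARD('q) ^ degree a. c a i = 0) \<and>
      (\<forall>z\<in>Omega j. q * absv (t z) < 1 \<longrightarrow> (\<lambda>i. c a i * t z ^ i) sums t (\<iota> a * z))"
    by (rule choice[THEN exE])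
  then have c_bound: "absv (c a i) \<le> q ^ i" and c_zero: "i < CARD('q) ^ degree a \<Longrightarrow> c a i = 0"
    and c_sums: "z \<in> Omega j \<Longrightarrow> q * absv (t z) < 1 \<Longrightarrow> (\<lambda>i. c a i * t z ^ i) sums t (\<iota> a * z)" if "a \<noteq> 0" for a i z
    using that by blast+
  let ?D = "\<lambda>m. polys_below (Suc m) - polys_below m :: 'q poly set"
  have D: "a \<noteq> 0 \<and> degree a = m" if "a \<in> ?D m" for a m
    using that by (auto simp: polys_below_iff)
  define A where "A m n = (\<Sum>a\<in>?D m. \<iota> a ^ (k - 1) * w * c a n)" for m n
  have A_zero: "A m n = 0" if "m > n" for m n
    unfolding A_def
  proof (intro sum.neutral ballI)
    fix a assume "a \<in> ?D m"
    note a = D[OF this]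
    have "n < CARD('q) ^ m"
      using that less_CARD_power[of m] by (rule less_trans)
    with a have "c a n = 0"
      by (intro c_zero) simp_all
    then show "\<iota> a ^ (k - 1) * w * c a n = 0"
      by simp
  qed
  have A_bound: "absv (A m n) \<le> absv w * (q ^ k) ^ n" for m n
  proof (cases "m > n")
    case False
    show ?thesis
      unfolding A_def
    proof (rule absv_sum_le)
      fix a assume a: "a \<in> ?D m"
      have "absv (\<iota> a) = q ^ m"
        using D[OF a] by (simp add: absv_of_A)
      also have "\<dots> \<le> q ^ n"
        using False by (intro q_power_mono) simp
      finally have "absv (\<iota> a) ^ (k - 1) \<le> (q ^ n) ^ (k - 1)"
        by (intro power_mono) auto
      moreover have "absv (c a n) \<le> q ^ n"
        using D[OF a] by (intro c_bound) auto
      ultimately have "absv w * (absv (\<iota> a) ^ (k - 1) * absv (c a n)) \<le> absv w * ((q ^ n) ^ (k - 1) * q ^ n)"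
        by (intro mult_left_mono mult_mono) auto
      also have "(q ^ n) ^ (k - 1) * q ^ n = (q ^ n) ^ Suc (k - 1)"
        by (simp add: mult.commute)
      also have "\<dots> = (q ^ k) ^ n"
        using assms by (simp add: mult.commute flip: power_mult del: power_Suc)
      finally show "absv (\<iota> a ^ (k - 1) * w * c a n) \<le> absv w * (q ^ k) ^ n"
        by (simp add: absv_mult absv_power mult_ac)
    qed simp
  qed (simp add: A_zero)
  define b where "b n = (\<Sum>m\<le>n. A m n)" for n
  obtain R where R: "R > 0" "\<And>z. far R z \<Longrightarrow> absv (t z) < 1 / q ^ k"
    by (rule absv_t_less[of "1 / q ^ k"]) (simp, rule that)
  have "has_t_expansion j w (G k) b"
  proof (rule has_t_expansionI[OF R(1)])
    fix z assume z: "far R z"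
    have \<Omega>: "z \<in> Omega j"
      using z R(1) by (rule far_imp_Omega)
    have small: "q ^ k * absv (t z) < 1"
      using R(2)[OF z] by (simp add: field_simps)
    have "q ^ 1 * absv (t z) \<le> q ^ k * absv (t z)"
      using assms by (intro mult_right_mono q_power_mono) auto
    then have small': "q * absv (t z) < 1"
      using small by simp
    define S where "S m = G_fin k (Suc m) z - G_fin k m z" for m
    have S: "S m = (\<Sum>a\<in>?D m. \<iota> a ^ (k - 1) * w * t (\<iota> a * z))" for m
    proof -
      have sub: "polys_below m \<subseteq> (polys_below (Suc m) :: 'q poly set)"
        by (rule polys_below_mono) simp
      have "S m = (\<Sum>a\<in>?D m. \<iota> a ^ (k - 1) * tau (\<iota> a * z))"
        unfolding S_def G_fin_def
        using sum.subset_diff[OF sub finite_polys_below, of "\<lambda>a. \<iota> a ^ (k - 1) * tau (\<iota> a * z)"] by simp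
      also have "\<dots> = (\<Sum>a\<in>?D m. \<iota> a ^ (k - 1) * w * t (\<iota> a * z))"
      proof (intro sum.cong refl)
        fix a assume a: "a \<in> ?D m"
        have "\<iota> a * z \<in> Omega j"
          using D[OF a] \<Omega> by (simp add: Omega_mult_iff)
        then show "\<iota> a ^ (k - 1) * tau (\<iota> a * z) = \<iota> a ^ (k - 1) * w * t (\<iota> a * z)"
          by (simp add: t_eq_tau)
      qed
      finally show ?thesis .
    qed
    have "(\<lambda>n. A m n * t z ^ n) sums S m" for m
    proof -
      have "(\<lambda>n. \<Sum>a\<in>?D m. \<iota> a ^ (k - 1) * w * (c a n * t z ^ n)) sums (\<Sum>a\<in>?D m. \<iota> a ^ (k - 1) * w * t (\<iota> a * z))"
        by (intro sums_sum sums_mult_nonarch c_sums \<Omega> small' conjunct1[OF D])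
      then show ?thesis
        unfolding S A_def by (simp add: sum_distrib_right mult.assoc)
    qed
    moreover have "S sums G k z"
    proof -
      have "(\<Sum>m<d. S m) = G_fin k d z - G_fin k 0 z" for d
        unfolding S_def by (rule sum_lessThan_telescope)
      moreover have "G_fin k 0 z = 0"
        using assms by (simp add: G_fin_def power_0_left)
      ultimately show ?thesis
        unfolding sums_def using G_fin_tendsto[OF \<Omega>, of k] assms by simp
    qed
    ultimately show "(\<lambda>n. b n * t z ^ n) sums G k z"
      unfolding b_def by (intro compose_sums[OF A_bound A_zero small]) auto
  qed
  moreover have "b 0 = 0"
  proof -
    have "c a 0 = 0" if "a \<in> ?D 0" for a
      using D[OF that] by (intro c_zero) auto
    then show ?thesis
      by (simp add: b_def A_def)
  qed
  moreover have "b 1 = w * (\<Sum>\<gamma>\<in>UNIV - {0}. \<iota> [:\<gamma>:] ^ (k - 1) / \<iota> [:\<gamma>:])"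
  proof -
    \<comment> \<open>The coefficients \<open>c\<close> come from an existence statement. Comparing
      with t(z) / \<gamma> and using uniqueness of the first coefficient identifies them.\<close>
    have c1: "c [:\<gamma>:] 1 = 1 / \<iota> [:\<gamma>:]" if "\<gamma> \<noteq> 0" for \<gamma>
    proof -
      have "has_t_expansion j w (\<lambda>z. t (\<iota> [:\<gamma>:] * z)) (c [:\<gamma>:])"
      proof (rule has_t_expansionI[OF R(1)])
        fix z assume z: "far R z"
        have "q ^ 1 * absv (t z) \<le> q ^ k * absv (t z)"
          using assms by (intro mult_right_mono q_power_mono) auto
        moreover have "q ^ k * absv (t z) < 1"
          using R(2)[OF z] by (simp add: field_simps)
        ultimately show "(\<lambda>i. c [:\<gamma>:] i * t z ^ i) sums t (\<iota> [:\<gamma>:] * z)"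
          using that z R(1) by (intro c_sums far_imp_Omega) auto
      qed
      from has_t_expansion_add[OF this has_t_expansion_cmult[OF has_t_expansion_t, of "- 1 / \<iota> [:\<gamma>:]"]]
      have exp: "has_t_expansion j w (\<lambda>_. 0) (\<lambda>i. c [:\<gamma>:] i + (- 1 / \<iota> [:\<gamma>:]) * (if i = 1 then 1 else 0))"
        by (rule has_t_expansion_cong) (simp add: t_eq e_w_def e_A_const_mult)
      have "c [:\<gamma>:] 0 = 0"
        by (rule c_zero) (use that in simp_all)
      then show ?thesis
        using t_expansion_first_coeff_0[OF exp] by simp
    qed
    have "A 1 1 = 0"
    proof -
      have "c a 1 = 0" if "a \<in> ?D 1" for a
        using D[OF that] CARD_ge_2 by (intro c_zero) auto
      then show ?thesis
        by (simp add: A_def)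
    qed
    then have "b 1 = A 0 1"
      by (simp add: b_def atMost_Suc)
    also have "\<dots> = (\<Sum>\<gamma>\<in>UNIV - {0}. \<iota> [:\<gamma>:] ^ (k - 1) * w * c [:\<gamma>:] 1)"
      unfolding A_def
    proof (rule sum.reindex_bij_witness[of _ "\<lambda>\<gamma>. [:\<gamma>:]" "\<lambda>a. coeff a 0"])
      fix a assume "a \<in> ?D 0"
      from D[OF this] have "a \<noteq> 0" "degree a = 0"
        by simp_all
      then obtain \<gamma> where a: "a = [:\<gamma>:]" "\<gamma> \<noteq> 0"
        by (metis degree_eq_zeroE pCons_0_0)
      then show "[:coeff a 0:] = a" "coeff a 0 \<in> UNIV - {0}"
        "\<iota> [:coeff a 0:] ^ (k - 1) * w * c [:coeff a 0:] 1 = \<iota> a ^ (k - 1) * w * c a 1"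
        by auto
    qed (auto simp: polys_below_iff)
    also have "\<dots> = w * (\<Sum>\<gamma>\<in>UNIV - {0}. \<iota> [:\<gamma>:] ^ (k - 1) / \<iota> [:\<gamma>:])"
      unfolding sum_distrib_left using c1 by (intro sum.cong refl) (simp add: mult_ac)
    finally show ?thesis .
  qed
  ultimately show ?thesis
    by blast
qed

text \<open>By the weight condition each of the q - 1 terms is 1, and q - 1 = -1 in C_inf.\<close>

lemma G_first_coeff:
  assumes "k \<ge> 3" and weight: "\<And>c :: 'q. c \<noteq> 0 \<Longrightarrow> c ^ k = c ^ 2"
  shows "\<exists>b. has_t_expansion j w (G k) b \<and> b 0 = 0 \<and> b 1 = - w"
proof -
  have "\<iota> [:\<gamma>:] ^ (k - 1) / \<iota> [:\<gamma>:] = 1" if "\<gamma> \<in> UNIV - {0}" for \<gamma>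
  proof -
    have "\<iota> [:\<gamma>:] ^ k = \<iota> [:\<gamma>:] ^ 2"
      using weight[of \<gamma>] that by (metis DiffD2 of_A_power poly_const_pow singletonI)
    moreover have "\<iota> [:\<gamma>:] ^ k = \<iota> [:\<gamma>:] * \<iota> [:\<gamma>:] ^ (k - 1)"
      using assms(1) by (simp flip: power_Suc)
    ultimately show ?thesis
      using that by (simp add: power2_eq_square)
  qed
  then have "(\<Sum>\<gamma>\<in>UNIV - {0}. \<iota> [:\<gamma>:] ^ (k - 1) / \<iota> [:\<gamma>:]) = of_nat (card (UNIV - {0 :: 'q}))"
    by simp
  also have "\<dots> = (of_nat CARD('q) - 1 :: 'c)"
    using CARD_ge_2 by (simp add: card_Diff_singleton of_nat_diff)
  also have "\<dots> = - 1"
    by (simp add: of_nat_card_eq_0)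
  finally show ?thesis
    using G_has_t_expansion[of k] assms(1) by auto
qed

lemma G_in_cusp_forms:
  assumes "k \<ge> 3" and "\<And>c :: 'q. c \<noteq> 0 \<Longrightarrow> c ^ k = c ^ 2"
  shows "G k \<in> cusp_forms j w k 1"
  using G_first_coeff[OF assms] rigid_analytic_G[of k] modular_transform_G[OF assms] assms(1)
  unfolding cusp_forms_def modular_forms_def by (auto simp: G_def)

section \<open>Hecke operators preserve double cuspidality\<close>

lemma poly_const_eq_0_mod:
  fixes P :: "'q poly"
  assumes "x \<in> polys_below (degree P)" and "y \<in> polys_below (degree P)" and "P dvd x - y"
  shows "x = y"
proof (rule ccontr)
  assume "x \<noteq> y"
  then have "degree P \<le> degree (x - y)"
    using assms(3) by (intro dvd_imp_degree_le) auto
  moreover have "x - y \<in> polys_below (degree P)"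
    using assms by (intro polys_below_diff)
  ultimately show False
    using \<open>x \<noteq> y\<close> by (auto simp: polys_below_iff)
qed

lemma hecke_translation:
  assumes P: "prime_elem P" and f: "modular_transform j k 1 f" and z: "z \<in> Omega j"
  shows "hecke j k P f (z + \<iota> u) = hecke j k P f z"
proof -
  let ?B = "polys_below (degree P) :: 'q poly set"
  have P0: "P \<noteq> 0"
    using P by auto
  have "f (\<iota> P * (z + \<iota> u)) = f (\<iota> P * z)"
    using modular_translation[OF f, of "\<iota> P * z" "P * u"] z P0
    by (simp add: distrib_left of_A_mult Omega_mult_iff)
  moreover have "(\<Sum>\<beta>\<in>?B. f ((z + \<iota> u + \<iota> \<beta>) / \<iota> P)) = (\<Sum>\<beta>\<in>?B. f ((z + \<iota> \<beta>) / \<iota> P))"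
  proof -
    have "f ((z + \<iota> u + \<iota> \<beta>) / \<iota> P) = f ((z + \<iota> ((u + \<beta>) mod P)) / \<iota> P)" for \<beta>
    proof -
      have "\<iota> u + \<iota> \<beta> = \<iota> P * \<iota> ((u + \<beta>) div P) + \<iota> ((u + \<beta>) mod P)"
        by (simp flip: of_A_mult of_A_add)
      then have "z + \<iota> u + \<iota> \<beta> = z + (\<iota> P * \<iota> ((u + \<beta>) div P) + \<iota> ((u + \<beta>) mod P))"
        by (simp only: add.assoc)
      then have eq: "(z + \<iota> u + \<iota> \<beta>) / \<iota> P = (z + \<iota> ((u + \<beta>) mod P)) / \<iota> P + \<iota> ((u + \<beta>) div P)"
        using P0 by (simp add: field_simps)
      show ?thesis
        unfolding eq using z P0
        by (intro modular_translation[OF f]) (simp add: Omega_divide_iff Omega_add_iff)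
    qed
    moreover have "bij_betw (\<lambda>\<beta>. (u + \<beta>) mod P) ?B ?B"
    proof -
      have sub: "(\<lambda>\<beta>. (u + \<beta>) mod P) ` ?B \<subseteq> ?B"
        using degree_mod_less[OF P0] by (auto simp: polys_below_iff)
      have inj: "inj_on (\<lambda>\<beta>. (u + \<beta>) mod P) ?B"
      proof (rule inj_onI)
        fix x y assume xy: "x \<in> ?B" "y \<in> ?B" "(u + x) mod P = (u + y) mod P"
        then have "P dvd x - y"
          by (simp add: mod_eq_dvd_iff)
        with xy show "x = y"
          by (intro poly_const_eq_0_mod)
      qed
      show ?thesis
        using endo_inj_surj[OF finite_polys_below sub inj] inj by (simp add: bij_betw_def)
    qed
    ultimately show ?thesis
      using sum.reindex_bij_betw[of "\<lambda>\<beta>. (u + \<beta>) mod P" ?B ?B "\<lambda>r. f ((z + \<iota> r) / \<iota> P)"] by simp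
  qed
  ultimately show ?thesis
    by (simp add: hecke_eq[OF P])
qed

lemma hecke_unit:
  assumes P: "prime_elem P" and f: "modular_transform j k 1 f" and z: "z \<in> Omega j" and c: "c \<noteq> 0"
  shows "hecke j k P f (\<iota> [:c:] * z) = hecke j k P f z / \<iota> [:c:]"
proof -
  let ?B = "polys_below (degree P) :: 'q poly set"
  have P0: "P \<noteq> 0"
    using P by auto
  have "f (\<iota> P * (\<iota> [:c:] * z)) = f (\<iota> P * z) / \<iota> [:c:]"
    using modular_unit[OF f, of "\<iota> P * z" c] z P0 c
    by (simp add: Omega_mult_iff mult.left_commute)
  moreover have "(\<Sum>\<beta>\<in>?B. f ((\<iota> [:c:] * z + \<iota> \<beta>) / \<iota> P)) = (\<Sum>\<beta>\<in>?B. f ((z + \<iota> \<beta>) / \<iota> P) / \<iota> [:c:])"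
  proof (rule sum.reindex_bij_witness[of _ "\<lambda>\<beta>. smult c \<beta>" "\<lambda>\<beta>. smult (1 / c) \<beta>"])
    fix \<beta> :: "'q poly" assume "\<beta> \<in> ?B"
    have "\<iota> [:c:] * \<iota> (smult (1 / c) \<beta>) = \<iota> \<beta>"
      using c by (simp flip: of_A_smult)
    then have eq: "(\<iota> [:c:] * z + \<iota> \<beta>) / \<iota> P = \<iota> [:c:] * ((z + \<iota> (smult (1 / c) \<beta>)) / \<iota> P)"
      by (simp add: distrib_left add_divide_distrib)
    show "f ((z + \<iota> (smult (1 / c) \<beta>)) / \<iota> P) / \<iota> [:c:] = f ((\<iota> [:c:] * z + \<iota> \<beta>) / \<iota> P)"
      unfolding eq using z P0 c
      by (intro modular_unit[OF f, symmetric]) (simp_all add: Omega_divide_iff Omega_add_iff)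
  qed (use c in \<open>auto simp: polys_below_def\<close>)
  ultimately show ?thesis
    by (simp add: hecke_eq[OF P] add_divide_distrib sum_divide_distrib)
qed

text \<open>Under \<open>z \<mapsto> 1/z\<close> the term with \<open>\<beta> \<noteq> 0\<close> goes to the term of the inverse of \<open>\<beta>\<close> modulo \<open>P\<close>, and the
  two remaining terms are interchanged.\<close>

lemma hecke_inversion:
  assumes P: "prime_elem P" and f: "modular_transform j k 1 f" and z: "z \<in> Omega j"
  shows "hecke j k P f (1 / z) = - (z ^ k * hecke j k P f z)"
proof -
  let ?B = "polys_below (degree P) - {0} :: 'q poly set"
  have P0: "P \<noteq> 0"
    using P by auto
  have z0: "z \<noteq> 0"
    using z by (rule Omega_nonzero)
  have ndvd: "\<not> P dvd \<beta>" if "\<beta> \<in> ?B" for \<beta>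
    using that dvd_imp_degree_le[of P \<beta>] by (auto simp: polys_below_iff)
  have mod1: "1 mod P = 1"
    using degree_prime_pos[OF P] by (intro mod_poly_less) simp
  have "\<exists>v\<in>?B. \<beta> * v mod P = 1" if "\<beta> \<in> ?B" for \<beta>
  proof -
    have "1 \<in> polys_below (degree P)"
      using degree_prime_pos[OF P] by (simp add: polys_below_iff)
    then have "1 \<in> (\<lambda>v. \<beta> * v mod P) ` polys_below (degree P)"
      using bij_betw_mult_mod[OF P ndvd[OF that]] by (simp add: bij_betw_def)
    then obtain v where v: "v \<in> polys_below (degree P)" "1 = \<beta> * v mod P"
      by (rule imageE)
    moreover have "v \<noteq> 0"
      using v(2) by auto
    ultimately show ?thesis
      by (intro bexI[of _ v]) auto
  qed
  then have "\<forall>\<beta>\<in>?B. \<exists>v. v \<in> ?B \<and> \<beta> * v mod P = 1"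
    by blast
  from bchoice[OF this] obtain v where v': "\<forall>\<beta>\<in>?B. v \<beta> \<in> ?B \<and> \<beta> * v \<beta> mod P = 1" ..
  then have v: "v \<beta> \<in> ?B \<and> \<beta> * v \<beta> mod P = 1" if "\<beta> \<in> ?B" for \<beta>
    using that by (rule bspec)
  have bij: "bij_betw v ?B ?B"
  proof -
    have sub: "v ` ?B \<subseteq> ?B"
      by (rule image_subsetI) (rule conjunct1[OF v])
    have inj: "inj_on v ?B"
    proof (rule inj_onI)
      fix x y assume x: "x \<in> ?B" and y: "y \<in> ?B" and eq: "v x = v y"
      have "x * v x mod P = y * v x mod P"
        using v[OF x] v[OF y] eq by simp
      then have "P dvd (x - y) * v x"
        by (simp add: mod_eq_dvd_iff left_diff_distrib)
      then have "P dvd x - y"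
        using prime_elem_dvd_mult_iff[OF P] ndvd v[OF x] by blast
      with x y show "x = y"
        by (intro poly_const_eq_0_mod[of x P y]) auto
    qed
    show ?thesis
      using endo_inj_surj[OF _ sub inj] inj by (simp add: bij_betw_def)
  qed
  have inv_term: "f ((1 / z + \<iota> \<beta>) / \<iota> P) = - (z ^ k * f ((z + \<iota> (v \<beta>)) / \<iota> P))" if \<beta>: "\<beta> \<in> ?B" for \<beta>
  proof -
    define y where "y = (z + \<iota> (v \<beta>)) / \<iota> P"
    have "P dvd 1 - \<beta> * v \<beta>"
      using v[OF \<beta>] mod1 by (simp flip: mod_eq_dvd_iff)
    then obtain e where e: "1 - \<beta> * v \<beta> = P * e"
      by blast
    \<comment> \<open>The matrix with rows (\<beta>, e) and (P, - v \<beta>) maps y = (z + v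
      \<beta>) / P to (1 / z + \<beta>) / P, and its denominator P y - v \<beta> is z.\<close>
    have det: "\<beta> * (- v \<beta>) - e * P = - 1"
      using e by (simp add: algebra_simps)
    have y: "y \<in> Omega j"
      using z P0 by (simp add: y_def Omega_divide_iff Omega_add_iff)
    have 0: "f ((\<iota> \<beta> * y + \<iota> e) / (\<iota> P * y + \<iota> (- v \<beta>))) =
        \<iota> (\<beta> * (- v \<beta>) - e * P) powi (- 1) * (\<iota> P * y + \<iota> (- v \<beta>)) ^ k * f y"
      by (rule f[unfolded modular_transform_def, rule_format, OF _ y]) (simp only: det, simp)
    have 1: "\<iota> P * y + \<iota> (- v \<beta>) = z"
      using P0 by (simp add: y_def of_A_minus)
    have 2: "(\<iota> \<beta> * y + \<iota> e) / z = (1 / z + \<iota> \<beta>) / \<iota> P"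
    proof -
      have "\<iota> P * \<iota> e = 1 - \<iota> \<beta> * \<iota> (v \<beta>)"
        using arg_cong[OF e, of \<iota>] by (simp add: of_A_diff of_A_mult)
      then have "\<iota> P * (\<iota> \<beta> * y + \<iota> e) = \<iota> \<beta> * z + 1"
        using P0 by (simp add: y_def field_simps)
      then show ?thesis
        using P0 z0 by (simp add: field_simps)
    qed
    show ?thesis
      using 0 unfolding det 1 2 by (simp add: of_A_minus power_int_minus y_def)
  qed
  have sum: "(\<Sum>\<beta>\<in>?B. f ((1 / z + \<iota> \<beta>) / \<iota> P)) = - (z ^ k * (\<Sum>\<beta>\<in>?B. f ((z + \<iota> \<beta>) / \<iota> P)))"
    using sum.reindex_bij_betw[OF bij, of "\<lambda>\<beta>. f ((z + \<iota> \<beta>) / \<iota> P)"]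
    by (simp add: inv_term sum_negf flip: sum_distrib_left)
  have split: "hecke j k P f x = \<iota> P ^ k * f (\<iota> P * x) + (f (x / \<iota> P) + (\<Sum>\<beta>\<in>?B. f ((x + \<iota> \<beta>) / \<iota> P)))" for x
    unfolding hecke_eq[OF P] by (subst sum.remove[of _ 0]) auto
  have "f (\<iota> P * (1 / z)) = - ((z / \<iota> P) ^ k * f (z / \<iota> P))"
    using modular_inversion[OF f, of "z / \<iota> P"] z P0 by (simp add: Omega_divide_iff)
  then have 1: "\<iota> P ^ k * f (\<iota> P * (1 / z)) = - (z ^ k * f (z / \<iota> P))"
    using P0 by (simp add: power_divide)
  have 2: "f (1 / z / \<iota> P) = - (z ^ k * (\<iota> P ^ k * f (\<iota> P * z)))"
  proof -
    have "\<iota> P * z \<in> Omega j"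
      using z P0 by (simp add: Omega_mult_iff)
    from modular_inversion[OF f this] show ?thesis
      by (simp add: power_mult_distrib mult_ac)
  qed
  show ?thesis
    unfolding split 1 2 sum by (simp add: algebra_simps)
qed

lemma modular_transform_hecke:
  assumes "prime_elem P" and "modular_transform j k 1 f" and "\<And>c :: 'q. c \<noteq> 0 \<Longrightarrow> c ^ k = c ^ 2"
  shows "modular_transform j k 1 (hecke j k P f)"
  by (rule modular_transformI[OF assms(3) hecke_translation[OF assms(1,2)] hecke_unit[OF assms(1,2)]
        hecke_inversion[OF assms(1,2)]])

section \<open>Analyticity and t-expansions of Hecke images\<close>

lemma rigid_analytic_hecke:
  assumes "prime_elem P" and "rigid_analytic j f"
  shows "rigid_analytic j (hecke j k P f)"
proof -
  have P: "P \<noteq> 0"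
    using assms by auto
  have 1: "rigid_analytic j (\<lambda>z. f (\<iota> P * z))"
    using rigid_analytic_affine[OF assms(2) affine_Omega_aff[of "\<iota> P" 0]] P by simp
  have "rigid_analytic j (\<lambda>z. f (1 / \<iota> P * z + \<iota> \<beta> / \<iota> P))" for \<beta>
    using P by (intro rigid_analytic_affine[OF assms(2) affine_Omega_aff] K_divide) auto
  then have 2: "rigid_analytic j (\<lambda>z. f ((z + \<iota> \<beta>) / \<iota> P))" for \<beta>
    by (simp add: add_divide_distrib)
  have "rigid_analytic j (\<lambda>z. \<iota> P ^ k * f (\<iota> P * z) + (\<Sum>\<beta>\<in>polys_below (degree P). f ((z + \<iota> \<beta>) / \<iota> P)))"
    by (intro rigid_analytic_add rigid_analytic_cmult rigid_analytic_sum 1 2)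
  then show ?thesis
    by (simp add: hecke_eq[OF assms(1), abs_def])
qed

text \<open>The series of t(P z)^m starts at order q^(deg P) m \<ge> m, so the new coefficient of
  t^n involves only a 0, ..., a n, and the vanishing of the first two persists.\<close>

lemma t_expansion_multiple:
  assumes "has_t_expansion j w f a" and "a 0 = 0" and "a 1 = 0" and "P \<noteq> 0"
  shows "\<exists>b. has_t_expansion j w (\<lambda>z. f (\<iota> P * z)) b \<and> b 0 = 0 \<and> b 1 = 0"
proof -
  obtain R where R: "R > 0" "\<And>z. far R z \<Longrightarrow> (\<lambda>i. a i * t z ^ i) sums f z"
    by (rule has_t_expansionE[OF assms(1)]) (rule that)
  obtain B L where BL: "B > 0" "L \<ge> 1" "\<And>i. absv (a i) \<le> B * L ^ i"
    by (rule t_expansion_coeff_bound[OF assms(1)]) (rule that)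
  have "\<forall>m. \<exists>c. (\<forall>i. absv (c i) \<le> q ^ i) \<and> (\<forall>i < CARD('q) ^ degree P * m. c i = 0) \<and>
      (\<forall>z\<in>Omega j. q * absv (t z) < 1 \<longrightarrow> (\<lambda>i. c i * t z ^ i) sums t (\<iota> P * z) ^ m)"
    using t_multiple_power_expansion[OF assms(4)] by blast
  then obtain c where "\<forall>m. (\<forall>i. absv (c m i) \<le> q ^ i) \<and> (\<forall>i < CARD('q) ^ degree P * m. c m i = 0) \<and>
      (\<forall>z\<in>Omega j. q * absv (t z) < 1 \<longrightarrow> (\<lambda>i. c m i * t z ^ i) sums t (\<iota> P * z) ^ m)"
    by (rule choice[THEN exE])
  then have c: "absv (c m i) \<le> q ^ i" "i < CARD('q) ^ degree P * m \<Longrightarrow> c m i = 0"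
    "z \<in> Omega j \<Longrightarrow> q * absv (t z) < 1 \<Longrightarrow> (\<lambda>i. c m i * t z ^ i) sums t (\<iota> P * z) ^ m" for m i z
    by blast+
  define A where "A m n = a m * c m n" for m n
  have A_zero: "A m n = 0" if "m > n" for m n
  proof -
    have "1 * m \<le> CARD('q) ^ degree P * m"
      by (intro mult_right_mono) (simp_all add: Suc_le_eq)
    with that have "n < CARD('q) ^ degree P * m"
      by linarith
    then show ?thesis
      by (simp add: A_def c(2))
  qed
  have A_bound: "absv (A m n) \<le> B * (L * q) ^ n" for m n
  proof (cases "m > n")
    case True
    then show ?thesis using BL by (simp add: A_zero)
  next
    case False
    have "absv (a m) \<le> B * L ^ m"
      by (rule BL)
    also have "\<dots> \<le> B * L ^ n"
      using BL False by (intro mult_left_mono power_increasing) auto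
    finally have "absv (a m) * absv (c m n) \<le> (B * L ^ n) * q ^ n"
      using c(1) BL by (intro mult_mono) auto
    then show ?thesis
      by (simp add: A_def absv_mult power_mult_distrib mult.assoc)
  qed
  define b where "b n = (\<Sum>m\<le>n. A m n)" for n
  have Lq: "L * q > 0" "L * q \<ge> q"
    using BL(2) by simp_all
  obtain R' where R': "R' > 0" "\<And>z. far R' z \<Longrightarrow> absv (t z) < 1 / (L * q)"
    by (rule absv_t_less[of "1 / (L * q)"]) (use Lq in simp, rule that)
  have "has_t_expansion j w (\<lambda>z. f (\<iota> P * z)) b"
  proof (rule has_t_expansionI[of "max R R'"])
    fix z assume z: "far (max R R') z"
    have \<Omega>: "z \<in> Omega j"
      by (rule far_imp_Omega[OF z]) (use R in simp)
    have small: "L * q * absv (t z) < 1"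
      using R'(2)[OF far_mono[OF z]] Lq(1) by (simp add: field_simps)
    have "q * absv (t z) \<le> L * q * absv (t z)"
      using Lq by (intro mult_right_mono) auto
    then have small': "q * absv (t z) < 1"
      using small by linarith
    have "far (absv (\<iota> P) * max R R') (\<iota> P * z)"
      using assms by (intro far_mult z) auto
    moreover have "1 * R \<le> absv (\<iota> P) * max R R'"
      using R absv_of_A_ge_1[OF assms(4)] by (intro mult_mono) auto
    ultimately have "far R (\<iota> P * z)"
      by (auto elim: far_mono)
    then have "(\<lambda>m. a m * t (\<iota> P * z) ^ m) sums f (\<iota> P * z)"
      by (rule R(2))
    moreover have "(\<lambda>n. A m n * t z ^ n) sums (a m * t (\<iota> P * z) ^ m)" for m
      unfolding A_def mult.assoc by (intro sums_mult_nonarch c(3) \<Omega> small')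
    ultimately show "(\<lambda>n. b n * t z ^ n) sums f (\<iota> P * z)"
      unfolding b_def using Lq by (intro compose_sums[OF A_bound A_zero small]) auto
  qed (use R in simp)
  moreover have "b 0 = 0" "b 1 = 0"
    using assms(2,3) by (simp_all add: b_def A_def atMost_Suc)
  ultimately show ?thesis
    by blast
qed

text \<open>The values e_w((z + \<beta>) / P) are the roots of \<rho>(X) = e_w(z), that is, of 1 -
  t(z) \<rho>. Up to scaling of t the resulting polynomials are the Goss polynomials of the zeros of
  \<rho>.\<close>

lemma t_power_sum:
  assumes "prime_elem P"
  obtains \<rho> where "degree \<rho> = CARD('q) ^ degree P" and "\<And>i. absv (coeff \<rho> i) \<le> q ^ (CARD('q) ^ degree P)"
    and "\<And>z i. z \<in> Omega j \<Longrightarrow> (\<Sum>\<beta>\<in>polys_below (degree P). t ((z + \<iota> \<beta>) / \<iota> P) ^ Suc i) =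
      (\<Sum>n\<le>i. \<iota> P * coeff (\<rho> ^ n) i * t z ^ Suc n)"
proof -
  let ?B = "polys_below (degree P) :: 'q poly set"
  define D where "D = CARD('q) ^ degree P"
  have P: "P \<noteq> 0"
    using assms by auto
  obtain \<rho> where \<rho>: "\<And>x. e_w (\<iota> P * x) = poly \<rho> (e_w x)" "degree \<rho> = D"
      "absv (lead_coeff \<rho>) = 1" "coeff \<rho> 0 = 0" "pderiv \<rho> = [:\<iota> P:]" "\<And>i. absv (coeff \<rho> i) \<le> q ^ (D - i)"
    using carlitz_poly_exists[OF P] unfolding D_def by blast
  have bound: "absv (coeff \<rho> i) \<le> q ^ D" for i
  proof -
    have "q ^ (D - i) \<le> q ^ D"
      by (intro q_power_mono) simp
    with \<rho>(6)[of i] show ?thesis by linarith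
  qed
  have "(\<Sum>\<beta>\<in>?B. t ((z + \<iota> \<beta>) / \<iota> P) ^ Suc i) = (\<Sum>n\<le>i. \<iota> P * coeff (\<rho> ^ n) i * t z ^ Suc n)"
    if z: "z \<in> Omega j" for z i
  proof (rule power_sums_of_reciprocal_roots[OF finite_polys_below \<rho>(4,5)])
    define x where "x \<beta> = e_w ((z + \<iota> \<beta>) / \<iota> P)" for \<beta>
    have \<Omega>: "(z + \<iota> \<beta>) / \<iota> P \<in> Omega j" for \<beta>
      using z P by (simp add: Omega_divide_iff Omega_add_iff)
    have x0: "x \<beta> \<noteq> 0" for \<beta>
      unfolding x_def by (rule e_w_nonzero[OF \<Omega>])
    have t: "t ((z + \<iota> \<beta>) / \<iota> P) = 1 / x \<beta>" for \<beta>
      by (simp add: x_def t_eq)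
    have root: "poly \<rho> (x \<beta>) = e_w z" for \<beta>
    proof -
      have "poly \<rho> (x \<beta>) = e_w (\<iota> P * ((z + \<iota> \<beta>) / \<iota> P))"
        by (simp only: x_def \<rho>(1))
      also have "\<dots> = e_w (z + \<iota> \<beta>)"
        using P by simp
      also have "\<dots> = e_w z"
        by (simp add: e_w_add) (simp add: e_w_def)
      finally show ?thesis .
    qed
    have inj: "inj_on x ?B"
    proof (rule inj_onI)
      fix \<beta> \<gamma> assume \<beta>: "\<beta> \<in> ?B" and \<gamma>: "\<gamma> \<in> ?B" and eq: "x \<beta> = x \<gamma>"
      have "(z + \<iota> \<beta>) / \<iota> P = (z + \<iota> \<gamma>) / \<iota> P + \<iota> (\<beta> - \<gamma>) / \<iota> P"
        by (simp add: of_A_diff add_divide_distrib diff_divide_distrib)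
      then have "x \<beta> = x \<gamma> + e_w (\<iota> (\<beta> - \<gamma>) / \<iota> P)"
        by (simp add: x_def e_w_add)
      then have "e_A (\<iota> (\<beta> - \<gamma>) / \<iota> P) = 0"
        using eq by (simp add: e_w_def)
      then obtain a where "\<iota> (\<beta> - \<gamma>) / \<iota> P = \<iota> a"
        by (auto simp: e_A_eq_0_iff)
      then have "\<iota> (\<beta> - \<gamma>) = \<iota> (P * a)"
        using P by (simp add: of_A_mult field_simps)
      then have "P dvd \<beta> - \<gamma>"
        by (simp only: of_A_eq_iff) simp
      with \<beta> \<gamma> show "\<beta> = \<gamma>"
        by (rule poly_const_eq_0_mod)
    qed
    define p r where "p = 1 - smult (t z) \<rho>" and "r = (\<Prod>\<beta>\<in>?B. [:1, - t ((z + \<iota> \<beta>) / \<iota> P):])"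
    have cardB: "card ?B = D"
      by (simp add: card_polys_below D_def)
    \<comment> \<open>Both polynomials have degree at most D and agree at D + 1 points: the roots
      \<open>x \<beta>\<close> and 0, where both are 1.\<close>
    have "p - r = 0"
    proof (rule ccontr)
      assume ne: "p - r \<noteq> 0"
      have "poly p (x \<beta>) = 0" for \<beta>
        using e_w_nonzero[OF z] by (simp add: p_def root t_eq)
      moreover have "poly r (x \<beta>) = 0" if "\<beta> \<in> ?B" for \<beta>
      proof -
        have "poly r (x \<beta>) = (\<Prod>\<beta>'\<in>?B. 1 - x \<beta> * t ((z + \<iota> \<beta>') / \<iota> P))"
          by (simp add: r_def poly_prod)
        also have "\<dots> = 0"
          using that x0 by (intro prod_zero) (auto simp: t intro!: bexI[of _ \<beta>])
        finally show ?thesis .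
      qed
      moreover have "poly \<rho> 0 = 0"
        using \<rho>(4) by (simp only: poly_0_coeff_0)
      then have "poly (p - r) 0 = 0"
        by (simp add: p_def r_def poly_prod)
      ultimately have sub: "insert 0 (x ` ?B) \<subseteq> {y. poly (p - r) y = 0}"
        by auto
      have "card (insert 0 (x ` ?B)) = Suc D"
        using x0 inj cardB by (subst card_insert_disjoint) (auto simp: card_image)
      moreover have "card (insert 0 (x ` ?B)) \<le> degree (p - r)"
        using sub ne by (intro order_trans[OF card_mono card_poly_roots_bound] poly_roots_finite) auto
      moreover have "degree (p - r) \<le> D"
      proof (rule degree_diff_le)
        show "degree p \<le> D"
          unfolding p_def using \<rho>(2) degree_smult_le[of "t z" \<rho>] by (intro degree_diff_le) auto
        have "degree r \<le> (\<Sum>\<beta>\<in>?B. degree [:1, - t ((z + \<iota> \<beta>) / \<iota> P):])"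
          unfolding r_def using degree_prod_sum_le[OF finite_polys_below, of "\<lambda>\<beta>. [:1, - t ((z + \<iota> \<beta>) / \<iota> P):]"]
          by (simp only: o_def)
        also have "\<dots> \<le> (\<Sum>\<beta>\<in>?B. 1)"
          by (intro sum_mono) simp
        finally show "degree r \<le> D"
          using cardB by simp
      qed
      ultimately show False
        by linarith
    qed
    then show "1 - smult (t z) \<rho> = (\<Prod>\<beta>\<in>?B. [:1, - t ((z + \<iota> \<beta>) / \<iota> P):])"
      by (simp add: p_def r_def)
  qed
  then show ?thesis
    using that[of \<rho>] \<rho>(2) bound unfolding D_def by blast
qed

text \<open>Summed over \<beta>, the term a m t^m becomes a polynomial in t(z) by
  \<open>t_power_sum\<close>. Collecting powers of t(z) is possible because t^n arises only from
  boundedly many m.\<close>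

lemma t_expansion_division:
  assumes "has_t_expansion j w f a" and "a 0 = 0" and "a 1 = 0" and "prime_elem P"
  shows "\<exists>b. has_t_expansion j w (\<lambda>z. \<Sum>\<beta>\<in>polys_below (degree P). f ((z + \<iota> \<beta>) / \<iota> P)) b \<and> b 0 = 0 \<and> b 1 = 0"
proof -
  let ?B = "polys_below (degree P) :: 'q poly set"
  define D where "D = CARD('q) ^ degree P"
  have P: "P \<noteq> 0"
    using assms by auto
  obtain R where R: "R > 0" "\<And>z. far R z \<Longrightarrow> (\<lambda>i. a i * t z ^ i) sums f z"
    by (rule has_t_expansionE[OF assms(1)]) (rule that)
  obtain B L where BL: "B > 0" "L \<ge> 1" "\<And>i. absv (a i) \<le> B * L ^ i"
    by (rule t_expansion_coeff_bound[OF assms(1)]) (rule that)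
  obtain \<rho> where \<rho>: "degree \<rho> = D" "\<And>i. absv (coeff \<rho> i) \<le> q ^ D"
    "\<And>z i. z \<in> Omega j \<Longrightarrow> (\<Sum>\<beta>\<in>?B. t ((z + \<iota> \<beta>) / \<iota> P) ^ Suc i) =
      (\<Sum>n\<le>i. \<iota> P * coeff (\<rho> ^ n) i * t z ^ Suc n)"
    by (rule t_power_sum[OF assms(4)]) (rule that, unfold D_def)
  define A where "A m n = (if 1 \<le> n \<and> n \<le> m then a m * (\<iota> P * coeff (\<rho> ^ (n - 1)) (m - 1)) else 0)" for m n
  \<comment> \<open>The coefficient of \<rho>^(n-1) at m - 1 vanishes for m - 1 > (n - 1) D; this
    bound on m is a generous version.\<close>
  define h where "h n = Suc (n * D)" for n
  have A_zero: "A m n = 0" if "m > h n" for m n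
  proof (cases "1 \<le> n \<and> n \<le> m")
    case True
    have "degree (\<rho> ^ (n - 1)) \<le> degree \<rho> * (n - 1)"
      by (rule degree_power_le)
    also have "\<dots> \<le> n * D"
      by (simp add: \<rho>(1) mult.commute)
    also have "\<dots> < m - 1"
      using that by (simp add: h_def)
    finally have "coeff (\<rho> ^ (n - 1)) (m - 1) = 0"
      by (rule coeff_eq_0)
    then show ?thesis
      by (simp add: A_def)
  qed (auto simp: A_def)
  define M where "M = L ^ D * q ^ D"
  have M: "M \<ge> 1"
    unfolding M_def using BL(2) mult_mono[of 1 "L ^ D" 1 "q ^ D"] by (simp add: one_le_power)
  have A_bound: "absv (A m n) \<le> (B * L * absv (\<iota> P)) * M ^ n" for m n
  proof (cases "1 \<le> n \<and> n \<le> m \<and> m \<le> h n")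
    case True
    have "absv (a m) \<le> B * L ^ m"
      by (rule BL)
    also have "\<dots> \<le> B * L ^ h n"
      using BL True by (intro mult_left_mono power_increasing) auto
    also have "\<dots> = B * L * (L ^ D) ^ n"
      by (simp add: h_def mult.commute flip: power_mult)
    finally have 1: "absv (a m) \<le> B * L * (L ^ D) ^ n" .
    have "absv (coeff (\<rho> ^ (n - 1)) (m - 1)) \<le> (q ^ D) ^ (n - 1)"
      by (rule absv_coeff_power_le_const[OF \<rho>(2)]) (simp add: one_le_power)
    also have "\<dots> \<le> (q ^ D) ^ n"
      by (intro power_increasing) (auto simp: one_le_power)
    finally have 2: "absv (coeff (\<rho> ^ (n - 1)) (m - 1)) \<le> (q ^ D) ^ n" .
    have "absv (a m) * (absv (\<iota> P) * absv (coeff (\<rho> ^ (n - 1)) (m - 1))) \<le>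
        (B * L * (L ^ D) ^ n) * (absv (\<iota> P) * (q ^ D) ^ n)"
      using 1 2 BL by (intro mult_mono mult_left_mono) auto
    then show ?thesis
      using True by (simp add: A_def M_def absv_mult power_mult_distrib mult_ac)
  next
    case False
    then have "A m n = 0"
      using A_zero[of n m] by (auto simp: A_def)
    then show ?thesis
      using BL M by simp
  qed
  define b where "b n = (\<Sum>m\<le>h n. A m n)" for n
  obtain R' where R': "R' > 0" "\<And>z. far R' z \<Longrightarrow> absv (t z) < 1 / M"
    by (rule absv_t_less[of "1 / M"]) (use M in simp, rule that)
  define R'' where "R'' = max (R * absv (\<iota> P)) R'"
  have "has_t_expansion j w (\<lambda>z. \<Sum>\<beta>\<in>?B. f ((z + \<iota> \<beta>) / \<iota> P)) b"
  proof (rule has_t_expansionI[of R''])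
    show "R'' > 0"
      using R' by (simp add: R''_def)
    fix z assume z: "far R'' z"
    have \<Omega>: "z \<in> Omega j"
      by (rule far_imp_Omega[OF z]) fact
    have small: "M * absv (t z) < 1"
      using R'(2)[OF far_mono[OF z]] M by (simp add: field_simps R''_def)
    have far': "far R ((z + \<iota> \<beta>) / \<iota> P)" for \<beta>
    proof -
      have "far (absv (1 / \<iota> P) * R'') (1 / \<iota> P * (z + \<iota> \<beta>))"
        using P by (intro far_mult far_add z K_divide) auto
      moreover have "R \<le> absv (1 / \<iota> P) * R''"
      proof -
        have "absv (1 / \<iota> P) * (R * absv (\<iota> P)) \<le> absv (1 / \<iota> P) * R''"
          by (intro mult_left_mono) (auto simp: R''_def)
        then show ?thesis
          using P by (simp add: absv_divide)
      qed
      ultimately show ?thesis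
        by (auto elim: far_mono)
    qed
    define S where "S m = (\<Sum>\<beta>\<in>?B. a m * t ((z + \<iota> \<beta>) / \<iota> P) ^ m)" for m
    have "S sums (\<Sum>\<beta>\<in>?B. f ((z + \<iota> \<beta>) / \<iota> P))"
      unfolding S_def by (intro sums_sum R(2) far')
    moreover have "(\<lambda>n. A m n * t z ^ n) sums S m" for m
    proof (cases m)
      case 0
      have "A 0 n = 0" for n
        by (auto simp: A_def)
      with 0 show ?thesis
        using assms(2) by (simp add: S_def)
    next
      case (Suc i)
      have "(\<lambda>n. A m n * t z ^ n) sums (\<Sum>n\<in>{1..m}. A m n * t z ^ n)"
        by (rule sums_finite) (auto simp: A_def)
      also have "(\<Sum>n\<in>{1..m}. A m n * t z ^ n) = (\<Sum>n\<le>i. a m * (\<iota> P * coeff (\<rho> ^ n) i * t z ^ Suc n))"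
        by (rule sum.reindex_bij_witness[of _ Suc "\<lambda>n. n - 1"]) (auto simp: A_def Suc)
      also have "\<dots> = a m * (\<Sum>\<beta>\<in>?B. t ((z + \<iota> \<beta>) / \<iota> P) ^ Suc i)"
        by (simp only: \<rho>(3)[OF \<Omega>] sum_distrib_left)
      also have "\<dots> = S m"
        by (simp only: S_def Suc sum_distrib_left)
      finally show ?thesis .
    qed
    ultimately show "(\<lambda>n. b n * t z ^ n) sums (\<Sum>\<beta>\<in>?B. f ((z + \<iota> \<beta>) / \<iota> P))"
      unfolding b_def using M by (intro compose_sums[OF A_bound A_zero small]) auto
  qed
  moreover have "b 0 = 0"
    by (simp add: b_def A_def)
  \<comment> \<open>For n = 1 the power \<rho>^0 = 1 has only a constant coefficient, so only m = 1
    contributes, with the factor a 1 = 0.\<close>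
  moreover have "A m 1 = 0" for m
    using assms(2,3) by (cases "m = 1") (auto simp: A_def coeff_1)
  then have "b 1 = 0"
    by (simp add: b_def)
  ultimately show ?thesis
    by blast
qed

text \<open>\<open>quotient_map\<close> forms the image of a coset G + U, which is contained in one
  coset only if the operator maps U into itself.\<close>

lemma hecke_double_cusp:
  assumes "prime_elem P" and "f \<in> double_cusp_forms j w k 1" and "\<And>c :: 'q. c \<noteq> 0 \<Longrightarrow> c ^ k = c ^ 2"
  shows "hecke j k P f \<in> double_cusp_forms j w k 1"
proof -
  have P: "P \<noteq> 0"
    using assms(1) by auto
  obtain a where f: "\<And>z. z \<notin> Omega j \<Longrightarrow> f z = 0" "rigid_analytic j f" "modular_transform j k 1 f"
    and a: "has_t_expansion j w f a" "a 0 = 0" "a 1 = 0"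
    using assms(2) unfolding double_cusp_forms_def modular_forms_def by blast
  obtain b where b: "has_t_expansion j w (\<lambda>z. f (\<iota> P * z)) b" "b 0 = 0" "b 1 = 0"
    using t_expansion_multiple[OF a P] by blast
  obtain b' where b': "has_t_expansion j w (\<lambda>z. \<Sum>\<beta>\<in>polys_below (degree P). f ((z + \<iota> \<beta>) / \<iota> P)) b'" "b' 0 = 0" "b' 1 = 0"
    using t_expansion_division[OF a assms(1)] by blast
  have "has_t_expansion j w (hecke j k P f) (\<lambda>i. \<iota> P ^ k * b i + b' i)"
    using has_t_expansion_add[OF has_t_expansion_cmult[OF b(1), of "\<iota> P ^ k"] b'(1)]
    by (simp add: hecke_eq[OF assms(1), abs_def])
  moreover have "\<iota> P ^ k * b 0 + b' 0 = 0" "\<iota> P ^ k * b 1 + b' 1 = 0"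
    using b b' by simp_all
  ultimately have "\<exists>a. has_t_expansion j w (hecke j k P f) a \<and> a 0 = 0 \<and> a 1 = 0"
    by (intro exI[of _ "\<lambda>i. \<iota> P ^ k * b i + b' i"] conjI)
  moreover have "modular_transform j k 1 (hecke j k P f)"
    by (rule modular_transform_hecke[OF assms(1) f(3)]) (rule assms(3))
  moreover have "\<forall>z. z \<notin> Omega j \<longrightarrow> hecke j k P f z = 0"
    using hecke_outside_Omega[of f P] f(1) assms(1) by blast
  moreover have "rigid_analytic j (hecke j k P f)"
    by (rule rigid_analytic_hecke[OF assms(1) f(2)])
  ultimately show ?thesis
    unfolding double_cusp_forms_def modular_forms_def by blast
qed

end

section \<open>Partial fractions and Laurent approximation\<close>

text \<open>Iterates 1 / ((z - s) (z - r)) = (1 / (z - r) - 1 / (z - s)) / (r - s). Lists of terms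
  are used because the same pole may occur repeatedly.\<close>

lemma partial_fraction_step:
  fixes c r s :: "'c::field"
  shows "\<exists>xs. (\<forall>(c', r', l')\<in>set xs. r' \<in> {r, s} \<and> l' \<ge> 1) \<and>
    (\<forall>z. z \<noteq> r \<and> z \<noteq> s \<longrightarrow> c / (z - s) ^ l * (1 / (z - r)) = (\<Sum>(c', r', l')\<leftarrow>xs. c' / (z - r') ^ l'))"
proof (cases "r = s")
  case True
  then show ?thesis
    by (intro exI[of _ "[(c, r, Suc l)]"]) (auto simp: mult.commute)
next
  case False
  show ?thesis
  proof (induction l arbitrary: c)
    case 0
    show ?case
      by (intro exI[of _ "[(c, r, 1)]"]) auto
  next
    case (Suc l)
    from Suc[of "c / (r - s)"] obtain xs where xs: "\<forall>(c', r', l')\<in>set xs. r' \<in> {r, s} \<and> l' \<ge> 1"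
      "\<And>z. z \<noteq> r \<Longrightarrow> z \<noteq> s \<Longrightarrow> c / (r - s) / (z - s) ^ l * (1 / (z - r)) = (\<Sum>(c', r', l')\<leftarrow>xs. c' / (z - r') ^ l')"
      by blast
    show ?case
    proof (intro exI[of _ "(- c / (r - s), s, Suc l) # xs"] conjI allI impI)
      show "\<forall>(c', r', l')\<in>set ((- c / (r - s), s, Suc l) # xs). r' \<in> {r, s} \<and> l' \<ge> 1"
        using xs(1) by auto
      fix z assume z: "z \<noteq> r \<and> z \<noteq> s"
      have "c / (z - s) ^ Suc l * (1 / (z - r)) = - c / (r - s) / (z - s) ^ Suc l + c / (r - s) / (z - s) ^ l * (1 / (z - r))"
      proof -
        define I J D where "I = 1 / (z - s)" and "J = 1 / (z - r)" and "D = 1 / (r - s)"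
        have IJ: "I * J = D * (J - I)"
          using z False by (simp add: I_def J_def D_def field_simps)
        have I: "x / (z - s) ^ n = x * I ^ n" for x n
          by (simp add: I_def power_one_over)
        have D: "x / (r - s) = x * D" for x
          by (simp add: D_def)
        have "c * I ^ Suc l * J = c * I ^ l * (I * J)"
          by simp
        also have "\<dots> = - c * D * I ^ Suc l + c * D * I ^ l * J"
          unfolding IJ by (simp add: algebra_simps)
        finally show ?thesis
          unfolding I D J_def[symmetric] .
      qed
      then show "c / (z - s) ^ Suc l * (1 / (z - r)) = (\<Sum>(c', r', l')\<leftarrow>(- c / (r - s), s, Suc l) # xs. c' / (z - r') ^ l')"
        using xs(2) z by simp
    qed
  qed
qed

lemma partial_fraction_list_step:
  fixes r :: "'c::field"
  assumes "\<forall>(c', r', l')\<in>set xs. r' \<in> S \<and> l' \<ge> 1" and "r \<in> S"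
  shows "\<exists>ys. (\<forall>(c', r', l')\<in>set ys. r' \<in> S \<and> l' \<ge> 1) \<and>
    (\<forall>z. z \<notin> S \<longrightarrow> (\<Sum>(c', r', l')\<leftarrow>xs. c' / (z - r') ^ l') * (1 / (z - r)) = (\<Sum>(c', r', l')\<leftarrow>ys. c' / (z - r') ^ l'))"
  using assms(1)
proof (induction xs)
  case Nil
  show ?case by (intro exI[of _ "[]"]) simp
next
  case (Cons x xs)
  obtain c s l where x: "x = (c, s, l)"
    by (cases x)
  have s: "s \<in> S"
    using Cons.prems x by auto
  obtain ys where ys: "\<forall>(c', r', l')\<in>set ys. r' \<in> S \<and> l' \<ge> 1"
    "\<forall>z. z \<notin> S \<longrightarrow> (\<Sum>(c', r', l')\<leftarrow>xs. c' / (z - r') ^ l') * (1 / (z - r)) = (\<Sum>(c', r', l')\<leftarrow>ys. c' / (z - r') ^ l')"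
    using Cons by auto
  obtain zs where zs: "\<forall>(c', r', l')\<in>set zs. r' \<in> {r, s} \<and> l' \<ge> 1"
    "\<forall>z. z \<noteq> r \<and> z \<noteq> s \<longrightarrow> c / (z - s) ^ l * (1 / (z - r)) = (\<Sum>(c', r', l')\<leftarrow>zs. c' / (z - r') ^ l')"
    using partial_fraction_step[of r s c l] by blast
  show ?case
  proof (intro exI[of _ "zs @ ys"] conjI allI impI)
    show "\<forall>(c', r', l')\<in>set (zs @ ys). r' \<in> S \<and> l' \<ge> 1"
      using zs(1) ys(1) s assms(2) by fastforce
    fix z assume z: "z \<notin> S"
    then have "z \<noteq> r \<and> z \<noteq> s"
      using s assms(2) by auto
    note 1 = zs(2)[rule_format, OF this] and 2 = ys(2)[rule_format, OF z]
    show "(\<Sum>(c', r', l')\<leftarrow>x # xs. c' / (z - r') ^ l') * (1 / (z - r)) =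
        (\<Sum>(c', r', l')\<leftarrow>zs @ ys. c' / (z - r') ^ l')"
      by (simp only: x list.map sum_list.Cons prod.case distrib_right 1 2 map_append sum_list_append)
  qed
qed

lemma absv_power_diff_le:
  fixes u v :: "'c::nonarch_field"
  assumes "absv u \<le> M" and "absv v \<le> M"
  shows "absv (u ^ l - v ^ l) \<le> absv (u - v) * M ^ (l - 1)"
proof (induction l)
  case (Suc l)
  have M: "M \<ge> 0"
    using assms(1) absv_nonneg[of u] by linarith
  have "absv (u * (u ^ l - v ^ l)) \<le> absv (u - v) * M ^ l"
  proof (cases l)
    case (Suc l')
    have "absv u * absv (u ^ l - v ^ l) \<le> M * (absv (u - v) * M ^ (l - 1))"
      using assms Suc.IH M by (intro mult_mono) auto
    then show ?thesis
      by (simp add: Suc absv_mult mult_ac)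
  qed simp
  moreover have "absv ((u - v) * v ^ l) \<le> absv (u - v) * M ^ l"
    unfolding absv_mult absv_power using assms by (intro mult_left_mono power_mono) auto
  moreover have "u ^ Suc l - v ^ Suc l = u * (u ^ l - v ^ l) + (u - v) * v ^ l"
    by (simp add: algebra_simps)
  ultimately show ?case
    using absv_add_leI[of "u * (u ^ l - v ^ l)" "absv (u - v) * M ^ l" "(u - v) * v ^ l"] by simp
qed simp

lemma geometric_error:
  fixes x s :: "'c::field"
  assumes "x \<noteq> 0" and "x \<noteq> s"
  shows "1 / (x - s) - (\<Sum>j<M. s ^ j / x ^ Suc j) = (s / x) ^ M / (x - s)"
proof (induction M)
  case (Suc M)
  have "1 / (x - s) - (\<Sum>j<Suc M. s ^ j / x ^ Suc j) = (s / x) ^ M / (x - s) - s ^ M / x ^ Suc M"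
    using Suc by simp
  also have "\<dots> = (s / x) ^ M * (1 / (x - s) - 1 / x)"
    by (simp add: power_divide right_diff_distrib mult.commute)
  also have "1 / (x - s) - 1 / x = (s / x) / (x - s)"
    using assms by (simp add: field_simps)
  finally show ?case
    by (simp add: mult.commute)
qed simp

context C_infinity
begin

lemma partial_fractions:
  fixes P Q :: "'c poly"
  assumes "Q \<noteq> 0"
  shows "\<exists>p xs. (\<forall>(c, r, l)\<in>set xs. poly Q r = 0 \<and> l \<ge> 1) \<and>
    (\<forall>z. poly Q z \<noteq> 0 \<longrightarrow> poly P z / poly Q z = poly p z + (\<Sum>(c, r, l)\<leftarrow>xs. c / (z - r) ^ l))"
  using assms
proof (induction "degree Q" arbitrary: Q)
  case 0
  then obtain c where "Q = [:c:]" "c \<noteq> 0"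
    by (metis degree_eq_zeroE pCons_0_0)
  then show ?case
    by (intro exI[of _ "smult (1 / c) P"] exI[of _ "[]"]) simp
next
  case (Suc n)
  then obtain r where r: "poly Q r = 0"
    using alg_closed_C[of Q] by auto
  then obtain Q' where Q: "Q = [:- r, 1:] * Q'"
    by (auto simp: poly_eq_0_iff_dvd)
  have "Q' \<noteq> 0"
    using Suc.prems Q by auto
  moreover from this have "degree Q = Suc (degree Q')"
    unfolding Q by (subst degree_mult_eq) auto
  with Suc(2) have "degree Q' = n"
    by simp
  ultimately have Q': "Q' \<noteq> 0" "degree Q' = n"
    by simp_all
  obtain p xs where pxs: "\<forall>(c, r, l)\<in>set xs. poly Q' r = 0 \<and> l \<ge> 1"
    "\<And>z. poly Q' z \<noteq> 0 \<Longrightarrow> poly P z / poly Q' z = poly p z + (\<Sum>(c, r, l)\<leftarrow>xs. c / (z - r) ^ l)"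
    using Suc(1)[OF Q'(2)[symmetric] Q'(1)] by blast
  define S where "S = {z. poly Q z = 0}"
  have "\<forall>(c, r, l)\<in>set xs. r \<in> S \<and> l \<ge> 1"
    using pxs(1) by (auto simp: S_def Q)
  then obtain ys where ys: "\<forall>(c', r', l')\<in>set ys. r' \<in> S \<and> l' \<ge> 1"
    "\<And>z. z \<notin> S \<Longrightarrow> (\<Sum>(c', r', l')\<leftarrow>xs. c' / (z - r') ^ l') * (1 / (z - r)) = (\<Sum>(c', r', l')\<leftarrow>ys. c' / (z - r') ^ l')"
    using partial_fraction_list_step[of xs S r] r by (auto simp: S_def)
  show ?case
  proof (intro exI[of _ "synthetic_div p r"] exI[of _ "(poly p r, r, 1) # ys"] conjI allI impI)
    show "\<forall>(c, r, l)\<in>set ((poly p r, r, 1) # ys). poly Q r = 0 \<and> l \<ge> 1"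
      using ys(1) r by (auto simp: S_def)
    fix z assume z: "poly Q z \<noteq> 0"
    then have z': "poly Q' z \<noteq> 0" "z \<noteq> r" "z \<notin> S"
      by (auto simp: Q S_def)
    have "p = [:- r, 1:] * synthetic_div p r + [:poly p r:]"
      by (simp only: synthetic_div_correct')
    then have "poly p z = poly ([:- r, 1:] * synthetic_div p r + [:poly p r:]) z"
      by (rule arg_cong)
    then have p: "poly p z * (1 / (z - r)) = poly (synthetic_div p r) z + poly p r / (z - r)"
      using z'(2) by (simp add: field_simps)
    have "poly Q z = poly Q' z * (z - r)"
      by (simp add: Q algebra_simps)
    then have "poly P z / poly Q z = poly P z / poly Q' z * (1 / (z - r))"
      by simp
    also have "\<dots> = poly (synthetic_div p r) z + (poly p r / (z - r) + (\<Sum>(c', r', l')\<leftarrow>ys. c' / (z - r') ^ l'))"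
      unfolding pxs(2)[OF z'(1)] distrib_right p ys(2)[OF z'(3)] by (rule add.assoc)
    finally show "poly P z / poly Q z = poly (synthetic_div p r) z + (\<Sum>(c, r, l)\<leftarrow>(poly p r, r, 1) # ys. c / (z - r) ^ l)"
      by simp
  qed
qed

lemma partial_fractions_indexed:
  fixes P Q :: "'c poly"
  assumes "Q \<noteq> 0"
  obtains p :: "'c poly" and m :: nat and c r :: "nat \<Rightarrow> 'c" and l :: "nat \<Rightarrow> nat"
    where "\<And>i. i < m \<Longrightarrow> poly Q (r i) = 0" and "\<And>i. i < m \<Longrightarrow> l i \<ge> 1"
    and "\<And>z. poly Q z \<noteq> 0 \<Longrightarrow> poly P z / poly Q z = poly p z + (\<Sum>i<m. c i / (z - r i) ^ l i)"
proof -
  obtain p xs where pxs: "\<forall>(c, r, l)\<in>set xs. poly Q r = 0 \<and> l \<ge> 1"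
    "\<And>z. poly Q z \<noteq> 0 \<Longrightarrow> poly P z / poly Q z = poly p z + (\<Sum>(c, r, l)\<leftarrow>xs. c / (z - r) ^ l)"
    using partial_fractions[OF assms, of P] by blast
  show ?thesis
  proof (rule that[of "length xs" "\<lambda>i. fst (snd (xs ! i))" "\<lambda>i. snd (snd (xs ! i))" p "\<lambda>i. fst (xs ! i)"])
    fix i assume "i < length xs"
    then have "xs ! i \<in> set xs"
      by simp
    with pxs(1) show "poly Q (fst (snd (xs ! i))) = 0" "snd (snd (xs ! i)) \<ge> 1"
      by (auto simp: case_prod_beta)
  next
    fix z assume "poly Q z \<noteq> 0"
    from pxs(2)[OF this] show "poly P z / poly Q z = poly p z +
        (\<Sum>i<length xs. fst (xs ! i) / (z - fst (snd (xs ! i))) ^ snd (snd (xs ! i)))"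
      by (simp add: sum_list_sum_nth case_prod_beta atLeast0LessThan)
  qed
qed

section \<open>Approximation of principal parts by Laurent and Taylor polynomials\<close>

lemma power_small:
  assumes "0 \<le> \<theta>" and "\<theta> < 1" and "\<delta> > 0"
  shows "\<exists>M. C * \<theta> ^ M \<le> (\<delta> :: real)"
proof -
  have "(\<lambda>M. C * \<theta> ^ M) \<longlonglongrightarrow> C * 0"
    using assms by (intro tendsto_mult tendsto_const LIMSEQ_realpow_zero)
  then have "\<forall>\<^sub>F M in sequentially. C * \<theta> ^ M < \<delta>"
    using assms(3) by (intro order_tendstoD(2)) auto
  then show ?thesis
    by (auto simp: eventually_sequentially intro: less_imp_le)
qed

text \<open>Outside the disc containing the pole s, 1 / (x - s) is a geometric series in 1/x.
  Coefficient 1 is the residue, which the case k = 2 of the vanishing argument needs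
  exactly.\<close>

lemma inner_approx:
  fixes s c :: 'c
  assumes "absv s < \<rho>" and "l \<ge> 1" and "\<delta> > 0"
  shows "\<exists>W. coeff W 0 = 0 \<and> coeff W 1 = (if l = 1 then c else 0) \<and>
    (\<forall>x. absv x \<ge> \<rho> \<longrightarrow> absv (c / (x - s) ^ l - poly W (1 / x)) \<le> \<delta>)"
proof -
  have \<rho>: "\<rho> > 0"
    using assms(1) absv_nonneg[of s] by linarith
  have "\<exists>M0. (absv c * (1 / \<rho>) ^ (l - 1) * (1 / \<rho>)) * (absv s / \<rho>) ^ M0 \<le> \<delta>"
    by (rule power_small) (use assms \<rho> in simp_all)
  then obtain M0 where M0: "(absv c * (1 / \<rho>) ^ (l - 1) * (1 / \<rho>)) * (absv s / \<rho>) ^ M0 \<le> \<delta>" ..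
  \<comment> \<open>At least one term of the geometric series is kept, so that \<open>V\<close> has
    constant coefficient 1.\<close>
  define M where "M = Suc M0"
  have "(absv s / \<rho>) ^ M \<le> (absv s / \<rho>) ^ M0"
    using assms(1) \<rho> unfolding M_def by (intro power_decreasing) auto
  then have "(absv c * (1 / \<rho>) ^ (l - 1) * (1 / \<rho>)) * (absv s / \<rho>) ^ M \<le> (absv c * (1 / \<rho>) ^ (l - 1) * (1 / \<rho>)) * (absv s / \<rho>) ^ M0"
    using \<rho> by (intro mult_left_mono) auto
  with M0 have M: "(absv c * (1 / \<rho>) ^ (l - 1) * (1 / \<rho>)) * (absv s / \<rho>) ^ M \<le> \<delta>"
    by linarith
  define V where "V = (\<Sum>j<M. monom (s ^ j) j)"
  define W0 where "W0 = pCons 0 V"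
  have V0: "coeff V 0 = 1"
    by (simp add: V_def coeff_sum coeff_monom M_def sum.delta)
  have W0: "poly W0 (1 / x) = (\<Sum>j<M. s ^ j / x ^ Suc j)" for x
    by (simp add: W0_def V_def poly_sum poly_monom sum_distrib_left power_divide)
  obtain l' where l: "l = Suc l'"
    using assms(2) by (cases l) auto
  have W0l: "W0 ^ l = pCons 0 (V * W0 ^ l')"
    by (simp add: l W0_def)
  show ?thesis
  proof (intro exI[of _ "smult c (W0 ^ l)"] conjI allI impI)
    show "coeff (smult c (W0 ^ l)) 0 = 0"
      by (simp add: W0l)
    show "coeff (smult c (W0 ^ l)) 1 = (if l = 1 then c else 0)"
    proof -
      have "coeff (W0 ^ l) 1 = coeff (V * W0 ^ l') 0"
        by (simp add: W0l)
      also have "\<dots> = coeff (W0 ^ l') 0"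
        using V0 by (simp add: coeff_mult)
      also have "\<dots> = 0 ^ l'"
        by (simp add: coeff_0_power W0_def)
      finally show ?thesis
        by (simp add: l power_0_left)
    qed
    fix x :: 'c assume x: "absv x \<ge> \<rho>"
    then have x0: "x \<noteq> 0" "x \<noteq> s"
      using \<rho> assms(1) by auto
    have xs: "absv (x - s) = absv x"
      using x assms(1) by (intro absv_diff_eq) linarith
    have "absv (1 / (x - s) - poly W0 (1 / x)) = (absv s / absv x) ^ M / absv x"
      unfolding W0 geometric_error[OF x0] by (simp add: absv_divide absv_power xs)
    also have "\<dots> \<le> (absv s / \<rho>) ^ M / \<rho>"
      using x \<rho> by (intro frac_le power_mono divide_left_mono) auto
    finally have err: "absv (1 / (x - s) - poly W0 (1 / x)) \<le> (absv s / \<rho>) ^ M / \<rho>" .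
    have b1: "absv (1 / (x - s)) \<le> 1 / \<rho>"
      using x \<rho> by (simp add: absv_divide xs frac_le)
    have "(absv s / \<rho>) ^ M \<le> 1"
      using assms(1) \<rho> by (intro power_le_one) auto
    then have "(absv s / \<rho>) ^ M / \<rho> \<le> 1 / \<rho>"
      using \<rho> by (intro divide_right_mono) auto
    then have b2: "absv (poly W0 (1 / x)) \<le> 1 / \<rho>"
      using absv_diff_leI[OF b1 order_trans[OF err]] by simp
    have "absv ((1 / (x - s)) ^ l - poly W0 (1 / x) ^ l) \<le> absv (1 / (x - s) - poly W0 (1 / x)) * (1 / \<rho>) ^ (l - 1)"
      by (rule absv_power_diff_le[OF b1 b2])
    also have "\<dots> \<le> (absv s / \<rho>) ^ M / \<rho> * (1 / \<rho>) ^ (l - 1)"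
      using \<rho> by (intro mult_right_mono err) auto
    finally have "absv c * absv ((1 / (x - s)) ^ l - poly W0 (1 / x) ^ l) \<le> absv c * ((absv s / \<rho>) ^ M / \<rho> * (1 / \<rho>) ^ (l - 1))"
      by (intro mult_left_mono) auto
    also have "\<dots> \<le> \<delta>"
      using M by (simp add: mult_ac)
    finally show "absv (c / (x - s) ^ l - poly (smult c (W0 ^ l)) (1 / x)) \<le> \<delta>"
      by (simp add: power_divide right_diff_distrib flip: absv_mult)
  qed
qed

text \<open>Here the pole lies outside the disc, and 1 / (x - s) is expanded in powers of x /
  s.\<close>

lemma outer_approx:
  fixes s c :: 'c
  assumes "\<rho> < absv s" and "\<rho> > 0" and "\<delta> > 0"
  shows "\<exists>U. \<forall>x. absv x \<le> \<rho> \<longrightarrow> absv (c / (x - s) ^ l - poly U x) \<le> \<delta>"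
proof -
  define \<eta> where "\<eta> = absv s"
  have "absv s > 0"
    using assms by linarith
  then have \<eta>: "\<eta> > 0" "\<rho> < \<eta>"
    using assms by (simp_all add: \<eta>_def)
  from \<open>absv s > 0\<close> have s0: "s \<noteq> 0"
    by simp
  have "\<exists>M. (absv c * (1 / \<eta>) ^ (l - 1) * (1 / \<eta>)) * (\<rho> / \<eta>) ^ M \<le> \<delta>"
    by (rule power_small) (use assms \<eta> in simp_all)
  then obtain M where M: "(absv c * (1 / \<eta>) ^ (l - 1) * (1 / \<eta>)) * (\<rho> / \<eta>) ^ M \<le> \<delta>" ..
  define U0 where "U0 = - (\<Sum>j<M. monom (1 / s ^ Suc j) j)"
  have U0: "poly U0 x = - (\<Sum>j<M. x ^ j / s ^ Suc j)" for x
    by (simp add: U0_def poly_sum poly_monom)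
  show ?thesis
  proof (intro exI[of _ "smult c (U0 ^ l)"] allI impI)
    fix x :: 'c assume x: "absv x \<le> \<rho>"
    then have xs0: "s \<noteq> x"
      using assms(1) by auto
    have xs: "absv (x - s) = \<eta>"
      unfolding \<eta>_def using x assms(1) by (intro absv_diff_eq') linarith
    have "1 / (x - s) - poly U0 x = - (1 / (s - x) - (\<Sum>j<M. x ^ j / s ^ Suc j))"
      by (simp add: U0 divide_minus_right[symmetric] del: divide_minus_right)
    then have "absv (1 / (x - s) - poly U0 x) = absv ((x / s) ^ M / (s - x))"
      by (simp only: geometric_error[OF s0 xs0] absv_minus)
    also have "\<dots> = (absv x / \<eta>) ^ M / \<eta>"
      using xs by (simp add: absv_divide absv_power \<eta>_def absv_minus_commute[of s])
    also have "\<dots> \<le> (\<rho> / \<eta>) ^ M / \<eta>"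
      using x \<eta> by (intro divide_right_mono power_mono) auto
    finally have err: "absv (1 / (x - s) - poly U0 x) \<le> (\<rho> / \<eta>) ^ M / \<eta>" .
    have b1: "absv (1 / (x - s)) \<le> 1 / \<eta>"
      by (simp add: absv_divide xs)
    have "(\<rho> / \<eta>) ^ M \<le> 1"
      using assms \<eta> by (intro power_le_one) auto
    then have "(\<rho> / \<eta>) ^ M / \<eta> \<le> 1 / \<eta>"
      using \<eta> by (intro divide_right_mono) auto
    then have b2: "absv (poly U0 x) \<le> 1 / \<eta>"
      using absv_diff_leI[OF b1 order_trans[OF err]] by simp
    have "absv ((1 / (x - s)) ^ l - poly U0 x ^ l) \<le> absv (1 / (x - s) - poly U0 x) * (1 / \<eta>) ^ (l - 1)"
      by (rule absv_power_diff_le[OF b1 b2])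
    also have "\<dots> \<le> (\<rho> / \<eta>) ^ M / \<eta> * (1 / \<eta>) ^ (l - 1)"
      using \<eta> by (intro mult_right_mono err) auto
    finally have "absv c * absv ((1 / (x - s)) ^ l - poly U0 x ^ l) \<le> absv c * ((\<rho> / \<eta>) ^ M / \<eta> * (1 / \<eta>) ^ (l - 1))"
      by (intro mult_left_mono) auto
    also have "\<dots> \<le> \<delta>"
      using M by (simp add: mult_ac)
    finally show "absv (c / (x - s) ^ l - poly (smult c (U0 ^ l)) x) \<le> \<delta>"
      by (simp add: power_divide right_diff_distrib flip: absv_mult)
  qed
qed

text \<open>The first coefficient is a sum of residues and does not depend on the centre
  \<open>a\<close>; this relates expansions about different centres.\<close>

lemma inner_approx_sum:
  fixes a :: 'c and c r :: "nat \<Rightarrow> 'c"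
  assumes "finite I" and "\<And>i. i \<in> I \<Longrightarrow> absv (r i - a) < \<rho>" and "\<And>i. i \<in> I \<Longrightarrow> l i \<ge> 1" and "\<delta> > 0"
  shows "\<exists>W. coeff W 0 = 0 \<and> coeff W 1 = (\<Sum>i\<in>I. if l i = 1 then c i else 0) \<and>
    (\<forall>x::'c. absv x \<ge> \<rho> \<longrightarrow> absv ((\<Sum>i\<in>I. c i / (a + x - r i) ^ l i) - poly W (1 / x)) \<le> \<delta>)"
proof -
  have "\<forall>i\<in>I. \<exists>W. coeff W 0 = 0 \<and> coeff W 1 = (if l i = 1 then c i else 0) \<and>
    (\<forall>x. absv x \<ge> \<rho> \<longrightarrow> absv (c i / (x - (r i - a)) ^ l i - poly W (1 / x)) \<le> \<delta>)"
    using assms by (intro ballI inner_approx)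
  from bchoice[OF this] obtain W where W: "\<forall>i\<in>I. coeff (W i) 0 = 0 \<and> coeff (W i) 1 = (if l i = 1 then c i else 0) \<and>
    (\<forall>x. absv x \<ge> \<rho> \<longrightarrow> absv (c i / (x - (r i - a)) ^ l i - poly (W i) (1 / x)) \<le> \<delta>)" ..
  show ?thesis
  proof (intro exI[of _ "\<Sum>i\<in>I. W i"] conjI allI impI)
    show "coeff (\<Sum>i\<in>I. W i) 0 = 0"
      using W by (simp add: coeff_sum)
    show "coeff (\<Sum>i\<in>I. W i) 1 = (\<Sum>i\<in>I. if l i = 1 then c i else 0)"
      unfolding coeff_sum using W by (intro sum.cong) auto
    fix x :: 'c assume x: "\<rho> \<le> absv x"
    have "absv (c i / (a + x - r i) ^ l i - poly (W i) (1 / x)) \<le> \<delta>" if "i \<in> I" for i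
    proof -
      have "a + x - r i = x - (r i - a)"
        by simp
      with W that x show ?thesis
        by metis
    qed
    then show "absv ((\<Sum>i\<in>I. c i / (a + x - r i) ^ l i) - poly (\<Sum>i\<in>I. W i) (1 / x)) \<le> \<delta>"
      unfolding poly_sum sum_subtractf[symmetric] using assms(4) by (intro absv_sum_le) auto
  qed
qed

lemma outer_approx_sum:
  fixes a :: 'c and c r :: "nat \<Rightarrow> 'c"
  assumes "finite I" and "\<And>i. i \<in> I \<Longrightarrow> \<rho> < absv (r i - a)" and "\<rho> > 0" and "\<delta> > 0"
  shows "\<exists>U. \<forall>x::'c. absv x \<le> \<rho> \<longrightarrow>
    absv (poly p (a + x) + (\<Sum>i\<in>I. c i / (a + x - r i) ^ l i) - poly U x) \<le> \<delta>"
proof -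
  have "\<forall>i\<in>I. \<exists>U. \<forall>x. absv x \<le> \<rho> \<longrightarrow> absv (c i / (x - (r i - a)) ^ l i - poly U x) \<le> \<delta>"
    using assms by (intro ballI outer_approx)
  from bchoice[OF this] obtain U where U: "\<forall>i\<in>I. \<forall>x. absv x \<le> \<rho> \<longrightarrow> absv (c i / (x - (r i - a)) ^ l i - poly (U i) x) \<le> \<delta>" ..
  show ?thesis
  proof (intro exI[of _ "pcompose p [:a, 1:] + (\<Sum>i\<in>I. U i)"] allI impI)
    fix x :: 'c assume x: "absv x \<le> \<rho>"
    have "absv (c i / (a + x - r i) ^ l i - poly (U i) x) \<le> \<delta>" if "i \<in> I" for i
    proof -
      have "a + x - r i = x - (r i - a)"
        by simp
      with U that x show ?thesis
        by metis
    qed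
    then have "absv ((\<Sum>i\<in>I. c i / (a + x - r i) ^ l i) - poly (\<Sum>i\<in>I. U i) x) \<le> \<delta>"
      unfolding poly_sum sum_subtractf[symmetric] using assms(4) by (intro absv_sum_le) auto
    then show "absv (poly p (a + x) + (\<Sum>i\<in>I. c i / (a + x - r i) ^ l i) - poly (pcompose p [:a, 1:] + (\<Sum>i\<in>I. U i)) x) \<le> \<delta>"
      by (simp add: poly_pcompose algebra_simps)
  qed
qed

lemma absv_poly_inverse_le:
  fixes W :: "'c poly"
  assumes "coeff W 0 = 0" and "\<And>i. absv (coeff W i) \<le> \<mu>" and "absv y \<ge> 1"
  shows "absv (poly W (1 / y)) \<le> \<mu> / absv y"
proof -
  have \<mu>: "\<mu> \<ge> 0"
    using assms(2)[of 0] order_trans[OF absv_nonneg] by blast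
  show ?thesis
    unfolding poly_altdef
  proof (rule absv_sum_le)
    fix i
    show "absv (coeff W i * (1 / y) ^ i) \<le> \<mu> / absv y"
    proof (cases i)
      case 0
      then show ?thesis using assms \<mu> by simp
    next
      case (Suc i')
      have "absv (coeff W i) * (1 / absv y) ^ i \<le> \<mu> * (1 / absv y) ^ 1"
        using assms \<mu> Suc by (intro mult_mono power_decreasing) (auto simp: divide_le_eq_1)
      then show ?thesis
        by (simp add: absv_mult absv_power absv_divide)
    qed
  qed (use \<mu> in auto)
qed

text \<open>Comparison of coefficients: x^-i receives \<open>coeff H i\<close> and coefficient i + k
  of \<open>W\<close>. For k = 2 the power x^1 receives the first coefficients of \<open>B\<close>
  and \<open>W\<close>, while x^2 U(x) starts later.\<close>

lemma inversion_coeffs: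
  fixes H B W U :: "'c poly" and y :: 'c
  assumes "y \<noteq> 0" and "coeff W 0 = 0" and "k = 1 \<or> k = 2" and "coeff B 0 = 0"
    and "\<And>x. absv x = absv y \<Longrightarrow> absv (poly H (1 / x) + poly B x + x ^ k * (poly W (1 / x) + poly U x)) \<le> \<epsilon>"
  shows "absv (coeff W (i + k) + coeff H i) \<le> \<epsilon> * absv y ^ i"
    and "k = 2 \<Longrightarrow> absv (coeff W 1 + coeff B 1) * absv y \<le> \<epsilon>"
proof -
  obtain V where W: "W = pCons 0 V"
    using assms(2) by (cases W) auto
  obtain v V' where V: "V = pCons v V'"
    by (cases V)
  \<comment> \<open>x^k W(1/x) is split into \<open>Wk\<close>, a polynomial in 1/x, and
    \<open>low\<close>, the positive powers: none for k = 1, only v x for k = 2.\<close>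
  define Wk where "Wk = (if k = 1 then V else V')"
  define low where "low = (if k = 1 then 0 else [:0, v:])"
  have coeff_Wk: "coeff Wk i = coeff W (i + k)" for i
    using assms(3) by (auto simp: Wk_def W V)
  have split: "x ^ k * poly W (1 / x) = poly Wk (1 / x) + poly low x" if "x \<noteq> 0" for x
    using assms(3) that by (auto simp: Wk_def low_def W V power2_eq_square field_simps)
  \<comment> \<open>The constant term is moved to the other side because
    \<open>laurent_coeff_bounds\<close> requires it to vanish in the polynomial in 1/x.\<close>
  define h where "h = coeff (H + Wk) 0"
  define W' where "W' = H + Wk - [:h:]"
  define U' where "U' = B + monom 1 k * U + low + [:h:]"
  have W'0: "coeff W' 0 = 0"
    by (simp add: W'_def h_def)
  have bound: "absv (poly W' (1 / x) + poly U' x) \<le> \<epsilon>" if "absv x = absv y" for x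
  proof -
    have "x \<noteq> 0"
      using that assms(1) by fastforce
    then have "poly W' (1 / x) + poly U' x = poly H (1 / x) + poly B x + x ^ k * (poly W (1 / x) + poly U x)"
      by (simp add: W'_def U'_def distrib_left split poly_monom)
    with assms(5)[OF that] show ?thesis by simp
  qed
  note bounds = laurent_coeff_bounds[OF assms(1) W'0 bound]
  have U'0: "coeff U' 0 = coeff B 0 + h"
    using assms(3) by (auto simp: U'_def low_def coeff_monom_mult)
  show "absv (coeff W (i + k) + coeff H i) \<le> \<epsilon> * absv y ^ i"
  proof (cases "i = 0")
    case True
    have "absv h \<le> \<epsilon>"
      using bounds(2)[of 0] U'0 assms(4) by simp
    with True show ?thesis
      by (simp add: h_def coeff_Wk add.commute)
  next
    case False
    then have "coeff W' i = coeff W (i + k) + coeff H i"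
      by (cases i) (simp_all add: W'_def coeff_Wk)
    with bounds(1)[of i] show ?thesis by simp
  qed
  show "absv (coeff W 1 + coeff B 1) * absv y \<le> \<epsilon>" if "k = 2"
  proof -
    have "coeff U' 1 = coeff B 1 + v"
      using that by (simp add: U'_def low_def coeff_monom_mult)
    with bounds(2)[of 1] show ?thesis
      by (simp add: W V add.commute)
  qed
qed

end

section \<open>Vanishing in weight at most two\<close>

context C_infinity
begin

text \<open>The radius is not an integral power of q, so no element of K has the same absolute
  value, and |x - y| is the larger of |x| and |y|.\<close>

lemma circle_far:
  assumes "absv x ^ 2 = q powi (2 * m + 1)"
  shows "far (absv x) x"
  unfolding far_def
proof
  fix y assume y: "y \<in> K"
  have "absv y \<noteq> absv x"
  proof
    assume eq: "absv y = absv x"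
    have "absv y \<noteq> 0"
      using assms eq by (metis power_int_eq_0_iff power_zero_numeral q_pos less_irrefl)
    then obtain t where "absv y = q powi t"
      using absv_K[OF y] by auto
    then have "q powi (2 * t) = q powi (2 * m + 1)"
      using assms eq by (simp add: power_int_mult mult.commute[of 2])
    then have "q powi (2 * t) \<le> q powi (2 * m + 1)" "q powi (2 * m + 1) \<le> q powi (2 * t)"
      by simp_all
    then have "2 * t \<le> 2 * m + 1" "2 * m + 1 \<le> 2 * t"
      by (simp_all only: q_powi_le_iff)
    then show False
      by presburger
  qed
  then consider "absv y < absv x" | "absv x < absv y"
    by linarith
  then show "absv x \<le> absv (x - y)"
    by cases (simp_all add: absv_diff_eq absv_diff_eq')
qed

text \<open>
  On the circle \<open>|x| = \<surd>q\<close> the approximation is \<open>H(x) + B(1/x)\<close> up to \<open>\<epsilon>\<close>, where \<open>B\<close> collects the principal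
  parts \<open>W a\<close> at the constants \<open>a\<close>, and on \<open>|x| = 1/\<surd>q\<close> it is \<open>W 0 (1/x) + U 0 (x)\<close>. The inversion
  exchanges the circles, so the coefficients of \<open>W 0\<close> of index \<open>i \<ge> k\<close> are close to those of \<open>- H\<close>. If
  \<open>k = 2\<close>, then coefficient 1 of \<open>W 0\<close> is close to that of \<open>- B\<close>, the sum of the residues at the \<open>q\<close>
  constants; as these residues agree up to \<open>\<epsilon>\<close>, their sum is small in characteristic \<open>p\<close>.
\<close>

lemma low_weight_estimate:
  fixes f :: "'c \<Rightarrow> 'c" and s0 z0 :: 'c
  assumes k: "k = 1 \<or> k = 2"
    and rigid: "rigid_analytic j f"
    and trans: "\<And>z b. z \<in> Omega j \<Longrightarrow> f (z + \<iota> b) = f z"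
    and inv: "\<And>z. z \<in> Omega j \<Longrightarrow> f (1 / z) = - (z ^ k * f z)"
    and decay: "\<And>e. e > 0 \<Longrightarrow> \<exists>y>0. \<forall>z. far y z \<longrightarrow> absv (f z) < e"
    and z0: "far 1 z0" and s0: "absv s0 ^ 2 = q" and \<epsilon>: "\<epsilon> > 0"
  shows "absv (f z0) \<le> \<epsilon> * absv s0"
proof -
  define \<sigma> where "\<sigma> = absv s0"
  define \<rho> where "\<rho> = 1 / \<sigma>"
  have \<sigma>2: "\<sigma> * \<sigma> = q"
    using s0 by (simp add: \<sigma>_def power2_eq_square)
  have "\<sigma> \<ge> 0"
    by (simp add: \<sigma>_def)
  have \<sigma>1: "\<sigma> > 1"
  proof (rule ccontr)
    assume "\<not> \<sigma> > 1"
    then have "\<sigma> * \<sigma> \<le> 1 * 1"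
      using \<open>\<sigma> \<ge> 0\<close> by (intro mult_mono) auto
    with \<sigma>2 q_gt_1 show False by linarith
  qed
  have \<sigma>q: "\<sigma> < q"
    using mult_strict_left_mono[OF \<sigma>1, of \<sigma>] \<sigma>1 \<sigma>2 by simp
  have s00: "s0 \<noteq> 0"
    using \<sigma>1 by (auto simp: \<sigma>_def)
  have \<rho>0: "\<rho> > 0" and \<rho>1: "\<rho> < 1" and \<rho>q: "1 / q < \<rho>"
    using \<sigma>1 \<sigma>q by (simp_all add: \<rho>_def frac_less2)
  have abs_inv: "absv (1 / s0) = \<rho>"
    by (simp add: absv_divide \<rho>_def \<sigma>_def)
  have \<epsilon>\<sigma>: "\<epsilon> \<le> \<epsilon> * \<sigma>"
    using \<epsilon> \<sigma>1 by simp
  obtain y0 where y0: "y0 > 0" "\<And>z. far y0 z \<Longrightarrow> absv (f z) < \<epsilon>"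
    using decay[OF \<epsilon>] by blast
  obtain n1 where n1: "y0 < q ^ n1"
    using exists_power_gt by blast
  obtain n2 where n2: "absv z0 < q ^ n2"
    using exists_power_gt by blast
  \<comment> \<open>n is so large that f is below \<epsilon> once the imaginary absolute value
    reaches q^n, and that z0 lies in the disc |z| \<le> q^n.\<close>
  define n where "n = max n1 n2"
  have "q ^ n1 \<le> q ^ n" "q ^ n2 \<le> q ^ n"
    by (intro q_power_mono; simp add: n_def)+
  with n1 n2 have y0n: "y0 \<le> q ^ n" and z0n: "absv z0 \<le> q ^ n"
    by linarith+
  have qn: "1 \<le> q ^ n" "q ^ n \<le> q ^ Suc n" "q \<le> q ^ Suc n"
    using q_power_mono[of 0 n] q_power_mono[of n "Suc n"] q_power_mono[of 1 "Suc n"] by simp_all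
  have inv_qn: "1 / q ^ Suc n \<le> 1 / q"
    using one_over_q_power_mono[of 1 "Suc n"] by simp
  define N where "N = Omega_aff j (Suc n)"
  obtain P Q where "\<And>z. z \<in> Omega_aff j (Suc n) \<Longrightarrow> poly Q z \<noteq> 0"
    "\<And>z. z \<in> Omega_aff j (Suc n) \<Longrightarrow> absv (poly P z / poly Q z - f z) < \<epsilon>"
    by (rule rigid_analyticE[OF rigid \<epsilon>, of "Suc n"]) (rule that)
  then have PQ: "\<And>z. z \<in> N \<Longrightarrow> poly Q z \<noteq> 0"
    "\<And>z. z \<in> N \<Longrightarrow> absv (poly P z / poly Q z - f z) < \<epsilon>"
    by (simp_all add: N_def)
  define R where "R z = poly P z / poly Q z" for z
  have R_close: "absv (R z - f z) \<le> \<epsilon>" if "z \<in> N" for z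
    using PQ(2)[OF that] by (simp add: R_def)
  have in_N: "z \<in> N" if "absv z \<le> q ^ Suc n" "far y z" "1 / q \<le> y" for y z
    unfolding N_def Omega_aff_iff
    using that(1) far_mono[OF that(2) order_trans[OF inv_qn that(3)]] ..
  have z0N: "z0 \<in> N"
    by (rule in_N[OF order_trans[OF z0n qn(2)] z0]) (use q_ge_1 in simp)
  then have Q0: "Q \<noteq> 0"
    using PQ(1) by fastforce
  obtain m :: nat and r l p c where pole: "\<And>i. i < m \<Longrightarrow> poly Q (r i) = 0" and l1: "\<And>i. i < m \<Longrightarrow> l i \<ge> 1"
    and PF: "\<And>z. poly Q z \<noteq> 0 \<Longrightarrow> poly P z / poly Q z = poly p z + (\<Sum>i<m. c i / (z - r i) ^ l i)"
    by (rule partial_fractions_indexed[OF Q0, of P]) (rule that)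
  define PP :: "'q poly set" where "PP = polys_below (Suc n)"
  have PP_le: "absv (\<iota> a) \<le> q ^ n" if "a \<in> PP" for a
  proof (cases "a = 0")
    case False
    then have "degree a \<le> n"
      using that by (simp add: PP_def polys_below_iff)
    then show ?thesis
      using False by (simp add: absv_of_A q_power_mono)
  qed simp
  have PP0: "0 \<in> PP" and PPfin: "finite PP"
    by (simp_all add: PP_def)
  define near where "near i a \<longleftrightarrow> a \<in> PP \<and> absv (r i - \<iota> a) \<le> 1 / q" for i a
  \<comment> \<open>A pole lies outside \<open>N\<close>: if it is smaller than q^(n+1), it is
    within q^-(n+1) of a point of K, hence within 1 / q of the polynomial part of that point, which
    has degree at most n.\<close>
  have dichotomy: "(\<exists>a. near i a) \<or> q ^ Suc n \<le> absv (r i)" if i: "i < m" for i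
  proof (rule disjCI)
    assume "\<not> q ^ Suc n \<le> absv (r i)"
    then have lt: "absv (r i) < q ^ Suc n"
      by simp
    have "r i \<notin> N"
      using pole[OF i] PQ(1) by blast
    then have "\<not> far (1 / q ^ Suc n) (r i)"
      using lt by (simp add: N_def Omega_aff_iff)
    then obtain x where x: "x \<in> K" "absv (r i - x) < 1 / q ^ Suc n"
      unfolding far_def by (meson not_le)
    then have rx: "absv (r i - x) < 1 / q"
      using inv_qn by linarith
    have "1 / q \<le> q ^ Suc n"
      using qn q_ge_1 by (meson divide_le_eq_1_pos order_trans q_pos)
    from absv_diff_lessI[OF lt order.strict_trans2[OF rx this]] have "absv (r i - (r i - x)) < q ^ Suc n" .
    then have xlt: "absv x < q ^ Suc n"
      by simp
    have "absv x \<le> q ^ n"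
    proof (cases "x = 0")
      case False
      obtain t where t: "absv x = q powi t"
        using absv_K[OF x(1) False] by blast
      have "q powi t < q powi (int (Suc n))"
        using xlt t by (simp only: power_int_of_nat)
      then have "t \<le> int n"
        by (simp only: q_powi_less_iff)
      then have "q powi t \<le> q powi (int n)"
        by (simp only: q_powi_le_iff)
      then show ?thesis
        by (simp only: t power_int_of_nat)
    qed simp
    from integral_part[OF x(1) this] obtain a where a: "a \<in> PP" "absv (x - \<iota> a) \<le> 1 / q"
      unfolding PP_def by blast
    have "absv ((r i - x) + (x - \<iota> a)) \<le> 1 / q"
      using rx a(2) by (intro absv_add_leI) linarith+
    with a(1) have "near i a"
      by (simp add: near_def)
    then show "\<exists>a. near i a" ..
  qed
  \<comment> \<open>Choosing one polynomial per pole makes the classes \<open>I a\<close> disjoint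
    by construction; \<open>None\<close> collects the poles belonging to infinity.\<close>
  define cls where "cls i = (if \<exists>a. near i a then Some (SOME a. near i a) else None)" for i
  have cls_Some: "near i a" if "cls i = Some a" for i a
    using that someI_ex[of "near i"] by (auto simp: cls_def split: if_splits)
  have cls_None: "q ^ Suc n \<le> absv (r i)" if "i < m" "cls i = None" for i
    using that dichotomy[of i] by (auto simp: cls_def split: if_splits)
  define I where "I a = {i. i < m \<and> cls i = Some a}" for a
  define IS where "IS S = (\<Union>a\<in>S. I a)" for S
  define IN where "IN = {i. i < m \<and> cls i = None}"
  have fin_I: "finite (I a)" for a
    by (rule finite_subset[of _ "{..<m}"]) (auto simp: I_def)
  have fin_IN: "finite IN"
    by (rule finite_subset[of _ "{..<m}"]) (auto simp: IN_def)
  have I_PP: "a \<in> PP \<and> absv (r i - \<iota> a) \<le> 1 / q \<and> i < m" if "i \<in> I a" for i a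
    using cls_Some[of i a] that by (simp add: I_def near_def)
  have sum_IS: "(\<Sum>i\<in>IS S. g i) = (\<Sum>a\<in>S. \<Sum>i\<in>I a. g i)" if "finite S" for S and g :: "nat \<Rightarrow> 'c"
    unfolding IS_def
  proof (rule sum.UNION_disjoint)
    show "\<forall>a\<in>S. \<forall>b\<in>S. a \<noteq> b \<longrightarrow> I a \<inter> I b = {}"
      by (auto simp: I_def)
  qed (use that fin_I in blast)+
  have all: "{..<m} = IN \<union> IS PP"
  proof
    show "{..<m} \<subseteq> IN \<union> IS PP"
    proof
      fix i assume "i \<in> {..<m}"
      then show "i \<in> IN \<union> IS PP"
      proof (cases "cls i")
        case None
        with \<open>i \<in> {..<m}\<close> show ?thesis
          by (simp add: IN_def)
      next
        case (Some a)
        with \<open>i \<in> {..<m}\<close> have "i \<in> I a"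
          by (simp add: I_def)
        with I_PP[OF this] show ?thesis
          unfolding IS_def by blast
      qed
    qed
  qed (auto simp: IN_def IS_def I_def)
  define e where "e i z = c i / (z - r i) ^ l i" for i z
  define Rp where "Rp a z = (\<Sum>i\<in>I a. e i z)" for a z
  define Rinf where "Rinf z = poly p z + (\<Sum>i\<in>IN. e i z)" for z
  have R_eq: "R z = poly p z + (\<Sum>i<m. e i z)" if "z \<in> N" for z
    unfolding R_def e_def using PF[OF PQ(1)[OF that]] .
  have one_q: "1 / q < 1"
    by simp
  have ge1: "absv (\<iota> b - \<iota> a) \<ge> 1" if "b \<noteq> a" for a b
    using absv_of_A_ge_1[of "b - a"] that by (simp add: of_A_diff)
  have dist_same: "absv (r i - \<iota> a) < \<rho>" if "i \<in> I a" for i a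
    using I_PP[OF that] \<rho>q by linarith
  have dist_other: "\<rho> < absv (r i - \<iota> a)" if "i < m" "i \<notin> I a" "a \<in> PP" for i a
  proof (cases "cls i")
    case None
    have le: "q ^ Suc n \<le> absv (r i)"
      by (rule cls_None[OF that(1) None])
    have "absv (\<iota> a) < q ^ Suc n"
      using that(3) unfolding PP_def by (rule absv_of_A_less)
    with le have "absv (r i - \<iota> a) = absv (r i)"
      by (intro absv_diff_eq) linarith
    with le qn \<rho>1 show ?thesis by linarith
  next
    case (Some b)
    with that have b: "b \<noteq> a" "i \<in> I b"
      by (auto simp: I_def)
    have "absv (r i - \<iota> b) < absv (\<iota> b - \<iota> a)"
      using I_PP[OF b(2)] ge1[OF b(1)] one_q by linarith
    then have "absv ((\<iota> b - \<iota> a) + (r i - \<iota> b)) = absv (\<iota> b - \<iota> a)"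
      by (rule absv_add_eq)
    with ge1[OF b(1)] \<rho>1 show ?thesis by simp
  qed
  have "\<forall>a. \<exists>W. coeff W 0 = 0 \<and> coeff W 1 = (\<Sum>i\<in>I a. if l i = 1 then c i else 0) \<and>
    (\<forall>x::'c. absv x \<ge> \<rho> \<longrightarrow> absv ((\<Sum>i\<in>I a. c i / (\<iota> a + x - r i) ^ l i) - poly W (1 / x)) \<le> \<epsilon>)"
    using dist_same l1 I_PP \<epsilon> fin_I by (intro allI inner_approx_sum) blast+
  then obtain W where W: "\<forall>a. coeff (W a) 0 = 0 \<and> coeff (W a) 1 = (\<Sum>i\<in>I a. if l i = 1 then c i else 0) \<and>
    (\<forall>x::'c. absv x \<ge> \<rho> \<longrightarrow> absv ((\<Sum>i\<in>I a. c i / (\<iota> a + x - r i) ^ l i) - poly (W a) (1 / x)) \<le> \<epsilon>)"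
    by (rule choice[THEN exE])
  then have W0: "coeff (W a) 0 = 0" and W1: "coeff (W a) 1 = (\<Sum>i\<in>I a. if l i = 1 then c i else 0)" for a
    by blast+
  have WR: "absv (Rp a (\<iota> a + x) - poly (W a) (1 / x)) \<le> \<epsilon>" if "absv x \<ge> \<rho>" for a x
    using W that unfolding Rp_def e_def by blast
  have "\<forall>a. \<exists>U. a \<in> PP \<longrightarrow> (\<forall>x::'c. absv x \<le> \<rho> \<longrightarrow>
    absv (poly p (\<iota> a + x) + (\<Sum>i\<in>{..<m} - I a. c i / (\<iota> a + x - r i) ^ l i) - poly U x) \<le> \<epsilon>)"
  proof
    fix a
    show "\<exists>U. a \<in> PP \<longrightarrow> (\<forall>x::'c. absv x \<le> \<rho> \<longrightarrow>
      absv (poly p (\<iota> a + x) + (\<Sum>i\<in>{..<m} - I a. c i / (\<iota> a + x - r i) ^ l i) - poly U x) \<le> \<epsilon>)"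
    proof (cases "a \<in> PP")
      case True
      have "\<exists>U. \<forall>x::'c. absv x \<le> \<rho> \<longrightarrow>
        absv (poly p (\<iota> a + x) + (\<Sum>i\<in>{..<m} - I a. c i / (\<iota> a + x - r i) ^ l i) - poly U x) \<le> \<epsilon>"
        using True dist_other \<rho>0 \<epsilon> by (intro outer_approx_sum) auto
      then show ?thesis by blast
    qed blast
  qed
  then obtain U where U: "\<forall>a. a \<in> PP \<longrightarrow> (\<forall>x::'c. absv x \<le> \<rho> \<longrightarrow>
    absv (poly p (\<iota> a + x) + (\<Sum>i\<in>{..<m} - I a. c i / (\<iota> a + x - r i) ^ l i) - poly (U a) x) \<le> \<epsilon>)"
    by (rule choice[THEN exE])
  have \<rho>2: "\<rho> ^ 2 = q powi (2 * (- 1) + 1)"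
    using \<sigma>2 by (simp add: \<rho>_def power2_eq_square power_int_minus inverse_eq_divide)
  have far_\<rho>: "far \<rho> x" if "absv x = \<rho>" for x
    using circle_far[of x "- 1"] \<rho>2 that by simp
  have \<rho>_N: "x + \<iota> a \<in> N" if "absv x = \<rho>" "a \<in> PP" for x a
  proof (rule in_N)
    show "absv (x + \<iota> a) \<le> q ^ Suc n"
      using that(1) PP_le[OF that(2)] \<rho>1 qn by (intro absv_add_leI) linarith+
    show "far \<rho> (x + \<iota> a)"
      using far_\<rho>[OF that(1)] by (rule far_add) simp
  qed (use \<rho>q in simp)
  have close: "absv (poly (W a) (1 / x) + poly (U a) x - f x) \<le> \<epsilon>" if x: "absv x = \<rho>" and a: "a \<in> PP" for x a
  proof -
    have N: "\<iota> a + x \<in> N"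
      using \<rho>_N[OF x a] by (simp add: add.commute)
    have "(\<Sum>i<m. e i z) = (\<Sum>i\<in>{..<m} - I a. e i z) + Rp a z" for z
      unfolding Rp_def by (rule sum.subset_diff) (auto simp: I_def)
    then have "R (\<iota> a + x) = poly p (\<iota> a + x) + (\<Sum>i\<in>{..<m} - I a. e i (\<iota> a + x)) + Rp a (\<iota> a + x)"
      using R_eq[OF N] by simp
    moreover have "absv (poly p (\<iota> a + x) + (\<Sum>i\<in>{..<m} - I a. e i (\<iota> a + x)) - poly (U a) x) \<le> \<epsilon>"
      using U a x unfolding e_def by simp
    moreover have "absv (Rp a (\<iota> a + x) - poly (W a) (1 / x)) \<le> \<epsilon>"
      using x by (intro WR) simp
    ultimately have 1: "absv (R (\<iota> a + x) - (poly (W a) (1 / x) + poly (U a) x)) \<le> \<epsilon>"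
      using absv_add_leI[of "poly p (\<iota> a + x) + (\<Sum>i\<in>{..<m} - I a. e i (\<iota> a + x)) - poly (U a) x" \<epsilon>
          "Rp a (\<iota> a + x) - poly (W a) (1 / x)"]
      by (simp add: algebra_simps)
    have "f (\<iota> a + x) = f x"
      using trans[of x a] far_imp_Omega[OF far_\<rho>[OF x] \<rho>0] by (simp add: add.commute)
    then have "absv (R (\<iota> a + x) - f x) \<le> \<epsilon>"
      using R_close[OF N] by simp
    from absv_diff_leI[OF this 1] show ?thesis
      by (simp add: algebra_simps)
  qed
  \<comment> \<open>Both Laurent expansions approximate the same f x on the circle by translation
    invariance, so Cauchy's inequality compares their coefficients.\<close>
  have W_diff: "absv (coeff (W a) i - coeff (W 0) i) \<le> \<epsilon>" if a: "a \<in> PP" for a i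
  proof -
    have bd: "absv (poly (W a - W 0) (1 / x) + poly (U a - U 0) x) \<le> \<epsilon>" if "absv x = absv (1 / s0)" for x
    proof -
      have x: "absv x = \<rho>"
        using that abs_inv by simp
      from absv_diff_leI[OF close[OF x a] close[OF x PP0]] show ?thesis
        by (simp add: algebra_simps)
    qed
    have "absv (coeff (W a - W 0) i) \<le> \<epsilon> * absv (1 / s0) ^ i"
      by (rule laurent_coeff_bounds(1)[OF _ _ bd]) (simp_all add: s00 W0)
    also have "\<dots> \<le> \<epsilon> * 1"
      unfolding abs_inv using \<epsilon> \<rho>0 \<rho>1 by (intro mult_left_mono power_le_one) auto
    finally show ?thesis by simp
  qed
  \<comment> \<open>The circle of radius q^(n + 1/2) separates the poles near \<open>PP\<close> from
    those in \<open>IN\<close> and reaches the region where f is small.\<close>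
  define \<tau> where "\<tau> = \<sigma> * q ^ n"
  have \<tau>: "q ^ n < \<tau>" "\<tau> < q ^ Suc n" "\<sigma> \<le> \<tau>" "\<tau> > 0"
    using \<sigma>1 \<sigma>q qn mult_strict_right_mono[OF \<sigma>1, of "q ^ n"] mult_strict_right_mono[OF \<sigma>q, of "q ^ n"]
      mult_left_mono[OF qn(1), of \<sigma>] by (simp_all add: \<tau>_def)
  \<comment> \<open>On |x| = \<tau> the whole Laurent expansion is small by decay. The part at
    infinity is its nonnegative half, so its coefficients are small, and the bound extends to the
    disc.\<close>
  have Rinf_small: "absv (Rinf x) \<le> \<epsilon>" if x: "absv x \<le> \<tau>" for x
  proof -
    have "\<exists>V. \<forall>x::'c. absv x \<le> \<tau> \<longrightarrow> absv (poly p (0 + x) + (\<Sum>i\<in>IN. c i / (0 + x - r i) ^ l i) - poly V x) \<le> \<epsilon>"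
    proof (rule outer_approx_sum[OF fin_IN _ \<tau>(4) \<epsilon>])
      fix i assume "i \<in> IN"
      then have "q ^ Suc n \<le> absv (r i)"
        using cls_None[of i] by (simp only: IN_def mem_Collect_eq)
      with \<tau>(2) show "\<tau> < absv (r i - 0)"
        by simp
    qed
    then obtain V where V: "\<And>x. absv x \<le> \<tau> \<Longrightarrow> absv (Rinf x - poly V x) \<le> \<epsilon>"
      unfolding Rinf_def e_def by auto
    have fin_IS: "finite (IS PP)"
      using PPfin fin_I by (simp add: IS_def)
    have "\<exists>Z. coeff Z 0 = 0 \<and> coeff Z 1 = (\<Sum>i\<in>IS PP. if l i = 1 then c i else 0) \<and>
      (\<forall>x::'c. absv x \<ge> \<tau> \<longrightarrow> absv ((\<Sum>i\<in>IS PP. c i / (0 + x - r i) ^ l i) - poly Z (1 / x)) \<le> \<epsilon>)"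
    proof (rule inner_approx_sum[OF fin_IS _ _ \<epsilon>])
      fix i assume "i \<in> IS PP"
      then obtain a where a: "a \<in> PP" "i \<in> I a"
        by (auto simp: IS_def)
      have "absv ((r i - \<iota> a) + \<iota> a) \<le> q ^ n"
        using I_PP[OF a(2)] PP_le[OF a(1)] one_q qn by (intro absv_add_leI) linarith+
      with \<tau>(1) show "absv (r i - 0) < \<tau>"
        by simp
      show "l i \<ge> 1"
        using I_PP[OF a(2)] l1 by blast
    qed
    then obtain Z where Z: "coeff Z 0 = 0"
      "\<And>x. absv x \<ge> \<tau> \<Longrightarrow> absv ((\<Sum>i\<in>IS PP. e i x) - poly Z (1 / x)) \<le> \<epsilon>"
      unfolding e_def by auto
    have y: "absv (s0 * T ^ n) = \<tau>"
      by (simp add: absv_mult absv_power absv_T \<tau>_def \<sigma>_def)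
    have bd: "absv (poly Z (1 / x) + poly V x) \<le> \<epsilon>" if "absv x = absv (s0 * T ^ n)" for x
    proof -
      have x: "absv x = \<tau>"
        using that y by simp
      have "\<tau> ^ 2 = q * (q ^ n) ^ 2"
        using \<sigma>2 by (simp add: \<tau>_def power2_eq_square mult_ac)
      also have "\<dots> = q ^ (2 * n + 1)"
        by (simp add: mult.commute flip: power_mult)
      also have "\<dots> = q powi (int (2 * n + 1))"
        by (simp only: power_int_of_nat)
      also have "int (2 * n + 1) = 2 * int n + 1"
        by simp
      finally have "absv x ^ 2 = q powi (2 * int n + 1)"
        by (simp only: x)
      from circle_far[OF this] have far: "far \<tau> x"
        by (simp only: x)
      have N: "x \<in> N"
        using x \<tau> far qn one_q by (intro in_N[of x \<tau>]) linarith+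
      have "far y0 x"
        using \<tau> y0n by (intro far_mono[OF far]) linarith
      then have "absv (f x) \<le> \<epsilon>"
        using y0(2) less_imp_le by blast
      from absv_add_leI[OF R_close[OF N] this] have "absv (R x) \<le> \<epsilon>"
        by simp
      moreover have "R x = Rinf x + (\<Sum>i\<in>IS PP. e i x)"
      proof -
        have "(\<Sum>i<m. e i x) = (\<Sum>i\<in>IN. e i x) + (\<Sum>i\<in>IS PP. e i x)"
          unfolding all using fin_IN fin_IS by (intro sum.union_disjoint) (auto simp: IN_def IS_def I_def)
        then show ?thesis
          using R_eq[OF N] by (simp add: Rinf_def)
      qed
      moreover have "absv ((Rinf x - poly V x) + ((\<Sum>i\<in>IS PP. e i x) - poly Z (1 / x))) \<le> \<epsilon>"
        using V[of x] Z(2)[of x] x by (intro absv_add_leI) auto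
      ultimately show ?thesis
        using absv_diff_leI[of "R x" \<epsilon> "(Rinf x - poly V x) + ((\<Sum>i\<in>IS PP. e i x) - poly Z (1 / x))"]
        by (simp add: algebra_simps)
    qed
    have V_coeff: "absv (coeff V i) * \<tau> ^ i \<le> \<epsilon>" for i
      using laurent_coeff_bounds(2)[where y = "s0 * T ^ n", OF _ Z(1) bd, of i] s00 unfolding y by simp
    have "absv (poly V x) \<le> \<epsilon>"
      unfolding poly_altdef
    proof (rule absv_sum_le)
      fix i
      have "absv (coeff V i) * absv x ^ i \<le> absv (coeff V i) * \<tau> ^ i"
        using x by (intro mult_left_mono power_mono) auto
      with V_coeff[of i] show "absv (coeff V i * x ^ i) \<le> \<epsilon>"
        by (simp add: absv_mult absv_power)
    qed (use \<epsilon> in simp)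
    from absv_add_leI[OF V[OF x] this] show ?thesis
      by simp
  qed
  \<comment> \<open>The size of the principal part at 0. The aim is to bound it by max (\<epsilon>
    \<sigma>) (\<mu> / q), which is self-improving.\<close>
  define \<mu> where "\<mu> = Max (insert 0 ((\<lambda>i. absv (coeff (W 0) i)) ` {..degree (W 0)}))"
  have \<mu>0: "\<mu> \<ge> 0"
    by (simp add: \<mu>_def)
  have \<mu>_ge: "absv (coeff (W 0) i) \<le> \<mu>" for i
  proof (cases "i \<le> degree (W 0)")
    case True
    then show ?thesis
      unfolding \<mu>_def by (intro Max_ge) auto
  next
    case False
    then show ?thesis
      using \<mu>0 coeff_eq_0[of "W 0" i] by simp
  qed
  \<comment> \<open>The principal parts at the other a agree with the one at 0 only up to
    \<epsilon>, so this bound serves for all of them.\<close>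
  define \<mu>' where "\<mu>' = max \<mu> \<epsilon>"
  have \<mu>'_ge: "absv (coeff (W a) i) \<le> \<mu>'" if "a \<in> PP" for a i
  proof -
    have "absv ((coeff (W a) i - coeff (W 0) i) + coeff (W 0) i) \<le> \<mu>'"
      using W_diff[OF that, of i] \<mu>_ge[of i] unfolding \<mu>'_def by (intro absv_add_leI) linarith+
    then show ?thesis by simp
  qed
  have Rp_small: "absv (Rp a z) \<le> max \<epsilon> (\<mu>' / d)" if a: "a \<in> PP" and d: "d \<le> absv (z - \<iota> a)" "d \<ge> 1" for a z d
  proof -
    have ge: "absv (z - \<iota> a) \<ge> 1"
      using d by linarith
    have "absv (poly (W a) (1 / (z - \<iota> a))) \<le> \<mu>' / absv (z - \<iota> a)"
      by (rule absv_poly_inverse_le[OF W0 \<mu>'_ge[OF a] ge])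
    also have "\<dots> \<le> \<mu>' / d"
      using d \<mu>0 by (intro divide_left_mono mult_pos_pos) (auto simp: \<mu>'_def)
    finally have 1: "absv (poly (W a) (1 / (z - \<iota> a))) \<le> max \<epsilon> (\<mu>' / d)"
      by simp
    have "absv (Rp a (\<iota> a + (z - \<iota> a)) - poly (W a) (1 / (z - \<iota> a))) \<le> \<epsilon>"
      using ge \<rho>1 by (intro WR) linarith
    then have "absv (Rp a z - poly (W a) (1 / (z - \<iota> a))) \<le> max \<epsilon> (\<mu>' / d)"
      by simp
    from absv_add_leI[OF this 1] show ?thesis
      by simp
  qed
  define C :: "'q poly set" where "C = polys_below 1"
  have C_PP: "C \<subseteq> PP" and C_fin: "finite C"
    unfolding C_def PP_def by (intro polys_below_mono, simp, simp)
  have C_le: "absv (\<iota> a) \<le> 1" if "a \<in> C" for a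
    using that by (cases "a = 0") (simp_all add: C_def polys_below_iff absv_of_A)
  have C_ge: "q \<le> absv (\<iota> a)" if "a \<notin> C" for a
    using absv_of_A_ge[of a 1] that by (simp add: C_def)
  \<comment> \<open>The poles outside the circle |x| = \<sigma>: those at infinity and those near
    nonconstant a, where |a| \<ge> q > \<sigma>.\<close>
  define J0 where "J0 = IN \<union> IS (PP - C)"
  have fin_IS: "finite (IS S)" if "finite S" for S
    using that fin_I by (simp add: IS_def)
  have disj: "IN \<inter> IS S = {}" for S
    by (auto simp: IN_def IS_def I_def)
  have all': "{..<m} = J0 \<union> IS C"
    unfolding all J0_def using C_PP by (auto simp: IS_def)
  have disj': "J0 \<inter> IS C = {}"
    unfolding J0_def by (auto simp: IN_def IS_def I_def)
  have fin_J0: "finite J0"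
    unfolding J0_def using fin_IN fin_IS PPfin by simp
  define g where "g x = poly p x + (\<Sum>i\<in>J0. e i x)" for x
  have g_eq: "g x = Rinf x + (\<Sum>a\<in>PP - C. Rp a x)" for x
    unfolding g_def Rinf_def J0_def Rp_def
    using fin_IN fin_IS[of "PP - C"] PPfin disj by (simp add: sum.union_disjoint sum_IS)
  \<comment> \<open>Principal parts at nonconstant a are evaluated at distance at least q from their
    centre; the factor 1 / q is gained here.\<close>
  define \<eta> where "\<eta> = max \<epsilon> (\<mu>' / q)"
  have g_small: "absv (g x) \<le> \<eta>" if x: "absv x = \<sigma>" for x
    unfolding g_eq
  proof (rule absv_add_leI)
    show "absv (Rinf x) \<le> \<eta>"
      using Rinf_small[of x] x \<tau>(3) by (simp add: \<eta>_def)
    show "absv (\<Sum>a\<in>PP - C. Rp a x) \<le> \<eta>"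
    proof (rule absv_sum_le)
      fix a assume a: "a \<in> PP - C"
      then have ge: "q \<le> absv (\<iota> a)"
        using C_ge by blast
      then have "absv (x - \<iota> a) = absv (\<iota> a)"
        using x \<sigma>q by (intro absv_diff_eq') linarith
      with ge a show "absv (Rp a x) \<le> \<eta>"
        unfolding \<eta>_def by (intro Rp_small) auto
    qed (use \<epsilon> in \<open>simp add: \<eta>_def\<close>)
  qed
  have "\<exists>H. \<forall>x::'c. absv x \<le> \<sigma> \<longrightarrow> absv (poly p (0 + x) + (\<Sum>i\<in>J0. c i / (0 + x - r i) ^ l i) - poly H x) \<le> \<epsilon>"
  proof (rule outer_approx_sum[OF fin_J0 _ _ \<epsilon>])
    fix i assume "i \<in> J0"
    then consider "i \<in> IN" | a where "a \<in> PP - C" "i \<in> I a"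
      by (auto simp: J0_def IS_def)
    then show "\<sigma> < absv (r i - 0)"
    proof cases
      case 1
      then have "q ^ Suc n \<le> absv (r i)"
        using cls_None[of i] by (simp only: IN_def mem_Collect_eq)
      with qn(3) \<sigma>q have "\<sigma> < absv (r i)"
        by linarith
      then show ?thesis by simp
    next
      case 2
      have ge: "q \<le> absv (\<iota> a)"
        using 2 C_ge by blast
      then have "absv (\<iota> a + (r i - \<iota> a)) = absv (\<iota> a)"
        using I_PP[OF 2(2)] one_q q_gt_1 by (intro absv_add_eq) linarith
      with ge \<sigma>q show ?thesis by simp
    qed
  qed (use \<sigma>1 in simp)
  then obtain H where H: "\<And>x. absv x \<le> \<sigma> \<Longrightarrow> absv (g x - poly H x) \<le> \<epsilon>"
    unfolding g_def e_def by auto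
  have H_coeff: "absv (coeff H i) \<le> \<eta>" for i
  proof -
    have "absv (poly H x) \<le> \<eta>" if "absv x = absv s0" for x
    proof -
      have x: "absv x = \<sigma>"
        using that by (simp add: \<sigma>_def)
      have "absv (g x - poly H x) \<le> \<eta>"
        using H[of x] x by (simp add: \<eta>_def)
      from absv_diff_leI[OF g_small[OF x] this] show ?thesis
        by simp
    qed
    then have "absv (coeff H i) * \<sigma> ^ i \<le> \<eta>"
      unfolding \<sigma>_def by (intro gauss_norm s00)
    moreover have "absv (coeff H i) * 1 \<le> absv (coeff H i) * \<sigma> ^ i"
      using \<sigma>1 by (intro mult_left_mono one_le_power) auto
    ultimately show ?thesis
      by simp
  qed
  have "\<exists>B. coeff B 0 = 0 \<and> coeff B 1 = (\<Sum>i\<in>IS C. if l i = 1 then c i else 0) \<and>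
    (\<forall>x::'c. absv x \<ge> \<sigma> \<longrightarrow> absv ((\<Sum>i\<in>IS C. c i / (0 + x - r i) ^ l i) - poly B (1 / x)) \<le> \<epsilon>)"
  proof (rule inner_approx_sum[OF fin_IS[OF C_fin] _ _ \<epsilon>])
    fix i assume "i \<in> IS C"
    then obtain a where a: "a \<in> C" "i \<in> I a"
      by (auto simp: IS_def)
    have "absv ((r i - \<iota> a) + \<iota> a) \<le> 1"
      using I_PP[OF a(2)] C_le[OF a(1)] one_q by (intro absv_add_leI) linarith+
    with \<sigma>1 show "absv (r i - 0) < \<sigma>"
      by simp
    show "l i \<ge> 1"
      using I_PP[OF a(2)] l1 by blast
  qed
  then obtain B where B0: "coeff B 0 = 0" and B1: "coeff B 1 = (\<Sum>i\<in>IS C. if l i = 1 then c i else 0)"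
    and B: "\<And>x. absv x \<ge> \<sigma> \<Longrightarrow> absv ((\<Sum>i\<in>IS C. e i x) - poly B (1 / x)) \<le> \<epsilon>"
    unfolding e_def by auto
  have B1_small: "absv (coeff B 1) \<le> \<epsilon>"
  proof -
    have "coeff B 1 = (\<Sum>a\<in>C. coeff (W a) 1)"
      unfolding B1 sum_IS[OF C_fin] W1 ..
    also have "\<dots> = (\<Sum>a\<in>C. coeff (W a) 1 - coeff (W 0) 1) + of_nat (card C) * coeff (W 0) 1"
      by (simp add: sum_subtractf)
    also have "of_nat (card C) = (0 :: 'c)"
      unfolding C_def by (rule of_nat_card_polys_below_eq_0) simp
    finally have "coeff B 1 = (\<Sum>a\<in>C. coeff (W a) 1 - coeff (W 0) 1)"
      by simp
    then show ?thesis
      using W_diff C_PP \<epsilon> by (auto intro!: absv_sum_le)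
  qed
  \<comment> \<open>The approximations of f(1 / x) and of x^k f(x) are added. By \<open>inv\<close>
    the values of f cancel, leaving only errors of size \<epsilon>.\<close>
  have key: "absv (poly H (1 / x) + poly B x + x ^ k * (poly (W 0) (1 / x) + poly (U 0) x)) \<le> \<epsilon>"
    if "absv x = absv (1 / s0)" for x
  proof -
    have x: "absv x = \<rho>"
      using that abs_inv by simp
    have ix: "absv (1 / x) = \<sigma>"
      using x by (simp add: absv_divide \<rho>_def)
    have x\<Omega>: "x \<in> Omega j"
      by (rule far_imp_Omega[OF far_\<rho>[OF x] \<rho>0])
    have "\<sigma> ^ 2 = q powi (2 * 0 + 1)"
      using \<sigma>2 by (simp add: power2_eq_square)
    then have "far \<sigma> (1 / x)"
      using circle_far[of "1 / x" 0] by (simp only: ix)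
    then have N: "1 / x \<in> N"
      using ix \<sigma>q \<sigma>1 qn one_q by (intro in_N[of "1 / x" \<sigma>]) linarith+
    have "(\<Sum>i<m. e i (1 / x)) = (\<Sum>i\<in>J0. e i (1 / x)) + (\<Sum>i\<in>IS C. e i (1 / x))"
      unfolding all' using fin_J0 fin_IS[OF C_fin] disj' by (intro sum.union_disjoint)
    then have R_split: "R (1 / x) = g (1 / x) + (\<Sum>i\<in>IS C. e i (1 / x))"
      using R_eq[OF N] by (simp add: g_def)
    have "absv ((\<Sum>i\<in>IS C. e i (1 / x)) - poly B (1 / (1 / x))) \<le> \<epsilon>"
      using ix by (intro B) simp
    then have "absv ((\<Sum>i\<in>IS C. e i (1 / x)) - poly B x) \<le> \<epsilon>"
      by simp
    moreover have "absv (g (1 / x) - poly H (1 / x)) \<le> \<epsilon>"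
      using ix by (intro H) simp
    ultimately have "absv ((g (1 / x) - poly H (1 / x)) + ((\<Sum>i\<in>IS C. e i (1 / x)) - poly B x)) \<le> \<epsilon>"
      by (intro absv_add_leI)
    from absv_diff_leI[OF R_close[OF N] this]
    have 1: "absv (poly H (1 / x) + poly B x - f (1 / x)) \<le> \<epsilon>"
      unfolding R_split by (simp add: algebra_simps)
    have "absv x ^ k * absv (poly (W 0) (1 / x) + poly (U 0) x - f x) \<le> 1 * \<epsilon>"
      using x \<rho>0 \<rho>1 by (intro mult_mono close[OF x PP0] power_le_one) auto
    then have 2: "absv (x ^ k * (poly (W 0) (1 / x) + poly (U 0) x - f x)) \<le> \<epsilon>"
      by (simp add: absv_mult absv_power)
    from absv_add_leI[OF 1 2] show ?thesis
      unfolding inv[OF x\<Omega>] by (simp add: algebra_simps)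
  qed
  have is0: "1 / s0 \<noteq> 0"
    using s00 by simp
  have bound: "absv (coeff (W 0) i) \<le> max (\<epsilon> * \<sigma>) (\<mu> / q)" for i
  proof -
    have "\<epsilon> / q \<le> \<epsilon>"
      using \<epsilon> q_ge_1 by (simp add: divide_le_eq)
    then have \<eta>_le: "\<eta> \<le> max (\<epsilon> * \<sigma>) (\<mu> / q)"
      using \<epsilon>\<sigma> by (auto simp: \<eta>_def \<mu>'_def max_def)
    \<comment> \<open>\<open>W 0\<close> has no constant term; for k = 2 its first coefficient is
      matched with \<open>B\<close>, and all indices i' + k are matched with
      \<open>H\<close>.\<close>
    consider "i = 0" | "i = 1" "k = 2" | i' where "i = i' + k"
      using k by (metis add.commute le_iff_add less_2_cases not_le One_nat_def less_Suc0)
    then show ?thesis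
    proof cases
      case 1
      then show ?thesis using W0 \<mu>0 \<epsilon> \<sigma>1 by (simp add: le_max_iff_disj)
    next
      case 2
      have "absv (coeff (W 0) 1 + coeff B 1) * \<rho> \<le> \<epsilon>"
        using inversion_coeffs(2)[OF is0 W0 k B0 key 2(2)] unfolding abs_inv .
      then have "absv (coeff (W 0) 1 + coeff B 1) \<le> \<epsilon> * \<sigma>"
        using \<sigma>1 by (simp add: \<rho>_def divide_le_eq)
      moreover have "absv (coeff B 1) \<le> \<epsilon> * \<sigma>"
        using B1_small \<epsilon>\<sigma> by linarith
      ultimately have "absv (coeff (W 0) 1 + coeff B 1 - coeff B 1) \<le> \<epsilon> * \<sigma>"
        by (rule absv_diff_leI)
      with 2 show ?thesis
        by (simp add: le_max_iff_disj)
    next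
      case (3 i')
      have "absv (coeff (W 0) (i' + k) + coeff H i') \<le> \<epsilon> * absv (1 / s0) ^ i'"
        by (rule inversion_coeffs(1)[OF is0 W0 k B0 key])
      also have "\<dots> \<le> \<epsilon> * 1"
        unfolding abs_inv using \<epsilon> \<rho>0 \<rho>1 by (intro mult_left_mono power_le_one) auto
      finally have "absv (coeff (W 0) (i' + k) + coeff H i') \<le> \<eta>"
        by (simp add: \<eta>_def)
      from absv_diff_leI[OF this H_coeff[of i']] show ?thesis
        using 3 \<eta>_le by simp
    qed
  qed
  \<comment> \<open>Since \<mu> / q < \<mu> for positive \<mu>, only \<epsilon> \<sigma> can attain
    the maximum in a bound for \<mu>.\<close>
  have "\<mu> \<le> max (\<epsilon> * \<sigma>) (\<mu> / q)"
  proof -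
    have "0 \<le> max (\<epsilon> * \<sigma>) (\<mu> / q)"
      using \<epsilon> \<sigma>1 by (simp add: le_max_iff_disj)
    with bound show ?thesis
      unfolding \<mu>_def by (intro Max.boundedI) auto
  qed
  moreover have "\<mu> / q < \<mu>" if "\<mu> > 0"
    using that q_gt_1 by (simp add: divide_less_eq)
  ultimately have "\<mu> \<le> \<epsilon> * \<sigma>"
    using \<epsilon> \<sigma>1 \<mu>0 by (cases "\<mu> = 0") (auto simp: max_def split: if_splits)
  then have \<mu>'_le: "\<mu>' \<le> \<epsilon> * \<sigma>"
    using \<epsilon>\<sigma> by (simp add: \<mu>'_def)
  \<comment> \<open>z0 has distance at least 1 from every polynomial, so every principal part is
    small at z0 once \<mu>' is.\<close>
  have "R z0 = Rinf z0 + (\<Sum>a\<in>PP. Rp a z0)"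
  proof -
    have "(\<Sum>i<m. e i z0) = (\<Sum>i\<in>IN. e i z0) + (\<Sum>i\<in>IS PP. e i z0)"
      unfolding all using fin_IN fin_IS[OF PPfin] disj by (intro sum.union_disjoint)
    then show ?thesis
      using R_eq[OF z0N] by (simp add: Rinf_def Rp_def sum_IS[OF PPfin])
  qed
  also have "absv \<dots> \<le> \<epsilon> * \<sigma>"
  proof (rule absv_add_leI)
    show "absv (Rinf z0) \<le> \<epsilon> * \<sigma>"
      using Rinf_small[of z0] z0n \<tau>(1) \<epsilon>\<sigma> by simp
    show "absv (\<Sum>a\<in>PP. Rp a z0) \<le> \<epsilon> * \<sigma>"
    proof (rule absv_sum_le)
      fix a assume "a \<in> PP"
      then have "absv (Rp a z0) \<le> max \<epsilon> (\<mu>' / 1)"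
        using far_of_A[OF z0] by (intro Rp_small) auto
      with \<mu>'_le \<epsilon>\<sigma> show "absv (Rp a z0) \<le> \<epsilon> * \<sigma>"
        by simp
    qed (use \<epsilon> \<sigma>1 in simp)
  qed
  finally have 1: "absv (R z0) \<le> \<epsilon> * \<sigma>" .
  have "absv (R z0 - f z0) \<le> \<epsilon> * \<sigma>"
    using R_close[OF z0N] \<epsilon>\<sigma> by linarith
  from absv_diff_leI[OF 1 this] show ?thesis
    by (simp add: \<sigma>_def)
qed

end

section \<open>The quotient\<close>

context C_infinity
begin

text \<open>The point s stays fixed while \<epsilon> = e / |s| becomes arbitrarily small in the
  estimate.\<close>

lemma low_weight_eq_0:
  assumes "k = 1 \<or> k = 2" and "rigid_analytic j f"
    and "\<And>z b. z \<in> Omega j \<Longrightarrow> f (z + \<iota> b) = f z"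
    and "\<And>z. z \<in> Omega j \<Longrightarrow> f (1 / z) = - (z ^ k * f z)"
    and "\<And>e. e > 0 \<Longrightarrow> \<exists>y>0. \<forall>z. far y z \<longrightarrow> absv (f z) < e"
    and "far 1 z"
  shows "f z = 0"
proof -
  obtain s :: 'c where s: "absv s ^ 2 = q"
    using exists_sqrt_T by blast
  have "absv (f z) \<le> 0"
  proof (rule field_le_epsilon)
    fix e :: real assume e: "e > 0"
    have "absv s \<noteq> 0"
      using s q_pos by (metis zero_power2 less_irrefl)
    then have pos: "absv s > 0"
      using absv_nonneg[of s] by linarith
    have "absv (f z) \<le> e / absv s * absv s"
      by (rule low_weight_estimate[OF assms s divide_pos_pos[OF e pos]])
    with pos show "absv (f z) \<le> 0 + e"
      by simp
  qed
  then show ?thesis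
    by simp
qed

end

context carlitz
begin

lemma cusp_form_decay:
  assumes "has_t_expansion j w f a" and "a 0 = 0" and "e > 0"
  shows "\<exists>y>0. \<forall>z. far y z \<longrightarrow> absv (f z) < e"
proof -
  obtain R where R: "R > 0" "\<And>z. far R z \<Longrightarrow> (\<lambda>i. a i * t z ^ i) sums f z"
    by (rule has_t_expansionE[OF assms(1)]) (rule that)
  obtain B L where BL: "B > 0" "L \<ge> 1" "\<And>i. absv (a i) \<le> B * L ^ i"
    by (rule t_expansion_coeff_bound[OF assms(1)]) (rule that)
  define \<delta> where "\<delta> = min (1 / L) (e / (2 * B * L))"
  have "\<delta> > 0"
    using BL(1,2) assms(3) by (simp add: \<delta>_def)
  then obtain y where y: "y > 0" "\<And>z. far y z \<Longrightarrow> absv (t z) < \<delta>"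
    by (rule absv_t_less) (rule that)
  have "absv (f z) < e" if z: "far (max R y) z" for z
  proof -
    have tz: "absv (t z) < \<delta>"
      by (rule y(2)[OF far_mono[OF z]]) simp
    then have Lt: "L * absv (t z) \<le> 1" and Bt: "B * (L * absv (t z)) \<le> e / 2"
      using BL(1,2) by (simp_all add: \<delta>_def field_simps)
    have "absv (a i * t z ^ i) \<le> e / 2" for i
    proof (cases i)
      case 0
      then show ?thesis using assms(2,3) by simp
    next
      case (Suc i')
      have "absv (a i * t z ^ i) \<le> B * L ^ i * absv (t z) ^ i"
        using BL(3)[of i] by (simp add: absv_mult absv_power mult_right_mono)
      also have "\<dots> = B * (L * absv (t z)) * (L * absv (t z)) ^ i'"
        by (simp add: Suc power_mult_distrib)
      also have "\<dots> \<le> B * (L * absv (t z)) * 1"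
        using BL(1,2) Lt by (intro mult_left_mono power_le_one) auto
      also have "\<dots> \<le> e / 2"
        using Bt by simp
      finally show ?thesis .
    qed
    with R(2)[OF far_mono[OF z max.cobounded1]] have "absv (f z) \<le> e / 2"
      by (rule absv_sums_le)
    with assms(3) show ?thesis by simp
  qed
  moreover have "max R y > 0"
    using y(1) by simp
  ultimately show ?thesis
    by blast
qed

text \<open>Vanishing for large imaginary part suffices: the zero series is then a t-expansion, and
  membership asks for the existence of one.\<close>

lemma low_weight_cusp_forms:
  assumes k: "k = 1 \<or> k = 2"
  shows "cusp_forms j w k 1 \<subseteq> double_cusp_forms j w k 1"
proof
  fix f assume f: "f \<in> cusp_forms j w k 1"
  then have rigid: "rigid_analytic j f" and mt: "modular_transform j k 1 f"
    and mf: "f \<in> modular_forms j w k 1"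
    by (simp_all add: cusp_forms_def modular_forms_def)
  obtain a where a: "has_t_expansion j w f a" "a 0 = 0"
    using f by (auto simp: cusp_forms_def)
  have "f z = 0" if "far 1 z" for z
    by (rule low_weight_eq_0[OF k rigid modular_translation[OF mt] modular_inversion[OF mt]
          cusp_form_decay[OF a] that])
  then have "has_t_expansion j w f (\<lambda>_. 0)"
    by (intro has_t_expansionI[of 1]) simp_all
  with mf show "f \<in> double_cusp_forms j w k 1"
    by (auto simp: double_cusp_forms_def)
qed

lemma bad_weight_cusp_forms:
  assumes "c \<noteq> (0 :: 'q)" and "c ^ k \<noteq> c ^ 2"
  shows "cusp_forms j w k 1 \<subseteq> double_cusp_forms j w k 1"
proof
  fix f assume "f \<in> cusp_forms j w k 1"
  then have mt: "modular_transform j k 1 f" and out: "\<And>z. z \<notin> Omega j \<Longrightarrow> f z = 0"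
    by (simp_all add: cusp_forms_def modular_forms_def)
  have "f z = 0" for z
  proof (cases "z \<in> Omega j")
    case True
    have "[:c:] ^ k \<noteq> [:c:] ^ 2"
      using assms(2) by (simp add: poly_const_pow)
    then have "\<iota> [:c:] ^ k \<noteq> \<iota> [:c:] ^ 2"
      by (simp flip: of_A_power)
    moreover have "f z * \<iota> [:c:] ^ 2 = \<iota> [:c:] ^ k * f z"
      by (rule modular_scalar[OF mt True assms(1)])
    ultimately show ?thesis
      by (auto simp: mult.commute)
  qed (rule out)
  then have "f = (\<lambda>_. 0)" ..
  then show "f \<in> double_cusp_forms j w k 1"
    using double_cusp_forms_0 by simp
qed

lemma cusp_forms_mod_G:
  assumes k: "k \<ge> 3" and weight: "\<And>c :: 'q. c \<noteq> 0 \<Longrightarrow> c ^ k = c ^ 2" and f: "f \<in> cusp_forms j w k 1"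
  shows "\<exists>c. (\<lambda>z. f z + (- c) * G k z) \<in> double_cusp_forms j w k 1"
proof -
  obtain a where a: "has_t_expansion j w f a" "a 0 = 0"
    using f by (auto simp: cusp_forms_def)
  obtain b where b: "has_t_expansion j w (G k) b" "b 0 = 0" "b 1 = - w"
    using G_first_coeff[OF k weight] by blast
  define c where "c = a 1 / (- w)"
  have "f \<in> modular_forms j w k 1" "G k \<in> modular_forms j w k 1"
    using f G_in_cusp_forms[OF k weight] by (simp_all add: cusp_forms_def)
  then have "(\<lambda>z. f z + (- c) * G k z) \<in> modular_forms j w k 1"
    by (intro modular_forms_add modular_forms_cmult)
  moreover have "has_t_expansion j w (\<lambda>z. f z + (- c) * G k z) (\<lambda>i. a i + (- c) * b i)"
    by (intro has_t_expansion_add has_t_expansion_cmult a b)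
  moreover have "a 0 + (- c) * b 0 = 0"
    using a(2) b(2) by simp
  moreover have "a 1 + (- c) * b 1 = 0"
    unfolding b(3) c_def by simp
  ultimately show ?thesis
    unfolding double_cusp_forms_def by blast
qed

text \<open>\<open>double_cusp_forms\<close> asks for some expansion with vanishing coefficients, so
  excluding G requires uniqueness of the first coefficient.\<close>

lemma G_notin_double_cusp_forms:
  assumes k: "k \<ge> 3" and weight: "\<And>c :: 'q. c \<noteq> 0 \<Longrightarrow> c ^ k = c ^ 2"
  shows "G k \<notin> double_cusp_forms j w k 1"
proof
  assume "G k \<in> double_cusp_forms j w k 1"
  then obtain a where a: "has_t_expansion j w (G k) a" "a 0 = 0" "a 1 = 0"
    unfolding double_cusp_forms_def by blast
  obtain b where b: "has_t_expansion j w (G k) b" "b 0 = 0" "b 1 = - w"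
    using G_first_coeff[OF k weight] by blast
  have "has_t_expansion j w (\<lambda>z. G k z + (- 1) * G k z) (\<lambda>i. a i + (- 1) * b i)"
    by (intro has_t_expansion_add has_t_expansion_cmult a b)
  then have "has_t_expansion j w (\<lambda>_. 0) (\<lambda>i. a i + (- 1) * b i)"
    by simp
  from t_expansion_first_coeff_0[OF this] show False
    using a(2,3) b(2,3) by simp
qed

lemma hecke_add: "hecke j k P (f + g) = hecke j k P f + hecke j k P g"
  by (rule ext) (simp add: hecke_def sum.distrib algebra_simps)

end

section \<open>Cosets modulo a subspace of functions\<close>

context
  fixes U :: "('c::field \<Rightarrow> 'c) set"
  assumes zero: "0 \<in> U"
    and add: "\<And>f g. f \<in> U \<Longrightarrow> g \<in> U \<Longrightarrow> f + g \<in> U"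
    and fscale: "\<And>c f. f \<in> U \<Longrightarrow> fscale c f \<in> U"
begin

lemma coset_eq_iff: "f +o U = g +o U \<longleftrightarrow> f - g \<in> U"
proof
  assume "f +o U = g +o U"
  moreover have "f \<in> f +o U"
    using set_plus_intro2[OF zero, of f] by simp
  ultimately show "f - g \<in> U"
    by (auto simp: elt_set_plus_def)
next
  assume fg: "f - g \<in> U"
  have "fscale (- 1) (f - g) = g - f"
    by (rule ext) (simp add: fscale_def)
  with fscale[OF fg, of "- 1"] have gf: "g - f \<in> U"
    by simp
  have "f + u \<in> g +o U" if "u \<in> U" for u
    using set_plus_intro2[OF add[OF fg that], of g] by simp
  moreover have "g + u \<in> f +o U" if "u \<in> U" for u
    using set_plus_intro2[OF add[OF gf that], of f] by simp
  ultimately show "f +o U = g +o U"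
    by (auto simp: elt_set_plus_def)
qed

lemma coset_eq_self_iff: "f +o U = U \<longleftrightarrow> f \<in> U"
  using coset_eq_iff[of f 0] by simp

lemma image_coset_plus:
  assumes H: "\<And>f g. H (f + g) = H f + H g" and HU: "\<And>f. f \<in> U \<Longrightarrow> H f \<in> U"
  shows "H ` (f +o U) + U = H f +o U"
proof
  show "H ` (f +o U) + U \<subseteq> H f +o U"
  proof
    fix h assume "h \<in> H ` (f +o U) + U"
    then obtain u v where uv: "u \<in> U" "v \<in> U" "h = H (f + u) + v"
      by (auto simp: set_plus_def elt_set_plus_def)
    then have "h = H f + (H u + v)"
      by (simp add: H add.assoc)
    then show "h \<in> H f +o U"
      using set_plus_intro2[OF add[OF HU[OF uv(1)] uv(2)], of "H f"] by simp
  qed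
  show "H f +o U \<subseteq> H ` (f +o U) + U"
  proof
    fix h assume "h \<in> H f +o U"
    then obtain u where u: "u \<in> U" "h = H f + u"
      by (auto simp: elt_set_plus_def)
    have "H f \<in> H ` (f +o U)"
      using set_plus_intro2[OF zero, of f] by (intro imageI) simp
    from set_plus_intro[OF this u(1)] u(2) show "h \<in> H ` (f +o U) + U"
      by simp
  qed
qed

lemma fscale_coset: "fscale c ` (f +o U) + U = fscale c f +o U"
  by (rule image_coset_plus) (auto simp: fscale_def algebra_simps intro: fscale[unfolded fscale_def])

lemma quotient_lincomb_empty: "quotient_lincomb U c {} = U"
  by (simp add: quotient_lincomb_def)

lemma quotient_lincomb_single: "quotient_lincomb U c {f +o U} = fscale (c (f +o U)) f +o U"
  by (simp add: quotient_lincomb_def fscale_coset)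

lemma quotient_basis_empty: "V \<subseteq> U \<Longrightarrow> quotient_basis V U {}"
  using coset_eq_self_iff quotient_lincomb_empty
  unfolding quotient_basis_def quotient_space_def by auto

lemma quotient_basis_single:
  assumes g: "g \<in> V" "g \<notin> U" and span: "\<And>f. f \<in> V \<Longrightarrow> \<exists>c. f - fscale c g \<in> U"
  shows "quotient_basis V U {g +o U}"
  unfolding quotient_basis_def
proof (intro conjI allI impI ballI)
  show "{g +o U} \<subseteq> quotient_space V U"
    using g(1) by (simp add: quotient_space_def)
next
  fix F c C
  assume F: "finite F \<and> F \<subseteq> {g +o U} \<and> quotient_lincomb U c F = U" and C: "C \<in> F"
  then have FC: "F = {g +o U}" "C = g +o U"
    by auto
  with F have cg: "fscale (c C) g \<in> U"
    using coset_eq_self_iff quotient_lincomb_single by metis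
  show "c C = 0"
  proof (rule ccontr)
    assume "c C \<noteq> 0"
    then have "fscale (1 / c C) (fscale (c C) g) = g"
      by (intro ext) (simp add: fscale_def)
    with fscale[OF cg, of "1 / c C"] g(2) show False
      by simp
  qed
next
  fix Y assume "Y \<in> quotient_space V U"
  then obtain f where f: "f \<in> V" "Y = f +o U"
    by (auto simp: quotient_space_def)
  obtain c where "f - fscale c g \<in> U"
    using span[OF f(1)] by blast
  then have "Y = quotient_lincomb U (\<lambda>_. c) {g +o U}"
    using coset_eq_iff f(2) quotient_lincomb_single by metis
  then show "\<exists>F c. finite F \<and> F \<subseteq> {g +o U} \<and> Y = quotient_lincomb U c F"
    by (intro exI[of _ "{g +o U}"] exI[of _ "\<lambda>_. c"]) simp
qed

end

context carlitz
begin

lemma double_cusp_forms_subspace: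
  shows "0 \<in> double_cusp_forms j w k 1"
    and "f \<in> double_cusp_forms j w k 1 \<Longrightarrow> g \<in> double_cusp_forms j w k 1 \<Longrightarrow> f + g \<in> double_cusp_forms j w k 1"
    and "f \<in> double_cusp_forms j w k 1 \<Longrightarrow> fscale c f \<in> double_cusp_forms j w k 1"
  unfolding fscale_def zero_fun_def plus_fun_def
  by (rule double_cusp_forms_0 double_cusp_forms_add double_cusp_forms_cmult; assumption?)+

text \<open>The case distinction is on the quotient being zero rather than on k: if it is nonzero,
  the contrapositives of the vanishing lemmas give k \<ge> 3 and the weight condition, exactly what
  G requires.\<close>

lemma cusp_quotient_diagonalizable:
  assumes "k > 0"
  shows "\<exists>B. quotient_basis (cusp_forms j w k 1) (double_cusp_forms j w k 1) B \<and>
    (\<forall>C\<in>B. \<exists>f\<in>cusp_forms j w k 1. C = f +o double_cusp_forms j w k 1 \<and> hecke_eigenform j k f \<and>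
      (\<forall>P. monic_prime P \<longrightarrow> hecke j k P f = fscale (\<iota> P) f \<and>
        quotient_map (double_cusp_forms j w k 1) (hecke j k P) C =
        quotient_scale (double_cusp_forms j w k 1) (\<iota> P) C))"
proof -
  let ?U = "double_cusp_forms j w k 1"
  let ?V = "cusp_forms j w k 1"
  note sub = double_cusp_forms_subspace[where k = k]
  show ?thesis
  proof (cases "?V \<subseteq> ?U")
    case True
    have "quotient_basis ?V ?U {}"
      by (rule quotient_basis_empty[OF sub True])
    then show ?thesis
      by blast
  next
    case False
    have weight: "c ^ k = c ^ 2" if "c \<noteq> 0" for c :: 'q
      using bad_weight_cusp_forms[OF that, of k] False by blast
    have "\<not> (k = 1 \<or> k = 2)"
      using low_weight_cusp_forms[of k] False by blast
    with assms have k: "k \<ge> 3"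
      by linarith
    have GV: "G k \<in> ?V" and GU: "G k \<notin> ?U"
      by (rule G_in_cusp_forms[OF k weight] G_notin_double_cusp_forms[OF k weight]; assumption)+
    have "quotient_basis ?V ?U {G k +o ?U}"
    proof (rule quotient_basis_single[OF sub GV GU])
      fix f assume "f \<in> ?V"
      then obtain c where c: "(\<lambda>z. f z + (- c) * G k z) \<in> ?U"
        using cusp_forms_mod_G[OF k weight] by blast
      have "f - fscale c (G k) = (\<lambda>z. f z + (- c) * G k z)"
        by (rule ext) (simp add: fscale_def)
      with c have "f - fscale c (G k) \<in> ?U"
        by (simp only:)
      then show "\<exists>c. f - fscale c (G k) \<in> ?U" ..
    qed
    moreover have eigen: "hecke j k P (G k) = fscale (\<iota> P) (G k)" if "monic_prime P" for P
      using that k by (intro hecke_G) (auto simp: monic_prime_def)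
    moreover have "hecke_eigenform j k (G k)"
      unfolding hecke_eigenform_def using eigen GU sub(1) by metis
    moreover have "quotient_map ?U (hecke j k P) (G k +o ?U) = quotient_scale ?U (\<iota> P) (G k +o ?U)"
      if P: "monic_prime P" for P
    proof -
      have HU: "hecke j k P f \<in> ?U" if "f \<in> ?U" for f
        using P by (intro hecke_double_cusp that weight) (simp_all add: monic_prime_def)
      have "hecke j k P ` (G k +o ?U) + ?U = hecke j k P (G k) +o ?U"
        by (rule image_coset_plus[OF sub hecke_add HU])
      also have "\<dots> = fscale (\<iota> P) ` (G k +o ?U) + ?U"
        unfolding eigen[OF P] by (rule fscale_coset[OF sub, symmetric])
      finally show ?thesis
        unfolding quotient_map_def quotient_scale_def .
    qed
    ultimately show ?thesis
      using GV by (intro exI[of _ "{G k +o ?U}"]) blast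
  qed
qed

end

theorem theorem3p2:
  fixes j :: "'q::finite_field fls alg_closure \<Rightarrow> 'c::{nonarch_field, complete_space}"
    and w :: 'c and k :: nat
  assumes "C_inf j"
    and "carlitz_period j w"
    and "k > 0"
  shows "hecke_diagonalizable j k (cusp_forms j w k 1) (double_cusp_forms j w k 1) \<and>
    (\<exists>B. quotient_basis (cusp_forms j w k 1) (double_cusp_forms j w k 1) B \<and>
      (\<forall>C\<in>B. \<exists>f\<in>cusp_forms j w k 1.
         C = f +o double_cusp_forms j w k 1 \<and>
         hecke_eigenform j k f \<and>
         (\<forall>P. monic_prime P \<longrightarrow> hecke j k P f = fscale (of_A j P) f)))"
proof -
  interpret carlitz j "real CARD('q)" w
    by unfold_locales (use assms in auto)
  obtain B where "quotient_basis (cusp_forms j w k 1) (double_cusp_forms j w k 1) B"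
    "\<forall>C\<in>B. \<exists>f\<in>cusp_forms j w k 1. C = f +o double_cusp_forms j w k 1 \<and> hecke_eigenform j k f \<and>
      (\<forall>P. monic_prime P \<longrightarrow> hecke j k P f = fscale (of_A j P) f \<and>
        quotient_map (double_cusp_forms j w k 1) (hecke j k P) C =
        quotient_scale (double_cusp_forms j w k 1) (of_A j P) C)"
    using cusp_quotient_diagonalizable[OF assms(3)] by blast
  note B = this
  show ?thesis
    unfolding hecke_diagonalizable_def
  proof (intro conjI exI[of _ B] ballI allI impI)
    fix C and P :: "'q poly"
    assume "C \<in> B" and P: "monic_prime P"
    with B(2) show "\<exists>c. quotient_map (double_cusp_forms j w k 1) (hecke j k P) C =
        quotient_scale (double_cusp_forms j w k 1) c C"
      by (meson P)
  next
    fix C assume "C \<in> B"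
    with B(2) show "\<exists>f\<in>cusp_forms j w k 1. C = f +o double_cusp_forms j w k 1 \<and> hecke_eigenform j k f \<and>
        (\<forall>P. monic_prime P \<longrightarrow> hecke j k P f = fscale (of_A j P) f)"
      by meson
  qed (rule B(1))+
qed

end
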